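(* Let $\Omega\subset\mathbb{C}$ be a bounded simply connected domain, $1<p<\infty$, and let $f\in W^{1,\infty}(\Omega)$ be a non-vanishing complex-valued function with $\frac1f\in L_\infty(\Omega)$. For all $W\in\mathcal{A}_f^p(\Omega;\mathbb{B})$, the function $U=\frac{u}{f}$, where $u=\operatorname{Sc}W$, is a weak solution in $W^{1,p}_{loc}(\Omega)$ of the conductivity equation $$\operatorname{div}\left(f^2\nabla U\right)=0\quad\text{in }\Omega.$$ Similarly, $V=fv$, where $v=\operatorname{Vec}W$, is a weak solution in $W^{1,p}_{loc}(\Omega)$ of $$\operatorname{div}\left(\frac{1}{f^2}\nabla V\right)=0\quad\text{in }\Omega.$$
   Context: $\mathbb{B}=\{u+\mathbf{j}v : u,v\in\mathbb{C}\}$ is the commutative $\mathbb{C}$-algebra of bicomplex numbers, with $\mathbf{j}^2=-1$ and $i\mathbf{j}=\mathbf{j}i$. For $W=u+\mathbf{j}v$: $\operatorname{Sc}W=u$, $\operatorname{Vec}W=v$, $\overline{W}=u-\mathbf{j}v$. A function $F:\Omega\to\mathbb{B}$ belongs to $\mathscr{F}(\Omega;\mathbb{B})$ (for a space $\mathscr{F}(\Omega)$ of complex-valued functions) iff $\operatorname{Sc}F,\operatorname{Vec}F\in\mathscr{F}(\Omega)$. With $z=x+iy$, $\overline{\boldsymbol{\partial}}=\frac12\left(\frac{\partial}{\partial x}+\mathbf{j}\frac{\partial}{\partial y}\right)$. A function $V\in L_{1,loc}(\Omega;\mathbb{B})$ is the weak $\overline{\boldsymbol{\partial}}$-derivative of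 $W\in L_p(\Omega;\mathbb{B})$ if $\iint_\Omega W\,\overline{\boldsymbol{\partial}}\phi\,dA=-\iint_\Omega V\phi\,dA$ for all $\phi\in C_0^\infty(\Omega;\mathbb{B})$. $\mathcal{A}_f^p(\Omega;\mathbb{B})$ is the set of all weak solutions $W\in L_p(\Omega;\mathbb{B})$ of the main Vekua equation $\overline{\boldsymbol{\partial}}W=\frac{\overline{\boldsymbol{\partial}}f}{f}\,\overline{W}$ in $\Omega$. A function $U\in W^{1,p}_{loc}(\Omega)$ is a weak solution of $\operatorname{div}(\sigma\nabla U)=0$ if $\iint_\Omega\sigma\nabla U\cdot\nabla\varphi\,dA=0$ for all $\varphi\in C_0^\infty(\Omega)$, where $\cdot$ is the bilinear dot product. *)

theory Defs
  imports "HOL-Analysis.Analysis"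
begin

section \<open>Bicomplex numbers\<close>

datatype bicomplex = Bicomplex (Sc: complex) (Vec: complex)

lemma bicomplex_eq_iff: "W = Z \<longleftrightarrow> Sc W = Sc Z \<and> Vec W = Vec Z"
  by (cases W; cases Z) simp

instantiation bicomplex :: comm_ring_1
begin

definition zero_bicomplex where "0 = Bicomplex 0 0"
definition one_bicomplex where "1 = Bicomplex 1 0"
definition plus_bicomplex where
  "W + Z = Bicomplex (Sc W + Sc Z) (Vec W + Vec Z)"
definition minus_bicomplex where
  "W - Z = Bicomplex (Sc W - Sc Z) (Vec W - Vec Z)"
definition uminus_bicomplex where
  "- W = Bicomplex (- Sc W) (- Vec W)"
definition times_bicomplex where
  "W * Z = Bicomplex (Sc W * Sc Z - Vec W * Vec Z) (Sc W * Vec Z + Vec W * Sc Z)"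

instance
  by standard
    (simp_all add: bicomplex_eq_iff zero_bicomplex_def one_bicomplex_def plus_bicomplex_def
      minus_bicomplex_def uminus_bicomplex_def times_bicomplex_def algebra_simps)

end

definition bc_of_complex :: "complex \<Rightarrow> bicomplex" where
  "bc_of_complex u = Bicomplex u 0"

definition bc_j :: bicomplex where
  "bc_j = Bicomplex 0 1"

definition bc_cnj :: "bicomplex \<Rightarrow> bicomplex" where
  "bc_cnj W = Bicomplex (Sc W) (- Vec W)"

lemma bc_j_mult_self: "bc_j * bc_j = - 1"
  by (simp add: bc_j_def times_bicomplex_def uminus_bicomplex_def one_bicomplex_def)

lemma bicomplex_expand: "W = bc_of_complex (Sc W) + bc_j * bc_of_complex (Vec W)"
  by (simp add: bicomplex_eq_iff bc_of_complex_def bc_j_def plus_bicomplex_def times_bicomplex_def)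

definition bc_valued :: "(complex \<Rightarrow> complex) set \<Rightarrow> (complex \<Rightarrow> bicomplex) set" where
  "bc_valued \<F> = {F. (\<lambda>z. Sc (F z)) \<in> \<F> \<and> (\<lambda>z. Vec (F z)) \<in> \<F>}"

definition bc_integral :: "complex set \<Rightarrow> (complex \<Rightarrow> bicomplex) \<Rightarrow> bicomplex" where
  "bc_integral \<Omega> F = Bicomplex (LINT z|lebesgue_on \<Omega>. Sc (F z)) (LINT z|lebesgue_on \<Omega>. Vec (F z))"


section \<open>Lebesgue spaces\<close>

text \<open>Elements of these spaces are representatives; their values outside \<open>\<Omega>\<close> are irrelevant.\<close>

definition Lp :: "real \<Rightarrow> complex set \<Rightarrow> (complex \<Rightarrow> complex) set" where
  "Lp p \<Omega> = {g \<in> borel_measurable (lebesgue_on \<Omega>).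
     integrable (lebesgue_on \<Omega>) (\<lambda>z. norm (g z) powr p)}"

definition Linf :: "complex set \<Rightarrow> (complex \<Rightarrow> complex) set" where
  "Linf \<Omega> = {g \<in> borel_measurable (lebesgue_on \<Omega>).
     \<exists>C. AE z in lebesgue_on \<Omega>. norm (g z) \<le> C}"

definition Lp_loc :: "real \<Rightarrow> complex set \<Rightarrow> (complex \<Rightarrow> complex) set" where
  "Lp_loc p \<Omega> = {g. \<forall>K. compact K \<and> K \<subseteq> \<Omega> \<longrightarrow> g \<in> Lp p K}"


section \<open>Test functions\<close>

text \<open>The directions \<open>e = 1\<close> and \<open>e = \<i>\<close> give the partial derivatives
  with respect to \<open>x\<close> and \<open>y\<close>, where \<open>z = x + \<i> y\<close>. Differentiability is over the reals.\<close>

definition pd :: "complex \<Rightarrow> (complex \<Rightarrow> complex) \<Rightarrow> complex \<Rightarrow> complex" where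
  "pd e \<phi> z = frechet_derivative \<phi> (at z) e"

primrec Ck :: "nat \<Rightarrow> (complex \<Rightarrow> complex) \<Rightarrow> bool" where
  "Ck 0 \<phi> \<longleftrightarrow> continuous_on UNIV \<phi>"
| "Ck (Suc k) \<phi> \<longleftrightarrow> (\<forall>z. \<phi> differentiable at z) \<and> Ck k (pd 1 \<phi>) \<and> Ck k (pd \<i> \<phi>)"

text \<open>Functions in \<open>C\<^sub>0\<^sup>\<infinity>(\<Omega>)\<close> are extended by zero to the whole plane.\<close>

definition test_fun :: "complex set \<Rightarrow> (complex \<Rightarrow> complex) set" where
  "test_fun \<Omega> = {\<phi>. (\<forall>k. Ck k \<phi>) \<and>
     compact (closure {z. \<phi> z \<noteq> 0}) \<and> closure {z. \<phi> z \<noteq> 0} \<subseteq> \<Omega>}"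


section \<open>Weak derivatives and Sobolev spaces\<close>

definition weak_pd ::
  "complex \<Rightarrow> complex set \<Rightarrow> (complex \<Rightarrow> complex) \<Rightarrow> (complex \<Rightarrow> complex) \<Rightarrow> bool" where
  "weak_pd e \<Omega> g h \<longleftrightarrow> g \<in> Lp_loc 1 \<Omega> \<and> h \<in> Lp_loc 1 \<Omega> \<and>
     (\<forall>\<phi>\<in>test_fun \<Omega>. (LINT z|lebesgue_on \<Omega>. g z * pd e \<phi> z) = - (LINT z|lebesgue_on \<Omega>. h z * \<phi> z))"

definition weak_gradient ::
  "complex set \<Rightarrow> (complex \<Rightarrow> complex) \<Rightarrow> (complex \<Rightarrow> complex) \<Rightarrow> (complex \<Rightarrow> complex) \<Rightarrow> bool" where
  "weak_gradient \<Omega> g gx gy \<longleftrightarrow> weak_pd 1 \<Omega> g gx \<and> weak_pd \<i> \<Omega> g gy"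

definition W1inf :: "complex set \<Rightarrow> (complex \<Rightarrow> complex) set" where
  "W1inf \<Omega> = {g \<in> Linf \<Omega>. \<exists>gx \<in> Linf \<Omega>. \<exists>gy \<in> Linf \<Omega>. weak_gradient \<Omega> g gx gy}"

definition W1p_loc :: "real \<Rightarrow> complex set \<Rightarrow> (complex \<Rightarrow> complex) set" where
  "W1p_loc p \<Omega> = {g \<in> Lp_loc p \<Omega>. \<exists>gx \<in> Lp_loc p \<Omega>. \<exists>gy \<in> Lp_loc p \<Omega>. weak_gradient \<Omega> g gx gy}"


section \<open>The main Vekua equation\<close>

definition bc_pd :: "complex \<Rightarrow> (complex \<Rightarrow> bicomplex) \<Rightarrow> complex \<Rightarrow> bicomplex" where
  "bc_pd e \<phi> z = Bicomplex (pd e (\<lambda>w. Sc (\<phi> w)) z) (pd e (\<lambda>w. Vec (\<phi> w)) z)"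

definition bc_dbar :: "(complex \<Rightarrow> bicomplex) \<Rightarrow> complex \<Rightarrow> bicomplex" where
  "bc_dbar \<phi> z = bc_of_complex (1 / 2) * (bc_pd 1 \<phi> z + bc_j * bc_pd \<i> \<phi> z)"

text \<open>Requiring only \<open>W \<in> L\<^sub>1\<^sub>,\<^sub>l\<^sub>o\<^sub>c\<close> makes the notion applicable both to
  \<open>W \<in> L\<^sub>p\<close>, \<open>p \<ge> 1\<close>, and to the coefficient \<open>f \<in> L\<^sub>\<infinity>\<close>.\<close>

definition weak_dbar ::
  "complex set \<Rightarrow> (complex \<Rightarrow> bicomplex) \<Rightarrow> (complex \<Rightarrow> bicomplex) \<Rightarrow> bool" where
  "weak_dbar \<Omega> W V \<longleftrightarrow> W \<in> bc_valued (Lp_loc 1 \<Omega>) \<and> V \<in> bc_valued (Lp_loc 1 \<Omega>) \<and>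
     (\<forall>\<phi>\<in>bc_valued (test_fun \<Omega>).
        bc_integral \<Omega> (\<lambda>z. W z * bc_dbar \<phi> z) = - bc_integral \<Omega> (\<lambda>z. V z * \<phi> z))"

text \<open>Weak derivatives are unique up to null sets, so the choice of the weak derivative \<open>D\<close>
  of \<open>f\<close> is immaterial; the same applies to the weak gradient of \<open>U\<close> further below.\<close>

definition vekua_space ::
  "real \<Rightarrow> complex set \<Rightarrow> (complex \<Rightarrow> complex) \<Rightarrow> (complex \<Rightarrow> bicomplex) set" where
  "vekua_space p \<Omega> f = {W \<in> bc_valued (Lp p \<Omega>).
     \<exists>D. weak_dbar \<Omega> (\<lambda>z. bc_of_complex (f z)) D \<and>
         weak_dbar \<Omega> W (\<lambda>z. D z * bc_of_complex (1 / f z) * bc_cnj (W z))}"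


section \<open>The conductivity equation\<close>

definition weak_conductivity_solution ::
  "real \<Rightarrow> complex set \<Rightarrow> (complex \<Rightarrow> complex) \<Rightarrow> (complex \<Rightarrow> complex) \<Rightarrow> bool" where
  "weak_conductivity_solution p \<Omega> \<sigma> U \<longleftrightarrow> U \<in> W1p_loc p \<Omega> \<and>
     (\<exists>Ux Uy. weak_gradient \<Omega> U Ux Uy \<and>
        (\<forall>\<phi>\<in>test_fun \<Omega>.
           (LINT z|lebesgue_on \<Omega>. \<sigma> z * (Ux z * pd 1 \<phi> z + Uy z * pd \<i> \<phi> z)) = 0))"

end

theory Submission
  imports Defs
begin

text \<open>
  The bicomplex equation splits under \<open>j \<mapsto> c\<close>, \<open>c = \<plusminus>\<i>\<close>, into complex equations for
  \<open>w\<^sub>c = Sc W + c Vec W\<close>, namely \<open>D\<^sub>c w\<^sub>c = (D\<^sub>c f / f) w\<^sub>-\<^sub>c\<close> with \<open>D\<^sub>c = \<partial>\<^sub>x + c \<partial>\<^sub>y\<close>, and the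
  real content is interior regularity. Iterating the bound of \<open>w\<^sub>c\<close> by its Cauchy potential
  three times makes \<open>w\<^sub>c\<close> locally bounded, hence Hoelder continuous. Because \<open>D\<^sub>c f\<close> is itself
  the derivative of a bounded function with bounded gradient, the gradient of the potential of
  \<open>D\<^sub>c f \<cdot> Y\<close>, \<open>Y = w\<^sub>-\<^sub>c / f\<close>, is an absolutely convergent commutator plus \<open>Y \<nabla>f\<close>. Thus \<open>w\<^sub>c\<close> has a
  locally bounded weak gradient for every \<open>p\<close>, without Calderon-Zygmund theory. The product rule
  then turns the Vekua equation into \<open>f\<^sup>2 \<nabla>(u/f) = (\<partial>\<^sub>y(f v), -\<partial>\<^sub>x(f v))\<close>, and both fields are
  divergence free since second derivatives of test functions commute.
\<close>

section \<open>\<open>C\<^sup>k\<close> and smooth functions on the plane: closure properties and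
  rules for partial derivatives\<close>

section \<open>Smooth functions\<close>

text \<open>The obstacle is that \<open>D\<^sub>c f\<close> is only bounded and measurable: the
  Cauchy potential of such a function can have an unbounded gradient, so size estimates alone cannot
  succeed and the product form of the right-hand side must be used. The tools come from one explicit
  family, the kernel \<open>(x - c y) / (|z|^2 + \<epsilon>^2)\<close>, a smooth version of 1/z or
  its conjugate. Its \<open>D\<^sub>c\<close> is twice
  \<open>\<epsilon>^2 / (|z|^2 + \<epsilon>^2)^2\<close>, a positive approximate identity of mass
  pi. Hence for a cut-off solution the Cauchy-Pompeiu formula holds exactly at every positive
  \<epsilon>, between two convolutions with smooth kernels, and the regularity statements are limits
  of it. These kernels decay only algebraically, so compact support is carried by the data. The same
  mollifier serves the fundamental lemma, the product and quotient rules and the symmetry of mixed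
  derivatives. Singular integrals are all reduced to the single weight \<open>|z|^(-3/2)\<close>,
  which is dominated by a product over the two coordinates, so that polar coordinates do not
  enter.\<close>

lemma Ck_SucD:
  assumes "Ck (Suc k) \<phi>"
  shows "(\<phi> has_derivative (\<lambda>h. Re h *\<^sub>R pd 1 \<phi> z + Im h *\<^sub>R pd \<i> \<phi> z)) (at z)"
proof -
  have d: "(\<phi> has_derivative frechet_derivative \<phi> (at z)) (at z)"
    using assms frechet_derivative_works by auto
  interpret bounded_linear "frechet_derivative \<phi> (at z)"
    using d by (rule has_derivative_bounded_linear)
  have "frechet_derivative \<phi> (at z) h = Re h *\<^sub>R pd 1 \<phi> z + Im h *\<^sub>R pd \<i> \<phi> z" for h
  proof -
    have "h = Re h *\<^sub>R 1 + Im h *\<^sub>R \<i>"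
      by (simp add: complex_eq_iff)
    then have "frechet_derivative \<phi> (at z) h = frechet_derivative \<phi> (at z) (Re h *\<^sub>R 1 + Im h *\<^sub>R \<i>)"
      by simp
    then show ?thesis
      by (simp only: add scaleR pd_def)
  qed
  then show ?thesis
    using d by presburger
qed

lemma pd_eqI:
  assumes "(\<phi> has_derivative D) (at z)"
  shows "pd e \<phi> z = D e"
  unfolding pd_def using frechet_derivative_at[OF assms] by simp

text \<open>Once candidates \<open>a\<close>, \<open>b\<close> are exhibited through the total
  derivative, they must be the partials \<open>pd 1 \<phi>\<close> and
  \<open>pd \<i> \<phi>\<close>. The closure proofs below are inductions on \<open>k\<close> through
  this rule.\<close>

lemma Ck_SucI:
  assumes "\<And>z. (\<phi> has_derivative (\<lambda>h. Re h *\<^sub>R a z + Im h *\<^sub>R b z)) (at z)" "Ck k a" "Ck k b"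
  shows "Ck (Suc k) \<phi>"
proof -
  have "pd 1 \<phi> = a" "pd \<i> \<phi> = b"
    using pd_eqI[OF assms(1)] by auto
  then show ?thesis
    using assms by (auto simp: differentiable_def)
qed

lemma Ck_Suc_imp_Ck: "Ck (Suc k) \<phi> \<Longrightarrow> Ck k \<phi>"
proof (induction k arbitrary: \<phi>)
  case 0
  then show ?case
    by (auto simp: continuous_on_eq_continuous_within intro: differentiable_imp_continuous_within)
next
  case (Suc k)
  have "Ck (Suc k) (pd 1 \<phi>)" "Ck (Suc k) (pd \<i> \<phi>)" "\<forall>z. \<phi> differentiable at z"
    using Suc.prems unfolding Ck.simps(2)[of "Suc k"] by blast+
  with Suc.IH show ?case
    by (metis Ck.simps(2))
qed

definition smooth :: "(complex \<Rightarrow> complex) \<Rightarrow> bool" where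
  "smooth \<phi> \<longleftrightarrow> (\<forall>k. Ck k \<phi>)"

lemma smooth_has_derivative:
  "smooth \<phi> \<Longrightarrow> (\<phi> has_derivative (\<lambda>h. Re h *\<^sub>R pd 1 \<phi> z + Im h *\<^sub>R pd \<i> \<phi> z)) (at z)"
  using Ck_SucD smooth_def by blast

lemma smooth_pd_1: "smooth \<phi> \<Longrightarrow> smooth (pd 1 \<phi>)"
  and smooth_pd_i: "smooth \<phi> \<Longrightarrow> smooth (pd \<i> \<phi>)"
  unfolding smooth_def by (metis Ck.simps(2))+

lemma smooth_pd: "smooth \<phi> \<Longrightarrow> e \<in> {1, \<i>} \<Longrightarrow> smooth (pd e \<phi>)"
  using smooth_pd_1 smooth_pd_i by auto

lemma smooth_continuous: "smooth \<phi> \<Longrightarrow> continuous_on UNIV \<phi>"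
  unfolding smooth_def by (metis Ck.simps(1))

lemma smooth_borel_measurable: "smooth \<phi> \<Longrightarrow> \<phi> \<in> borel_measurable borel"
  by (intro borel_measurable_continuous_onI smooth_continuous)

lemma Ck_const: "Ck k (\<lambda>z. c)"
proof (induction k arbitrary: c)
  case (Suc k)
  show ?case
    by (rule Ck_SucI[of _ "\<lambda>_. 0" "\<lambda>_. 0"]) (auto simp: Suc)
qed auto

lemma Ck_add: "Ck k f \<Longrightarrow> Ck k g \<Longrightarrow> Ck k (\<lambda>z. f z + g z)"
proof (induction k arbitrary: f g)
  case 0
  then show ?case by (auto intro: continuous_intros)
next
  case (Suc k)
  note d = Ck_SucD[OF Suc.prems(1)] Ck_SucD[OF Suc.prems(2)]
  show ?case
  proof (rule Ck_SucI)
    show "((\<lambda>z. f z + g z) has_derivative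
        (\<lambda>h. Re h *\<^sub>R (pd 1 f z + pd 1 g z) + Im h *\<^sub>R (pd \<i> f z + pd \<i> g z))) (at z)" for z
      by (rule derivative_eq_intros d refl)+ (auto simp: algebra_simps)
  qed (use Suc in auto)
qed

lemma Ck_mult: "Ck k f \<Longrightarrow> Ck k g \<Longrightarrow> Ck k (\<lambda>z. f z * g z)"
proof (induction k arbitrary: f g)
  case 0
  then show ?case by (auto intro: continuous_intros)
next
  case (Suc k)
  note d = Ck_SucD[OF Suc.prems(1)] Ck_SucD[OF Suc.prems(2)]
  have fg: "Ck k f" "Ck k g"
    using Suc.prems Ck_Suc_imp_Ck by blast+
  show ?case
  proof (rule Ck_SucI)
    show "((\<lambda>z. f z * g z) has_derivative
        (\<lambda>h. Re h *\<^sub>R (pd 1 f z * g z + f z * pd 1 g z) + Im h *\<^sub>R (pd \<i> f z * g z + f z * pd \<i> g z))) (at z)" for z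
      by (rule derivative_eq_intros d refl)+ (auto simp: algebra_simps)
  qed (use Suc fg in \<open>auto intro!: Ck_add\<close>)
qed

lemma Ck_inverse: "Ck k f \<Longrightarrow> (\<And>z. f z \<noteq> 0) \<Longrightarrow> Ck k (\<lambda>z. inverse (f z))"
proof (induction k)
  case 0
  then show ?case by (auto intro: continuous_intros)
next
  case (Suc k)
  note d = Ck_SucD[OF Suc.prems(1)]
  have "Ck k (\<lambda>z. inverse (f z))"
    using Suc Ck_Suc_imp_Ck by blast
  then show ?case
    using Suc.prems
    by (intro Ck_SucI[where a = "\<lambda>z. (-1) * (inverse (f z) * (pd 1 f z * inverse (f z)))"
        and b = "\<lambda>z. (-1) * (inverse (f z) * (pd \<i> f z * inverse (f z)))"] Ck_mult Ck_const)
      (auto intro!: derivative_eq_intros d simp: algebra_simps)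
qed

lemma Ck_cnj: "Ck k f \<Longrightarrow> Ck k (\<lambda>z. cnj (f z))"
proof (induction k arbitrary: f)
  case 0
  then show ?case by (auto intro: continuous_intros)
next
  case (Suc k)
  note d = Ck_SucD[OF Suc.prems(1)]
  show ?case
  proof (rule Ck_SucI)
    show "((\<lambda>z. cnj (f z)) has_derivative
        (\<lambda>h. Re h *\<^sub>R cnj (pd 1 f z) + Im h *\<^sub>R cnj (pd \<i> f z))) (at z)" for z
      by (rule derivative_eq_intros d refl)+ (auto simp: algebra_simps)
  qed (use Suc in auto)
qed

text \<open>Reflection turns a kernel value \<open>\<kappa> (z - t)\<close> into a smooth function
  of the integration variable \<open>t\<close>; times a cutoff it is an admissible test function.
  The minus sign cancels against that of the weak derivative.\<close>

lemma has_derivative_reflect: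
  assumes "Ck (Suc k) f"
  shows "((\<lambda>t. f (a - t)) has_derivative
      (\<lambda>h. Re h *\<^sub>R (- pd 1 f (a - t)) + Im h *\<^sub>R (- pd \<i> f (a - t)))) (at t)"
proof -
  have "((\<lambda>t. a - t) has_derivative (\<lambda>h. - h)) (at t)"
    by (auto intro!: derivative_eq_intros)
  from has_derivative_compose[OF this Ck_SucD[OF assms]]
  show ?thesis
    by (simp add: algebra_simps)
qed

lemma Ck_reflect: "Ck k f \<Longrightarrow> Ck k (\<lambda>t. f (a - t))"
proof (induction k arbitrary: f)
  case 0
  then show ?case
    by (auto intro!: continuous_on_compose2[of UNIV f] continuous_intros)
next
  case (Suc k)
  have "Ck k (\<lambda>t. - 1 * pd 1 f (a - t))" "Ck k (\<lambda>t. - 1 * pd \<i> f (a - t))"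
    using Suc by (intro Ck_mult Ck_const; simp)+
  then show ?case
    by (intro Ck_SucI[OF has_derivative_reflect[OF Suc.prems]]) simp_all
qed

lemma Ck_Re: "Ck k (\<lambda>z. complex_of_real (Re z))"
proof (cases k)
  case (Suc k)
  show ?thesis unfolding Suc
    by (rule Ck_SucI[of _ "\<lambda>_. 1" "\<lambda>_. 0"])
      (auto simp: Ck_const scaleR_conv_of_real intro!: derivative_eq_intros)
qed (auto intro!: continuous_intros)

lemma Ck_Im: "Ck k (\<lambda>z. complex_of_real (Im z))"
proof (cases k)
  case (Suc k)
  show ?thesis unfolding Suc
    by (rule Ck_SucI[of _ "\<lambda>_. 0" "\<lambda>_. 1"])
      (auto simp: Ck_const scaleR_conv_of_real intro!: derivative_eq_intros)
qed (auto intro!: continuous_intros)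

lemma smooth_const : "smooth (\<lambda>z. c)"
  and smooth_add : "smooth f \<Longrightarrow> smooth g \<Longrightarrow> smooth (\<lambda>z. f z + g z)"
  and smooth_mult : "smooth f \<Longrightarrow> smooth g \<Longrightarrow> smooth (\<lambda>z. f z * g z)"
  and smooth_inverse: "smooth f \<Longrightarrow> (\<And>z. f z \<noteq> 0) \<Longrightarrow> smooth (\<lambda>z. inverse (f z))"
  and smooth_cnj: "smooth f \<Longrightarrow> smooth (\<lambda>z. cnj (f z))"
  and smooth_reflect: "smooth f \<Longrightarrow> smooth (\<lambda>t. f (a - t))"
  and smooth_Re : "smooth (\<lambda>z. complex_of_real (Re z))"
  and smooth_Im : "smooth (\<lambda>z. complex_of_real (Im z))"
  unfolding smooth_def
  by (auto intro: Ck_const Ck_add Ck_mult Ck_inverse Ck_cnj Ck_reflect Ck_Re Ck_Im)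

lemma smooth_diff: "smooth f \<Longrightarrow> smooth g \<Longrightarrow> smooth (\<lambda>z. f z - g z)"
  using smooth_add[of f "\<lambda>z. (-1) * g z"] smooth_mult[OF smooth_const, of g "-1"] by simp

lemmas smooth_intros = smooth_const smooth_add smooth_diff smooth_mult smooth_cnj smooth_Re smooth_Im

lemma smooth_prod: "(\<And>i. i \<in> A \<Longrightarrow> smooth (f i)) \<Longrightarrow> smooth (\<lambda>z. \<Prod>i\<in>A. f i z)"
  by (induction A rule: infinite_finite_induct) (simp_all add: smooth_const smooth_mult)

lemma smooth_cmult: "smooth f \<Longrightarrow> smooth (\<lambda>z. c * f z)"
  by (intro smooth_intros)

lemma pd_mult:
  assumes "smooth f" "smooth g" "e \<in> {1, \<i>}"
  shows "pd e (\<lambda>z. f z * g z) z = pd e f z * g z + f z * pd e g z"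
  using assms(3)
  by (subst pd_eqI[OF has_derivative_mult[OF smooth_has_derivative[OF assms(1)] smooth_has_derivative[OF assms(2)]]])
    auto

lemma pd_add:
  assumes "smooth f" "smooth g" "e \<in> {1, \<i>}"
  shows "pd e (\<lambda>z. f z + g z) z = pd e f z + pd e g z"
  using assms(3)
  by (subst pd_eqI[OF has_derivative_add[OF smooth_has_derivative[OF assms(1)] smooth_has_derivative[OF assms(2)]]])
    auto

lemma pd_const: "pd e (\<lambda>z. c) z = 0"
  by (rule pd_eqI) auto

lemma pd_cmult:
  assumes "smooth f" "e \<in> {1, \<i>}"
  shows "pd e (\<lambda>z. c * f z) z = c * pd e f z"
  using pd_mult[OF smooth_const assms] by (simp add: pd_const)

lemma pd_cnj:
  assumes "smooth f" "e \<in> {1, \<i>}"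
  shows "pd e (\<lambda>z. cnj (f z)) z = cnj (pd e f z)"
  using assms(2)
  by (subst pd_eqI[OF has_derivative_cnj[OF smooth_has_derivative[OF assms(1)]]]) auto

lemma pd_inverse:
  assumes "smooth f" "\<And>z. f z \<noteq> 0" "e \<in> {1, \<i>}"
  shows "pd e (\<lambda>z. inverse (f z)) z = - (inverse (f z) * pd e f z * inverse (f z))"
  using assms(3)
  by (subst pd_eqI[OF Deriv.has_derivative_inverse[OF assms(2) smooth_has_derivative[OF assms(1)]]]) auto

lemma pd_reflect:
  assumes "smooth f" "e \<in> {1, \<i>}"
  shows "pd e (\<lambda>t. f (a - t)) t = - pd e f (a - t)"
proof -
  have "Ck (Suc 0) f"
    using assms(1) smooth_def by blast
  from pd_eqI[OF has_derivative_reflect[OF this]] show ?thesis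
    using assms(2) by auto
qed

section \<open>Flat functions, cutoffs for balls and for compact sets\<close>

subsection \<open>Cutoff functions\<close>

text \<open>Dividing by \<open>t ^ n\<close> closes the family under differentiation, at the price
  of a higher index. The single function \<open>exp (- 1 / t)\<close> would not support the
  induction that gives smoothness at 0.\<close>

definition flat :: "nat \<Rightarrow> real \<Rightarrow> real" where
  "flat n t = (if t > 0 then exp (- 1 / t) / t ^ n else 0)"

lemma flat_has_real_derivative:
  "(flat n has_real_derivative (flat (n + 2) t - n * flat (n + 1) t)) (at t)"
proof -
  consider "t > 0" | "t < 0" | "t = 0" by linarith
  then show ?thesis
  proof cases
    case 1
    have "((\<lambda>t. exp (- 1 / t) / t ^ n) has_real_derivative (flat (n + 2) t - n * flat (n + 1) t)) (at t)"
      using 1 by (auto intro!: derivative_eq_intros simp: flat_def)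
        (cases n; simp add: field_simps power2_eq_square)
    moreover have "\<forall>\<^sub>F x in nhds t. exp (- 1 / x) / x ^ n = flat n x"
      using eventually_gt_at_top 1 by (auto simp: flat_def eventually_nhds intro!: exI[of _ "{0<..}"])
    ultimately show ?thesis
      by (subst (asm) DERIV_cong_ev[OF refl _ refl]) auto
  next
    case 2
    have "((\<lambda>t. 0) has_real_derivative 0) (at t)" by auto
    moreover have "\<forall>\<^sub>F x in nhds t. 0 = flat n x"
      using 2 by (auto simp: flat_def eventually_nhds intro!: exI[of _ "{..<0}"])
    ultimately show ?thesis
      using 2 by (subst (asm) DERIV_cong_ev[OF refl _ refl]) (auto simp: flat_def)
  next
    case 3
    \<comment> \<open>The difference quotient of \<open>flat n\<close> at 0 is
      \<open>flat (n + 1)\<close>; with x = 1/y its limit is that of a power of x against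
      \<open>exp x\<close>.\<close>
    have lim: "((\<lambda>y::real. exp (- 1 / y) / y ^ (n + 1)) \<longlongrightarrow> 0) (at_right 0)"
    proof -
      have "((\<lambda>x::real. x ^ (n + 1) / exp x) \<longlongrightarrow> 0) at_top"
        by (rule tendsto_power_div_exp_0)
      then have "((\<lambda>y::real. inverse y ^ (n + 1) / exp (inverse y)) \<longlongrightarrow> 0) (at_right 0)"
        by (rule filterlim_compose) (rule filterlim_inverse_at_top_right)
      then show ?thesis
        by (simp add: exp_minus field_simps)
    qed
    have "((\<lambda>y. flat n y / y) \<longlongrightarrow> 0) (at_right 0)"
      by (rule Lim_transform_eventually[OF lim])
        (auto simp: flat_def intro: eventually_mono[OF eventually_at_right_less])
    moreover have "((\<lambda>y. flat n y / y) \<longlongrightarrow> 0) (at_left 0)"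
      by (rule Lim_transform_eventually[OF tendsto_const])
        (auto simp: flat_def eventually_at_filter)
    ultimately have "((\<lambda>y. flat n y / y) \<longlongrightarrow> 0) (at 0)"
      by (simp add: filterlim_at_split)
    then show ?thesis
      using 3 by (simp add: has_field_derivative_iff flat_def)
  qed
qed

text \<open>\<open>n\<close> stays arbitrary in the induction because the derivative involves
  \<open>flat (n + 1)\<close> and \<open>flat (n + 2)\<close>.\<close>

lemma Ck_flat:
  assumes "\<And>z. (q has_derivative (\<lambda>h. Re h * a z + Im h * b z)) (at z)"
    and "\<And>k. Ck k (\<lambda>z. complex_of_real (a z))" "\<And>k. Ck k (\<lambda>z. complex_of_real (b z))"
  shows "Ck k (\<lambda>z. complex_of_real (flat n (q z)))"
proof (induction k arbitrary: n)
  case 0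
  have "continuous_on UNIV (flat n)"
    using flat_has_real_derivative DERIV_isCont continuous_at_imp_continuous_on by blast
  moreover have "continuous_on UNIV q"
    by (rule has_derivative_continuous_on) (rule has_derivative_at_withinI[OF assms(1)])
  ultimately have "continuous_on UNIV (\<lambda>z. flat n (q z))"
    by (rule continuous_on_compose2) simp
  then show ?case
    by (simp add: continuous_on_of_real)
next
  case (Suc k)
  let ?D = "\<lambda>z. complex_of_real (flat (n + 2) (q z)) + (- of_nat n) * complex_of_real (flat (n + 1) (q z))"
  show ?case
  proof (rule Ck_SucI)
    show "((\<lambda>z. complex_of_real (flat n (q z))) has_derivative
        (\<lambda>h. Re h *\<^sub>R (?D z * of_real (a z)) + Im h *\<^sub>R (?D z * of_real (b z)))) (at z)" for z
    proof -
      have "((\<lambda>z. flat n (q z)) has_derivative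
          (\<lambda>h. (Re h * a z + Im h * b z) * (flat (n + 2) (q z) - n * flat (n + 1) (q z)))) (at z)"
        using has_derivative_compose[OF assms(1) flat_has_real_derivative[unfolded has_field_derivative_def]]
        by (simp add: mult.commute)
      from has_derivative_of_real[OF this, where ?'a = complex] show ?thesis
        by (rule has_derivative_eq_rhs) (simp add: fun_eq_iff scaleR_conv_of_real algebra_simps)
    qed
  qed (intro Ck_mult Ck_add Ck_const Suc assms)+
qed

text \<open>The quotient \<open>flat(q) / (flat(q) + flat(p))\<close> with
  \<open>q = r^2 - |z - a|^2\<close>, positive inside the ball, and
  \<open>p = |z - a|^2 - r^2/4\<close>, positive outside the closed half ball. The sum of p and q is
  the constant \<open>3 r^2 / 4\<close>, so one of them is always positive and the denominator never
  vanishes.\<close>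

lemma ball_cutoff:
  assumes "0 < r"
  obtains s where "smooth s" "\<And>z. s z \<in> \<real>" "\<And>z. 0 \<le> Re (s z)" "\<And>z. Re (s z) \<le> 1"
    "\<And>z. z \<in> ball a (r / 2) \<Longrightarrow> s z = 1" "\<And>z. z \<notin> ball a r \<Longrightarrow> s z = 0"
proof
  let ?q = "\<lambda>z. r\<^sup>2 - ((Re z - Re a)\<^sup>2 + (Im z - Im a)\<^sup>2)"
  let ?p = "\<lambda>z. 3 * r\<^sup>2 / 4 - ?q z"
  define s where "s z = complex_of_real (flat 0 (?q z)) *
      inverse (complex_of_real (flat 0 (?q z)) + complex_of_real (flat 0 (?p z)))" for z
  have nn: "flat 0 t \<ge> 0" for t by (auto simp: flat_def)
  have fpos: "flat 0 t > 0" if "t > 0" for t using that by (auto simp: flat_def)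
  have "r\<^sup>2 > 0" using assms by simp
  have pos: "flat 0 (?q z) + flat 0 (?p z) > 0" for z
  proof -
    from \<open>r\<^sup>2 > 0\<close> have "?q z > 0 \<or> ?p z > 0" by linarith
    then show ?thesis
    proof
      assume "?q z > 0"
      from add_pos_nonneg[OF fpos[OF this] nn] show ?thesis .
    next
      assume "?p z > 0"
      from add_nonneg_pos[OF nn fpos[OF this]] show ?thesis .
    qed
  qed
  have re: "s z = of_real (flat 0 (?q z) / (flat 0 (?q z) + flat 0 (?p z)))" for z
    by (simp only: s_def divide_inverse of_real_mult of_real_inverse of_real_add)
  have R: "smooth (\<lambda>z. complex_of_real (c * (Re z - Re a)))" "smooth (\<lambda>z. complex_of_real (c * (Im z - Im a)))" for c
    unfolding of_real_mult of_real_diff by (intro smooth_intros)+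
  have 1: "Ck k (\<lambda>z. complex_of_real (flat 0 (?q z)))" for k
    by (rule Ck_flat[of _ "\<lambda>z. (-2) * (Re z - Re a)" "\<lambda>z. (-2) * (Im z - Im a)"])
       ((rule allE[OF R(1)[unfolded smooth_def]] allE[OF R(2)[unfolded smooth_def]], assumption) |
         (auto intro!: derivative_eq_intros simp: algebra_simps; fail))+
  have 2: "Ck k (\<lambda>z. complex_of_real (flat 0 (?p z)))" for k
    by (rule Ck_flat[of _ "\<lambda>z. 2 * (Re z - Re a)" "\<lambda>z. 2 * (Im z - Im a)"])
       ((rule allE[OF R(1)[unfolded smooth_def]] allE[OF R(2)[unfolded smooth_def]], assumption) |
         (auto intro!: derivative_eq_intros simp: algebra_simps; fail))+
  have "complex_of_real (flat 0 (?q z)) + complex_of_real (flat 0 (?p z)) \<noteq> 0" for z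
    using pos[of z] by (metis less_irrefl of_real_add of_real_eq_0_iff)
  then show "smooth s"
    unfolding s_def using 1 2 by (intro smooth_mult smooth_inverse smooth_add) (auto simp: smooth_def)
  show "s z \<in> \<real>" for z by (simp add: re)
  show "0 \<le> Re (s z)" for z using nn by (simp add: re)
  show "Re (s z) \<le> 1" for z using pos[of z] nn[of "?p z"] by (simp add: re)
  have dist: "(dist a z)\<^sup>2 = (Re z - Re a)\<^sup>2 + (Im z - Im a)\<^sup>2" for z
    by (simp add: dist_norm cmod_power2 power2_commute)
  show "s z = 1" if "z \<in> ball a (r / 2)" for z
  proof -
    have "(dist a z)\<^sup>2 < (r / 2)\<^sup>2"
      using that by (intro power_strict_mono) auto
    then have "?p z < 0" "?q z > 0" unfolding dist[symmetric] using assms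
      by (auto simp: power_divide intro: le_less_trans) (smt (verit) zero_less_power)
    then show ?thesis by (simp add: re flat_def)
  qed
  show "s z = 0" if "z \<notin> ball a r" for z
  proof -
    have "(dist a z)\<^sup>2 \<ge> r\<^sup>2"
      using that assms by (intro power_mono) auto
    then show ?thesis unfolding re dist[symmetric] by (simp add: flat_def)
  qed
qed

text \<open>Any compact set outside which \<phi> vanishes may replace the closure of the nonzero
  set; products and convolutions are easier to handle in this form.\<close>

lemma test_fun_iff:
  "\<phi> \<in> test_fun \<Omega> \<longleftrightarrow> smooth \<phi> \<and> (\<exists>K. compact K \<and> K \<subseteq> \<Omega> \<and> (\<forall>z. z \<notin> K \<longrightarrow> \<phi> z = 0))"
proof
  assume "\<phi> \<in> test_fun \<Omega>"
  then show "smooth \<phi> \<and> (\<exists>K. compact K \<and> K \<subseteq> \<Omega> \<and> (\<forall>z. z \<notin> K \<longrightarrow> \<phi> z = 0))"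
    unfolding test_fun_def smooth_def
    by (auto intro!: exI[of _ "closure {z. \<phi> z \<noteq> 0}"] dest: contra_subsetD[OF closure_subset])
next
  assume "smooth \<phi> \<and> (\<exists>K. compact K \<and> K \<subseteq> \<Omega> \<and> (\<forall>z. z \<notin> K \<longrightarrow> \<phi> z = 0))"
  then obtain K where K: "compact K" "K \<subseteq> \<Omega>" "\<And>z. z \<notin> K \<Longrightarrow> \<phi> z = 0" "smooth \<phi>"
    by auto
  have "closure {z. \<phi> z \<noteq> 0} \<subseteq> K"
    by (rule closure_minimal) (use K in \<open>auto simp: compact_imp_closed\<close>)
  then show "\<phi> \<in> test_fun \<Omega>"
    using K unfolding test_fun_def smooth_def
    by (auto intro: compact_closure[THEN iffD2] bounded_subset[OF compact_imp_bounded]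
        bounded_subset[OF compact_imp_bounded closure_subset[THEN subset_trans]])
qed

text \<open>Finitely many half balls cover \<open>K\<close>. The function
  \<open>1 - \<Prod>(1 - s a)\<close> is 1 where some \<open>s a\<close> is 1, and 0 where all of
  them are 0. Being 1 on a neighbourhood of \<open>K\<close>, not just on \<open>K\<close>, makes
  the derivatives of the cutoff vanish there; realness and nonnegativity serve in the quotient
  rule.\<close>

lemma cutoff_exists:
  assumes "open \<Omega>" "compact K" "K \<subseteq> \<Omega>"
  obtains \<eta> U where "\<eta> \<in> test_fun \<Omega>" "\<And>z. \<eta> z \<in> \<real>" "\<And>z. 0 \<le> Re (\<eta> z)" "\<And>z. Re (\<eta> z) \<le> 1"
    "open U" "K \<subseteq> U" "\<And>z. z \<in> U \<Longrightarrow> \<eta> z = 1"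
proof -
  have "\<forall>a\<in>K. \<exists>r>0. cball a r \<subseteq> \<Omega>"
    using assms open_contains_cball by blast
  then obtain r where r: "\<And>a. a \<in> K \<Longrightarrow> r a > 0 \<and> cball a (r a) \<subseteq> \<Omega>"
    by metis
  have "K \<subseteq> (\<Union>a\<in>K. ball a (r a / 2))"
    using r by fastforce
  then obtain A where A: "A \<subseteq> K" "finite A" "K \<subseteq> (\<Union>a\<in>A. ball a (r a / 2))"
    using compactE_image[OF assms(2), of K "\<lambda>a. ball a (r a / 2)"] by auto
  define good where "good a s \<longleftrightarrow> smooth s \<and> (\<forall>z. s z \<in> \<real> \<and> 0 \<le> Re (s z) \<and> Re (s z) \<le> 1 \<and>
      (z \<in> ball a (r a / 2) \<longrightarrow> s z = 1) \<and> (z \<notin> ball a (r a) \<longrightarrow> s z = 0))" for a s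
  have "\<exists>s. good a s" if "a \<in> A" for a
  proof -
    have "0 < r a" using r A(1) that by blast
    then obtain s where "smooth s" "\<And>z. s z \<in> \<real>" "\<And>z. 0 \<le> Re (s z)" "\<And>z. Re (s z) \<le> 1"
      "\<And>z. z \<in> ball a (r a / 2) \<Longrightarrow> s z = 1" "\<And>z. z \<notin> ball a (r a) \<Longrightarrow> s z = 0"
      by (rule ball_cutoff) blast
    then have "good a s" unfolding good_def by blast
    then show ?thesis by (rule exI[of _ s])
  qed
  then have "\<forall>a\<in>A. \<exists>s. good a s" by (rule ballI)
  from bchoice[OF this] obtain s where good: "\<And>a. a \<in> A \<Longrightarrow> good a (s a)"
    by (elim exE) (rule that, rule bspec)
  have s: "\<And>a. a \<in> A \<Longrightarrow> smooth (s a)"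
    "\<And>a z. a \<in> A \<Longrightarrow> s a z \<in> \<real>"  "\<And>a z. a \<in> A \<Longrightarrow> 0 \<le> Re (s a z)" "\<And>a z. a \<in> A \<Longrightarrow> Re (s a z) \<le> 1"
    "\<And>a z. a \<in> A \<Longrightarrow> z \<in> ball a (r a / 2) \<Longrightarrow> s a z = 1"
    "\<And>a z. a \<in> A \<Longrightarrow> z \<notin> ball a (r a) \<Longrightarrow> s a z = 0"
    using good unfolding good_def by simp_all
  define \<eta> where "\<eta> z = 1 - (\<Prod>a\<in>A. 1 - s a z)" for z
  have re: "\<eta> z = of_real (1 - (\<Prod>a\<in>A. 1 - Re (s a z)))" for z
    unfolding \<eta>_def of_real_diff of_real_prod
    by (auto intro!: prod.cong simp: s(2) )
  have "0 \<le> (\<Prod>a\<in>A. 1 - Re (s a z))" "(\<Prod>a\<in>A. 1 - Re (s a z)) \<le> 1" for z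
    by (auto intro!: prod_nonneg prod_le_1 simp: s)
  then have 1: "\<And>z. \<eta> z \<in> \<real>" "\<And>z. 0 \<le> Re (\<eta> z)" "\<And>z. Re (\<eta> z) \<le> 1"
    unfolding re by (simp_all del: of_real_diff of_real_prod)
  have 2: "\<eta> z = 1" if z: "z \<in> (\<Union>a\<in>A. ball a (r a / 2))" for z
  proof -
    obtain a where "a \<in> A" "s a z = 1" using z s(5) by blast
    then have "(\<Prod>a\<in>A. 1 - s a z) = 0" using A(2) by (intro prod_zero) auto
    then show ?thesis by (simp add: \<eta>_def)
  qed
  have 3: "\<eta> \<in> test_fun \<Omega>"
    unfolding test_fun_iff
  proof (intro conjI exI)
    show "smooth \<eta>"
      unfolding \<eta>_def by (intro smooth_diff smooth_prod smooth_const s)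
    show "compact (\<Union>a\<in>A. cball a (r a))"
      using A by (intro compact_UN) auto
    show "(\<Union>a\<in>A. cball a (r a)) \<subseteq> \<Omega>"
      using A r by blast
    show "\<forall>z. z \<notin> (\<Union>a\<in>A. cball a (r a)) \<longrightarrow> \<eta> z = 0"
    proof (intro allI impI)
      fix z assume "z \<notin> (\<Union>a\<in>A. cball a (r a))"
      then have "s a z = 0" if "a \<in> A" for a
        using that s(6) by (metis UN_I ball_subset_cball subsetD)
      then have "(\<Prod>a\<in>A. 1 - s a z) = 1" by (intro prod.neutral) simp
      then show "\<eta> z = 0" by (simp add: \<eta>_def)
    qed
  qed
  show ?thesis
    by (rule that[OF 3 1 _ A(3) 2]) auto
qed

lemma test_fun_smooth: "\<phi> \<in> test_fun \<Omega> \<Longrightarrow> smooth \<phi>"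
  by (simp add: test_fun_iff)

lemma test_fun_mult: "\<phi> \<in> test_fun \<Omega> \<Longrightarrow> smooth g \<Longrightarrow> (\<lambda>z. \<phi> z * g z) \<in> test_fun \<Omega>"
  unfolding test_fun_iff by (metis mult_zero_left smooth_mult)

lemma pd_eq_0_if_locally_const:
  assumes "open U" "z \<in> U" "\<And>z. z \<in> U \<Longrightarrow> \<phi> z = c"
  shows "pd e \<phi> z = 0"
proof (rule pd_eqI)
  show "(\<phi> has_derivative (\<lambda>h. 0)) (at z)"
    by (rule has_derivative_transform_within_open[OF has_derivative_const[of c] assms(1,2)])
       (simp add: assms)
qed

lemma test_fun_pd:
  assumes "\<phi> \<in> test_fun \<Omega>" "e \<in> {1, \<i>}"
  shows "pd e \<phi> \<in> test_fun \<Omega>"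
proof -
  from assms obtain K where K: "smooth \<phi>" "compact K" "K \<subseteq> \<Omega>" "\<And>z. z \<notin> K \<Longrightarrow> \<phi> z = 0"
    by (auto simp: test_fun_iff)
  have "pd e \<phi> z = 0" if "z \<notin> K" for z
    using K that pd_eq_0_if_locally_const[of "- K" z \<phi> 0] by (auto simp: compact_imp_closed open_Compl)
  then show ?thesis
    using K smooth_pd assms(2) unfolding test_fun_iff by blast
qed

section \<open>Convolution of compactly supported integrable data with continuous and smooth
  kernels\<close>

section \<open>Convolution\<close>

text \<open>Affine change of variables solved for the pushforward; the square of
  \<open>\<bar>c\<bar>\<close> is the Jacobian in real dimension 2. Reflection and translation are
  the cases -1 and 1, and general \<open>c\<close> gives the dilations of an approximate
  identity.\<close>

lemma distr_lborel_affine: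
  fixes a :: complex
  assumes "c \<noteq> 0"
  shows "distr lborel borel (\<lambda>t. a + c *\<^sub>R t) = density lborel (\<lambda>_. ennreal (inverse (\<bar>c\<bar>\<^sup>2)))"
proof -
  have "density lborel (\<lambda>_. ennreal (inverse (\<bar>c\<bar>\<^sup>2))) =
      density (density (distr lborel borel (\<lambda>x. a + c *\<^sub>R x)) (\<lambda>_. ennreal (\<bar>c\<bar>\<^sup>2))) (\<lambda>_. ennreal (inverse (\<bar>c\<bar>\<^sup>2)))"
    using lborel_affine[OF assms, of a] by simp
  also have "\<dots> = density (distr lborel borel (\<lambda>x. a + c *\<^sub>R x)) (\<lambda>_. ennreal (\<bar>c\<bar>\<^sup>2) * ennreal (inverse (\<bar>c\<bar>\<^sup>2)))"
    by (subst density_density_eq) auto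
  also have "\<dots> = distr lborel borel (\<lambda>x. a + c *\<^sub>R x)"
    using assms by (subst density_1[symmetric]) (simp add: ennreal_mult[symmetric] flip: one_ennreal_def)
  finally show ?thesis ..
qed

lemma distr_lborel_reflect: "distr lborel borel (\<lambda>t. a - t) = (lborel :: complex measure)"
  using distr_lborel_affine[of "-1" a] by (simp add: density_1)

lemma distr_lborel_shift: "distr lborel borel (\<lambda>t. t - a) = (lborel :: complex measure)"
  using distr_lborel_affine[of 1 "- a"] by (simp add: density_1)

lemma integral_lborel_reflect:
  fixes g :: "complex \<Rightarrow> 'a::{banach, second_countable_topology}"
  assumes [measurable]: "g \<in> borel_measurable borel"
  shows "(LINT t|lborel. g (a - t)) = (LINT t|lborel. g t)"
  by (subst (2) distr_lborel_reflect[of a, symmetric]) (simp add: integral_distr)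

lemma integral_lborel_shift:
  fixes g :: "complex \<Rightarrow> 'a::{banach, second_countable_topology}"
  assumes [measurable]: "g \<in> borel_measurable borel"
  shows "(LINT t|lborel. g (t - a)) = (LINT t|lborel. g t)"
  by (subst (2) distr_lborel_shift[of a, symmetric]) (simp add: integral_distr)

lemma integrable_lborel_shift:
  fixes g :: "complex \<Rightarrow> 'a::{banach, second_countable_topology}"
  assumes "integrable lborel g"
  shows "integrable lborel (\<lambda>t. g (t - a))"
proof -
  have "integrable (distr lborel borel (\<lambda>t. t - a)) g"
    unfolding distr_lborel_shift by fact
  then show ?thesis
    by (rule integrable_distr[rotated]) simp
qed

lemma nn_integral_lborel_reflect:
  fixes a :: complex
  assumes [measurable]: "g \<in> borel_measurable borel"
  shows "(\<integral>\<^sup>+ t. g (a - t) \<partial>lborel) = (\<integral>\<^sup>+ t. g t \<partial>lborel)"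
  by (subst (2) distr_lborel_reflect[of a, symmetric]) (simp add: nn_integral_distr)

definition conv :: "(complex \<Rightarrow> complex) \<Rightarrow> (complex \<Rightarrow> complex) \<Rightarrow> complex \<Rightarrow> complex" where
  "conv w \<kappa> z = (LINT t|lborel. w t * \<kappa> (z - t))"

text \<open>Compact support is demanded of the data, not of the kernel: at a given point only values
  of the kernel on a bounded set enter, so continuity of the kernel suffices and slow decay is
  harmless.\<close>

definition L1c :: "(complex \<Rightarrow> complex) \<Rightarrow> bool" where
  "L1c w \<longleftrightarrow> integrable lborel w \<and> (\<exists>R. \<forall>t. R < norm t \<longrightarrow> w t = 0)"

lemma L1c_integrable: "L1c w \<Longrightarrow> integrable lborel w"
  by (simp add: L1c_def)

lemma L1c_borel: "L1c w \<Longrightarrow> w \<in> borel_measurable borel"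
  using L1c_integrable borel_measurable_integrable by fastforce

lemma L1c_add:
  assumes "L1c v" "L1c w"
  shows "L1c (\<lambda>t. v t + w t)"
proof -
  from assms obtain R S where "\<And>t. R < norm t \<Longrightarrow> v t = 0" "\<And>t. S < norm t \<Longrightarrow> w t = 0"
    unfolding L1c_def by metis
  then have "\<forall>t. max R S < norm t \<longrightarrow> v t + w t = 0" by simp
  with assms show ?thesis unfolding L1c_def by blast
qed

lemma continuous_bound_cball:
  fixes \<kappa> :: "complex \<Rightarrow> complex"
  assumes "continuous_on UNIV \<kappa>"
  obtains C where "0 < C" "\<And>z. norm z \<le> R \<Longrightarrow> norm (\<kappa> z) \<le> C"
proof -
  have "compact (\<kappa> ` cball 0 R)"
    using assms by (intro compact_continuous_image continuous_on_subset[OF assms]) auto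
  then obtain C where "0 < C" "\<forall>x\<in>\<kappa> ` cball 0 R. norm x \<le> C"
    using compact_imp_bounded bounded_pos by metis
  then show ?thesis by (intro that[of C]) auto
qed

lemma L1c_bound_integrable:
  fixes g :: "complex \<Rightarrow> complex"
  assumes "L1c w" "g \<in> borel_measurable borel" "\<And>t. norm (g t) \<le> C * norm (w t)"
  shows "integrable lborel g"
proof (rule Bochner_Integration.integrable_bound)
  show "integrable lborel (\<lambda>t. C * norm (w t))"
    using assms by (auto intro: L1c_integrable integrable_norm)
  show "AE x in lborel. norm (g x) \<le> norm (C * norm (w x))"
    using assms(3) by (intro AE_I2) (metis abs_ge_self order_trans real_norm_def)
qed (use assms in auto)

text \<open>For z and t in bounded sets the difference z - t stays in a fixed ball, where the
  continuous kernel is bounded. The constant does not depend on z, as dominated convergence along a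
  sequence of points requires.\<close>

lemma conv_bounded_point:
  assumes "L1c w" "continuous_on UNIV \<kappa>"
  obtains C where "0 < C" "\<And>z t. norm z \<le> B \<Longrightarrow> norm (w t * \<kappa> (z - t)) \<le> C * norm (w t)"
proof -
  obtain R where R: "\<And>t. R < norm t \<Longrightarrow> w t = 0"
    using assms unfolding L1c_def by blast
  obtain C where C: "0 < C" "\<And>z. norm z \<le> B + R \<Longrightarrow> norm (\<kappa> z) \<le> C"
    using continuous_bound_cball[OF assms(2), of "B + R"] by blast
  show ?thesis
  proof (rule that[OF C(1)])
    fix z t :: complex assume z: "norm z \<le> B"
    show "norm (w t * \<kappa> (z - t)) \<le> C * norm (w t)"
    proof (cases "norm t \<le> R")
      case True
      then have "norm (z - t) \<le> B + R"
        using z norm_triangle_ineq4[of z t] by linarith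
      then show ?thesis
        using C(2)[of "z - t"] by (simp add: norm_mult mult.commute[of C] mult_left_mono)
    qed (use R in simp)
  qed
qed

lemma conv_integrable:
  assumes "L1c w" "continuous_on UNIV \<kappa>"
  shows "integrable lborel (\<lambda>t. w t * \<kappa> (z - t))"
proof -
  obtain C where C: "\<And>z' t. norm z' \<le> norm z \<Longrightarrow> norm (w t * \<kappa> (z' - t)) \<le> C * norm (w t)"
    using conv_bounded_point[OF assms, of "norm z"] by blast
  have [measurable]: "w \<in> borel_measurable borel" "\<kappa> \<in> borel_measurable borel"
    using assms by (auto intro: L1c_borel borel_measurable_continuous_onI)
  show ?thesis
    by (rule L1c_bound_integrable[OF assms(1) _ C]) auto
qed

lemma LIMSEQ_norm_bounded:
  fixes x :: "nat \<Rightarrow> 'a::real_normed_vector"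
  assumes "x \<longlonglongrightarrow> a"
  obtains B where "\<And>n. norm (x n) \<le> B"
  using convergent_imp_Bseq[OF convergentI[OF assms]] unfolding Bseq_def by blast

lemma conv_continuous:
  assumes "L1c w" "continuous_on UNIV \<kappa>"
  shows "continuous_on UNIV (conv w \<kappa>)"
  unfolding continuous_on_sequentially
proof (intro ballI allI impI)
  fix x :: "nat \<Rightarrow> complex" and a
  assume "a \<in> UNIV" and x: "(\<forall>n. x n \<in> UNIV) \<and> x \<longlonglongrightarrow> a"
  then obtain B where B: "\<And>n. norm (x n) \<le> B"
    using LIMSEQ_norm_bounded by blast
  obtain C where C: "\<And>z t. norm z \<le> B \<Longrightarrow> norm (w t * \<kappa> (z - t)) \<le> C * norm (w t)"
    using conv_bounded_point[OF assms, of B] by blast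
  have [measurable]: "w \<in> borel_measurable borel" "\<kappa> \<in> borel_measurable borel"
    using assms by (auto intro: L1c_borel borel_measurable_continuous_onI)
  have "(\<lambda>n. LINT t|lborel. w t * \<kappa> (x n - t)) \<longlonglongrightarrow> (LINT t|lborel. w t * \<kappa> (a - t))"
  proof (rule integral_dominated_convergence)
    show "integrable lborel (\<lambda>t. C * norm (w t))"
      using assms by (auto intro: L1c_integrable integrable_norm)
    show "AE t in lborel. (\<lambda>n. w t * \<kappa> (x n - t)) \<longlonglongrightarrow> w t * \<kappa> (a - t)"
    proof (intro AE_I2 tendsto_mult tendsto_const)
      fix t
      show "(\<lambda>n. \<kappa> (x n - t)) \<longlonglongrightarrow> \<kappa> (a - t)"
        by (rule continuous_on_tendsto_compose[OF assms(2)]) (use x in \<open>auto intro!: tendsto_diff\<close>)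
    qed
    show "AE t in lborel. norm (w t * \<kappa> (x n - t)) \<le> C * norm (w t)" for n
      using C[OF B] by simp
  qed auto
  then show "(conv w \<kappa> \<circ> x) \<longlonglongrightarrow> conv w \<kappa> a"
    by (simp add: conv_def o_def)
qed

text \<open>Mean value inequality on a convex set; the 2 comes from
  \<open>\<bar>Re h\<bar> + \<bar>Im h\<bar> \<le> 2 * norm h\<close>.\<close>

lemma Ck1_Lipschitz:
  assumes "Ck (Suc k) \<kappa>" "convex S" "\<And>z. z \<in> S \<Longrightarrow> norm (pd 1 \<kappa> z) \<le> C" "\<And>z. z \<in> S \<Longrightarrow> norm (pd \<i> \<kappa> z) \<le> C"
    "x \<in> S" "y \<in> S"
  shows "norm (\<kappa> x - \<kappa> y) \<le> 2 * C * norm (x - y)"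
proof (rule differentiable_bound[OF assms(2) has_derivative_at_withinI[OF Ck_SucD[OF assms(1)]] _ assms(5,6)])
  fix z assume z: "z \<in> S"
  have C: "0 \<le> C" using assms(3)[OF z] norm_ge_zero order_trans by blast
  show "onorm (\<lambda>h. Re h *\<^sub>R pd 1 \<kappa> z + Im h *\<^sub>R pd \<i> \<kappa> z) \<le> 2 * C"
  proof (rule onorm_le)
    fix h
    have "norm (Re h *\<^sub>R pd 1 \<kappa> z + Im h *\<^sub>R pd \<i> \<kappa> z) \<le> \<bar>Re h\<bar> * norm (pd 1 \<kappa> z) + \<bar>Im h\<bar> * norm (pd \<i> \<kappa> z)"
      by (rule norm_triangle_le) simp
    also have "\<dots> \<le> norm h * C + norm h * C"
      using assms(3,4)[OF z] C abs_Re_le_cmod abs_Im_le_cmod by (intro add_mono mult_mono) auto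
    finally show "norm (Re h *\<^sub>R pd 1 \<kappa> z + Im h *\<^sub>R pd \<i> \<kappa> z) \<le> 2 * C * norm h"
      by (simp add: algebra_simps)
  qed
qed

text \<open>Differentiation under the integral sign in the Frechet sense: the first-order remainder
  of \<kappa>, divided by the increment, tends to 0 pointwise and is dominated through a Lipschitz
  bound on a fixed ball.\<close>

lemma conv_has_derivative:
  assumes w: "L1c w" and k: "Ck (Suc 0) \<kappa>"
  shows "(conv w \<kappa> has_derivative (\<lambda>h. Re h *\<^sub>R conv w (pd 1 \<kappa>) z + Im h *\<^sub>R conv w (pd \<i> \<kappa>) z)) (at z)"
  unfolding has_derivative_iff_norm
proof (intro conjI)
  show "bounded_linear (\<lambda>h. Re h *\<^sub>R conv w (pd 1 \<kappa>) z + Im h *\<^sub>R conv w (pd \<i> \<kappa>) z)"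
    by (intro bounded_linear_add bounded_linear_scaleR_left bounded_linear_compose[OF bounded_linear_scaleR_left]
        bounded_linear_Re bounded_linear_Im)
  have c: "continuous_on UNIV \<kappa>" "continuous_on UNIV (pd 1 \<kappa>)" "continuous_on UNIV (pd \<i> \<kappa>)"
    using k Ck_Suc_imp_Ck[OF k] by auto
  note [measurable] = c[THEN borel_measurable_continuous_onI] L1c_borel[OF w]
  obtain R where R: "\<And>t. R < norm t \<Longrightarrow> w t = 0"
    using w unfolding L1c_def by blast
  define D where "D a h = Re h *\<^sub>R pd 1 \<kappa> a + Im h *\<^sub>R pd \<i> \<kappa> a" for a h
  have D: "(\<kappa> has_derivative D a) (at a)" for a
    unfolding D_def by (rule Ck_SucD[OF k])
  show "((\<lambda>y. norm (conv w \<kappa> y - conv w \<kappa> z - (Re (y - z) *\<^sub>R conv w (pd 1 \<kappa>) z + Im (y - z) *\<^sub>R conv w (pd \<i> \<kappa>) z)) / norm (y - z)) \<longlongrightarrow> 0) (at z)"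
    unfolding tendsto_at_iff_sequentially o_def
  proof (intro allI impI)
    fix y :: "nat \<Rightarrow> complex"
    assume "\<forall>i. y i \<in> UNIV - {z}" and y: "y \<longlonglongrightarrow> z"
    then have ne: "\<And>n. y n \<noteq> z" by auto
    obtain B' where "\<And>n. norm (y n) \<le> B'"
      using LIMSEQ_norm_bounded[OF y] by blast
    then obtain B where B: "\<And>n. norm (y n) \<le> B" "norm z \<le> B"
      by (metis max.coboundedI1 max.coboundedI2 order_refl)
    obtain C1 where C1: "0 < C1" "\<And>z. norm z \<le> B + R \<Longrightarrow> norm (pd 1 \<kappa> z) \<le> C1"
      using continuous_bound_cball[OF c(2), of "B + R"] by blast
    obtain C2 where C2: "0 < C2" "\<And>z. norm z \<le> B + R \<Longrightarrow> norm (pd \<i> \<kappa> z) \<le> C2"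
      using continuous_bound_cball[OF c(3), of "B + R"] by blast
    define C where "C = max C1 C2"
    have C: "0 < C" "\<And>z. norm z \<le> B + R \<Longrightarrow> norm (pd 1 \<kappa> z) \<le> C" "\<And>z. norm z \<le> B + R \<Longrightarrow> norm (pd \<i> \<kappa> z) \<le> C"
      unfolding C_def using C1 C2 by (auto intro: max.coboundedI1 max.coboundedI2)
    define q where "q n t = w t * (\<kappa> (y n - t) - \<kappa> (z - t) - D (z - t) (y n - z))" for n t
    have int: "integrable lborel (\<lambda>t. w t * \<kappa> (y n - t))" "integrable lborel (\<lambda>t. w t * \<kappa> (z - t))"
        "integrable lborel (\<lambda>t. w t * pd 1 \<kappa> (z - t))" "integrable lborel (\<lambda>t. w t * pd \<i> \<kappa> (z - t))" for n
      by (intro conv_integrable w c)+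
    have q: "conv w \<kappa> (y n) - conv w \<kappa> z - (Re (y n - z) *\<^sub>R conv w (pd 1 \<kappa>) z + Im (y n - z) *\<^sub>R conv w (pd \<i> \<kappa>) z)
        = (LINT t|lborel. q n t)" for n
    proof -
      have "(LINT t|lborel. q n t) = (LINT t|lborel. w t * \<kappa> (y n - t) - w t * \<kappa> (z - t) -
          (Re (y n - z) *\<^sub>R (w t * pd 1 \<kappa> (z - t)) + Im (y n - z) *\<^sub>R (w t * pd \<i> \<kappa> (z - t))))"
        by (rule Bochner_Integration.integral_cong) (auto simp: q_def D_def algebra_simps)
      also have "\<dots> = conv w \<kappa> (y n) - conv w \<kappa> z - (Re (y n - z) *\<^sub>R conv w (pd 1 \<kappa>) z + Im (y n - z) *\<^sub>R conv w (pd \<i> \<kappa>) z)"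
        unfolding conv_def using int
        by (simp only: Bochner_Integration.integral_diff Bochner_Integration.integral_add integral_scaleR_right
            integrable_scaleR_right Bochner_Integration.integrable_add Bochner_Integration.integrable_diff)
      finally show ?thesis ..
    qed
    have [measurable]: "q n \<in> borel_measurable borel" for n
      unfolding q_def D_def by measurable
    \<comment> \<open>Of the 4, the increment of \<kappa> takes 2 and its linear part the other
      2.\<close>
    have bd: "norm (q n t) / norm (y n - z) \<le> 4 * C * norm (w t)" for n t
    proof (cases "norm t \<le> R")
      case True
      have in1: "y n - t \<in> cball 0 (B + R)" "z - t \<in> cball 0 (B + R)"
        using True B(1)[of n] B(2) norm_triangle_ineq4[of "y n" t] norm_triangle_ineq4[of z t] by auto
      then have n1: "norm (\<kappa> (y n - t) - \<kappa> (z - t)) \<le> 2 * C * norm (y n - z)"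
        using Ck1_Lipschitz[OF k convex_cball, of 0 "B + R" C "y n - t" "z - t"] C by auto
      have "norm (D (z - t) (y n - z)) \<le> \<bar>Re (y n - z)\<bar> * norm (pd 1 \<kappa> (z - t)) + \<bar>Im (y n - z)\<bar> * norm (pd \<i> \<kappa> (z - t))"
        unfolding D_def by (rule norm_triangle_le) simp
      also have "\<dots> \<le> norm (y n - z) * C + norm (y n - z) * C"
        using C(1) C(2)[of "z - t"] C(3)[of "z - t"] in1(2) abs_Re_le_cmod[of "y n - z"] abs_Im_le_cmod[of "y n - z"]
        by (intro add_mono mult_mono) auto
      finally have "norm (\<kappa> (y n - t) - \<kappa> (z - t) - D (z - t) (y n - z)) \<le> 4 * C * norm (y n - z)"
        using n1 norm_triangle_ineq4[of "\<kappa> (y n - t) - \<kappa> (z - t)" "D (z - t) (y n - z)"]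
        by (simp add: algebra_simps)
      then have "norm (q n t) \<le> norm (w t) * (4 * C * norm (y n - z))"
        unfolding q_def norm_mult by (rule mult_left_mono) simp
      then show ?thesis
        using ne[of n] by (simp add: divide_le_eq mult_ac)
    qed (use R in \<open>simp add: q_def\<close>)
    have "(\<lambda>n. LINT t|lborel. norm (q n t) / norm (y n - z)) \<longlonglongrightarrow> (LINT (t::complex)|lborel. (0::real))"
    proof (rule integral_dominated_convergence)
      show "integrable lborel (\<lambda>t. 4 * C * norm (w t))"
        using w by (auto intro: L1c_integrable integrable_norm)
      show "AE t in lborel. (\<lambda>n. norm (q n t) / norm (y n - z)) \<longlonglongrightarrow> 0"
      proof (rule AE_I2)
        fix t
        have "((\<lambda>x. norm (\<kappa> x - \<kappa> (z - t) - D (z - t) (x - (z - t))) / norm (x - (z - t))) \<longlongrightarrow> 0) (at (z - t))"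
          using D[of "z - t"] has_derivative_iff_norm[of \<kappa> "D (z - t)" "z - t" UNIV] by blast
        moreover have "filterlim (\<lambda>n. y n - t) (at (z - t)) sequentially"
          using y ne by (auto simp: filterlim_at intro!: tendsto_diff)
        ultimately have "(\<lambda>n. norm (\<kappa> (y n - t) - \<kappa> (z - t) - D (z - t) (y n - t - (z - t))) / norm (y n - t - (z - t))) \<longlonglongrightarrow> 0"
          by (rule filterlim_compose)
        then have "(\<lambda>n. norm (w t) * (norm (\<kappa> (y n - t) - \<kappa> (z - t) - D (z - t) (y n - z)) / norm (y n - z))) \<longlonglongrightarrow> norm (w t) * 0"
          by (intro tendsto_mult tendsto_const) simp
        then show "(\<lambda>n. norm (q n t) / norm (y n - z)) \<longlonglongrightarrow> 0"
          by (simp add: q_def norm_mult)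
      qed
      show "AE t in lborel. norm (norm (q n t) / norm (y n - z)) \<le> 4 * C * norm (w t)" for n
        using bd by simp
    qed auto
    then have lim: "(\<lambda>n. LINT t|lborel. norm (q n t) / norm (y n - z)) \<longlonglongrightarrow> 0" by simp
    show "(\<lambda>n. norm (conv w \<kappa> (y n) - conv w \<kappa> z - (Re (y n - z) *\<^sub>R conv w (pd 1 \<kappa>) z + Im (y n - z) *\<^sub>R conv w (pd \<i> \<kappa>) z)) / norm (y n - z)) \<longlonglongrightarrow> 0"
    proof (rule tendsto_sandwich[OF _ _ tendsto_const lim])
      show "\<forall>\<^sub>F n in sequentially. norm (conv w \<kappa> (y n) - conv w \<kappa> z - (Re (y n - z) *\<^sub>R conv w (pd 1 \<kappa>) z + Im (y n - z) *\<^sub>R conv w (pd \<i> \<kappa>) z)) / norm (y n - z)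
          \<le> (LINT t|lborel. norm (q n t) / norm (y n - z))"
      proof (intro always_eventually allI)
        fix n
        have "norm (LINT t|lborel. q n t) / norm (y n - z) \<le> (LINT t|lborel. norm (q n t)) / norm (y n - z)"
          by (intro divide_right_mono integral_norm_bound) simp
        then show "norm (conv w \<kappa> (y n) - conv w \<kappa> z - (Re (y n - z) *\<^sub>R conv w (pd 1 \<kappa>) z + Im (y n - z) *\<^sub>R conv w (pd \<i> \<kappa>) z)) / norm (y n - z)
          \<le> (LINT t|lborel. norm (q n t) / norm (y n - z))"
          unfolding q by simp
      qed
    qed simp
  qed
qed

lemma Ck_conv: "L1c w \<Longrightarrow> Ck k \<kappa> \<Longrightarrow> Ck k (conv w \<kappa>)"
proof (induction k arbitrary: \<kappa>)
  case 0
  then show ?case by (simp add: conv_continuous)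
next
  case (Suc k)
  have "Ck (Suc 0) \<kappa>"
    using Suc.prems(2) Ck_Suc_imp_Ck by (induction k) blast+
  from conv_has_derivative[OF Suc.prems(1) this] show ?case
    using Suc by (intro Ck_SucI) auto
qed

lemma smooth_conv: "L1c w \<Longrightarrow> smooth \<kappa> \<Longrightarrow> smooth (conv w \<kappa>)"
  by (simp add: smooth_def Ck_conv)

lemma pd_conv:
  assumes "L1c w" "smooth \<kappa>" "e \<in> {1, \<i>}"
  shows "pd e (conv w \<kappa>) z = conv w (pd e \<kappa>) z"
proof -
  have "Ck (Suc 0) \<kappa>" using assms(2) smooth_def by blast
  from pd_eqI[OF conv_has_derivative[OF assms(1) this]] show ?thesis
    using assms(3) by auto
qed

lemma L1c_bounded:
  assumes "w \<in> borel_measurable borel" "\<And>t. norm (w t) \<le> C" "\<And>t. R < norm t \<Longrightarrow> w t = 0"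
  shows "L1c w"
proof -
  have "integrable lborel (\<lambda>t. indicator (cball 0 R) t *\<^sub>R C)"
    by (rule integrable_scaleR_left, rule integrable_real_indicator) (use emeasure_lborel_cball_finite[of 0 R] in \<open>auto simp: less_top\<close>)
  then have "integrable lborel w"
  proof (rule Bochner_Integration.integrable_bound)
    show "AE x in lborel. norm (w x) \<le> norm (indicator (cball 0 R) x *\<^sub>R C)"
      using assms by (intro AE_I2) (auto simp: indicator_def intro: order_trans[OF _ abs_ge_self])
  qed (use assms in simp)
  with assms(3) show ?thesis unfolding L1c_def by blast
qed

lemma test_fun_support:
  assumes "\<phi> \<in> test_fun \<Omega>"
  obtains R where "\<And>t. R < norm t \<Longrightarrow> \<phi> t = 0"
proof -
  from assms obtain K where K: "compact K" "\<And>z. z \<notin> K \<Longrightarrow> \<phi> z = 0"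
    by (auto simp: test_fun_iff)
  then obtain R where "\<And>x. x \<in> K \<Longrightarrow> norm x \<le> R"
    using compact_imp_bounded bounded_iff by metis
  then show ?thesis using K by (intro that[of R]) (meson not_le)
qed

lemma test_fun_bounded:
  assumes "\<phi> \<in> test_fun \<Omega>"
  obtains C where "0 < C" "\<And>t. norm (\<phi> t) \<le> C"
proof -
  obtain R where R: "\<And>t. R < norm t \<Longrightarrow> \<phi> t = 0"
    using test_fun_support[OF assms] by blast
  obtain C where C: "0 < C" "\<And>z. norm z \<le> R \<Longrightarrow> norm (\<phi> z) \<le> C"
    using continuous_bound_cball[OF smooth_continuous[OF test_fun_smooth[OF assms]], of R] by blast
  show ?thesis
    by (rule that[OF C(1)]) (metis C R less_eq_real_def linorder_not_le norm_zero)
qed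

lemma test_fun_L1c:
  assumes "\<phi> \<in> test_fun \<Omega>"
  shows "L1c \<phi>"
  using test_fun_bounded[OF assms] test_fun_support[OF assms] L1c_bounded
    smooth_borel_measurable[OF test_fun_smooth[OF assms]] by metis

text \<open>Convolving \<phi> with the indicator of a large ball gives a function that is constant
  near 0, equal to the integral of \<phi>. Its derivative there is 0, and it is also the integral of
  the derivative of \<phi>. This replaces integration along lines.\<close>

lemma integral_pd_test_fun:
  assumes \<phi>: "\<phi> \<in> test_fun \<Omega>" and e: "e \<in> {1, \<i>}"
  shows "(LINT t|lborel. pd e \<phi> t) = 0"
proof -
  obtain R where R: "\<And>t. R < norm t \<Longrightarrow> \<phi> t = 0"
    using test_fun_support[OF \<phi>] by blast
  obtain S where S: "\<And>t. S < norm t \<Longrightarrow> pd e \<phi> t = 0"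
    using test_fun_support[OF test_fun_pd[OF \<phi> e]] by blast
  \<comment> \<open>One unit of slack: for z in the unit ball, any t with z - t in the support still
    lies in the ball of radius \<open>T\<close>, where \<open>w\<close> is 1.\<close>
  define T where "T = max R S + 1"
  define w :: "complex \<Rightarrow> complex" where "w = indicator (cball 0 T)"
  have w: "L1c w"
    by (rule L1c_bounded[of _ 1 T]) (auto simp: w_def split: split_indicator intro!: borel_measurable_indicator)
  have sm: "smooth \<phi>" using \<phi> by (rule test_fun_smooth)
  have const: "conv w \<psi> z = (LINT t|lborel. \<psi> t)"
    if "z \<in> ball 0 1" "\<And>t. max R S < norm t \<Longrightarrow> \<psi> t = 0" "smooth \<psi>" for z \<psi>
  proof -
    have "w t * \<psi> (z - t) = \<psi> (z - t)" for t
    proof (cases "norm t \<le> T")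
      case False
      then have "norm (z - t) > max R S"
        using that(1) norm_triangle_ineq2[of t z] norm_minus_commute[of t z] T_def
        unfolding mem_ball dist_0_norm by linarith
      then show ?thesis using that(2) by simp
    qed (simp add: w_def)
    then have "conv w \<psi> z = (LINT t|lborel. \<psi> (z - t))"
      by (simp only: conv_def)
    also have "\<dots> = (LINT t|lborel. \<psi> t)"
      using that(3) by (intro integral_lborel_reflect smooth_borel_measurable)
    finally show ?thesis .
  qed
  have "(LINT t|lborel. pd e \<phi> t) = conv w (pd e \<phi>) 0"
    using S sm e by (subst const) (auto intro!: smooth_pd)
  also have "\<dots> = pd e (conv w \<phi>) 0"
    using w sm e by (simp add: pd_conv)
  also have "\<dots> = 0"
    by (rule pd_eq_0_if_locally_const[of "ball 0 1"]) (use const R sm in auto)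
  finally show ?thesis .
qed

section \<open>Continuity of translations in L1 and convergence of approximate identities\<close>

section \<open>Approximate identities\<close>

text \<open>Openness of \<open>U\<close> gives pointwise convergence of the shifted indicator only
  at points of \<open>U\<close>, which settles the positive part of indicator minus shifted
  indicator, with \<open>indicator U\<close> as dominating function. Translation preserves measure,
  so the negative part has the same integral; hence the factor 2.\<close>

lemma translation_L1_open:
  fixes U :: "complex set"
  assumes U: "open U" "emeasure lborel U < \<infinity>" and h: "h \<longlonglongrightarrow> (0::complex)"
  shows "(\<lambda>n. LINT t|lborel. \<bar>indicator U (t - h n) - (indicator U t :: real)\<bar>) \<longlonglongrightarrow> 0"
proof -
  have [measurable]: "U \<in> sets borel" using U by simp
  have iU: "integrable lborel (indicator U :: complex \<Rightarrow> real)"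
    using U by (intro integrable_real_indicator) auto
  have iUh: "integrable lborel (\<lambda>t. indicator U (t - h n) :: real)" for n
    by (rule integrable_lborel_shift[OF iU])
  have "(\<lambda>n. LINT t|lborel. max 0 (indicator U t - (indicator U (t - h n) :: real))) \<longlonglongrightarrow> (LINT (t::complex)|lborel. 0)"
  proof (rule integral_dominated_convergence[OF _ _ iU])
    show "AE t in lborel. (\<lambda>n. max 0 (indicator U t - (indicator U (t - h n) :: real))) \<longlonglongrightarrow> 0"
    proof (rule AE_I2)
      fix t
      show "(\<lambda>n. max 0 (indicator U t - (indicator U (t - h n) :: real))) \<longlonglongrightarrow> 0"
      proof (cases "t \<in> U")
        case True
        have "(\<lambda>n. t - h n) \<longlonglongrightarrow> t"
          using tendsto_diff[OF tendsto_const h] by simp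
        then have "\<forall>\<^sub>F n in sequentially. t - h n \<in> U"
          using U True topological_tendstoD by blast
        then have "\<forall>\<^sub>F n in sequentially. max 0 (indicator U t - (indicator U (t - h n) :: real)) = 0"
          by eventually_elim (simp add: True)
        then show ?thesis by (rule tendsto_eventually)
      next
        case False
        then have "max 0 (indicator U t - (indicator U (t - h n) :: real)) = 0" for n
          by (simp add: indicator_def)
        then show ?thesis by simp
      qed
    qed
  qed (auto simp: indicator_def)
  then have "(\<lambda>n. 2 * (LINT t|lborel. max 0 (indicator U t - (indicator U (t - h n) :: real)))) \<longlonglongrightarrow> 2 * 0"
    by (intro tendsto_mult tendsto_const) simp
  moreover have "(LINT t|lborel. \<bar>indicator U (t - h n) - (indicator U t :: real)\<bar>) =
      2 * (LINT t|lborel. max 0 (indicator U t - (indicator U (t - h n) :: real)))" for n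
  proof -
    have im: "integrable lborel (\<lambda>t. max 0 (indicator U t - (indicator U (t - h n) :: real)))"
      by (rule Bochner_Integration.integrable_bound[OF iU]) (auto simp: indicator_def)
    have "(LINT t|lborel. \<bar>indicator U (t - h n) - (indicator U t :: real)\<bar>) =
      (LINT t|lborel. 2 * max 0 (indicator U t - indicator U (t - h n)) + (indicator U (t - h n) - indicator U t))"
      by (rule Bochner_Integration.integral_cong) (auto simp: indicator_def)
    also have "\<dots> = 2 * (LINT t|lborel. max 0 (indicator U t - (indicator U (t - h n) :: real)))
        + ((LINT t|lborel. indicator U (t - h n)) - (LINT t|lborel. indicator U t))"
      using im iU iUh[of n] by simp
    also have "(LINT t|lborel. indicator U (t - h n)) = (LINT t|lborel. (indicator U t :: real))"
      by (rule integral_lborel_shift) simp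
    finally show ?thesis by simp
  qed
  ultimately show ?thesis by simp
qed

text \<open>A three-term estimate: the approximation error enters twice, once translated, and
  translation does not change its integral.\<close>

lemma translation_L1_approx:
  fixes f :: "complex \<Rightarrow> complex"
  assumes f: "integrable lborel f"
    and ap: "\<And>e. e > 0 \<Longrightarrow> \<exists>g. integrable lborel g \<and> (LINT t|lborel. norm (g t - f t)) < e \<and>
       (\<lambda>n. LINT t|lborel. norm (g (t - h n) - g t)) \<longlonglongrightarrow> 0"
  shows "(\<lambda>n. LINT t|lborel. norm (f (t - h n) - f t)) \<longlonglongrightarrow> 0"
proof (rule LIMSEQ_I)
  fix e :: real assume "e > 0"
  then obtain g where g: "integrable lborel g" "(LINT t|lborel. norm (g t - f t)) < e / 3"
       "(\<lambda>n. LINT t|lborel. norm (g (t - h n) - g t)) \<longlonglongrightarrow> 0"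
    using ap[of "e / 3"] by auto
  have [measurable]: "f \<in> borel_measurable borel" "g \<in> borel_measurable borel"
    using f g by (auto dest: borel_measurable_integrable)
  obtain N where N: "\<And>n. n \<ge> N \<Longrightarrow> norm (LINT t|lborel. norm (g (t - h n) - g t)) < e / 3"
    using LIMSEQ_D[OF g(3), of "e / 3"] \<open>e > 0\<close> by auto
  show "\<exists>no. \<forall>n\<ge>no. norm ((LINT t|lborel. norm (f (t - h n) - f t)) - 0) < e"
  proof (intro exI allI impI)
    fix n assume n: "n \<ge> N"
    note ints = f g(1) integrable_lborel_shift[OF f, of "h n"] integrable_lborel_shift[OF g(1), of "h n"]
    have "(LINT t|lborel. norm (f (t - h n) - f t)) \<le>
        (LINT t|lborel. norm (g (t - h n) - f (t - h n)) + norm (g (t - h n) - g t) + norm (g t - f t))"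
    proof (rule integral_mono)
      show "norm (f (t - h n) - f t) \<le> norm (g (t - h n) - f (t - h n)) + norm (g (t - h n) - g t) + norm (g t - f t)" for t
        by norm
    qed (use ints in \<open>auto intro!: integrable_norm Bochner_Integration.integrable_diff Bochner_Integration.integrable_add\<close>)
    also have "\<dots> = (LINT t|lborel. norm (g (t - h n) - f (t - h n))) + (LINT t|lborel. norm (g (t - h n) - g t)) + (LINT t|lborel. norm (g t - f t))"
      using ints by (subst Bochner_Integration.integral_add; (subst Bochner_Integration.integral_add)?;
         auto intro!: integrable_norm Bochner_Integration.integrable_diff Bochner_Integration.integrable_add)
    also have "(LINT t|lborel. norm (g (t - h n) - f (t - h n))) = (LINT t|lborel. norm (g t - f t))"
      by (rule integral_lborel_shift[where g = "\<lambda>t. norm (g t - f t)"]) simp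
    finally have "(LINT t|lborel. norm (f (t - h n) - f t)) < e"
      using g(2) N[OF n] by simp
    then show "norm ((LINT t|lborel. norm (f (t - h n) - f t)) - 0) < e"
      by simp
  qed
qed

text \<open>Borel sets of finite measure are approximated from outside by open sets, where the claim
  is known; sums and dominated limits complete the induction over integrable functions.\<close>

lemma translation_L1:
  fixes f :: "complex \<Rightarrow> complex"
  assumes f: "integrable lborel f" and h: "h \<longlonglongrightarrow> (0::complex)"
  shows "(\<lambda>n. LINT t|lborel. norm (f (t - h n) - f t)) \<longlonglongrightarrow> 0"
  using f
proof (induct rule: integrable_induct)
  case (base A c)
  have [measurable]: "A \<in> sets borel" using base by simp
  have iA: "integrable lborel (indicator A :: complex \<Rightarrow> real)"
    using base by (intro integrable_real_indicator) auto
  show ?case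
  proof (rule translation_L1_approx)
    fix e :: real assume "e > 0"
    \<comment> \<open>The summand 1 keeps the quotient defined for \<open>c = 0\<close> and makes
      the final inequality strict.\<close>
    define e' where "e' = e / (norm c + 1)"
    have e': "e' > 0" using \<open>e > 0\<close> by (auto simp: e'_def intro!: divide_pos_pos add_nonneg_pos)
    obtain U where U: "open U" "A \<subseteq> U" "emeasure lborel (U - A) < e'"
      using outer_regular_lborel[OF \<open>A \<in> sets borel\<close> e'] by blast
    have [measurable]: "U \<in> sets borel" using U by simp
    have "emeasure lborel U = emeasure lborel (A \<union> (U - A))"
      using U by (simp add: Un_absorb1)
    also have "\<dots> \<le> emeasure lborel A + emeasure lborel (U - A)"
      by (rule emeasure_subadditive) auto
    also have "\<dots> < \<infinity>"
      using base U(3) by (auto simp: ennreal_add_less_top less_top intro: less_trans)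
    finally have fin: "emeasure lborel U < \<infinity>" .
    then have iU: "integrable lborel (indicator U :: complex \<Rightarrow> real)"
      by (intro integrable_real_indicator) auto
    have "(LINT t|lborel. norm (indicator U t *\<^sub>R c - indicator A t *\<^sub>R c)) = (LINT t|lborel. indicator (U - A) t * norm c)"
      using U(2) by (intro Bochner_Integration.integral_cong) (auto simp: indicator_def)
    also have "\<dots> = measure lborel (U - A) * norm c"
      by simp
    also have "\<dots> \<le> e' * norm c"
      using U(3) e' by (intro mult_right_mono) (auto simp: measure_def enn2real_leI less_imp_le)
    also have "\<dots> < e"
      using \<open>e > 0\<close> by (simp add: e'_def divide_less_eq add_nonneg_pos)
    finally have 1: "(LINT t|lborel. norm (indicator U t *\<^sub>R c - indicator A t *\<^sub>R c)) < e" .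
    have "(\<lambda>n. (LINT t|lborel. \<bar>indicator U (t - h n) - (indicator U t :: real)\<bar>) * norm c) \<longlonglongrightarrow> 0 * norm c"
      by (intro tendsto_mult tendsto_const translation_L1_open U fin h)
    then have 2: "(\<lambda>n. LINT t|lborel. norm (indicator U (t - h n) *\<^sub>R c - indicator U t *\<^sub>R c)) \<longlonglongrightarrow> 0"
      by (simp flip: scaleR_left_diff_distrib)
    show "\<exists>g. integrable lborel g \<and> (LINT t|lborel. norm (g t - indicator A t *\<^sub>R c)) < e \<and>
       (\<lambda>n. LINT t|lborel. norm (g (t - h n) - g t)) \<longlonglongrightarrow> 0"
      using 1 2 iU by (intro exI[of _ "\<lambda>t. indicator U t *\<^sub>R c"]) auto
  qed (use iA in auto)
next
  case (add f g)
  note ints = add(1,3) integrable_lborel_shift[OF add(1)] integrable_lborel_shift[OF add(3)]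
  show ?case
  proof (rule tendsto_sandwich[OF _ _ tendsto_const tendsto_add_zero[OF add(2,4)]])
    show "\<forall>\<^sub>F n in sequentially. (LINT t|lborel. norm (f (t - h n) + g (t - h n) - (f t + g t))) \<le>
       (LINT t|lborel. norm (f (t - h n) - f t)) + (LINT t|lborel. norm (g (t - h n) - g t))"
    proof (intro always_eventually allI)
      fix n
      have "(LINT t|lborel. norm (f (t - h n) + g (t - h n) - (f t + g t))) \<le>
         (LINT t|lborel. norm (f (t - h n) - f t) + norm (g (t - h n) - g t))"
      proof (rule integral_mono)
        show "norm (f (t - h n) + g (t - h n) - (f t + g t)) \<le> norm (f (t - h n) - f t) + norm (g (t - h n) - g t)" for t
          by norm
      qed (use ints in \<open>auto intro!: integrable_norm Bochner_Integration.integrable_diff Bochner_Integration.integrable_add\<close>)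
      also have "\<dots> = (LINT t|lborel. norm (f (t - h n) - f t)) + (LINT t|lborel. norm (g (t - h n) - g t))"
        using ints by (intro Bochner_Integration.integral_add) auto
      finally show "(LINT t|lborel. norm (f (t - h n) + g (t - h n) - (f t + g t))) \<le>
       (LINT t|lborel. norm (f (t - h n) - f t)) + (LINT t|lborel. norm (g (t - h n) - g t))" .
    qed
  qed auto
next
  case (lim f s)
  have "(\<lambda>i. LINT t|lborel. norm (s i t - f t)) \<longlonglongrightarrow> (LINT (t::complex)|lborel. 0)"
  proof (rule integral_dominated_convergence)
    show "integrable lborel (\<lambda>t. 3 * norm (f t))" using lim by auto
    show "AE t in lborel. (\<lambda>i. norm (s i t - f t)) \<longlonglongrightarrow> 0"
      using lim(3) by (intro AE_I2 tendsto_norm_zero LIM_zero) auto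
    show "AE t in lborel. norm (norm (s i t - f t)) \<le> 3 * norm (f t)" for i
    proof (rule AE_I2)
      fix t
      have "norm (s i t) \<le> 2 * norm (f t)" using lim(4) by auto
      then show "norm (norm (s i t - f t)) \<le> 3 * norm (f t)"
        using norm_triangle_ineq4[of "s i t" "f t"] by simp
    qed
  qed (use lim in \<open>auto dest: borel_measurable_integrable\<close>)
  then have l0: "(\<lambda>i. LINT t|lborel. norm (s i t - f t)) \<longlonglongrightarrow> 0" by simp
  show ?case
  proof (rule translation_L1_approx[OF lim(5)])
    fix e :: real assume "e > 0"
    then have "\<exists>i. (LINT t|lborel. norm (s i t - f t)) < e"
      using order_tendstoD(2)[OF l0] eventually_happens' sequentially_bot by blast
    then show "\<exists>g. integrable lborel g \<and> (LINT t|lborel. norm (g t - f t)) < e \<and>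
       (\<lambda>n. LINT t|lborel. norm (g (t - h n) - g t)) \<longlonglongrightarrow> 0"
      using lim(1,2) by blast
  qed
qed

text \<open>By Tonelli the L1 distance is at most the integral of
  \<open>norm (\<rho> s) * T (c n *\<^sub>R s)\<close>, where \<open>T h\<close> is the L1 distance
  between \<open>w\<close> and its translate by \<open>h\<close>; \<open>T\<close> is bounded and
  tends to 0 at 0. Unbounded support of \<rho> is allowed, and its integral stays as a factor
  instead of being normalised to 1. The bound \<open>B\<close> makes the shifted product integrable
  at every point z.\<close>

lemma approximate_identity_L1:
  fixes w \<rho> :: "complex \<Rightarrow> complex" and c :: "nat \<Rightarrow> real"
  assumes w: "integrable lborel w" and \<rho>: "integrable lborel \<rho>" and bd: "\<And>t. norm (\<rho> t) \<le> B"
    and c: "\<And>n. c n > 0" "c \<longlonglongrightarrow> 0"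
  shows "(\<lambda>n. \<integral>\<^sup>+ z. norm (conv w (\<lambda>t. \<rho> (t /\<^sub>R c n) /\<^sub>R (c n)\<^sup>2) z - (LINT t|lborel. \<rho> t) * w z) \<partial>lborel) \<longlonglongrightarrow> 0"
proof -
  have [measurable]: "w \<in> borel_measurable borel" "\<rho> \<in> borel_measurable borel"
    using w \<rho> by (auto dest: borel_measurable_integrable)
  define T where "T h = (\<integral>\<^sup>+ z. norm (w (z - h) - w z) \<partial>lborel)" for h
  have intw: "integrable lborel (\<lambda>z. norm (w (z - h) - w z))" for h
    by (intro integrable_norm Bochner_Integration.integrable_diff integrable_lborel_shift w)
  have Tint: "T h = ennreal (LINT z|lborel. norm (w (z - h) - w z))" for h
    unfolding T_def by (rule nn_integral_eq_integral[OF intw]) simp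
  have Tbd: "T h \<le> ennreal (2 * (LINT z|lborel. norm (w z)))" for h
  proof -
    have "(LINT z|lborel. norm (w (z - h) - w z)) \<le> (LINT z|lborel. norm (w (z - h)) + norm (w z))"
      using w integrable_lborel_shift[OF w, of h] by (intro integral_mono intw norm_triangle_ineq4) auto
    also have "\<dots> = (LINT z|lborel. norm (w (z - h))) + (LINT z|lborel. norm (w z))"
      using w integrable_lborel_shift[OF w, of h] by (intro Bochner_Integration.integral_add) auto
    also have "(LINT z|lborel. norm (w (z - h))) = (LINT z|lborel. norm (w z))"
      by (rule integral_lborel_shift[where g = "\<lambda>z. norm (w z)"]) simp
    finally show ?thesis unfolding Tint by (intro ennreal_leI) simp
  qed
  \<comment> \<open>Substitution \<open>t = z - c n *\<^sub>R s\<close>, whose Jacobian cancels the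
    normalising factor.\<close>
  have cv: "conv w (\<lambda>t. \<rho> (t /\<^sub>R c n) /\<^sub>R (c n)\<^sup>2) z = (LINT s|lborel. w (z - c n *\<^sub>R s) * \<rho> s)" for n z
  proof -
    have "conv w (\<lambda>t. \<rho> (t /\<^sub>R c n) /\<^sub>R (c n)\<^sup>2) z = (LINT t|lborel. (w t * \<rho> ((z - t) /\<^sub>R c n)) /\<^sub>R (c n)\<^sup>2)"
      by (simp add: conv_def)
    also have "\<dots> = (LINT t|density lborel (\<lambda>_. ennreal (inverse (\<bar>- c n\<bar>\<^sup>2))). w t * \<rho> ((z - t) /\<^sub>R c n))"
      by (subst integral_density) (auto simp: power_inverse)
    also have "\<dots> = (LINT t|distr lborel borel (\<lambda>s. z + (- c n) *\<^sub>R s). w t * \<rho> ((z - t) /\<^sub>R c n))"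
      using c(1)[of n] by (subst distr_lborel_affine) auto
    also have "\<dots> = (LINT s|lborel. w (z - c n *\<^sub>R s) * \<rho> s)"
      using c(1)[of n] by (subst integral_distr) auto
    finally show ?thesis .
  qed
  have shint: "integrable lborel (\<lambda>s. w (z - c n *\<^sub>R s))" for n z
  proof -
    have "integrable (density lborel (\<lambda>_. ennreal (inverse (\<bar>- c n\<bar>\<^sup>2)))) w"
      using w by (subst integrable_density) auto
    then have "integrable (distr lborel borel (\<lambda>s. z + (- c n) *\<^sub>R s)) w"
      using c(1)[of n] by (subst distr_lborel_affine) auto
    from integrable_distr[OF _ this] show ?thesis by simp
  qed
  have le: "(\<integral>\<^sup>+ z. norm (conv w (\<lambda>t. \<rho> (t /\<^sub>R c n) /\<^sub>R (c n)\<^sup>2) z - (LINT t|lborel. \<rho> t) * w z) \<partial>lborel)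
      \<le> (\<integral>\<^sup>+ s. norm (\<rho> s) * T (c n *\<^sub>R s) \<partial>lborel)" for n
  proof -
    have "(\<integral>\<^sup>+ z. norm (conv w (\<lambda>t. \<rho> (t /\<^sub>R c n) /\<^sub>R (c n)\<^sup>2) z - (LINT t|lborel. \<rho> t) * w z) \<partial>lborel)
       \<le> (\<integral>\<^sup>+ z. (\<integral>\<^sup>+ s. norm ((w (z - c n *\<^sub>R s) - w z) * \<rho> s) \<partial>lborel) \<partial>lborel)"
    proof (rule nn_integral_mono)
      fix z
      have i1: "integrable lborel (\<lambda>s. w (z - c n *\<^sub>R s) * \<rho> s)"
      proof (rule Bochner_Integration.integrable_bound)
        show "integrable lborel (\<lambda>s. norm (w (z - c n *\<^sub>R s)) * B)"
          using shint by auto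
        show "AE s in lborel. norm (w (z - c n *\<^sub>R s) * \<rho> s) \<le> norm (norm (w (z - c n *\<^sub>R s)) * B)"
          using bd by (intro AE_I2) (simp add: norm_mult mult_left_mono order_trans[OF _ abs_ge_self])
      qed auto
      have "conv w (\<lambda>t. \<rho> (t /\<^sub>R c n) /\<^sub>R (c n)\<^sup>2) z - (LINT t|lborel. \<rho> t) * w z
          = (LINT s|lborel. w (z - c n *\<^sub>R s) * \<rho> s - w z * \<rho> s)"
        unfolding cv using i1 \<rho> by simp
      also have "\<dots> = (LINT s|lborel. (w (z - c n *\<^sub>R s) - w z) * \<rho> s)"
        by (simp add: algebra_simps)
      finally have eq: "conv w (\<lambda>t. \<rho> (t /\<^sub>R c n) /\<^sub>R (c n)\<^sup>2) z - (LINT t|lborel. \<rho> t) * w z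
          = (LINT s|lborel. (w (z - c n *\<^sub>R s) - w z) * \<rho> s)" .
      have "integrable lborel (\<lambda>s. w (z - c n *\<^sub>R s) * \<rho> s - w z * \<rho> s)"
        using i1 \<rho> by auto
      then have i2: "integrable lborel (\<lambda>s. (w (z - c n *\<^sub>R s) - w z) * \<rho> s)"
        by (simp add: algebra_simps)
      show "ennreal (norm (conv w (\<lambda>t. \<rho> (t /\<^sub>R c n) /\<^sub>R (c n)\<^sup>2) z - (LINT t|lborel. \<rho> t) * w z))
        \<le> (\<integral>\<^sup>+ s. norm ((w (z - c n *\<^sub>R s) - w z) * \<rho> s) \<partial>lborel)"
        unfolding eq by (rule integral_norm_bound_ennreal[OF i2])
    qed
    also have "\<dots> = (\<integral>\<^sup>+ s. (\<integral>\<^sup>+ z. norm ((w (z - c n *\<^sub>R s) - w z) * \<rho> s) \<partial>lborel) \<partial>lborel)"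
      by (rule lborel_pair.Fubini') measurable
    also have "\<dots> = (\<integral>\<^sup>+ s. norm (\<rho> s) * T (c n *\<^sub>R s) \<partial>lborel)"
      unfolding T_def
      by (intro nn_integral_cong, subst nn_integral_cmult[symmetric])
         (auto simp: norm_mult ennreal_mult mult.commute)
    finally show ?thesis .
  qed
  have "(\<lambda>n. \<integral>\<^sup>+ s. norm (\<rho> s) * T (c n *\<^sub>R s) \<partial>lborel) \<longlonglongrightarrow> (\<integral>\<^sup>+ (s::complex). 0 \<partial>lborel)"
  proof (rule nn_integral_dominated_convergence)
    show "(\<integral>\<^sup>+ s. norm (\<rho> s) * ennreal (2 * (LINT z|lborel. norm (w z))) \<partial>lborel) < \<infinity>"
      using \<rho> by (subst nn_integral_multc) (auto simp: ennreal_mult_less_top integrable_iff_bounded)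
    show "AE s in lborel. (\<lambda>n. norm (\<rho> s) * T (c n *\<^sub>R s)) \<longlonglongrightarrow> 0"
    proof (rule AE_I2)
      fix s :: complex
      have "(\<lambda>n. c n *\<^sub>R s) \<longlonglongrightarrow> 0"
        using tendsto_scaleR[OF c(2) tendsto_const, of s] by simp
      from translation_L1[OF w this] have "(\<lambda>n. T (c n *\<^sub>R s)) \<longlonglongrightarrow> 0"
        unfolding Tint using tendsto_ennrealI by fastforce
      then have "(\<lambda>n. norm (\<rho> s) * T (c n *\<^sub>R s)) \<longlonglongrightarrow> ennreal (norm (\<rho> s)) * 0"
        by (intro ennreal_tendsto_cmult) auto
      then show "(\<lambda>n. norm (\<rho> s) * T (c n *\<^sub>R s)) \<longlonglongrightarrow> 0" by simp
    qed
    show "AE s in lborel. norm (\<rho> s) * T (c n *\<^sub>R s) \<le> norm (\<rho> s) * ennreal (2 * (LINT z|lborel. norm (w z)))" for n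
      using Tbd by (intro AE_I2 mult_left_mono) auto
  qed (auto simp: T_def)
  then have "(\<lambda>n. \<integral>\<^sup>+ s. norm (\<rho> s) * T (c n *\<^sub>R s) \<partial>lborel) \<longlonglongrightarrow> 0" by simp
  then show ?thesis
    by (rule tendsto_sandwich[OF _ _ tendsto_const, rotated 2]) (auto intro: always_eventually le)
qed

section \<open>Weakly singular integrals, iteration of potentials and the Hoelder bound for Cauchy
  potentials\<close>

section \<open>Singular kernels\<close>

lemma cball_borel_measurable [measurable]: "cball (a::complex) r \<in> sets borel"
  by simp

lemma nn_integral_complex_prod:
  fixes f g :: "real \<Rightarrow> ennreal"
  assumes [measurable]: "f \<in> borel_measurable borel" "g \<in> borel_measurable borel"
  shows "(\<integral>\<^sup>+ z. f (Re z) * g (Im z) \<partial>lborel) = (\<integral>\<^sup>+ x. f x \<partial>lborel) * (\<integral>\<^sup>+ x. g x \<partial>lborel)"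
proof -
  define h where "h b = (if b = (1::complex) then f else g)" for b
  have "(\<integral>\<^sup>+ z. (\<Prod>b\<in>Basis. h b (z \<bullet> b)) \<partial>lborel) = (\<Prod>b\<in>(Basis::complex set). \<integral>\<^sup>+ x. h b x \<partial>lborel)"
    by (rule nn_integral_lborel_prod) (auto simp: h_def)
  then show ?thesis
    by (simp add: Basis_complex_def h_def)
qed

text \<open>Each half of the interval contributes 4, from the primitive \<open>4 x^(1/4)\<close>.
  The exponent -3/4 is half of -3/2.\<close>

lemma nn_integral_powr_unit: "(\<integral>\<^sup>+ (x::real). ennreal (\<bar>x\<bar> powr (-3/4)) * indicator {-1..1} x \<partial>lborel) \<le> 8"
proof -
  have "((\<lambda>x. x powr (-3/4)) has_integral (1 powr (-3/4 + 1) / (-3/4 + 1))) {0..(1::real)}"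
    by (rule has_integral_powr_from_0) auto
  then have *: "(\<integral>\<^sup>+ (x::real). ennreal (indicator {0..1} x * x powr (-3/4)) \<partial>lborel) = ennreal (1 powr (-3/4 + 1) / (-3/4 + 1))"
    by (intro nn_integral_has_integral_lebesgue) auto
  then have pos: "(\<integral>\<^sup>+ (x::real). ennreal (\<bar>x\<bar> powr (-3/4)) * indicator {0..1} x \<partial>lborel) = 4"
  proof -
    have "ennreal (\<bar>x\<bar> powr (-3/4)) * indicator {0..1} x = ennreal (indicator {0..1} x * x powr (-3/4))" for x :: real
      by (simp split: split_indicator)
    with * show ?thesis by simp
  qed
  have "(\<integral>\<^sup>+ (x::real). ennreal (\<bar>x\<bar> powr (-3/4)) * indicator {-1..0} x \<partial>lborel)
      = ennreal \<bar>-1\<bar> * (\<integral>\<^sup>+ (x::real). ennreal (\<bar>0 + (-1) * x\<bar> powr (-3/4)) * indicator {-1..0} (0 + (-1) * x) \<partial>lborel)"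
    by (rule nn_integral_real_affine) auto
  also have "\<dots> = (\<integral>\<^sup>+ (x::real). ennreal (\<bar>x\<bar> powr (-3/4)) * indicator {0..1} x \<partial>lborel)"
    by simp (intro nn_integral_cong, auto simp: indicator_def)
  finally have neg: "(\<integral>\<^sup>+ (x::real). ennreal (\<bar>x\<bar> powr (-3/4)) * indicator {-1..0} x \<partial>lborel) = 4"
    using pos by simp
  have "(\<integral>\<^sup>+ (x::real). ennreal (\<bar>x\<bar> powr (-3/4)) * indicator {-1..1} x \<partial>lborel)
     \<le> (\<integral>\<^sup>+ (x::real). ennreal (\<bar>x\<bar> powr (-3/4)) * indicator {0..1} x + ennreal (\<bar>x\<bar> powr (-3/4)) * indicator {-1..0} x \<partial>lborel)"
    by (rule nn_integral_mono) (auto simp: indicator_def)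
  also have "\<dots> = 4 + 4"
    by (subst nn_integral_add, simp, simp) (simp only: pos neg)
  finally show ?thesis by simp
qed

text \<open>\<open>norm z\<close> dominates both coordinates, so half of the negative power can be
  charged to each of them. The bound is then a product of two one-dimensional integrals, whence 64
  as the square of 8.\<close>

lemma nn_integral_norm_powr_unit:
  "(\<integral>\<^sup>+ (z::complex). ennreal (norm z powr (-3/2)) * indicator (cball 0 1) z \<partial>lborel) \<le> 64"
proof -
  \<comment> \<open>The axes are removed because a negative power of 0 is 0 by convention, which
    would falsify the product bound there.\<close>
  have "AE z::complex in lborel. z \<bullet> 1 \<noteq> 0" "AE z::complex in lborel. z \<bullet> \<i> \<noteq> 0"
    by (rule AE_lborel_inner_neq; simp add: Basis_complex_def)+
  then have "AE z::complex in lborel. ennreal (norm z powr (-3/2)) * indicator (cball 0 1) z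
      \<le> (ennreal (\<bar>Re z\<bar> powr (-3/4)) * indicator {-1..1} (Re z)) * (ennreal (\<bar>Im z\<bar> powr (-3/4)) * indicator {-1..1} (Im z))"
  proof eventually_elim
    case (elim z)
    show ?case
    proof (cases "norm z \<le> 1")
      case True
      then have le: "\<bar>Re z\<bar> \<le> 1" "\<bar>Im z\<bar> \<le> 1"
        using abs_Re_le_cmod[of z] abs_Im_le_cmod[of z] by linarith+
      have "norm z powr (-3/2) = norm z powr (-3/4) * norm z powr (-3/4)"
        by (simp flip: powr_add)
      also have "\<dots> \<le> \<bar>Re z\<bar> powr (-3/4) * \<bar>Im z\<bar> powr (-3/4)"
        using elim abs_Re_le_cmod[of z] abs_Im_le_cmod[of z] by (intro mult_mono powr_mono2') auto
      finally show ?thesis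
        using le True by (simp add: ennreal_mult[symmetric] indicator_def abs_le_iff)
    qed simp
  qed
  then have "(\<integral>\<^sup>+ (z::complex). ennreal (norm z powr (-3/2)) * indicator (cball 0 1) z \<partial>lborel)
      \<le> (\<integral>\<^sup>+ z. (ennreal (\<bar>Re z\<bar> powr (-3/4)) * indicator {-1..1} (Re z)) * (ennreal (\<bar>Im z\<bar> powr (-3/4)) * indicator {-1..1} (Im z)) \<partial>lborel)"
    by (rule nn_integral_mono_AE)
  also have "\<dots> = (\<integral>\<^sup>+ (x::real). ennreal (\<bar>x\<bar> powr (-3/4)) * indicator {-1..1} x \<partial>lborel)
      * (\<integral>\<^sup>+ (x::real). ennreal (\<bar>x\<bar> powr (-3/4)) * indicator {-1..1} x \<partial>lborel)"
    by (rule nn_integral_complex_prod) measurable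
  also have "\<dots> \<le> 8 * 8"
    by (intro mult_mono nn_integral_powr_unit) auto
  finally show ?thesis by simp
qed

text \<open>64 pays for the unit disc around the singularity; farther away the weight is at most 1
  and the area of the ball suffices. The constant is independent of where the singularity
  lies.\<close>

definition riesz_bound :: "real \<Rightarrow> real" where
  "riesz_bound R = 64 + measure lborel (cball (0::complex) R)"

lemma riesz_bound_pos: "0 < riesz_bound R"
  by (simp add: riesz_bound_def add_pos_nonneg)

lemma nn_integral_riesz:
  fixes z :: complex
  shows "(\<integral>\<^sup>+ t. ennreal (norm (z - t) powr (-3/2)) * indicator (cball 0 R) t \<partial>lborel) \<le> ennreal (riesz_bound R)"
proof -
  have "(\<integral>\<^sup>+ t. ennreal (norm (z - t) powr (-3/2)) * indicator (cball 0 R) t \<partial>lborel)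
     \<le> (\<integral>\<^sup>+ t. ennreal (norm (z - t) powr (-3/2)) * indicator (cball 0 1) (z - t) + indicator (cball 0 R) t \<partial>lborel)"
  proof (rule nn_integral_mono)
    fix t
    show "ennreal (norm (z - t) powr (-3/2)) * indicator (cball 0 R) t \<le>
        ennreal (norm (z - t) powr (-3/2)) * indicator (cball 0 1) (z - t) + indicator (cball 0 R) t"
    proof (cases "norm (z - t) \<le> 1")
      case False
      then have "norm (z - t) powr (-3/2) \<le> 1 powr (-3/2)"
        by (intro powr_mono2') auto
      then show ?thesis using False by (auto simp: indicator_def)
    qed (auto simp: indicator_def)
  qed
  also have "\<dots> = (\<integral>\<^sup>+ t. ennreal (norm (z - t) powr (-3/2)) * indicator (cball 0 1) (z - t) \<partial>lborel) + emeasure lborel (cball (0::complex) R)"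
    by (subst nn_integral_add) auto
  also have "(\<integral>\<^sup>+ t. ennreal (norm (z - t) powr (-3/2)) * indicator (cball 0 1) (z - t) \<partial>lborel)
      = (\<integral>\<^sup>+ (t::complex). ennreal (norm t powr (-3/2)) * indicator (cball 0 1) t \<partial>lborel)"
    by (rule nn_integral_lborel_reflect[where g = "\<lambda>t. ennreal (norm t powr (-3/2)) * indicator (cball 0 1) t"]) measurable
  also have "\<dots> + emeasure lborel (cball (0::complex) R) \<le> 64 + emeasure lborel (cball (0::complex) R)"
    by (intro add_mono nn_integral_norm_powr_unit) auto
  also have "\<dots> = ennreal (riesz_bound R)"
    using emeasure_lborel_cball_finite[of "0::complex" R]
    by (simp add: riesz_bound_def emeasure_eq_ennreal_measure less_top ennreal_plus)
  finally show ?thesis .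
qed

text \<open>The larger of \<open>a\<close> and \<open>b\<close> is at least d/2. Of its reciprocal,
  one square root is at most \<open>(d/2) powr (-1/2)\<close>, which explains \<open>sqrt 2\<close>;
  the other is at most the reciprocal square root of the smaller variable and raises the exponent
  there to -3/2. If a variable is 0, its inverse is 0 by convention.\<close>

lemma inverse_mult_le_powr:
  fixes a b d :: real
  assumes "0 \<le> a" "0 \<le> b" "0 < d" "d \<le> a + b"
  shows "inverse a * inverse b \<le> sqrt 2 * d powr (-1/2) * (a powr (-3/2) + b powr (-3/2))"
proof -
  have *: "inverse a * inverse b \<le> sqrt 2 * d powr (-1/2) * a powr (-3/2)"
    if "0 < a" "a \<le> b" "d \<le> a + b" for a b :: real
  proof -
    have b: "inverse b = b powr (-1/2) * b powr (-1/2)"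
      using that powr_add[of b "-1/2" "-1/2"] powr_minus[of b 1] by simp
    have "b powr (-1/2) \<le> (d / 2) powr (-1/2)"
      using that assms by (intro powr_mono2') auto
    also have "\<dots> = sqrt 2 * d powr (-1/2)"
      using assms by (simp add: powr_divide powr_minus_divide powr_half_sqrt)
    finally have 1: "b powr (-1/2) \<le> sqrt 2 * d powr (-1/2)" .
    have 2: "b powr (-1/2) \<le> a powr (-1/2)"
      using that by (intro powr_mono2') auto
    have "inverse a = a powr (-1)" using that by (simp add: powr_minus)
    then have 3: "inverse a * a powr (-1/2) = a powr (-3/2)"
      using powr_add[of a "-1" "-1/2"] by simp
    have "inverse a * inverse b \<le> inverse a * (sqrt 2 * d powr (-1/2) * a powr (-1/2))"
      unfolding b using that 1 2 by (intro mult_left_mono mult_mono) auto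
    also have "\<dots> = sqrt 2 * d powr (-1/2) * (inverse a * a powr (-1/2))"
      by (simp only: mult_ac)
    finally show ?thesis unfolding 3 .
  qed
  have nn: "0 \<le> sqrt 2 * d powr (-1/2) * c powr (-3/2)" for c by simp
  consider "a = 0 \<or> b = 0" | "0 < a" "a \<le> b" | "0 < b" "b \<le> a"
    using assms by linarith
  then show ?thesis
  proof cases
    case 1 then show ?thesis using nn[of a] nn[of b] by auto
  next
    case 2 from *[OF this] show ?thesis
      unfolding distrib_left using assms nn[of b] by linarith
  next
    case 3 from *[OF this] show ?thesis
      unfolding distrib_left mult.commute[of "inverse a" "inverse b"] using assms nn[of a] by linarith
  qed
qed

text \<open>The exponents already add up to -3/2, so it is enough to replace the larger variable by
  the smaller one.\<close>

lemma powr_half_mult_inverse_le: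
  fixes a b :: real
  assumes "0 \<le> a" "0 \<le> b"
  shows "inverse a * b powr (-1/2) \<le> a powr (-3/2) + b powr (-3/2)"
proof -
  consider "a = 0 \<or> b = 0" | "0 < a" "a \<le> b" | "0 < b" "b \<le> a"
    using assms by linarith
  then show ?thesis
  proof cases
    case 2
    have "inverse a * b powr (-1/2) \<le> inverse a * a powr (-1/2)"
      using 2 by (intro mult_left_mono powr_mono2') auto
    also have "inverse a * a powr (-1/2) = a powr (-1) * a powr (-1/2)" using 2 by (simp add: powr_minus)
    also have "\<dots> = a powr (-3/2)" by (subst powr_add[symmetric]) simp
    finally show ?thesis by (rule order_trans) simp
  next
    case 3
    have "inverse a * b powr (-1/2) \<le> inverse b * b powr (-1/2)"
      using 3 by (intro mult_right_mono) auto
    also have "inverse b * b powr (-1/2) = b powr (-1) * b powr (-1/2)" using 3 by (simp add: powr_minus)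
    also have "\<dots> = b powr (-3/2)" by (subst powr_add[symmetric]) simp
    finally show ?thesis by (rule order_trans) simp
  qed auto
qed

text \<open>Common final step of the kernel estimates: two copies of the weight, centred at
  \<open>z\<close> and \<open>z'\<close>, each cost one \<open>riesz_bound R\<close>. Estimates with
  a single singularity use \<open>z = z'\<close>.\<close>

lemma nn_integral_le_riesz_bound:
  fixes F :: "complex \<Rightarrow> real"
  assumes [measurable]: "F \<in> borel_measurable borel" and "0 \<le> C"
    and le: "\<And>t. F t \<le> C * (norm (z - t) powr (-3/2) + norm (z' - t) powr (-3/2))"
  shows "(\<integral>\<^sup>+ t. ennreal (F t) * indicator (cball 0 R) t \<partial>lborel) \<le> ennreal (C * (2 * riesz_bound R))"
proof -
  have "(\<integral>\<^sup>+ t. ennreal (F t) * indicator (cball 0 R) t \<partial>lborel)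
     \<le> (\<integral>\<^sup>+ t. ennreal C * (ennreal (norm (z - t) powr (-3/2)) * indicator (cball 0 R) t
          + ennreal (norm (z' - t) powr (-3/2)) * indicator (cball 0 R) t) \<partial>lborel)"
  proof (rule nn_integral_mono)
    fix t
    have "ennreal (F t) \<le> ennreal (C * (norm (z - t) powr (-3/2) + norm (z' - t) powr (-3/2)))"
      by (rule ennreal_leI[OF le])
    also have "\<dots> = ennreal C * (ennreal (norm (z - t) powr (-3/2)) + ennreal (norm (z' - t) powr (-3/2)))"
      using assms by (simp add: ennreal_mult)
    finally show "ennreal (F t) * indicator (cball 0 R) t \<le> ennreal C * (ennreal (norm (z - t) powr (-3/2)) * indicator (cball 0 R) t
          + ennreal (norm (z' - t) powr (-3/2)) * indicator (cball 0 R) t)"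
      by (auto simp: indicator_def)
  qed
  also have "\<dots> = ennreal C * ((\<integral>\<^sup>+ t. ennreal (norm (z - t) powr (-3/2)) * indicator (cball 0 R) t \<partial>lborel)
        + (\<integral>\<^sup>+ t. ennreal (norm (z' - t) powr (-3/2)) * indicator (cball 0 R) t \<partial>lborel))"
    by (subst nn_integral_cmult, measurable, subst nn_integral_add) auto
  also have "\<dots> \<le> ennreal C * (ennreal (riesz_bound R) + ennreal (riesz_bound R))"
    by (intro mult_left_mono add_mono nn_integral_riesz) auto
  also have "\<dots> = ennreal (C * (2 * riesz_bound R))"
    using assms riesz_bound_pos[of R] by (simp add: ennreal_mult flip: ennreal_plus)
  finally show ?thesis .
qed

text \<open>A local estimate of \<open>m\<close> by its own potential, over a compact set
  \<open>L\<close> that may exceed \<open>K\<close>: the enlargement is the price of a cutoff, and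
  quantifying over all \<open>K\<close> lets two such estimates be composed. In
  \<open>ennreal\<close> the potential may be infinite, as no bound on it is known at this
  stage.\<close>

definition potential_bound :: "(complex \<Rightarrow> real) \<Rightarrow> complex set \<Rightarrow> (complex \<Rightarrow> real) \<Rightarrow> bool" where
  "potential_bound k \<Omega> m \<longleftrightarrow> (\<forall>K. compact K \<and> K \<subseteq> \<Omega> \<longrightarrow> (\<exists>L C. compact L \<and> L \<subseteq> \<Omega> \<and> 0 \<le> C \<and>
     (AE z in lborel. z \<in> K \<longrightarrow> ennreal (m z) \<le> ennreal C * (\<integral>\<^sup>+ t. ennreal (k (z - t)) * (ennreal (m t) * indicator L t) \<partial>lborel))))"

lemma potential_boundE:
  assumes "potential_bound k \<Omega> m" "compact K" "K \<subseteq> \<Omega>"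
  obtains L C where "compact L" "L \<subseteq> \<Omega>" "0 \<le> C"
    "AE z in lborel. z \<in> K \<longrightarrow> ennreal (m z) \<le> ennreal C * (\<integral>\<^sup>+ t. ennreal (k (z - t)) * (ennreal (m t) * indicator L t) \<partial>lborel)"
  using assms(1)[unfolded potential_bound_def, THEN spec, THEN mp, OF conjI[OF assms(2,3)]]
  by (elim exE conjE) (rule that)

text \<open>Inserting the second estimate into the first and exchanging the integrals replaces the
  two kernels by their composition over a ball, which \<open>k3\<close> dominates.\<close>

lemma potential_bound_iterate:
  assumes k1: "potential_bound k1 \<Omega> m" and k2: "potential_bound k2 \<Omega> m"
    and [measurable]: "m \<in> borel_measurable borel" "k1 \<in> borel_measurable borel" "k2 \<in> borel_measurable borel"
    and nn: "\<And>z. 0 \<le> k1 z" "\<And>z. 0 \<le> k2 z" "\<And>z. 0 \<le> k3 z"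
    and [measurable]: "k3 \<in> borel_measurable borel"
    and k3: "\<And>R. \<exists>C\<ge>0. \<forall>z z'. z \<noteq> z' \<longrightarrow>
       (\<integral>\<^sup>+ t. ennreal (k1 (z - t) * k2 (t - z')) * indicator (cball 0 R) t \<partial>lborel) \<le> ennreal (C * k3 (z - z'))"
  shows "potential_bound k3 \<Omega> m"
  unfolding potential_bound_def
proof (intro allI impI, elim conjE)
  fix K assume K: "compact K" "K \<subseteq> \<Omega>"
  obtain L C where L: "compact L" "L \<subseteq> \<Omega>" "0 \<le> C" and
    1: "AE z in lborel. z \<in> K \<longrightarrow> ennreal (m z) \<le> ennreal C * (\<integral>\<^sup>+ t. ennreal (k1 (z - t)) * (ennreal (m t) * indicator L t) \<partial>lborel)"
    by (rule potential_boundE[OF k1 K])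
  obtain L' C' where L': "compact L'" "L' \<subseteq> \<Omega>" "0 \<le> C'" and
    2: "AE z in lborel. z \<in> L \<longrightarrow> ennreal (m z) \<le> ennreal C' * (\<integral>\<^sup>+ t. ennreal (k2 (z - t)) * (ennreal (m t) * indicator L' t) \<partial>lborel)"
    by (rule potential_boundE[OF k2 L(1,2)])
  obtain R where "\<forall>x\<in>L. norm x \<le> R"
    using compact_imp_bounded[OF L(1)] unfolding bounded_iff by (rule exE)
  then have R: "L \<subseteq> cball 0 R"
    by (auto simp: mem_cball_0)
  obtain C'' where c: "0 \<le> C'' \<and> (\<forall>z z'. z \<noteq> z' \<longrightarrow>
       (\<integral>\<^sup>+ t. ennreal (k1 (z - t) * k2 (t - z')) * indicator (cball 0 R) t \<partial>lborel) \<le> ennreal (C'' * k3 (z - z')))"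
    using k3[of R] by (rule exE)
  note C'' = c[THEN conjunct1] c[THEN conjunct2, THEN spec, THEN spec, THEN mp]
  have [measurable]: "L \<in> sets borel" "L' \<in> sets borel"
    using L L' by (auto simp: compact_imp_closed)
  have "AE z in lborel. z \<in> K \<longrightarrow> ennreal (m z) \<le> ennreal (C * C' * C'') * (\<integral>\<^sup>+ t. ennreal (k3 (z - t)) * (ennreal (m t) * indicator L' t) \<partial>lborel)"
    using 1
  proof eventually_elim
    case (elim z)
    show ?case
    proof
      assume "z \<in> K"
      with elim have "ennreal (m z) \<le> ennreal C * (\<integral>\<^sup>+ t. ennreal (k1 (z - t)) * (ennreal (m t) * indicator L t) \<partial>lborel)"
        by simp
      also have "\<dots> \<le> ennreal C * (\<integral>\<^sup>+ t. ennreal (k1 (z - t)) *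
          ((ennreal C' * (\<integral>\<^sup>+ s. ennreal (k2 (t - s)) * (ennreal (m s) * indicator L' s) \<partial>lborel)) * indicator L t) \<partial>lborel)"
        using 2 by (intro mult_left_mono nn_integral_mono_AE) (auto simp: indicator_def intro!: mult_left_mono)
      also have "\<dots> = ennreal C * (\<integral>\<^sup>+ t. (\<integral>\<^sup>+ s. ennreal C' * (ennreal (m s) * indicator L' s) * (ennreal (k1 (z - t) * k2 (t - s)) * indicator L t) \<partial>lborel) \<partial>lborel)"
      proof -
        have "ennreal (k1 (z - t)) * ((ennreal C' * (\<integral>\<^sup>+ s. ennreal (k2 (t - s)) * (ennreal (m s) * indicator L' s) \<partial>lborel)) * indicator L t)
          = (\<integral>\<^sup>+ s. ennreal C' * (ennreal (m s) * indicator L' s) * (ennreal (k1 (z - t) * k2 (t - s)) * indicator L t) \<partial>lborel)" for t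
        proof -
          have "(\<integral>\<^sup>+ s. ennreal C' * (ennreal (m s) * indicator L' s) * (ennreal (k1 (z - t) * k2 (t - s)) * indicator L t) \<partial>lborel)
            = (\<integral>\<^sup>+ s. (ennreal C' * ennreal (k1 (z - t)) * indicator L t) * (ennreal (k2 (t - s)) * (ennreal (m s) * indicator L' s)) \<partial>lborel)"
            by (simp only: ennreal_mult[OF nn(1,2)] mult_ac)
          also have "\<dots> = (ennreal C' * ennreal (k1 (z - t)) * indicator L t) * (\<integral>\<^sup>+ s. ennreal (k2 (t - s)) * (ennreal (m s) * indicator L' s) \<partial>lborel)"
            by (rule nn_integral_cmult) measurable
          finally show ?thesis by (simp only: mult_ac)
        qed
        then show ?thesis by simp
      qed
      also have "\<dots> = ennreal C * (\<integral>\<^sup>+ s. (\<integral>\<^sup>+ t. ennreal C' * (ennreal (m s) * indicator L' s) * (ennreal (k1 (z - t) * k2 (t - s)) * indicator L t) \<partial>lborel) \<partial>lborel)"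
        by (subst lborel_pair.Fubini') auto
      also have "\<dots> = ennreal C * (\<integral>\<^sup>+ s. ennreal C' * (ennreal (m s) * indicator L' s) * (\<integral>\<^sup>+ t. ennreal (k1 (z - t) * k2 (t - s)) * indicator L t \<partial>lborel) \<partial>lborel)"
        by (subst nn_integral_cmult) auto
      also have "\<dots> \<le> ennreal C * (\<integral>\<^sup>+ s. ennreal C' * (ennreal (m s) * indicator L' s) * ennreal (C'' * k3 (z - s)) \<partial>lborel)"
      proof (intro mult_left_mono nn_integral_mono_AE)
        \<comment> \<open>The composed kernel may diverge on the diagonal, which is a null set in
          \<open>s\<close>.\<close>
        have "AE s in lborel. s \<noteq> z" by (rule AE_lborel_singleton)
        then show "AE s in lborel. ennreal C' * (ennreal (m s) * indicator L' s) * (\<integral>\<^sup>+ t. ennreal (k1 (z - t) * k2 (t - s)) * indicator L t \<partial>lborel)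
           \<le> ennreal C' * (ennreal (m s) * indicator L' s) * ennreal (C'' * k3 (z - s))"
        proof eventually_elim
          case (elim s)
          have "(\<integral>\<^sup>+ t. ennreal (k1 (z - t) * k2 (t - s)) * indicator L t \<partial>lborel)
            \<le> (\<integral>\<^sup>+ t. ennreal (k1 (z - t) * k2 (t - s)) * indicator (cball 0 R) t \<partial>lborel)"
            using R by (intro nn_integral_mono) (auto simp: indicator_def)
          also have "\<dots> \<le> ennreal (C'' * k3 (z - s))"
            by (rule C''(2)) (use elim in blast)
          finally show ?case by (rule mult_left_mono) simp
        qed
      qed auto
      also have "\<dots> = ennreal C * (\<integral>\<^sup>+ s. ennreal (C' * C'') * (ennreal (k3 (z - s)) * (ennreal (m s) * indicator L' s)) \<partial>lborel)"
        unfolding ennreal_mult[OF L'(3) C''(1)] ennreal_mult[OF C''(1) nn(3)] by (simp only: mult_ac)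
      also have "\<dots> = ennreal C * (ennreal (C' * C'') * (\<integral>\<^sup>+ s. ennreal (k3 (z - s)) * (ennreal (m s) * indicator L' s) \<partial>lborel))"
        by (subst nn_integral_cmult) auto
      also have "\<dots> = ennreal (C * C' * C'') * (\<integral>\<^sup>+ s. (ennreal (k3 (z - s)) * (ennreal (m s) * indicator L' s)) \<partial>lborel)"
        using L(3) L'(3) C''(1) by (simp only: ennreal_mult mult_nonneg_nonneg mult_ac)
      finally show "ennreal (m z) \<le> ennreal (C * C' * C'') * (\<integral>\<^sup>+ t. ennreal (k3 (z - t)) * (ennreal (m t) * indicator L' t) \<partial>lborel)" .
    qed
  qed
  then show "\<exists>L C. compact L \<and> L \<subseteq> \<Omega> \<and> 0 \<le> C \<and>
     (AE z in lborel. z \<in> K \<longrightarrow> ennreal (m z) \<le> ennreal C * (\<integral>\<^sup>+ t. ennreal (k3 (z - t)) * (ennreal (m t) * indicator L t) \<partial>lborel))"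
    using L L' C'' by (intro exI[of _ L'] exI[of _ "C * C' * C''"]) auto
qed

text \<open>Composing 1/|z| with itself leaves a logarithmic singularity, here bounded crudely by
  \<open>|z|^(-1/2)\<close>; a further composition with 1/|z| gives a bounded kernel. The potential
  for the kernel 1 is just the integral of \<open>m\<close> over a compact set, finite by
  \<open>int\<close>.\<close>

lemma potential_bound_imp_locally_bounded:
  fixes m :: "complex \<Rightarrow> real"
  assumes k: "potential_bound (\<lambda>z. inverse (norm z)) \<Omega> m"
    and [measurable]: "m \<in> borel_measurable borel"
    and int: "\<And>K. compact K \<Longrightarrow> K \<subseteq> \<Omega> \<Longrightarrow> (\<integral>\<^sup>+ t. ennreal (m t) * indicator K t \<partial>lborel) < \<infinity>"
    and K: "compact K" "K \<subseteq> \<Omega>"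
  shows "\<exists>C. AE z in lborel. z \<in> K \<longrightarrow> m z \<le> C"
proof -
  have k2: "potential_bound (\<lambda>z. norm z powr (-1/2)) \<Omega> m"
  proof (rule potential_bound_iterate[OF k k])
    fix R
    show "\<exists>C\<ge>0. \<forall>z z'::complex. z \<noteq> z' \<longrightarrow>
       (\<integral>\<^sup>+ t. ennreal (inverse (norm (z - t)) * inverse (norm (t - z'))) * indicator (cball 0 R) t \<partial>lborel)
         \<le> ennreal (C * norm (z - z') powr (-1/2))"
    proof (intro exI conjI allI impI)
      show "0 \<le> sqrt 2 * (2 * riesz_bound R)" using riesz_bound_pos[of R] by simp
      fix z z' :: complex assume ne: "z \<noteq> z'"
      have "(\<integral>\<^sup>+ t. ennreal (inverse (norm (z - t)) * inverse (norm (t - z'))) * indicator (cball 0 R) t \<partial>lborel)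
         \<le> ennreal (sqrt 2 * norm (z - z') powr (-1/2) * (2 * riesz_bound R))"
      proof (rule nn_integral_le_riesz_bound[of _ _ z z'])
        fix t
        show "inverse (norm (z - t)) * inverse (norm (t - z'))
            \<le> sqrt 2 * norm (z - z') powr (-1/2) * (norm (z - t) powr (-3/2) + norm (z' - t) powr (-3/2))"
          unfolding norm_minus_commute[of z' t]
          using ne norm_triangle_ineq[of "z - t" "t - z'"] by (intro inverse_mult_le_powr) auto
      qed auto
      then show "(\<integral>\<^sup>+ t. ennreal (inverse (norm (z - t)) * inverse (norm (t - z'))) * indicator (cball 0 R) t \<partial>lborel)
         \<le> ennreal (sqrt 2 * (2 * riesz_bound R) * norm (z - z') powr (-1/2))"
        by (simp only: mult_ac)
    qed
  qed auto
  have k3: "potential_bound (\<lambda>z. 1) \<Omega> m"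
  proof (rule potential_bound_iterate[OF k k2])
    fix R
    show "\<exists>C\<ge>0. \<forall>z z'::complex. z \<noteq> z' \<longrightarrow>
       (\<integral>\<^sup>+ t. ennreal (inverse (norm (z - t)) * norm (t - z') powr (-1/2)) * indicator (cball 0 R) t \<partial>lborel)
         \<le> ennreal (C * 1)"
    proof (intro exI conjI allI impI)
      show "0 \<le> 1 * (2 * riesz_bound R)" using riesz_bound_pos[of R] by simp
      fix z z' :: complex
      have "(\<integral>\<^sup>+ t. ennreal (inverse (norm (z - t)) * norm (t - z') powr (-1/2)) * indicator (cball 0 R) t \<partial>lborel)
         \<le> ennreal (1 * (2 * riesz_bound R))"
      proof (rule nn_integral_le_riesz_bound[of _ _ z z'])
        fix t
        show "inverse (norm (z - t)) * norm (t - z') powr (-1/2)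
            \<le> 1 * (norm (z - t) powr (-3/2) + norm (z' - t) powr (-3/2))"
          unfolding norm_minus_commute[of z' t] mult_1 by (intro powr_half_mult_inverse_le) auto
      qed auto
      then show "(\<integral>\<^sup>+ t. ennreal (inverse (norm (z - t)) * norm (t - z') powr (-1/2)) * indicator (cball 0 R) t \<partial>lborel)
         \<le> ennreal (1 * (2 * riesz_bound R) * 1)" by simp
    qed
  qed auto
  obtain L C where L: "compact L" "L \<subseteq> \<Omega>" "0 \<le> C" and
    1: "AE z in lborel. z \<in> K \<longrightarrow> ennreal (m z) \<le> ennreal C * (\<integral>\<^sup>+ t. ennreal 1 * (ennreal (m t) * indicator L t) \<partial>lborel)"
    by (rule potential_boundE[OF k3 K])
  have fin: "ennreal C * (\<integral>\<^sup>+ t. ennreal 1 * (ennreal (m t) * indicator L t) \<partial>lborel) < top"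
    using int[OF L(1,2)] by (simp add: ennreal_mult_less_top)
  show ?thesis
  proof (intro exI)
    show "AE z in lborel. z \<in> K \<longrightarrow> m z \<le> enn2real (ennreal C * (\<integral>\<^sup>+ t. ennreal 1 * (ennreal (m t) * indicator L t) \<partial>lborel))"
      using 1
    proof eventually_elim
      case (elim z)
      then show ?case
        using fin by (metis enn2real_ennreal enn2real_mono enn2real_nonneg linorder_le_cases order_trans)
    qed
  qed
qed

text \<open>The hypothesis \<open>k\<close> is the identity
  \<open>1/a - 1/b = (b - a) / (a b)\<close> in norm. Bounding the product of the two reciprocals
  costs \<open>d powr (-1/2)\<close>, which leaves \<open>d powr (1/2)\<close>. The exponent is not
  optimal, but any positive one makes the later commutator integrable.\<close>

lemma cauchy_kernel_Lipschitz_half: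
  fixes k :: "complex \<Rightarrow> complex"
  assumes k: "\<And>a b. a \<noteq> 0 \<Longrightarrow> b \<noteq> 0 \<Longrightarrow> norm (k a - k b) \<le> norm (a - b) * (inverse (norm a) * inverse (norm b))"
    and [measurable]: "k \<in> borel_measurable borel" "w \<in> borel_measurable borel"
    and w: "\<And>t. norm (w t) \<le> C" "\<And>t. R < norm t \<Longrightarrow> w t = 0"
    and int: "integrable lborel (\<lambda>t. w t * k (z - t))" "integrable lborel (\<lambda>t. w t * k (z' - t))"
  shows "norm (conv w k z - conv w k z') \<le> C * (2 * sqrt 2 * riesz_bound R) * norm (z - z') powr (1/2)"
proof (cases "z = z'")
  case False
  have C: "0 \<le> C" using w(1) norm_ge_zero order_trans by blast
  define d where "d = norm (z - z')"
  have d: "d > 0" using False by (simp add: d_def)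
  have dd: "d * d powr (-1/2) = d powr (1/2)"
    using d by (simp add: powr_mult_base)
  have "conv w k z - conv w k z' = (LINT t|lborel. w t * k (z - t) - w t * k (z' - t))"
    unfolding conv_def using int by simp
  moreover have "ennreal (norm (LINT t|lborel. w t * k (z - t) - w t * k (z' - t)))
      \<le> (\<integral>\<^sup>+ t. norm (w t * k (z - t) - w t * k (z' - t)) \<partial>lborel)"
    by (intro integral_norm_bound_ennreal Bochner_Integration.integrable_diff int)
  ultimately have "ennreal (norm (conv w k z - conv w k z')) \<le> (\<integral>\<^sup>+ t. norm (w t * k (z - t) - w t * k (z' - t)) \<partial>lborel)"
    by (simp only:)
  also have "\<dots> \<le> (\<integral>\<^sup>+ t. ennreal (C * (d * (inverse (norm (z - t)) * inverse (norm (z' - t))))) * indicator (cball 0 R) t \<partial>lborel)"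
  proof (rule nn_integral_mono_AE)
    have "AE t in lborel. t \<noteq> z" "AE t in lborel. t \<noteq> z'"
      by (rule AE_lborel_singleton)+
    then show "AE t in lborel. ennreal (norm (w t * k (z - t) - w t * k (z' - t))) \<le>
        ennreal (C * (d * (inverse (norm (z - t)) * inverse (norm (z' - t))))) * indicator (cball 0 R) t"
    proof eventually_elim
      case (elim t)
      show ?case
      proof (cases "norm t \<le> R")
        case True
        have "norm (w t * k (z - t) - w t * k (z' - t)) = norm (w t) * norm (k (z - t) - k (z' - t))"
          by (simp add: norm_mult flip: right_diff_distrib)
        also have "\<dots> \<le> C * (d * (inverse (norm (z - t)) * inverse (norm (z' - t))))"
          using k[of "z - t" "z' - t"] w C elim by (intro mult_mono) (auto simp: d_def)
        finally show ?thesis using True by (simp add: ennreal_leI)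
      qed (use w in auto)
    qed
  qed
  also have "\<dots> \<le> ennreal (C * (d * (sqrt 2 * d powr (-1/2))) * (2 * riesz_bound R))"
  proof (rule nn_integral_le_riesz_bound[of _ _ z z'])
    fix t
    have "inverse (norm (z - t)) * inverse (norm (z' - t))
            \<le> sqrt 2 * d powr (-1/2) * (norm (z - t) powr (-3/2) + norm (z' - t) powr (-3/2))"
      using d norm_triangle_ineq4[of "z - t" "z' - t"] by (intro inverse_mult_le_powr) (auto simp: d_def)
    then show "C * (d * (inverse (norm (z - t)) * inverse (norm (z' - t)))) \<le>
       C * (d * (sqrt 2 * d powr (-1/2))) * (norm (z - t) powr (-3/2) + norm (z' - t) powr (-3/2))"
      using C d by (auto simp: mult.assoc intro!: mult_left_mono)
  qed (use C d in auto)
  also have "C * (d * (sqrt 2 * d powr (-1/2))) * (2 * riesz_bound R) = C * (2 * sqrt 2 * riesz_bound R) * (d * d powr (-1/2))"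
    by (simp only: mult_ac)
  finally have "ennreal (norm (conv w k z - conv w k z')) \<le> ennreal (C * (2 * sqrt 2 * riesz_bound R) * (d * d powr (-1/2)))" .
  then show ?thesis
    using C riesz_bound_pos[of R] unfolding dd unfolding d_def by (subst (asm) ennreal_le_iff) auto
qed simp

section \<open>The regularised Cauchy kernel, its derivatives and the mollifier that it
  generates\<close>

section \<open>Regularised Cauchy kernels\<close>

text \<open>The function \<open>1 / (|z|^2 + \<epsilon>^2)\<close>, written with products of
  coordinates so that the closure rules for \<open>smooth\<close> apply. For \<epsilon> = 0 it takes
  the value 0 at the origin.\<close>

definition sker :: "real \<Rightarrow> complex \<Rightarrow> complex" where
  "sker \<epsilon> z = inverse (complex_of_real (Re z) * complex_of_real (Re z) +
     complex_of_real (Im z) * complex_of_real (Im z) + complex_of_real (\<epsilon>\<^sup>2))"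

text \<open>For c = \<plusminus>\<i> one has \<open>(x - c y) (x + c y) = |z|^2\<close>, so
  \<epsilon> = 0 gives \<open>1 / (x + c y)\<close>, which is 2 pi times the fundamental solution of
  \<open>D\<^sub>c\<close>.\<close>

definition cker :: "complex \<Rightarrow> real \<Rightarrow> complex \<Rightarrow> complex" where
  "cker c \<epsilon> z = (complex_of_real (Re z) - c * complex_of_real (Im z)) * sker \<epsilon> z"

text \<open>Half of \<open>D\<^sub>c\<close> applied to \<open>cker c \<epsilon>\<close>, the same
  for both signs of c. It is positive for positive \<epsilon> and decays like
  \<open>|z|^(-4)\<close>, without compact support.\<close>

definition moll :: "real \<Rightarrow> complex \<Rightarrow> complex" where
  "moll \<epsilon> z = complex_of_real (\<epsilon>\<^sup>2) * (sker \<epsilon> z * sker \<epsilon> z)"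

text \<open>The value is pi, but it stays a symbol: it occurs on both sides of the limit identities
  and cancels once it is known to be positive.\<close>

definition moll_mass :: real where
  "moll_mass = (LINT (z::complex)|lborel. 1 / ((norm z)\<^sup>2 + 1)\<^sup>2)"

lemma sker_real: "sker \<epsilon> z = complex_of_real (1 / ((norm z)\<^sup>2 + \<epsilon>\<^sup>2))"
proof -
  have n: "(norm z)\<^sup>2 = Re z * Re z + Im z * Im z"
    unfolding cmod_power2 by (simp add: power2_eq_square)
  show ?thesis
    unfolding sker_def n by (simp add: divide_inverse)
qed

lemma sker_nonzero_arg:
  assumes "0 < \<epsilon>"
  shows "complex_of_real (Re z) * complex_of_real (Re z) + complex_of_real (Im z) * complex_of_real (Im z) + complex_of_real (\<epsilon>\<^sup>2) \<noteq> 0"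
proof -
  have "Re z * Re z + Im z * Im z + \<epsilon>\<^sup>2 > 0"
    using assms by (simp add: add_nonneg_pos)
  then have "complex_of_real (Re z * Re z + Im z * Im z + \<epsilon>\<^sup>2) \<noteq> 0"
    by (metis less_irrefl of_real_eq_0_iff)
  then show ?thesis by simp
qed

lemma smooth_sker: "0 < \<epsilon> \<Longrightarrow> smooth (sker \<epsilon>)"
  unfolding sker_def by (intro smooth_inverse smooth_intros sker_nonzero_arg)

lemma smooth_cker: "0 < \<epsilon> \<Longrightarrow> smooth (cker c \<epsilon>)"
  unfolding cker_def by (intro smooth_intros smooth_sker)

lemma smooth_moll: "0 < \<epsilon> \<Longrightarrow> smooth (moll \<epsilon>)"
  unfolding moll_def by (intro smooth_intros smooth_sker)

lemma pd_sker:
  assumes "0 < \<epsilon>"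
  shows "pd 1 (sker \<epsilon>) z = - 2 * complex_of_real (Re z) * (sker \<epsilon> z * sker \<epsilon> z)"
    "pd \<i> (sker \<epsilon>) z = - 2 * complex_of_real (Im z) * (sker \<epsilon> z * sker \<epsilon> z)"
proof -
  let ?q = "\<lambda>z. complex_of_real (Re z) * complex_of_real (Re z) +
     complex_of_real (Im z) * complex_of_real (Im z) + complex_of_real (\<epsilon>\<^sup>2)"
  have s: "smooth ?q" by (intro smooth_intros)
  have "(?q has_derivative (\<lambda>h. 2 * complex_of_real (Re z) * complex_of_real (Re h) + 2 * complex_of_real (Im z) * complex_of_real (Im h))) (at z)"
    by (auto intro!: derivative_eq_intros simp: algebra_simps)
  note q = pd_eqI[OF this]
  show "pd 1 (sker \<epsilon>) z = - 2 * complex_of_real (Re z) * (sker \<epsilon> z * sker \<epsilon> z)"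
    "pd \<i> (sker \<epsilon>) z = - 2 * complex_of_real (Im z) * (sker \<epsilon> z * sker \<epsilon> z)"
    unfolding sker_def
    by (subst pd_inverse[OF s sker_nonzero_arg[OF assms]], simp, subst q, simp)+
qed

lemma pd_cker:
  assumes "0 < \<epsilon>"
  shows "pd 1 (cker c \<epsilon>) z = sker \<epsilon> z - 2 * complex_of_real (Re z) * (complex_of_real (Re z) - c * complex_of_real (Im z)) * (sker \<epsilon> z * sker \<epsilon> z)"
    "pd \<i> (cker c \<epsilon>) z = - c * sker \<epsilon> z - 2 * complex_of_real (Im z) * (complex_of_real (Re z) - c * complex_of_real (Im z)) * (sker \<epsilon> z * sker \<epsilon> z)"
proof -
  have "((\<lambda>z. complex_of_real (Re z) - c * complex_of_real (Im z)) has_derivative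
      (\<lambda>h. complex_of_real (Re h) - c * complex_of_real (Im h))) (at z)"
    by (auto intro!: derivative_eq_intros)
  note l = pd_eqI[OF this]
  have s: "smooth (\<lambda>z. complex_of_real (Re z) - c * complex_of_real (Im z))"
    by (intro smooth_intros)
  have m: "pd e (cker c \<epsilon>) z = pd e (\<lambda>z. complex_of_real (Re z) - c * complex_of_real (Im z)) z * sker \<epsilon> z +
     (complex_of_real (Re z) - c * complex_of_real (Im z)) * pd e (sker \<epsilon>) z" if "e \<in> {1, \<i>}" for e
    unfolding cker_def using that s smooth_sker[OF assms] by (rule pd_mult[rotated 2])
  show "pd 1 (cker c \<epsilon>) z = sker \<epsilon> z - 2 * complex_of_real (Re z) * (complex_of_real (Re z) - c * complex_of_real (Im z)) * (sker \<epsilon> z * sker \<epsilon> z)"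
    by (subst m, simp, subst l) (simp add: pd_sker[OF assms] algebra_simps)
  show "pd \<i> (cker c \<epsilon>) z = - c * sker \<epsilon> z - 2 * complex_of_real (Im z) * (complex_of_real (Re z) - c * complex_of_real (Im z)) * (sker \<epsilon> z * sker \<epsilon> z)"
    by (subst m, simp, subst l) (simp add: pd_sker[OF assms] algebra_simps)
qed

text \<open>With s for \<open>sker \<epsilon> z\<close> and \<open>c^2 = -1\<close> the left side is
  \<open>2 s - 2 |z|^2 s^2\<close>; the relation \<open>s (|z|^2 + \<epsilon>^2) = 1\<close> turns
  this into \<open>2 \<epsilon>^2 s^2\<close>.\<close>

lemma cker_dbar:
  assumes "0 < \<epsilon>" "c * c = - 1"
  shows "pd 1 (cker c \<epsilon>) z + c * pd \<i> (cker c \<epsilon>) z = 2 * moll \<epsilon> z"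
proof -
  define x where "x = complex_of_real (Re z)"
  define y where "y = complex_of_real (Im z)"
  define s where "s = sker \<epsilon> z"
  have s1: "s * (x * x + y * y + complex_of_real (\<epsilon>\<^sup>2)) = 1"
    unfolding s_def sker_def x_def y_def using sker_nonzero_arg[OF assms(1), of z] by simp
  have cy: "c * (y * (c * y)) = - (y * y)"
    using assms(2) by (metis mult.assoc mult.left_commute mult_minus1)
  have "pd 1 (cker c \<epsilon>) z + c * pd \<i> (cker c \<epsilon>) z
     = s - 2 * x * (x - c * y) * (s * s) + c * (- c * s - 2 * y * (x - c * y) * (s * s))"
    unfolding pd_cker[OF assms(1)] x_def y_def s_def ..
  also have "\<dots> = s - (c * c) * s - 2 * (x * x - (c * c) * (y * y)) * (s * s)"
    by (simp add: algebra_simps)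
  also have "\<dots> = 2 * s * (s * (x * x + y * y + complex_of_real (\<epsilon>\<^sup>2))) - 2 * (x * x + y * y) * (s * s)"
    unfolding assms(2) s1 by simp
  also have "\<dots> = 2 * (complex_of_real (\<epsilon>\<^sup>2) * (s * s))"
    by (simp add: algebra_simps)
  finally show ?thesis
    by (simp add: moll_def s_def)
qed

lemma norm_sker_le: "z \<noteq> 0 \<Longrightarrow> norm (sker \<epsilon> z) \<le> inverse ((norm z)\<^sup>2)"
  unfolding sker_real norm_of_real by (simp add: inverse_eq_divide frac_le)

lemma norm_Re_Im_c:
  assumes "c \<in> {\<i>, -\<i>}"
  shows "norm (complex_of_real (Re z) - c * complex_of_real (Im z)) = norm z"
  using assms by (auto simp: cmod_def)

lemma norm_cker_le:
  assumes "c \<in> {\<i>, -\<i>}"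
  shows "norm (cker c \<epsilon> z) \<le> inverse (norm z)"
proof (cases "z = 0")
  case False
  have "norm (cker c \<epsilon> z) = norm z * norm (sker \<epsilon> z)"
    by (simp add: cker_def norm_mult norm_Re_Im_c[OF assms])
  also have "\<dots> \<le> norm z * inverse ((norm z)\<^sup>2)"
    using norm_sker_le[OF False] by (intro mult_left_mono) auto
  also have "\<dots> = inverse (norm z)"
    using False by (simp add: power2_eq_square)
  finally show ?thesis .
qed (simp add: cker_def)

text \<open>Uniform in \<epsilon>: differentiating the numerator costs one \<open>|z|^(-2)\<close>,
  differentiating \<open>sker\<close> two. This is the borderline non-integrable size that a Hoelder
  increment has to compensate.\<close>

lemma norm_pd_cker_le:
  assumes "c \<in> {\<i>, -\<i>}" "0 < \<epsilon>" "e \<in> {1, \<i>}" "z \<noteq> 0"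
  shows "norm (pd e (cker c \<epsilon>) z) \<le> 3 * inverse ((norm z)\<^sup>2)"
proof -
  have s: "norm (sker \<epsilon> z) \<le> inverse ((norm z)\<^sup>2)" by (rule norm_sker_le[OF assms(4)])
  have nc: "norm c = 1" using assms(1) by auto
  have *: "norm (2 * complex_of_real r * (complex_of_real (Re z) - c * complex_of_real (Im z)) * (sker \<epsilon> z * sker \<epsilon> z))
     \<le> 2 * inverse ((norm z)\<^sup>2)" if "\<bar>r\<bar> \<le> norm z" for r
  proof -
    have "norm (2 * complex_of_real r * (complex_of_real (Re z) - c * complex_of_real (Im z)) * (sker \<epsilon> z * sker \<epsilon> z))
       = 2 * (\<bar>r\<bar> * norm z * (norm (sker \<epsilon> z) * norm (sker \<epsilon> z)))"
      by (simp add: norm_mult norm_Re_Im_c[OF assms(1)])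
    also have "\<dots> \<le> 2 * (norm z * norm z * (inverse ((norm z)\<^sup>2) * inverse ((norm z)\<^sup>2)))"
      using that s by (intro mult_left_mono mult_mono) auto
    also have "\<dots> = 2 * inverse ((norm z)\<^sup>2)"
      using assms(4) by (simp add: power2_eq_square field_simps)
    finally show ?thesis .
  qed
  from assms(3) consider "e = 1" | "e = \<i>" by auto
  then show ?thesis
  proof cases
    case 1
    have "norm (pd e (cker c \<epsilon>) z) \<le> norm (sker \<epsilon> z) + 2 * inverse ((norm z)\<^sup>2)"
      unfolding 1 pd_cker[OF assms(2)]
      using norm_triangle_ineq4 *[OF abs_Re_le_cmod] by (meson add_left_mono order_trans)
    then show ?thesis using s by simp
  next
    case 2
    have "norm (pd e (cker c \<epsilon>) z) \<le> norm (- c * sker \<epsilon> z) + 2 * inverse ((norm z)\<^sup>2)"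
      unfolding 2 pd_cker[OF assms(2)]
      using norm_triangle_ineq4 *[OF abs_Im_le_cmod] by (meson add_left_mono order_trans)
    then show ?thesis using s by (simp add: norm_mult nc)
  qed
qed

lemma sker_tendsto:
  assumes "z \<noteq> 0" "\<epsilon> \<longlonglongrightarrow> 0"
  shows "(\<lambda>n. sker (\<epsilon> n) z) \<longlonglongrightarrow> sker 0 z"
  unfolding sker_real using assms by (auto intro!: tendsto_eq_intros)

lemma cker_tendsto:
  assumes "\<epsilon> \<longlonglongrightarrow> 0"
  shows "(\<lambda>n. cker c (\<epsilon> n) z) \<longlonglongrightarrow> cker c 0 z"
proof (cases "z = 0")
  case False
  then show ?thesis
    unfolding cker_def using assms by (intro tendsto_intros sker_tendsto)
qed (simp add: cker_def)

text \<open>The formulas for the partials of \<open>cker\<close> at \<epsilon> = 0, written out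
  because the limit kernel is singular at the origin. Its size \<open>|z|^(-2)\<close> is not
  locally integrable, so it is paired with factors that are small at the singularity or supported
  away from it.\<close>

definition dker :: "complex \<Rightarrow> complex \<Rightarrow> complex \<Rightarrow> complex" where
  "dker c e z = (if e = 1 then sker 0 z - 2 * complex_of_real (Re z) * (complex_of_real (Re z) - c * complex_of_real (Im z)) * (sker 0 z * sker 0 z)
     else - c * sker 0 z - 2 * complex_of_real (Im z) * (complex_of_real (Re z) - c * complex_of_real (Im z)) * (sker 0 z * sker 0 z))"

lemma pd_cker_tendsto:
  assumes "z \<noteq> 0" "\<epsilon> \<longlonglongrightarrow> 0" "\<And>n. 0 < \<epsilon> n" "e \<in> {1, \<i>}"
  shows "(\<lambda>n. pd e (cker c (\<epsilon> n)) z) \<longlonglongrightarrow> dker c e z"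
proof -
  from assms(4) consider "e = 1" | "e = \<i>" by auto
  then show ?thesis
  proof cases
    case 1
    show ?thesis unfolding 1 pd_cker[OF assms(3)] dker_def if_True refl
      by (simp, intro tendsto_intros sker_tendsto assms)
  next
    case 2
    show ?thesis unfolding 2 pd_cker[OF assms(3)] dker_def
      by (simp, intro tendsto_intros sker_tendsto assms)
  qed
qed

lemma cker_0:
  assumes "c \<in> {\<i>, -\<i>}"
  shows "cker c 0 z = (if c = \<i> then inverse z else inverse (cnj z))"
proof (cases "z = 0")
  case False
  have "cnj z * complex_of_real (1 / (norm z)\<^sup>2) = inverse z"
    using False by (simp add: field_simps complex_norm_square[symmetric] mult.commute)
  moreover have "z * complex_of_real (1 / (norm z)\<^sup>2) = inverse (cnj z)"
    using False by (simp add: field_simps complex_norm_square[symmetric])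
  moreover have "complex_of_real (Re z) - \<i> * complex_of_real (Im z) = cnj z"
    "complex_of_real (Re z) - (-\<i>) * complex_of_real (Im z) = z"
    by (auto simp: complex_eq_iff)
  ultimately show ?thesis
    using assms by (auto simp: cker_def sker_real)
qed (simp add: cker_def)

lemma norm_cker_0_diff_le:
  assumes "c \<in> {\<i>, -\<i>}" "a \<noteq> 0" "b \<noteq> 0"
  shows "norm (cker c 0 a - cker c 0 b) \<le> norm (a - b) * (inverse (norm a) * inverse (norm b))"
proof -
  have 1: "norm (inverse a - inverse b) = norm (a - b) * (inverse (norm a) * inverse (norm b))"
    if "a \<noteq> 0" "b \<noteq> 0" for a b :: complex
    using that by (simp add: inverse_diff_inverse norm_mult norm_inverse norm_minus_commute)
  have "norm (inverse (cnj a) - inverse (cnj b)) = norm (a - b) * (inverse (norm a) * inverse (norm b))"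
    using 1[of "cnj a" "cnj b"] assms by (simp flip: complex_cnj_diff)
  then show ?thesis
    using 1[OF assms(2,3)] assms(1) by (simp add: cker_0)
qed

text \<open>Exhibits the mollifiers as the L1-normalised dilations of one profile, the shape
  expected of an approximate identity.\<close>

lemma moll_scale:
  assumes "0 < \<epsilon>"
  shows "moll \<epsilon> t = moll 1 (t /\<^sub>R \<epsilon>) /\<^sub>R \<epsilon>\<^sup>2"
proof -
  define n where "n = (norm t)\<^sup>2"
  have n: "n + \<epsilon>\<^sup>2 > 0" using assms by (simp add: n_def add_nonneg_pos)
  have "1 / (n / \<epsilon>\<^sup>2 + 1) = \<epsilon>\<^sup>2 * (1 / (n + \<epsilon>\<^sup>2))"
    using assms n by (simp add: field_simps)
  moreover have norm_t: "(norm (t /\<^sub>R \<epsilon>))\<^sup>2 = (norm t)\<^sup>2 / \<epsilon>\<^sup>2"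
    by (simp add: power_mult_distrib divide_inverse power_inverse mult.commute)
  ultimately have s: "sker 1 (t /\<^sub>R \<epsilon>) = complex_of_real (\<epsilon>\<^sup>2) * sker \<epsilon> t"
    using assms unfolding sker_real norm_t of_real_mult[symmetric] of_real_eq_iff n_def by simp
  show ?thesis
    unfolding moll_def s using assms by (simp add: scaleR_conv_of_real field_simps power2_eq_square)
qed

lemma moll_real: "moll \<epsilon> z = complex_of_real (\<epsilon>\<^sup>2 * (1 / ((norm z)\<^sup>2 + \<epsilon>\<^sup>2))\<^sup>2)"
  by (simp add: moll_def sker_real power2_eq_square)

lemma nn_integral_inverse_square: "(\<integral>\<^sup>+ (x::real). ennreal (1 / (1 + x\<^sup>2)) \<partial>lborel) < \<infinity>"
proof -
  have pos: "(\<integral>\<^sup>+ (x::real). ennreal (1 / (1 + x\<^sup>2)) * indicator {0..} x \<partial>lborel) = ennreal (pi / 2)"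
    by (subst nn_integral_FTC_atLeast[where F = arctan and T = "pi / 2"])
       (auto intro!: derivative_eq_intros tendsto_arctan_at_top simp: inverse_eq_divide)
  have "(\<integral>\<^sup>+ (x::real). ennreal (1 / (1 + x\<^sup>2)) * indicator {..0} x \<partial>lborel)
      = ennreal \<bar>-1\<bar> * (\<integral>\<^sup>+ (x::real). ennreal (1 / (1 + (0 + (-1) * x)\<^sup>2)) * indicator {..0} (0 + (-1) * x) \<partial>lborel)"
    by (rule nn_integral_real_affine) auto
  also have "\<dots> = (\<integral>\<^sup>+ (x::real). ennreal (1 / (1 + x\<^sup>2)) * indicator {0..} x \<partial>lborel)"
    by simp (intro nn_integral_cong, auto simp: indicator_def)
  finally have neg: "(\<integral>\<^sup>+ (x::real). ennreal (1 / (1 + x\<^sup>2)) * indicator {..0} x \<partial>lborel) = ennreal (pi / 2)"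
    using pos by simp
  have "(\<integral>\<^sup>+ (x::real). ennreal (1 / (1 + x\<^sup>2)) \<partial>lborel)
     \<le> (\<integral>\<^sup>+ (x::real). ennreal (1 / (1 + x\<^sup>2)) * indicator {0..} x + ennreal (1 / (1 + x\<^sup>2)) * indicator {..0} x \<partial>lborel)"
    by (rule nn_integral_mono) (auto simp: indicator_def)
  also have "\<dots> = ennreal (pi / 2) + ennreal (pi / 2)"
    by (subst nn_integral_add, simp, simp) (simp only: pos neg)
  also have "\<dots> < \<infinity>" by simp
  finally show ?thesis .
qed

text \<open>\<open>(1 + x^2) (1 + y^2) \<le> (1 + x^2 + y^2)^2\<close> bounds the profile by a
  product of two derivatives of arctan.\<close>

lemma integrable_moll_real: "integrable lborel (\<lambda>z::complex. 1 / ((norm z)\<^sup>2 + 1)\<^sup>2)"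
  unfolding integrable_iff_bounded
proof
  have "(\<integral>\<^sup>+ (z::complex). ennreal (norm (1 / ((norm z)\<^sup>2 + 1)\<^sup>2)) \<partial>lborel)
     \<le> (\<integral>\<^sup>+ z. ennreal (1 / (1 + (Re z)\<^sup>2)) * ennreal (1 / (1 + (Im z)\<^sup>2)) \<partial>lborel)"
  proof (rule nn_integral_mono)
    fix z :: complex
    define a b where "a = (Re z)\<^sup>2" "b = (Im z)\<^sup>2"
    have ab: "0 \<le> a" "0 \<le> b" by (auto simp: a_b_def)
    have "(1 + a) * (1 + b) \<le> (a + b + 1) * (a + b + 1)"
      using ab by (intro mult_mono) auto
    then have "1 / ((a + b + 1) * (a + b + 1)) \<le> 1 / ((1 + a) * (1 + b))"
      using ab by (intro divide_left_mono) (auto intro!: mult_pos_pos add_nonneg_pos add_pos_nonneg)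
    then show "ennreal (norm (1 / ((norm z)\<^sup>2 + 1)\<^sup>2)) \<le> ennreal (1 / (1 + (Re z)\<^sup>2)) * ennreal (1 / (1 + (Im z)\<^sup>2))"
      using ab unfolding cmod_power2 power2_eq_square[of "_ + 1"] a_b_def[symmetric]
      by (subst ennreal_mult[symmetric]) (auto intro!: ennreal_leI)
  qed
  also have "\<dots> = (\<integral>\<^sup>+ (x::real). ennreal (1 / (1 + x\<^sup>2)) \<partial>lborel) * (\<integral>\<^sup>+ (x::real). ennreal (1 / (1 + x\<^sup>2)) \<partial>lborel)"
    by (rule nn_integral_complex_prod) measurable
  also have "\<dots> < \<infinity>"
    using nn_integral_inverse_square by (simp add: ennreal_mult_less_top)
  finally show "(\<integral>\<^sup>+ (z::complex). ennreal (norm (1 / ((norm z)\<^sup>2 + 1)\<^sup>2)) \<partial>lborel) < \<infinity>" .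
qed measurable

lemma moll_mass_pos: "0 < moll_mass"
proof -
  have "(\<integral>\<^sup>+ (z::complex). ennreal (1 / ((norm z)\<^sup>2 + 1)\<^sup>2) \<partial>lborel) \<noteq> 0"
  proof
    assume "(\<integral>\<^sup>+ (z::complex). ennreal (1 / ((norm z)\<^sup>2 + 1)\<^sup>2) \<partial>lborel) = 0"
    then have "AE z::complex in lborel. ennreal (1 / ((norm z)\<^sup>2 + 1)\<^sup>2) = 0"
      by (subst (asm) nn_integral_0_iff_AE) auto
    then have "AE z::complex in lborel. False"
    proof eventually_elim
      case (elim z)
      have "1 / ((norm z)\<^sup>2 + 1)\<^sup>2 > 0"
        by (intro divide_pos_pos zero_less_power add_nonneg_pos) auto
      with elim show False by (simp add: ennreal_eq_0_iff)
    qed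
    then show False
      using AE_iff_measurable[of "UNIV :: complex set" lborel "\<lambda>_. False"] by simp
  qed
  then have "moll_mass \<noteq> 0"
    unfolding moll_mass_def using nn_integral_eq_integral[OF integrable_moll_real] by auto
  moreover have "0 \<le> moll_mass"
    unfolding moll_mass_def by (rule integral_nonneg_AE) simp
  ultimately show ?thesis by simp
qed

lemma moll_one: "moll 1 z = complex_of_real (1 / ((norm z)\<^sup>2 + 1)\<^sup>2)"
  by (simp add: moll_real power_divide)

lemma integrable_moll: "integrable lborel (moll 1)"
  unfolding moll_one[abs_def] by (rule integrable_of_real[OF integrable_moll_real])

lemma integral_moll: "(LINT z|lborel. moll 1 z) = complex_of_real moll_mass"
  unfolding moll_one moll_mass_def by (rule integral_of_real[OF integrable_moll_real])

lemma norm_moll_le: "norm (moll 1 z) \<le> 1"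
proof -
  have "1 \<le> ((norm z)\<^sup>2 + 1)\<^sup>2" by (rule one_le_power) simp
  then show ?thesis unfolding moll_one norm_of_real by (simp add: abs_if divide_le_eq)
qed

definition eps :: "nat \<Rightarrow> real" where
  "eps n = 1 / real (Suc n)"

lemma eps_pos: "0 < eps n"
  by (simp add: eps_def)

lemma eps_tendsto: "eps \<longlonglongrightarrow> 0"
  unfolding eps_def using LIMSEQ_inverse_real_of_nat by (simp add: inverse_eq_divide)

lemma conv_moll_L1:
  fixes w :: "complex \<Rightarrow> complex"
  assumes "integrable lborel w"
  shows "(\<lambda>n. \<integral>\<^sup>+ z. norm (conv w (moll (eps n)) z - moll_mass * w z) \<partial>lborel) \<longlonglongrightarrow> 0"
proof -
  have "moll (eps n) = (\<lambda>t. moll 1 (t /\<^sub>R eps n) /\<^sub>R (eps n)\<^sup>2)" for n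
    using moll_scale[OF eps_pos] by blast
  then show ?thesis
    using approximate_identity_L1[OF assms integrable_moll norm_moll_le eps_pos eps_tendsto]
    by (simp add: integral_moll)
qed

section \<open>Weak equations: cutoff, mollification, Cauchy representation and local
  boundedness\<close>

section \<open>Weak first-order equations\<close>

text \<open>Here all functions are Borel measurable on the whole plane, so that Fubini's theorem
  for \<open>lborel\<close> applies; only their values on \<open>\<Omega>\<close> matter.\<close>

definition locint :: "complex set \<Rightarrow> (complex \<Rightarrow> complex) \<Rightarrow> bool" where
  "locint \<Omega> g \<longleftrightarrow> g \<in> borel_measurable borel \<and>
     (\<forall>K. compact K \<longrightarrow> K \<subseteq> \<Omega> \<longrightarrow> integrable lborel (\<lambda>z. indicator K z *\<^sub>R g z))"

definition locbdd :: "complex set \<Rightarrow> (complex \<Rightarrow> complex) \<Rightarrow> bool" where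
  "locbdd \<Omega> g \<longleftrightarrow> g \<in> borel_measurable borel \<and>
     (\<forall>K. compact K \<longrightarrow> K \<subseteq> \<Omega> \<longrightarrow> (\<exists>C. AE z in lborel. z \<in> K \<longrightarrow> norm (g z) \<le> C))"

text \<open>The coefficients cover \<open>D\<^sub>c\<close> (with \<open>a = 1\<close>,
  \<open>b = c\<close>) and each single partial derivative, so the cutoff identity below is proved
  once for all of them.\<close>

definition weak_op :: "complex \<Rightarrow> complex \<Rightarrow> complex set \<Rightarrow> (complex \<Rightarrow> complex) \<Rightarrow> (complex \<Rightarrow> complex) \<Rightarrow> bool" where
  "weak_op a b \<Omega> g h \<longleftrightarrow> locint \<Omega> g \<and> locint \<Omega> h \<and> (\<forall>\<phi>\<in>test_fun \<Omega>.
     (LINT z|lborel. g z * (a * pd 1 \<phi> z + b * pd \<i> \<phi> z)) = - (LINT z|lborel. h z * \<phi> z))"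

lemma locint_borel: "locint \<Omega> g \<Longrightarrow> g \<in> borel_measurable borel"
  by (simp add: locint_def)

lemma locbdd_borel: "locbdd \<Omega> g \<Longrightarrow> g \<in> borel_measurable borel"
  by (simp add: locbdd_def)

lemma locintD: "locint \<Omega> g \<Longrightarrow> compact K \<Longrightarrow> K \<subseteq> \<Omega> \<Longrightarrow> integrable lborel (\<lambda>z. indicator K z *\<^sub>R g z)"
  by (simp add: locint_def)

lemma locbddE:
  assumes "locbdd \<Omega> g" "compact K" "K \<subseteq> \<Omega>"
  obtains C where "0 \<le> C" "AE z in lborel. z \<in> K \<longrightarrow> norm (g z) \<le> C"
proof -
  obtain C where C: "AE z in lborel. z \<in> K \<longrightarrow> norm (g z) \<le> C"
    using assms unfolding locbdd_def by (elim conjE allE[of _ K] impE exE)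
  have "AE z in lborel. z \<in> K \<longrightarrow> norm (g z) \<le> max 0 C"
    using C by eventually_elim auto
  then show ?thesis by (rule that[rotated]) simp
qed

lemma L1c_boundI:
  fixes g :: "complex \<Rightarrow> complex"
  assumes w: "L1c w" and g: "g \<in> borel_measurable borel" and le: "\<And>t. norm (g t) \<le> C * norm (w t)"
  shows "L1c g"
proof -
  obtain R where "\<forall>t. R < norm t \<longrightarrow> w t = 0"
    using w unfolding L1c_def by (elim conjE exE)
  then have "\<forall>t. R < norm t \<longrightarrow> g t = 0"
    using le by (metis mult_zero_right norm_le_zero_iff norm_zero)
  then show ?thesis
    unfolding L1c_def using L1c_bound_integrable[OF assms] by blast
qed

lemma locint_L1c_indicator:
  assumes "locint \<Omega> g" "compact K" "K \<subseteq> \<Omega>"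
  shows "L1c (\<lambda>z. indicator K z *\<^sub>R g z)"
proof -
  obtain R where "\<forall>x\<in>K. norm x \<le> R"
    using compact_imp_bounded[OF assms(2)] unfolding bounded_iff by (rule exE)
  then have "\<forall>t. R < norm t \<longrightarrow> indicator K t *\<^sub>R g t = 0"
    by (auto simp: indicator_def)
  then show ?thesis
    unfolding L1c_def using locintD[OF assms] by blast
qed

lemma locint_test_mult:
  assumes g: "locint \<Omega> g" and \<psi>: "\<psi> \<in> test_fun \<Omega>"
  shows "L1c (\<lambda>t. \<psi> t * g t)"
proof -
  from \<psi> obtain K where K: "compact K" "K \<subseteq> \<Omega>" "\<forall>z. z \<notin> K \<longrightarrow> \<psi> z = 0"
    unfolding test_fun_iff by (elim conjE exE)
  obtain C where C: "0 < C" "\<And>t. norm (\<psi> t) \<le> C"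
    using test_fun_bounded[OF \<psi>] by blast
  note [measurable] = locint_borel[OF g] smooth_borel_measurable[OF test_fun_smooth[OF \<psi>]]
  show ?thesis
  proof (rule L1c_boundI[OF locint_L1c_indicator[OF g K(1,2)]])
    fix t
    show "norm (\<psi> t * g t) \<le> C * norm (indicator K t *\<^sub>R g t)"
      using K(3) C(2)[of t] by (cases "t \<in> K") (auto simp: norm_mult intro!: mult_right_mono)
  qed measurable
qed

lemma locint_test_integrable:
  assumes "locint \<Omega> g" "\<psi> \<in> test_fun \<Omega>"
  shows "integrable lborel (\<lambda>t. g t * \<psi> t)"
  using L1c_integrable[OF locint_test_mult[OF assms]] by (simp add: mult.commute)

lemma locbdd_imp_locint:
  assumes "locbdd \<Omega> g"
  shows "locint \<Omega> g"
  unfolding locint_def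
proof (intro conjI allI impI)
  fix K assume K: "compact K" "K \<subseteq> \<Omega>"
  obtain C where C: "0 \<le> C" "AE z in lborel. z \<in> K \<longrightarrow> norm (g z) \<le> C"
    by (rule locbddE[OF assms K])
  have [measurable]: "K \<in> sets borel" using K by (simp add: compact_imp_closed)
  note [measurable] = locbdd_borel[OF assms]
  have "integrable lborel (\<lambda>z. indicator K z *\<^sub>R C)"
    using emeasure_compact_finite[OF K(1)] by (intro integrable_scaleR_left integrable_real_indicator) (auto simp: less_top)
  then show "integrable lborel (\<lambda>z. indicator K z *\<^sub>R g z)"
  proof (rule Bochner_Integration.integrable_bound)
    show "AE z in lborel. norm (indicator K z *\<^sub>R g z) \<le> norm (indicator K z *\<^sub>R C)"
      using C(2) by eventually_elim (use C(1) in \<open>auto simp: indicator_def\<close>)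
  qed measurable
qed (use locbdd_borel[OF assms] in simp)

lemma test_fun_add:
  assumes "\<phi> \<in> test_fun \<Omega>" "\<psi> \<in> test_fun \<Omega>"
  shows "(\<lambda>z. \<phi> z + \<psi> z) \<in> test_fun \<Omega>"
proof -
  from assms(1) obtain K where K: "smooth \<phi>" "compact K" "K \<subseteq> \<Omega>" "\<forall>z. z \<notin> K \<longrightarrow> \<phi> z = 0"
    unfolding test_fun_iff by (elim conjE exE)
  from assms(2) obtain L where L: "smooth \<psi>" "compact L" "L \<subseteq> \<Omega>" "\<forall>z. z \<notin> L \<longrightarrow> \<psi> z = 0"
    unfolding test_fun_iff by (elim conjE exE)
  show ?thesis
    unfolding test_fun_iff using K L by (intro conjI smooth_add exI[of _ "K \<union> L"]) auto
qed

lemma test_fun_cmult: "\<phi> \<in> test_fun \<Omega> \<Longrightarrow> (\<lambda>z. c * \<phi> z) \<in> test_fun \<Omega>"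
  using test_fun_mult[of \<phi> \<Omega> "\<lambda>_. c"] by (simp add: smooth_const mult.commute)

lemma test_fun_op:
  "\<phi> \<in> test_fun \<Omega> \<Longrightarrow> (\<lambda>z. a * pd 1 \<phi> z + b * pd \<i> \<phi> z) \<in> test_fun \<Omega>"
  by (intro test_fun_add test_fun_cmult test_fun_pd) auto

text \<open>Testing with \<open>\<eta> t * \<kappa> (z - t)\<close> moves the equation to the whole
  plane: for the operator L with coefficients \<open>a\<close>, \<open>b\<close>, it says that
  L(\<eta> g) = \<eta> h + (L \<eta>) g in the weak sense, read against the kernel. The cutoff
  supplies the compact support that \<kappa> need not have.\<close>

lemma conv_cutoff_weak_op:
  assumes W: "weak_op a b \<Omega> g h" and \<eta>: "\<eta> \<in> test_fun \<Omega>" and \<kappa>: "smooth \<kappa>"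
  shows "conv (\<lambda>t. \<eta> t * g t) (\<lambda>z. a * pd 1 \<kappa> z + b * pd \<i> \<kappa> z) z
     = conv (\<lambda>t. \<eta> t * h t + (a * pd 1 \<eta> t + b * pd \<i> \<eta> t) * g t) \<kappa> z"
proof -
  have g: "locint \<Omega> g" and h: "locint \<Omega> h" using W unfolding weak_op_def by blast+
  define \<phi> where "\<phi> t = \<eta> t * \<kappa> (z - t)" for t
  have \<phi>: "\<phi> \<in> test_fun \<Omega>"
    unfolding \<phi>_def by (intro test_fun_mult \<eta> smooth_reflect \<kappa>)
  have pd: "pd e \<phi> t = pd e \<eta> t * \<kappa> (z - t) - \<eta> t * pd e \<kappa> (z - t)" if "e \<in> {1, \<i>}" for e t
    unfolding \<phi>_def using pd_mult[OF test_fun_smooth[OF \<eta>] smooth_reflect[OF \<kappa>] that]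
      pd_reflect[OF \<kappa> that] by simp
  have sm: "smooth (\<lambda>z. a * pd 1 \<kappa> z + b * pd \<i> \<kappa> z)"
    by (intro smooth_add smooth_cmult smooth_pd \<kappa>) auto
  have I1: "integrable lborel (\<lambda>t. (\<eta> t * g t) * (a * pd 1 \<kappa> (z - t) + b * pd \<i> \<kappa> (z - t)))"
    using conv_integrable[OF locint_test_mult[OF g \<eta>] smooth_continuous[OF sm]] .
  have I2: "integrable lborel (\<lambda>t. ((a * pd 1 \<eta> t + b * pd \<i> \<eta> t) * g t) * \<kappa> (z - t))"
    by (rule conv_integrable[OF locint_test_mult[OF g test_fun_op[OF \<eta>]] smooth_continuous[OF \<kappa>]])
  have I3: "integrable lborel (\<lambda>t. (\<eta> t * h t) * \<kappa> (z - t))"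
    by (rule conv_integrable[OF locint_test_mult[OF h \<eta>] smooth_continuous[OF \<kappa>]])
  have "(LINT t|lborel. ((a * pd 1 \<eta> t + b * pd \<i> \<eta> t) * g t) * \<kappa> (z - t)) -
      (LINT t|lborel. (\<eta> t * g t) * (a * pd 1 \<kappa> (z - t) + b * pd \<i> \<kappa> (z - t)))
     = (LINT t|lborel. ((a * pd 1 \<eta> t + b * pd \<i> \<eta> t) * g t) * \<kappa> (z - t) -
          (\<eta> t * g t) * (a * pd 1 \<kappa> (z - t) + b * pd \<i> \<kappa> (z - t)))"
    using I1 I2 by simp
  also have "\<dots> = (LINT t|lborel. g t * (a * pd 1 \<phi> t + b * pd \<i> \<phi> t))"
    by (rule Bochner_Integration.integral_cong) (auto simp: pd algebra_simps)
  also have "\<dots> = - (LINT t|lborel. h t * \<phi> t)"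
    using W \<phi> unfolding weak_op_def by blast
  also have "(LINT t|lborel. h t * \<phi> t) = (LINT t|lborel. (\<eta> t * h t) * \<kappa> (z - t))"
    by (rule Bochner_Integration.integral_cong) (auto simp: \<phi>_def algebra_simps)
  finally have "(LINT t|lborel. (\<eta> t * g t) * (a * pd 1 \<kappa> (z - t) + b * pd \<i> \<kappa> (z - t)))
     = (LINT t|lborel. (\<eta> t * h t) * \<kappa> (z - t)) + (LINT t|lborel. ((a * pd 1 \<eta> t + b * pd \<i> \<eta> t) * g t) * \<kappa> (z - t))"
    by (simp add: algebra_simps)
  also have "\<dots> = (LINT t|lborel. (\<eta> t * h t) * \<kappa> (z - t) + ((a * pd 1 \<eta> t + b * pd \<i> \<eta> t) * g t) * \<kappa> (z - t))"
    using I2 I3 by simp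
  also have "\<dots> = (LINT t|lborel. (\<eta> t * h t + (a * pd 1 \<eta> t + b * pd \<i> \<eta> t) * g t) * \<kappa> (z - t))"
    by (simp only: distrib_right)
  finally show ?thesis unfolding conv_def .
qed

lemma conv_cmult_right: "conv w (\<lambda>z. c * \<kappa> z) z = c * conv w \<kappa> z"
  unfolding conv_def by (simp add: mult.left_commute[of _ c])

lemma conv_cong_AE:
  assumes "AE t in lborel. w t = w' t" "w \<in> borel_measurable borel" "w' \<in> borel_measurable borel"
    "\<kappa> \<in> borel_measurable borel"
  shows "conv w \<kappa> z = conv w' \<kappa> z"
  unfolding conv_def using assms by (intro integral_cong_AE) auto

lemma conv_moll_borel:
  fixes w :: "complex \<Rightarrow> complex"
  assumes "L1c w"
  shows "conv w (moll (eps n)) \<in> borel_measurable borel"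
  by (intro borel_measurable_continuous_onI conv_continuous[OF assms] smooth_continuous smooth_moll eps_pos)

text \<open>L1 convergence yields almost everywhere convergence along a subsequence; this is the
  source of pointwise information about mollifications.\<close>

lemma conv_moll_AE:
  fixes w :: "complex \<Rightarrow> complex"
  assumes w: "L1c w"
  obtains r where "strict_mono r" "AE z in lborel. (\<lambda>n. conv w (moll (eps (r n))) z) \<longlonglongrightarrow> moll_mass * w z"
proof -
  note [measurable] = conv_moll_borel[OF w] L1c_borel[OF w]
  define u where "u n z = conv w (moll (eps n)) z - moll_mass * w z" for n z
  have [measurable]: "u n \<in> borel_measurable borel" for n
    unfolding u_def by measurable
  have lim: "(\<lambda>n. \<integral>\<^sup>+ z. norm (u n z) \<partial>lborel) \<longlonglongrightarrow> 0"
    using conv_moll_L1[OF L1c_integrable[OF w]] unfolding u_def .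
  \<comment> \<open>The distances tend to 0, hence are finite from some \<open>N\<close> on;
    dropping the earlier terms makes every remaining difference integrable.\<close>
  have "\<forall>\<^sub>F n in sequentially. (\<integral>\<^sup>+ z. norm (u n z) \<partial>lborel) < \<infinity>"
    by (rule order_tendstoD(2)[OF lim]) simp
  then obtain N where N: "\<And>n. n \<ge> N \<Longrightarrow> (\<integral>\<^sup>+ z. norm (u n z) \<partial>lborel) < \<infinity>"
    by (auto simp: eventually_sequentially)
  have int: "integrable lborel (u (n + N))" for n
    unfolding integrable_iff_bounded using N[of "n + N"] by simp
  have eq: "(\<integral>\<^sup>+ z. norm (u (n + N) z) \<partial>lborel) = ennreal (LINT z|lborel. norm (u (n + N) z))" for n
    by (rule nn_integral_eq_integral[OF integrable_norm[OF int]]) simp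
  have "(\<lambda>n. ennreal (LINT z|lborel. norm (u (n + N) z))) \<longlonglongrightarrow> ennreal 0"
    using LIMSEQ_ignore_initial_segment[OF lim, of N] unfolding eq by simp
  then have "(\<lambda>n. LINT z|lborel. norm (u (n + N) z)) \<longlonglongrightarrow> 0"
    by (subst (asm) tendsto_ennreal_iff) auto
  from tendsto_L1_AE_subseq[OF int this]
  obtain r where r: "strict_mono r" "AE z in lborel. (\<lambda>n. u (r n + N) z) \<longlonglongrightarrow> 0"
    by (elim exE conjE)
  have "AE z in lborel. (\<lambda>n. conv w (moll (eps (r n + N))) z) \<longlonglongrightarrow> moll_mass * w z"
    using r(2) by eventually_elim (simp add: u_def LIM_zero_iff)
  moreover have "strict_mono (\<lambda>n. r n + N)"
    using r(1) by (simp add: strict_mono_def)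
  ultimately show ?thesis by (rule that[rotated])
qed

text \<open>L1 convergence on one side needs only a common bound on the other, so the test functions
  may vary with n. The quotient rule relies on this: its test function contains the mollified
  denominator.\<close>

lemma conv_moll_test_seq:
  fixes w :: "complex \<Rightarrow> complex"
  assumes w: "L1c w" and \<psi>: "\<And>n. L1c (\<psi> n)" "\<And>n z. norm (\<psi> n z) \<le> C"
  shows "(\<lambda>n. (LINT z|lborel. conv w (moll (eps n)) z * \<psi> n z) - moll_mass * (LINT z|lborel. w z * \<psi> n z)) \<longlonglongrightarrow> 0"
proof -
  note [measurable] = conv_moll_borel[OF w] L1c_borel[OF w] L1c_borel[OF \<psi>(1)]
  have C: "0 \<le> C" using \<psi>(2)[of 0 0] norm_ge_zero order_trans by blast
  have i1: "integrable lborel (\<lambda>z. conv w (moll (eps n)) z * \<psi> n z)" for n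
  proof -
    have c: "continuous_on UNIV (conv w (moll (eps n)))"
      by (intro conv_continuous[OF w] smooth_continuous smooth_moll eps_pos)
    \<comment> \<open>The product is the integrand of a convolution of \<psi> at the point 0 with
      the reflected function as kernel, hence integrable.\<close>
    have "continuous_on UNIV (\<lambda>t. conv w (moll (eps n)) (- t))"
      by (intro continuous_on_compose2[OF c] continuous_intros) auto
    from conv_integrable[OF \<psi>(1)[of n] this, of 0] show ?thesis by (simp add: mult.commute)
  qed
  have i2: "integrable lborel (\<lambda>z. w z * \<psi> n z)" for n
  proof (rule Bochner_Integration.integrable_bound)
    show "integrable lborel (\<lambda>z. C * norm (w z))" using L1c_integrable[OF w] by auto
    show "AE z in lborel. norm (w z * \<psi> n z) \<le> norm (C * norm (w z))"
      using \<psi>(2) C by (intro AE_I2) (simp add: norm_mult mult.commute[of C] mult_left_mono)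
  qed measurable
  have le: "ennreal (norm ((LINT z|lborel. conv w (moll (eps n)) z * \<psi> n z) - moll_mass * (LINT z|lborel. w z * \<psi> n z)))
     \<le> ennreal C * (\<integral>\<^sup>+ z. norm (conv w (moll (eps n)) z - moll_mass * w z) \<partial>lborel)" for n
  proof -
    have a: "(LINT z|lborel. conv w (moll (eps n)) z * \<psi> n z) - moll_mass * (LINT z|lborel. w z * \<psi> n z)
       = (LINT z|lborel. conv w (moll (eps n)) z * \<psi> n z - moll_mass * (w z * \<psi> n z))"
      using i1 i2 by simp
    have b: "ennreal (norm (LINT z|lborel. conv w (moll (eps n)) z * \<psi> n z - moll_mass * (w z * \<psi> n z)))
       \<le> (\<integral>\<^sup>+ z. norm (conv w (moll (eps n)) z * \<psi> n z - moll_mass * (w z * \<psi> n z)) \<partial>lborel)"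
      using i1 i2 by (intro integral_norm_bound_ennreal) auto
    also have "\<dots> \<le> (\<integral>\<^sup>+ z. ennreal C * norm (conv w (moll (eps n)) z - moll_mass * w z) \<partial>lborel)"
    proof (rule nn_integral_mono)
      fix z
      have "norm (conv w (moll (eps n)) z * \<psi> n z - moll_mass * (w z * \<psi> n z))
        = norm (\<psi> n z) * norm (conv w (moll (eps n)) z - moll_mass * w z)"
        unfolding norm_mult[symmetric] by (simp add: algebra_simps)
      also have "\<dots> \<le> C * norm (conv w (moll (eps n)) z - moll_mass * w z)"
        using \<psi>(2) by (intro mult_right_mono) auto
      finally show "ennreal (norm (conv w (moll (eps n)) z * \<psi> n z - moll_mass * (w z * \<psi> n z)))
        \<le> ennreal C * norm (conv w (moll (eps n)) z - moll_mass * w z)"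
        using C by (subst ennreal_mult[symmetric]) (auto intro: ennreal_leI)
    qed
    also have "\<dots> = ennreal C * (\<integral>\<^sup>+ z. norm (conv w (moll (eps n)) z - moll_mass * w z) \<partial>lborel)"
      by (rule nn_integral_cmult) measurable
    finally show ?thesis unfolding a .
  qed
  have "(\<lambda>n. ennreal C * (\<integral>\<^sup>+ z. norm (conv w (moll (eps n)) z - moll_mass * w z) \<partial>lborel)) \<longlonglongrightarrow> ennreal C * 0"
    by (intro ennreal_tendsto_cmult conv_moll_L1 L1c_integrable w) simp
  then have "(\<lambda>n. ennreal C * (\<integral>\<^sup>+ z. norm (conv w (moll (eps n)) z - moll_mass * w z) \<partial>lborel)) \<longlonglongrightarrow> 0"
    by simp
  then have "(\<lambda>n. ennreal (norm ((LINT z|lborel. conv w (moll (eps n)) z * \<psi> n z) - moll_mass * (LINT z|lborel. w z * \<psi> n z)))) \<longlonglongrightarrow> ennreal 0"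
    unfolding ennreal_0 by (rule tendsto_sandwich[OF always_eventually always_eventually tendsto_const, rotated 2]) (auto intro: le)
  then have "(\<lambda>n. norm ((LINT z|lborel. conv w (moll (eps n)) z * \<psi> n z) - moll_mass * (LINT z|lborel. w z * \<psi> n z))) \<longlonglongrightarrow> 0"
    by (subst (asm) tendsto_ennreal_iff) auto
  then show ?thesis
    by (simp add: tendsto_norm_zero_iff)
qed

lemma conv_moll_test:
  fixes w :: "complex \<Rightarrow> complex"
  assumes w: "L1c w" and \<psi>: "L1c \<psi>" "\<And>z. norm (\<psi> z) \<le> C"
  shows "(\<lambda>n. LINT z|lborel. conv w (moll (eps n)) z * \<psi> z) \<longlonglongrightarrow> moll_mass * (LINT z|lborel. w z * \<psi> z)"
  using conv_moll_test_seq[OF w, of "\<lambda>_. \<psi>" C] \<psi> by (simp add: LIM_zero_iff)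

lemma compact_exhaustion:
  assumes "open (\<Omega> :: complex set)"
  obtains K :: "nat \<Rightarrow> complex set" where "\<forall>n. compact (K n)" "\<forall>n. K n \<subseteq> \<Omega>" "\<Union>(range K) = \<Omega>"
    "\<forall>S. compact S \<longrightarrow> S \<subseteq> \<Omega> \<longrightarrow> (\<exists>N. \<forall>n\<ge>N. S \<subseteq> K n)" "\<forall>n. K n \<subseteq> interior (K (Suc n))"
proof (rule open_Union_compact_subsets[OF assms])
  fix C :: "nat \<Rightarrow> complex set"
  assume C: "\<And>n. compact (C n)" "\<And>n. C n \<subseteq> \<Omega>" "\<Union>(range C) = \<Omega>"
    "\<And>n. C n \<subseteq> interior (C (Suc n))" "\<And>S. \<lbrakk>compact S; S \<subseteq> \<Omega>\<rbrakk> \<Longrightarrow> \<exists>N. \<forall>n\<ge>N. S \<subseteq> C n"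
  show thesis
    by (rule that[of C]; (intro allI impI)?; fact C)
qed

lemma AE_on_open_if_compact:
  assumes "open (\<Omega> :: complex set)"
    and "\<And>K. compact K \<Longrightarrow> K \<subseteq> \<Omega> \<Longrightarrow> AE z in lborel. z \<in> K \<longrightarrow> P z"
  shows "AE z in lborel. z \<in> \<Omega> \<longrightarrow> P z"
proof -
  obtain K :: "nat \<Rightarrow> complex set" where K: "\<forall>n. compact (K n)" "\<forall>n. K n \<subseteq> \<Omega>" "\<Union>(range K) = \<Omega>"
    using compact_exhaustion[OF assms(1)] by metis
  have "\<forall>n::nat. AE z in lborel. z \<in> K n \<longrightarrow> P z"
    by (intro allI assms(2) K(1,2)[THEN spec])
  then have "AE z in lborel. \<forall>n. z \<in> K n \<longrightarrow> P z"
    unfolding AE_all_countable .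
  then show ?thesis
    by eventually_elim (use K(3) in blast)
qed

text \<open>For fixed z the function \<open>\<eta> t * moll (eps n) (z - t)\<close> is a test
  function in t, so all mollifications of \<eta> g vanish identically, and with them the almost
  everywhere limit.\<close>

lemma weakly_zero_imp_AE_zero:
  assumes \<Omega>: "open \<Omega>" and g: "locint \<Omega> g"
    and 0: "\<And>\<phi>. \<phi> \<in> test_fun \<Omega> \<Longrightarrow> (LINT z|lborel. g z * \<phi> z) = 0"
  shows "AE z in lborel. z \<in> \<Omega> \<longrightarrow> g z = 0"
proof (rule AE_on_open_if_compact[OF \<Omega>])
  fix K assume K: "compact K" "K \<subseteq> \<Omega>"
  obtain \<eta> U where \<eta>: "\<eta> \<in> test_fun \<Omega>" "K \<subseteq> U" "\<And>z. z \<in> U \<Longrightarrow> \<eta> z = 1"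
    by (rule cutoff_exists[OF \<Omega> K]) blast
  have w: "L1c (\<lambda>t. \<eta> t * g t)" by (rule locint_test_mult[OF g \<eta>(1)])
  have z: "conv (\<lambda>t. \<eta> t * g t) (moll (eps n)) z = 0" for n z
  proof -
    have "(LINT t|lborel. g t * (\<eta> t * moll (eps n) (z - t))) = 0"
      by (intro 0 test_fun_mult \<eta> smooth_reflect smooth_moll eps_pos)
    then show ?thesis by (simp add: conv_def mult_ac)
  qed
  obtain r where "AE z in lborel. (\<lambda>n. conv (\<lambda>t. \<eta> t * g t) (moll (eps (r n))) z) \<longlonglongrightarrow> moll_mass * (\<eta> z * g z)"
    by (rule conv_moll_AE[OF w])
  then show "AE z in lborel. z \<in> K \<longrightarrow> g z = 0"
  proof eventually_elim
    case (elim t)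
    then have "moll_mass * (\<eta> t * g t) = 0"
      unfolding z by (simp add: LIMSEQ_const_iff)
    then show ?case using \<eta> moll_mass_pos by auto
  qed
qed

text \<open>Cauchy-Pompeiu formula at positive \<epsilon>. There is no error term because
  \<open>D\<^sub>c\<close> of the kernel is exactly twice the mollifier, and no boundary term
  because of the cutoff.\<close>

lemma conv_cauchy:
  assumes W: "weak_op 1 c \<Omega> g h" and c: "c \<in> {\<i>, -\<i>}" and \<eta>: "\<eta> \<in> test_fun \<Omega>"
  shows "2 * conv (\<lambda>t. \<eta> t * g t) (moll (eps n)) z = conv (\<lambda>t. \<eta> t * h t + (pd 1 \<eta> t + c * pd \<i> \<eta> t) * g t) (cker c (eps n)) z"
proof -
  have cc: "c * c = - 1" using c by auto
  have "(\<lambda>z. 1 * pd 1 (cker c (eps n)) z + c * pd \<i> (cker c (eps n)) z) = (\<lambda>z. 2 * moll (eps n) z)"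
    using cker_dbar[OF eps_pos cc] by simp
  then show ?thesis
    using conv_cutoff_weak_op[OF W \<eta> smooth_cker[OF eps_pos, of c n], of z] by (simp add: conv_cmult_right)
qed

lemma L1c_cauchy_data:
  assumes W: "weak_op a b \<Omega> g h" and \<eta>: "\<eta> \<in> test_fun \<Omega>"
  shows "L1c (\<lambda>t. \<eta> t * h t + (pd 1 \<eta> t + c * pd \<i> \<eta> t) * g t)"
proof -
  have "(\<lambda>t. pd 1 \<eta> t + c * pd \<i> \<eta> t) \<in> test_fun \<Omega>"
    using test_fun_op[OF \<eta>, of 1 c] by simp
  then show ?thesis
    using W \<eta> unfolding weak_op_def by (intro L1c_add locint_test_mult) auto
qed

text \<open>The bound of \<open>cker\<close> by 1/|z| is uniform in \<epsilon> and survives the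
  limit without integrability of the potential; where the potential is infinite nothing is
  claimed.\<close>

lemma cauchy_potential:
  assumes W: "weak_op 1 c \<Omega> g h" and c: "c \<in> {\<i>, -\<i>}" and \<eta>: "\<eta> \<in> test_fun \<Omega>"
  shows "AE z in lborel. ennreal (2 * moll_mass * norm (\<eta> z * g z)) \<le>
    (\<integral>\<^sup>+ t. ennreal (inverse (norm (z - t))) * ennreal (norm (\<eta> t * h t + (pd 1 \<eta> t + c * pd \<i> \<eta> t) * g t)) \<partial>lborel)"
proof -
  define k where "k t = \<eta> t * h t + (pd 1 \<eta> t + c * pd \<i> \<eta> t) * g t" for t
  have k: "L1c k" unfolding k_def by (rule L1c_cauchy_data[OF W \<eta>])
  note [measurable] = L1c_borel[OF k]
  have w: "L1c (\<lambda>t. \<eta> t * g t)"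
    using W \<eta> unfolding weak_op_def by (intro locint_test_mult) auto
  obtain r where r: "AE z in lborel. (\<lambda>n. conv (\<lambda>t. \<eta> t * g t) (moll (eps (r n))) z) \<longlonglongrightarrow> moll_mass * (\<eta> z * g z)"
    by (rule conv_moll_AE[OF w])
  have le: "ennreal (norm (2 * conv (\<lambda>t. \<eta> t * g t) (moll (eps n)) z)) \<le> (\<integral>\<^sup>+ t. ennreal (inverse (norm (z - t))) * ennreal (norm (k t)) \<partial>lborel)" for n z
  proof -
    have a: "2 * conv (\<lambda>t. \<eta> t * g t) (moll (eps n)) z = (LINT t|lborel. k t * cker c (eps n) (z - t))"
      using conv_cauchy[OF W c \<eta>, of n z] by (simp only: conv_def k_def)
    have "ennreal (norm (LINT t|lborel. k t * cker c (eps n) (z - t))) \<le> (\<integral>\<^sup>+ t. norm (k t * cker c (eps n) (z - t)) \<partial>lborel)"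
      by (intro integral_norm_bound_ennreal conv_integrable[OF k] smooth_continuous smooth_cker eps_pos)
    also have "\<dots> \<le> (\<integral>\<^sup>+ t. ennreal (inverse (norm (z - t))) * ennreal (norm (k t)) \<partial>lborel)"
    proof (rule nn_integral_mono)
      fix t
      have "norm (k t * cker c (eps n) (z - t)) \<le> inverse (norm (z - t)) * norm (k t)"
        unfolding norm_mult mult.commute[of "norm (k t)"] by (intro mult_right_mono norm_cker_le[OF c]) simp
      then show "ennreal (norm (k t * cker c (eps n) (z - t))) \<le> ennreal (inverse (norm (z - t))) * ennreal (norm (k t))"
        by (subst ennreal_mult[symmetric]) (auto intro: ennreal_leI)
    qed
    finally show ?thesis unfolding a .
  qed
  show ?thesis
    unfolding k_def[symmetric] using r
  proof eventually_elim
    case (elim z)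
    have "(\<lambda>n. ennreal (norm (2 * conv (\<lambda>t. \<eta> t * g t) (moll (eps (r n))) z))) \<longlonglongrightarrow> ennreal (norm (2 * (moll_mass * (\<eta> z * g z))))"
      by (intro tendsto_ennrealI tendsto_norm tendsto_mult tendsto_const elim)
    then have "ennreal (norm (2 * (moll_mass * (\<eta> z * g z)))) \<le> (\<integral>\<^sup>+ t. ennreal (inverse (norm (z - t))) * ennreal (norm (k t)) \<partial>lborel)"
      by (rule LIMSEQ_le_const2) (use le in blast)
    then show ?case using moll_mass_pos by (simp add: norm_mult mult.assoc)
  qed
qed

lemma test_fun_op_bounded:
  assumes "\<eta> \<in> test_fun \<Omega>"
  obtains B where "0 < B" "\<And>z. norm (\<eta> z) \<le> B" "\<And>z. norm (pd 1 \<eta> z + c * pd \<i> \<eta> z) \<le> B"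
proof -
  obtain B1 where B1: "0 < B1" "\<And>z. norm (\<eta> z) \<le> B1"
    using test_fun_bounded[OF assms] by blast
  have "(\<lambda>z. pd 1 \<eta> z + c * pd \<i> \<eta> z) \<in> test_fun \<Omega>"
    using test_fun_op[OF assms, of 1 c] by simp
  from test_fun_bounded[OF this]
  obtain B2 where B2: "0 < B2" "\<And>z. norm (pd 1 \<eta> z + c * pd \<i> \<eta> z) \<le> B2" by blast
  show ?thesis
    by (rule that[of "max B1 B2"]) (use B1 B2 in \<open>auto intro: max.coboundedI1 max.coboundedI2\<close>)
qed

lemma test_fun_supportE:
  assumes "\<eta> \<in> test_fun \<Omega>"
  obtains L where "compact L" "L \<subseteq> \<Omega>" "\<And>z. z \<notin> L \<Longrightarrow> \<eta> z = 0" "\<And>z e. z \<notin> L \<Longrightarrow> pd e \<eta> z = 0"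
proof -
  from assms obtain L where L: "compact L" "L \<subseteq> \<Omega>" "\<forall>z. z \<notin> L \<longrightarrow> \<eta> z = 0"
    unfolding test_fun_iff by (elim conjE exE)
  have "pd e \<eta> z = 0" if "z \<notin> L" for e z
    by (rule pd_eq_0_if_locally_const[of "- L" z \<eta> 0]) (use L that in \<open>auto simp: compact_imp_closed\<close>)
  then show ?thesis using L by (intro that[of L]) auto
qed

text \<open>On the support of the cutoff the Cauchy data is at most a multiple of \<open>m\<close>:
  \<open>B * A\<close> from \<eta> h and \<open>B\<close> from the derivative of \<eta>. The weight
  \<open>m\<close> may exceed the norm of \<open>g\<close>, which leaves room for a second
  unknown.\<close>

lemma norm_le_cauchy_potential:
  fixes m :: "complex \<Rightarrow> real"
  assumes \<Omega>: "open \<Omega>" and W: "weak_op 1 c \<Omega> g h" and c: "c \<in> {\<i>, -\<i>}" and A: "0 \<le> A"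
    and h: "AE z in lborel. z \<in> \<Omega> \<longrightarrow> norm (h z) \<le> A * m z"
    and g: "\<And>z. norm (g z) \<le> m z" and K: "compact K" "K \<subseteq> \<Omega>"
    and [measurable]: "m \<in> borel_measurable borel"
  shows "\<exists>L C. compact L \<and> L \<subseteq> \<Omega> \<and> 0 \<le> C \<and>
     (AE z in lborel. z \<in> K \<longrightarrow> ennreal (norm (g z)) \<le> ennreal C * (\<integral>\<^sup>+ t. ennreal (inverse (norm (z - t))) * (ennreal (m t) * indicator L t) \<partial>lborel))"
proof -
  obtain \<eta> U where \<eta>: "\<eta> \<in> test_fun \<Omega>" "K \<subseteq> U" "\<And>z. z \<in> U \<Longrightarrow> \<eta> z = 1"
    by (rule cutoff_exists[OF \<Omega> K]) blast
  obtain L where L: "compact L" "L \<subseteq> \<Omega>" "\<And>z. z \<notin> L \<Longrightarrow> \<eta> z = 0" "\<And>z e. z \<notin> L \<Longrightarrow> pd e \<eta> z = 0"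
    using test_fun_supportE[OF \<eta>(1)] by blast
  obtain B where B: "0 < B" "\<And>z. norm (\<eta> z) \<le> B" "\<And>z. norm (pd 1 \<eta> z + c * pd \<i> \<eta> z) \<le> B"
    using test_fun_op_bounded[OF \<eta>(1), of c] by blast
  have [measurable]: "L \<in> sets borel" using L by (simp add: compact_imp_closed)
  have m: "0 \<le> m z" for z using g[of z] norm_ge_zero order_trans by blast
  define E where "E = B * A + B"
  have E: "0 \<le> E" using B A by (simp add: E_def)
  define I where "I z = (\<integral>\<^sup>+ t. ennreal (inverse (norm (z - t))) * (ennreal (m t) * indicator L t) \<partial>lborel)" for z
  have k: "AE t in lborel. ennreal (norm (\<eta> t * h t + (pd 1 \<eta> t + c * pd \<i> \<eta> t) * g t)) \<le> ennreal E * (ennreal (m t) * indicator L t)"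
    using h
  proof eventually_elim
    case (elim t)
    show ?case
    proof (cases "t \<in> L")
      case True
      then have "norm (h t) \<le> A * m t" using elim L by blast
      then have "norm (\<eta> t * h t) + norm ((pd 1 \<eta> t + c * pd \<i> \<eta> t) * g t) \<le> B * (A * m t) + B * m t"
        unfolding norm_mult using B g m[of t] A by (intro add_mono mult_mono) auto
      then have "norm (\<eta> t * h t + (pd 1 \<eta> t + c * pd \<i> \<eta> t) * g t) \<le> E * m t"
        using norm_triangle_ineq[of "\<eta> t * h t" "(pd 1 \<eta> t + c * pd \<i> \<eta> t) * g t"]
        by (simp add: E_def algebra_simps)
      then show ?thesis
        using True E m by (simp add: ennreal_mult[symmetric] ennreal_leI)
    qed (simp add: L)
  qed
  have "AE z in lborel. z \<in> K \<longrightarrow> ennreal (norm (g z)) \<le> ennreal (E / (2 * moll_mass)) * I z"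
    using cauchy_potential[OF W c \<eta>(1)]
  proof eventually_elim
    case (elim z)
    show ?case
    proof
      assume z: "z \<in> K"
      note elim
      also have "(\<integral>\<^sup>+ t. ennreal (inverse (norm (z - t))) * ennreal (norm (\<eta> t * h t + (pd 1 \<eta> t + c * pd \<i> \<eta> t) * g t)) \<partial>lborel)
        \<le> (\<integral>\<^sup>+ t. ennreal E * (ennreal (inverse (norm (z - t))) * (ennreal (m t) * indicator L t)) \<partial>lborel)"
        using k by (intro nn_integral_mono_AE, eventually_elim) (subst mult.left_commute, rule mult_left_mono, simp_all)
      also have "\<dots> = ennreal E * I z"
        unfolding I_def by (rule nn_integral_cmult) measurable
      finally have "ennreal (1 / (2 * moll_mass)) * ennreal (2 * moll_mass * norm (\<eta> z * g z)) \<le> ennreal (1 / (2 * moll_mass)) * (ennreal E * I z)"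
        by (rule mult_left_mono) simp
      then show "ennreal (norm (g z)) \<le> ennreal (E / (2 * moll_mass)) * I z"
        using z \<eta>(2,3) moll_mass_pos E
        by (auto simp: ennreal_mult[symmetric] mult.assoc[symmetric] subset_iff)
    qed
  qed
  then show ?thesis
    using L E moll_mass_pos unfolding I_def by (intro exI[of _ L] exI[of _ "E / (2 * moll_mass)"]) auto
qed

text \<open>The equations are coupled crosswise, each right-hand side being controlled by the other
  unknown, so neither modulus alone closes the estimate. The sum of both moduli is bounded by its
  own potential.\<close>

lemma vekua_locally_bounded:
  assumes \<Omega>: "open \<Omega>" and W1: "weak_op 1 \<i> \<Omega> g1 h1" and W2: "weak_op 1 (-\<i>) \<Omega> g2 h2"
    and A: "0 \<le> A" and h1: "AE z in lborel. z \<in> \<Omega> \<longrightarrow> norm (h1 z) \<le> A * norm (g2 z)"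
    and h2: "AE z in lborel. z \<in> \<Omega> \<longrightarrow> norm (h2 z) \<le> A * norm (g1 z)"
  shows "locbdd \<Omega> g1" "locbdd \<Omega> g2"
proof -
  have g1: "locint \<Omega> g1" and g2: "locint \<Omega> g2" using W1 W2 unfolding weak_op_def by blast+
  note [measurable] = locint_borel[OF g1] locint_borel[OF g2]
  define m where "m z = norm (g1 z) + norm (g2 z)" for z
  have [measurable]: "m \<in> borel_measurable borel" unfolding m_def by measurable
  have pb: "potential_bound (\<lambda>z. inverse (norm z)) \<Omega> m"
    unfolding potential_bound_def
  proof (intro allI impI, elim conjE)
    fix K assume K: "compact K" "K \<subseteq> \<Omega>"
    define I where "I L z = (\<integral>\<^sup>+ t. ennreal (inverse (norm (z - t))) * (ennreal (m t) * indicator L t) \<partial>lborel)" for L z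
    have le: "AE z in lborel. z \<in> \<Omega> \<longrightarrow> norm (h1 z) \<le> A * m z" "AE z in lborel. z \<in> \<Omega> \<longrightarrow> norm (h2 z) \<le> A * m z"
      using h1 h2 by (eventually_elim, use A in \<open>auto simp: m_def distrib_left add_increasing add_increasing2\<close>)+
    obtain L1 C1 where 1: "compact L1" "L1 \<subseteq> \<Omega>" "0 \<le> C1" "AE z in lborel. z \<in> K \<longrightarrow> ennreal (norm (g1 z)) \<le> ennreal C1 * I L1 z"
      using norm_le_cauchy_potential[OF \<Omega> W1 _ A le(1) _ K] unfolding I_def m_def by auto
    obtain L2 C2 where 2: "compact L2" "L2 \<subseteq> \<Omega>" "0 \<le> C2" "AE z in lborel. z \<in> K \<longrightarrow> ennreal (norm (g2 z)) \<le> ennreal C2 * I L2 z"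
      using norm_le_cauchy_potential[OF \<Omega> W2 _ A le(2) _ K] unfolding I_def m_def by auto
    have mono: "I L1 z \<le> I (L1 \<union> L2) z" "I L2 z \<le> I (L1 \<union> L2) z" for z
      unfolding I_def by (auto intro!: nn_integral_mono mult_left_mono simp: indicator_def)
    have "AE z in lborel. z \<in> K \<longrightarrow> ennreal (m z) \<le> ennreal (C1 + C2) * I (L1 \<union> L2) z"
      using 1(4) 2(4)
    proof eventually_elim
      case (elim z)
      show ?case
      proof
        assume "z \<in> K"
        have "ennreal (m z) = ennreal (norm (g1 z)) + ennreal (norm (g2 z))"
          by (simp add: m_def)
        also have "\<dots> \<le> ennreal C1 * I L1 z + ennreal C2 * I L2 z"
          using elim \<open>z \<in> K\<close> by (intro add_mono) auto
        also have "\<dots> \<le> ennreal C1 * I (L1 \<union> L2) z + ennreal C2 * I (L1 \<union> L2) z"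
          by (intro add_mono mult_left_mono mono) auto
        also have "\<dots> = ennreal (C1 + C2) * I (L1 \<union> L2) z"
          using 1(3) 2(3) by (simp add: ennreal_plus distrib_right)
        finally show "ennreal (m z) \<le> ennreal (C1 + C2) * I (L1 \<union> L2) z" .
      qed
    qed
    then show "\<exists>L C. compact L \<and> L \<subseteq> \<Omega> \<and> 0 \<le> C \<and> (AE z in lborel. z \<in> K \<longrightarrow> ennreal (m z) \<le>
        ennreal C * (\<integral>\<^sup>+ t. ennreal (inverse (norm (z - t))) * (ennreal (m t) * indicator L t) \<partial>lborel))"
      using 1 2 unfolding I_def by (intro exI[of _ "L1 \<union> L2"] exI[of _ "C1 + C2"]) auto
  qed
  have fin: "(\<integral>\<^sup>+ t. ennreal (m t) * indicator K t \<partial>lborel) < \<infinity>" if "compact K" "K \<subseteq> \<Omega>" for K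
  proof -
    have [measurable]: "K \<in> sets borel" using that by (simp add: compact_imp_closed)
    have "(\<integral>\<^sup>+ t. ennreal (m t) * indicator K t \<partial>lborel)
       = (\<integral>\<^sup>+ t. ennreal (norm (indicator K t *\<^sub>R g1 t)) + ennreal (norm (indicator K t *\<^sub>R g2 t)) \<partial>lborel)"
      by (rule nn_integral_cong) (auto simp: indicator_def m_def)
    also have "\<dots> = (\<integral>\<^sup>+ t. ennreal (norm (indicator K t *\<^sub>R g1 t)) \<partial>lborel) + (\<integral>\<^sup>+ t. ennreal (norm (indicator K t *\<^sub>R g2 t)) \<partial>lborel)"
      by (rule nn_integral_add) measurable
    also have "\<dots> < \<infinity>"
      using locintD[OF g1 that] locintD[OF g2 that] unfolding integrable_iff_bounded by simp
    finally show ?thesis .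
  qed
  have bd: "\<exists>C. AE z in lborel. z \<in> K \<longrightarrow> m z \<le> C" if "compact K" "K \<subseteq> \<Omega>" for K
    by (rule potential_bound_imp_locally_bounded[OF pb _ fin that]) auto
  have "\<exists>C. AE z in lborel. z \<in> K \<longrightarrow> norm (g1 z) \<le> C" "\<exists>C. AE z in lborel. z \<in> K \<longrightarrow> norm (g2 z) \<le> C"
    if K: "compact K" "K \<subseteq> \<Omega>" for K
  proof -
    obtain C where C: "AE z in lborel. z \<in> K \<longrightarrow> m z \<le> C" using bd[OF K] by (rule exE)
    show "\<exists>C. AE z in lborel. z \<in> K \<longrightarrow> norm (g1 z) \<le> C"
      by (rule exI[of _ C], use C in eventually_elim) (auto simp: m_def intro: order_trans[rotated])
    show "\<exists>C. AE z in lborel. z \<in> K \<longrightarrow> norm (g2 z) \<le> C"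
      by (rule exI[of _ C], use C in eventually_elim) (auto simp: m_def intro: order_trans[rotated])
  qed
  then show "locbdd \<Omega> g1" "locbdd \<Omega> g2" unfolding locbdd_def by simp_all
qed

section \<open>Hoelder continuity of locally bounded solutions\<close>

section \<open>Hoelder continuity\<close>

text \<open>The exceptional null set spares us the choice of continuous representatives.\<close>

definition hoelder_ae :: "complex set \<Rightarrow> (complex \<Rightarrow> complex) \<Rightarrow> bool" where
  "hoelder_ae K g \<longleftrightarrow> (\<exists>H N. 0 \<le> H \<and> N \<in> null_sets lborel \<and>
     (\<forall>z\<in>K - N. \<forall>z'\<in>K - N. norm (g z - g z') \<le> H * norm (z - z') powr (1/2)))"

lemma hoelder_aeE:
  assumes "hoelder_ae K g"
  obtains H N where "0 \<le> H" "N \<in> null_sets lborel"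
    "\<And>z z'. z \<in> K \<Longrightarrow> z \<notin> N \<Longrightarrow> z' \<in> K \<Longrightarrow> z' \<notin> N \<Longrightarrow> norm (g z - g z') \<le> H * norm (z - z') powr (1/2)"
proof -
  from assms obtain H N where *: "0 \<le> H \<and> N \<in> null_sets lborel \<and>
     (\<forall>z\<in>K - N. \<forall>z'\<in>K - N. norm (g z - g z') \<le> H * norm (z - z') powr (1/2))"
    unfolding hoelder_ae_def by (elim exE)
  show ?thesis
    by (rule that[of H N]) (use * in simp_all)
qed

text \<open>On the support the distance r from z is at most \<open>D\<close>, so
  \<open>1/r \<le> D^(1/2) r^(-3/2)\<close> and the earlier weight applies. The second conclusion
  provides the dominating function for \<epsilon> tending to 0.\<close>

lemma integrable_cauchy_kernel:
  fixes k w :: "complex \<Rightarrow> complex"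
  assumes [measurable]: "k \<in> borel_measurable borel" "w \<in> borel_measurable borel"
    and k: "\<And>a. norm (k a) \<le> inverse (norm a)"
    and w: "\<And>t. norm (w t) \<le> C" "\<And>t. R < norm t \<Longrightarrow> w t = 0"
  shows "integrable lborel (\<lambda>t. w t * k (z - t))"
    and "integrable lborel (\<lambda>t. C * inverse (norm (z - t)) * indicator (cball 0 R) t)"
proof -
  have C: "0 \<le> C" using w(1) norm_ge_zero order_trans by blast
  define D where "D = norm z + \<bar>R\<bar>"
  have D: "0 \<le> D" by (simp add: D_def)
  have le: "inverse (norm (z - t)) * indicator (cball 0 R) t \<le> D powr (1/2) * (norm (z - t) powr (-3/2) + norm (z - t) powr (-3/2))" for t
  proof (cases "norm t \<le> R \<and> z \<noteq> t")
    case True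
    define r where "r = norm (z - t)"
    have r: "0 < r" "r \<le> D" using True norm_triangle_ineq4[of z t] by (auto simp: r_def D_def)
    have "inverse r = r powr (1/2) * r powr (-3/2)"
      using r powr_add[of r "1/2" "-3/2"] powr_minus[of r 1] by simp
    also have "\<dots> \<le> D powr (1/2) * r powr (-3/2)"
      using r by (intro mult_right_mono powr_mono2) auto
    also have "\<dots> \<le> D powr (1/2) * (r powr (-3/2) + r powr (-3/2))"
      by (intro mult_left_mono) auto
    finally show ?thesis using True by (simp add: r_def)
  qed (auto simp: indicator_def)
  have "(\<integral>\<^sup>+ t. ennreal (inverse (norm (z - t)) * indicator (cball 0 R) t) \<partial>lborel)
     = (\<integral>\<^sup>+ t. ennreal (inverse (norm (z - t)) * indicator (cball 0 R) t) * indicator (cball 0 R) t \<partial>lborel)"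
    by (rule nn_integral_cong) (auto simp: indicator_def)
  also have "\<dots> \<le> ennreal (D powr (1/2) * (2 * riesz_bound R))"
    by (rule nn_integral_le_riesz_bound[OF _ _ le]) auto
  also have "\<dots> < \<infinity>" by simp
  finally have "integrable lborel (\<lambda>t. inverse (norm (z - t)) * indicator (cball 0 R) t)"
    unfolding integrable_iff_bounded by simp
  then have "integrable lborel (\<lambda>t. C * (inverse (norm (z - t)) * indicator (cball 0 R) t))"
    by (rule integrable_mult_right)
  then show i: "integrable lborel (\<lambda>t. C * inverse (norm (z - t)) * indicator (cball 0 R) t)"
    by (simp add: mult.assoc)
  show "integrable lborel (\<lambda>t. w t * k (z - t))"
  proof (rule Bochner_Integration.integrable_bound[OF i])
    have "norm (w t * k (z - t)) \<le> C * inverse (norm (z - t)) * indicator (cball 0 R) t" for t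
    proof (cases "norm t \<le> R")
      case True
      then show ?thesis unfolding norm_mult using w C k by (auto intro!: mult_mono)
    qed (simp add: w)
    then show "AE t in lborel. norm (w t * k (z - t)) \<le> norm (C * inverse (norm (z - t)) * indicator (cball 0 R) t)"
      by (intro AE_I2) (metis abs_ge_self order_trans real_norm_def)
  qed measurable
qed

text \<open>Setting the exceptional values to 0 turns an almost everywhere bound into an everywhere
  bound, and integrals do not notice the change.\<close>

lemma AE_bounded_modification:
  assumes k: "L1c k" and bd: "AE z in lborel. norm (k z) \<le> C"
  obtains k' R where "k' \<in> borel_measurable borel" "AE z in lborel. k z = k' z" "\<And>z. norm (k' z) \<le> \<bar>C\<bar>"
    "\<And>t. R < norm t \<Longrightarrow> k' t = 0"
proof -
  obtain R where R: "\<forall>t. R < norm t \<longrightarrow> k t = 0"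
    using k unfolding L1c_def by (elim conjE exE)
  note [measurable] = L1c_borel[OF k]
  show ?thesis
  proof (rule that[of "\<lambda>z. if norm (k z) \<le> C then k z else 0" R])
    show "AE z in lborel. k z = (if norm (k z) \<le> C then k z else 0)"
      using bd by eventually_elim simp
  qed (use R in \<open>auto simp: abs_if\<close>)
qed

lemma cker_borel [measurable]: "cker c \<epsilon> \<in> borel_measurable borel"
  unfolding cker_def sker_def by measurable

lemma locbdd_cauchy_data:
  assumes "locbdd \<Omega> g" "locbdd \<Omega> h" "\<eta> \<in> test_fun \<Omega>"
  obtains C where "AE t in lborel. norm (\<eta> t * h t + (pd 1 \<eta> t + c * pd \<i> \<eta> t) * g t) \<le> C"
proof -
  obtain L where L: "compact L" "L \<subseteq> \<Omega>" "\<And>z. z \<notin> L \<Longrightarrow> \<eta> z = 0" "\<And>z e. z \<notin> L \<Longrightarrow> pd e \<eta> z = 0"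
    using test_fun_supportE[OF assms(3)] by blast
  obtain B where B: "0 < B" "\<And>z. norm (\<eta> z) \<le> B" "\<And>z. norm (pd 1 \<eta> z + c * pd \<i> \<eta> z) \<le> B"
    using test_fun_op_bounded[OF assms(3), of c] by blast
  obtain Cg where Cg: "0 \<le> Cg" "AE z in lborel. z \<in> L \<longrightarrow> norm (g z) \<le> Cg" by (rule locbddE[OF assms(1) L(1,2)])
  obtain Ch where Ch: "0 \<le> Ch" "AE z in lborel. z \<in> L \<longrightarrow> norm (h z) \<le> Ch" by (rule locbddE[OF assms(2) L(1,2)])
  show ?thesis
  proof (rule that[of "B * Ch + B * Cg"], use Cg(2) Ch(2) in eventually_elim)
    case (elim t)
    show ?case
    proof (cases "t \<in> L")
      case True
      then show ?thesis
        using elim B Cg(1) Ch(1) by (intro norm_triangle_le) (auto simp: norm_mult intro!: add_mono mult_mono)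
    qed (use L B Cg(1) Ch(1) in simp)
  qed
qed

text \<open>For bounded data the kernels pass to \<epsilon> = 0 at every z, so \<eta> g is almost
  everywhere a constant multiple of a true Cauchy potential of a bounded, compactly supported
  function. Such potentials are Hoelder continuous of order 1/2, and \<eta> is 1 on
  \<open>K\<close>.\<close>

lemma weak_solution_hoelder:
  assumes \<Omega>: "open \<Omega>" and W: "weak_op 1 c \<Omega> g h" and c: "c \<in> {\<i>, -\<i>}"
    and g: "locbdd \<Omega> g" and h: "locbdd \<Omega> h" and K: "compact K" "K \<subseteq> \<Omega>"
  shows "hoelder_ae K g"
proof -
  obtain \<eta> U where \<eta>: "\<eta> \<in> test_fun \<Omega>" "K \<subseteq> U" "\<And>z. z \<in> U \<Longrightarrow> \<eta> z = 1"
    by (rule cutoff_exists[OF \<Omega> K]) blast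
  define k where "k t = \<eta> t * h t + (pd 1 \<eta> t + c * pd \<i> \<eta> t) * g t" for t
  have k: "L1c k" unfolding k_def by (rule L1c_cauchy_data[OF W \<eta>(1)])
  obtain C where C: "AE t in lborel. norm (k t) \<le> C"
    unfolding k_def by (rule locbdd_cauchy_data[OF g h \<eta>(1)])
  obtain k' R where k': "k' \<in> borel_measurable borel" "AE z in lborel. k z = k' z" "\<And>z. norm (k' z) \<le> \<bar>C\<bar>"
    "\<And>t. R < norm t \<Longrightarrow> k' t = 0"
    by (rule AE_bounded_modification[OF k C]) blast
  note [measurable] = k'(1) L1c_borel[OF k]
  have w: "L1c (\<lambda>t. \<eta> t * g t)" by (rule locint_test_mult[OF locbdd_imp_locint[OF g] \<eta>(1)])
  obtain r where r: "strict_mono r" "AE z in lborel. (\<lambda>n. conv (\<lambda>t. \<eta> t * g t) (moll (eps (r n))) z) \<longlonglongrightarrow> moll_mass * (\<eta> z * g z)"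
    by (rule conv_moll_AE[OF w])
  have e: "(\<lambda>n. eps (r n)) \<longlonglongrightarrow> 0"
    using LIMSEQ_subseq_LIMSEQ[OF eps_tendsto r(1)] by (simp add: o_def)
  have lim: "(\<lambda>n. conv k' (cker c (eps (r n))) z) \<longlonglongrightarrow> conv k' (cker c 0) z" for z
    unfolding conv_def
  proof (rule integral_dominated_convergence)
    show "integrable lborel (\<lambda>t. \<bar>C\<bar> * inverse (norm (z - t)) * indicator (cball 0 R) t)"
      by (rule integrable_cauchy_kernel(2)[OF _ k'(1) norm_cker_le[OF c] k'(3,4)]) measurable
    show "AE t in lborel. (\<lambda>n. k' t * cker c (eps (r n)) (z - t)) \<longlonglongrightarrow> k' t * cker c 0 (z - t)"
      by (intro AE_I2 tendsto_mult tendsto_const cker_tendsto e)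
    show "AE t in lborel. norm (k' t * cker c (eps (r n)) (z - t)) \<le> \<bar>C\<bar> * inverse (norm (z - t)) * indicator (cball 0 R) t" for n
    proof (rule AE_I2)
      fix t
      show "norm (k' t * cker c (eps (r n)) (z - t)) \<le> \<bar>C\<bar> * inverse (norm (z - t)) * indicator (cball 0 R) t"
      proof (cases "norm t \<le> R")
        case True
        then show ?thesis unfolding norm_mult using k'(3)[of t] norm_cker_le[OF c] by (auto intro!: mult_mono)
      qed (simp add: k')
    qed
  qed measurable
  have "AE z in lborel. 2 * (moll_mass * (\<eta> z * g z)) = conv k' (cker c 0) z"
    using r(2)
  proof eventually_elim
    case (elim z)
    have "(\<lambda>n. 2 * conv (\<lambda>t. \<eta> t * g t) (moll (eps (r n))) z) \<longlonglongrightarrow> 2 * (moll_mass * (\<eta> z * g z))"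
      by (intro tendsto_mult tendsto_const elim)
    moreover have "2 * conv (\<lambda>t. \<eta> t * g t) (moll (eps n)) z = conv k' (cker c (eps n)) z" for n
      unfolding conv_cauchy[OF W c \<eta>(1)] k_def[symmetric]
      by (rule conv_cong_AE[OF k'(2)]) measurable
    ultimately show ?case
      using lim[of z] LIMSEQ_unique by simp
  qed
  then obtain N where N: "N \<in> null_sets lborel" "\<And>z. z \<notin> N \<Longrightarrow> 2 * (moll_mass * (\<eta> z * g z)) = conv k' (cker c 0) z"
    by (rule AE_E3) simp
  define H where "H = \<bar>C\<bar> * (2 * sqrt 2 * riesz_bound R) / (2 * moll_mass)"
  show ?thesis
    unfolding hoelder_ae_def
  proof (intro exI conjI ballI)
    show "0 \<le> H" using riesz_bound_pos[of R] moll_mass_pos by (simp add: H_def)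
    show "N \<in> null_sets lborel" by fact
    fix z z' assume z: "z \<in> K - N" "z' \<in> K - N"
    have "2 * moll_mass * norm (g z - g z') = norm (2 * (moll_mass * (\<eta> z * g z)) - 2 * (moll_mass * (\<eta> z' * g z')))"
      using z \<eta>(2,3) moll_mass_pos
      by (simp add: subset_iff norm_mult flip: right_diff_distrib)
    also have "\<dots> = norm (conv k' (cker c 0) z - conv k' (cker c 0) z')"
      using N(2) z by simp
    also have "\<dots> \<le> \<bar>C\<bar> * (2 * sqrt 2 * riesz_bound R) * norm (z - z') powr (1/2)"
      by (intro cauchy_kernel_Lipschitz_half norm_cker_0_diff_le[OF c] k'
          integrable_cauchy_kernel(1)[OF _ k'(1) norm_cker_le[OF c] k'(3,4)]) measurable
    finally show "norm (g z - g z') \<le> H * norm (z - z') powr (1/2)"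
      using moll_mass_pos by (simp add: H_def field_simps)
  qed
qed

section \<open>Bounded weak gradients through the commutator\<close>

section \<open>Weak derivatives of solutions\<close>

definition weak_d :: "complex \<Rightarrow> complex set \<Rightarrow> (complex \<Rightarrow> complex) \<Rightarrow> (complex \<Rightarrow> complex) \<Rightarrow> bool" where
  "weak_d e \<Omega> g h \<longleftrightarrow> locint \<Omega> g \<and> locint \<Omega> h \<and> (\<forall>\<phi>\<in>test_fun \<Omega>.
     (LINT z|lborel. g z * pd e \<phi> z) = - (LINT z|lborel. h z * \<phi> z))"

lemma weak_d_imp_weak_op:
  assumes "weak_d e \<Omega> g h" "e \<in> {1, \<i>}"
  shows "weak_op (if e = 1 then 1 else 0) (if e = 1 then 0 else 1) \<Omega> g h"
  using assms unfolding weak_d_def weak_op_def by auto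

lemma conv_cutoff_weak_d:
  assumes "weak_d e \<Omega> g h" "e \<in> {1, \<i>}" "\<eta> \<in> test_fun \<Omega>" "smooth \<kappa>"
  shows "conv (\<lambda>t. \<eta> t * g t) (pd e \<kappa>) z = conv (\<lambda>t. \<eta> t * h t + pd e \<eta> t * g t) \<kappa> z"
proof -
  have b: "(if e = 1 then 1 else 0) * pd 1 \<kappa> t + (if e = 1 then 0 else 1) * pd \<i> \<kappa> t = pd e \<kappa> t" for \<kappa> t
    using assms(2) by auto
  show ?thesis
    using conv_cutoff_weak_op[OF weak_d_imp_weak_op[OF assms(1,2)] assms(3,4), of z] unfolding b .
qed

lemma integral_by_parts_smooth:
  assumes \<phi>: "\<phi> \<in> test_fun \<Omega>" and w: "smooth w" and e: "e \<in> {1, \<i>}"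
  shows "(LINT z|lborel. w z * pd e \<phi> z) = - (LINT z|lborel. pd e w z * \<phi> z)"
proof -
  have i: "integrable lborel (\<lambda>z. v z * \<psi> z)" if "\<psi> \<in> test_fun \<Omega>" "smooth v" for v \<psi>
    using L1c_integrable[OF test_fun_L1c[OF test_fun_mult[OF that]]] by (simp add: mult.commute)
  have "(LINT z|lborel. pd e (\<lambda>z. \<phi> z * w z) z) = 0"
    by (rule integral_pd_test_fun[OF test_fun_mult[OF \<phi> w] e])
  also have "(LINT z|lborel. pd e (\<lambda>z. \<phi> z * w z) z) = (LINT z|lborel. w z * pd e \<phi> z + pd e w z * \<phi> z)"
    by (rule Bochner_Integration.integral_cong)
       (simp_all add: pd_mult[OF test_fun_smooth[OF \<phi>] w e] algebra_simps)
  also have "\<dots> = (LINT z|lborel. w z * pd e \<phi> z) + (LINT z|lborel. pd e w z * \<phi> z)"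
    by (intro Bochner_Integration.integral_add i test_fun_pd \<phi> w e smooth_pd)
  finally show ?thesis by (simp add: eq_neg_iff_add_eq_0)
qed

lemma conv_moll_test_AE:
  fixes w :: "complex \<Rightarrow> complex"
  assumes w: "L1c w" and \<psi>: "L1c \<psi>" and C: "AE z in lborel. norm (\<psi> z) \<le> C"
  shows "(\<lambda>n. LINT z|lborel. conv w (moll (eps n)) z * \<psi> z) \<longlonglongrightarrow> moll_mass * (LINT z|lborel. w z * \<psi> z)"
proof -
  obtain \<psi>' R where \<psi>': "\<psi>' \<in> borel_measurable borel" "AE z in lborel. \<psi> z = \<psi>' z" "\<And>z. norm (\<psi>' z) \<le> \<bar>C\<bar>"
    "\<And>t. R < norm t \<Longrightarrow> \<psi>' t = 0"
    by (rule AE_bounded_modification[OF \<psi> C]) blast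
  note [measurable] = \<psi>'(1) L1c_borel[OF \<psi>] L1c_borel[OF w] conv_moll_borel[OF w]
  have "L1c \<psi>'" by (rule L1c_bounded[OF \<psi>'(1,3,4)])
  from conv_moll_test[OF w this \<psi>'(3)]
  have "(\<lambda>n. LINT z|lborel. conv w (moll (eps n)) z * \<psi>' z) \<longlonglongrightarrow> moll_mass * (LINT z|lborel. w z * \<psi>' z)" .
  moreover have "(LINT z|lborel. v z * \<psi> z) = (LINT z|lborel. v z * \<psi>' z)" if "v \<in> borel_measurable borel" for v
    using \<psi>'(2) that by (intro integral_cong_AE) auto
  ultimately show ?thesis by (simp add: L1c_borel[OF w] conv_moll_borel[OF w])
qed

lemma dker_borel [measurable]: "dker c e \<in> borel_measurable borel"
  unfolding dker_def sker_def by measurable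

lemma pd_conv_moll_eq_conv_pd_cker:
  assumes w: "L1c w" and k: "L1c k" and e: "e \<in> {1, \<i>}"
    and eq: "\<And>z. 2 * conv w (moll (eps n)) z = conv k (cker c (eps n)) z"
  shows "2 * pd e (conv w (moll (eps n))) z = conv k (pd e (cker c (eps n))) z"
proof -
  have "2 * pd e (conv w (moll (eps n))) z = pd e (\<lambda>z. 2 * conv w (moll (eps n)) z) z"
    by (rule pd_cmult[symmetric, OF smooth_conv[OF w smooth_moll[OF eps_pos]] e])
  also have "\<dots> = pd e (conv k (cker c (eps n))) z"
    unfolding eq ..
  also have "\<dots> = conv k (pd e (cker c (eps n))) z"
    by (rule pd_conv[OF k smooth_cker[OF eps_pos] e])
  finally show ?thesis .
qed

text \<open>The derivative of the Cauchy potential of \<open>d \<cdot> Y\<close> is a commutator, which converges absolutely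
  because \<open>Y\<close> is Hoelder continuous, plus \<open>Y\<close> times the derivative of the potential of \<open>d\<close>, which
  is the derivative of the bounded function \<open>\<eta> \<cdot> f\<close> itself. No singular integrals are needed.\<close>

lemma gradient_local:
  assumes \<Omega>: "open \<Omega>" and c: "c \<in> {\<i>, -\<i>}" and e: "e \<in> {1, \<i>}"
    and W: "weak_op 1 c \<Omega> w h" and w: "locbdd \<Omega> w"
    and F: "weak_op 1 c \<Omega> f d" and f: "locbdd \<Omega> f" and d: "locbdd \<Omega> d"
    and Fe: "weak_d e \<Omega> f fe" and fe: "locbdd \<Omega> fe"
    and Y: "locbdd \<Omega> Y" and Yh: "\<And>K. compact K \<Longrightarrow> K \<subseteq> \<Omega> \<Longrightarrow> hoelder_ae K Y"
    and hd: "AE z in lborel. z \<in> \<Omega> \<longrightarrow> h z = d z * Y z"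
    and K: "compact K" "K \<subseteq> \<Omega>"
  shows "\<exists>g C. g \<in> borel_measurable borel \<and> (AE z in lborel. norm (g z) \<le> C) \<and>
     (\<forall>\<phi>\<in>test_fun \<Omega>. (\<forall>z. z \<notin> K \<longrightarrow> \<phi> z = 0) \<longrightarrow> (LINT z|lborel. w z * pd e \<phi> z) = - (LINT z|lborel. g z * \<phi> z))"
proof -
  obtain \<eta> U where \<eta>: "\<eta> \<in> test_fun \<Omega>" "open U" "K \<subseteq> U" "\<And>z. z \<in> U \<Longrightarrow> \<eta> z = 1"
    by (rule cutoff_exists[OF \<Omega> K]) blast
  obtain L where L: "compact L" "L \<subseteq> \<Omega>" "\<And>z. z \<notin> L \<Longrightarrow> \<eta> z = 0" "\<And>z e. z \<notin> L \<Longrightarrow> pd e \<eta> z = 0"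
    using test_fun_supportE[OF \<eta>(1)] by blast
  \<comment> \<open>Within distance \<delta> of \<open>K\<close> the cutoff is constant; the kernel
    is therefore bounded wherever a derivative of \<eta> is nonzero.\<close>
  obtain \<delta> where \<delta>: "\<delta> > 0" "(\<Union>x\<in>K. ball x \<delta>) \<subseteq> U"
    using compact_subset_open_imp_ball_epsilon_subset[OF K(1) \<eta>(2,3)] by blast
  have KL: "K \<subseteq> L"
    using \<eta>(3,4) L(3) by (metis subset_iff zero_neq_one)
  have [measurable]: "K \<in> sets borel" "L \<in> sets borel"
    using K L by (auto simp: compact_imp_closed)
  note [measurable] = locbdd_borel[OF w] locbdd_borel[OF f] locbdd_borel[OF d] locbdd_borel[OF fe] locbdd_borel[OF Y]
    smooth_borel_measurable[OF test_fun_smooth[OF \<eta>(1)]] smooth_borel_measurable[OF smooth_pd_1[OF test_fun_smooth[OF \<eta>(1)]]]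
    smooth_borel_measurable[OF smooth_pd_i[OF test_fun_smooth[OF \<eta>(1)]]] smooth_borel_measurable[OF smooth_pd[OF test_fun_smooth[OF \<eta>(1)] e]]
  obtain R where "\<forall>x\<in>L. norm x \<le> R"
    using compact_imp_bounded[OF L(1)] unfolding bounded_iff by (rule exE)
  then have R: "\<And>t. t \<in> L \<Longrightarrow> norm t \<le> R" by blast
  define D where "D t = pd 1 \<eta> t + c * pd \<i> \<eta> t" for t
  have D0: "D t = 0" if "t \<in> U" for t
    unfolding D_def using pd_eq_0_if_locally_const[OF \<eta>(2) that \<eta>(4)] by simp
  have [measurable]: "D \<in> borel_measurable borel" unfolding D_def by measurable
  \<comment> \<open>\<open>k\<close> and \<open>dd\<close> are the Cauchy data of \<eta> w and
    \<eta> f. Because \<open>h\<close> is \<open>d\<close> times \<open>Y\<close>, the data satisfy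
    k = dd Y + r, where \<open>r\<close> contains no derivative of \<open>f\<close> and lives where
    \<eta> is not constant.\<close>
  define k where "k t = \<eta> t * h t + D t * w t" for t
  define dd where "dd t = \<eta> t * d t + D t * f t" for t
  define r where "r t = (w t - f t * Y t) * D t" for t
  have k: "L1c k" unfolding k_def D_def by (rule L1c_cauchy_data[OF W \<eta>(1)])
  have dd: "L1c dd" unfolding dd_def D_def by (rule L1c_cauchy_data[OF F \<eta>(1)])
  note [measurable] = L1c_borel[OF k] L1c_borel[OF dd]
  have [measurable]: "r \<in> borel_measurable borel" unfolding r_def by measurable
  have kd: "AE t in lborel. k t = dd t * Y t + r t"
    using hd
  proof eventually_elim
    case (elim t)
    show ?case
      using elim L(2,3) by (cases "t \<in> L") (auto simp: k_def dd_def r_def algebra_simps)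
  qed
  obtain C1 where C1: "AE t in lborel. norm (dd t) \<le> C1"
    unfolding dd_def D_def by (rule locbdd_cauchy_data[OF f d \<eta>(1)])
  have dd0: "dd t = 0" if "t \<notin> L" for t using L(3,4) that by (simp add: dd_def D_def)
  have r0: "r t = 0" if "t \<notin> L \<or> t \<in> U" for t using L(4) D0 that by (auto simp: r_def D_def)
  obtain B where B: "0 < B" "\<And>z. norm (\<eta> z) \<le> B" "\<And>z. norm (D z) \<le> B"
    unfolding D_def using test_fun_op_bounded[OF \<eta>(1), of c] by blast
  obtain Cw where Cw: "0 \<le> Cw" "AE z in lborel. z \<in> L \<longrightarrow> norm (w z) \<le> Cw" by (rule locbddE[OF w L(1,2)])
  obtain Cf where Cf: "0 \<le> Cf" "AE z in lborel. z \<in> L \<longrightarrow> norm (f z) \<le> Cf" by (rule locbddE[OF f L(1,2)])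
  obtain CY where CY: "0 \<le> CY" "AE z in lborel. z \<in> L \<longrightarrow> norm (Y z) \<le> CY" by (rule locbddE[OF Y L(1,2)])
  obtain Ce where Ce: "0 \<le> Ce" "AE z in lborel. z \<in> L \<longrightarrow> norm (fe z) \<le> Ce" by (rule locbddE[OF fe L(1,2)])
  define C2 where "C2 = (Cw + Cf * CY) * B"
  have C2: "0 \<le> C2" using Cw Cf CY B by (simp add: C2_def)
  have rb: "AE t in lborel. norm (r t) \<le> C2"
    using Cw(2) Cf(2) CY(2)
  proof eventually_elim
    case (elim t)
    show ?case
    proof (cases "t \<in> L")
      case True
      have "norm (w t - f t * Y t) \<le> norm (w t) + norm (f t) * norm (Y t)"
        using norm_triangle_ineq4[of "w t" "f t * Y t"] by (simp add: norm_mult)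
      also have "\<dots> \<le> Cw + Cf * CY"
        using elim True Cf CY by (intro add_mono mult_mono) auto
      finally show ?thesis
        unfolding r_def C2_def norm_mult using B Cw Cf CY by (intro mult_mono) auto
    qed (use r0 C2 in simp)
  qed
  have "0 \<le> \<bar>C1\<bar>" by simp
  obtain H N where H: "0 \<le> H" "N \<in> null_sets lborel"
    "\<And>z z'. z \<in> L \<Longrightarrow> z \<notin> N \<Longrightarrow> z' \<in> L \<Longrightarrow> z' \<notin> N \<Longrightarrow> norm (Y z - Y z') \<le> H * norm (z - z') powr (1/2)"
    using hoelder_aeE[OF Yh[OF L(1,2)]] by blast
  have AEN: "AE t in lborel. t \<notin> N" by (rule AE_not_in[OF H(2)])

  \<comment> \<open>Dominating function, uniform in n. The increment of \<open>Y\<close> is at most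
    H times the square root of the distance, and the kernel at most 3 times the inverse square,
    which leaves the power -3/2; \<open>r\<close> meets the kernel only at distance at least
    \<delta>.\<close>
  define G where "G z t = (3 * (\<bar>C1\<bar> * H) * norm (z - t) powr (-3/2) + 3 * C2 / \<delta>\<^sup>2) * indicator (cball 0 R) t" for z t :: complex
  define S where "S n z t = (dd t * (Y t - Y z) + r t) * pd e (cker c (eps n)) (z - t)" for n z t
  define S0 where "S0 z t = (dd t * (Y t - Y z) + r t) * dker c e (z - t)" for z t
  have dom: "AE t in lborel. norm (S n z t) \<le> G z t" if z: "z \<in> K" "z \<notin> N" for z n
    using AEN C1 rb AE_lborel_singleton[of z]
  proof eventually_elim
    case (elim t)
    have p: "norm (pd e (cker c (eps n)) (z - t)) \<le> 3 * inverse ((norm (z - t))\<^sup>2)"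
      using elim by (intro norm_pd_cker_le[OF c eps_pos e]) auto
    show ?case
    proof (cases "t \<in> L")
      case True
      define \<rho> where "\<rho> = norm (z - t)"
      have \<rho>: "\<rho> > 0" using elim by (auto simp: \<rho>_def)
      have pw: "\<rho> powr (1/2) * inverse (\<rho>\<^sup>2) = \<rho> powr (-3/2)"
      proof -
        have "inverse (\<rho>\<^sup>2) = \<rho> powr (-2)" using \<rho> by (simp add: powr_minus powr_numeral)
        then show ?thesis using powr_add[of \<rho> "1/2" "-2"] by simp
      qed
      have 1: "norm (dd t * (Y t - Y z)) * (3 * inverse (\<rho>\<^sup>2)) \<le> 3 * (\<bar>C1\<bar> * H) * \<rho> powr (-3/2)"
      proof -
        have "norm (Y t - Y z) \<le> H * \<rho> powr (1/2)"
          using H(3)[of t z] elim z True KL by (auto simp: \<rho>_def norm_minus_commute)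
        then have "norm (dd t * (Y t - Y z)) \<le> \<bar>C1\<bar> * (H * \<rho> powr (1/2))"
          unfolding norm_mult using elim by (intro mult_mono) auto
        then have "norm (dd t * (Y t - Y z)) * (3 * inverse (\<rho>\<^sup>2)) \<le> \<bar>C1\<bar> * (H * \<rho> powr (1/2)) * (3 * inverse (\<rho>\<^sup>2))"
          by (rule mult_right_mono) simp
        also have "\<dots> = 3 * (\<bar>C1\<bar> * H) * (\<rho> powr (1/2) * inverse (\<rho>\<^sup>2))"
          by (simp only: mult_ac)
        finally show ?thesis unfolding pw .
      qed
      have 2: "norm (r t) * (3 * inverse (\<rho>\<^sup>2)) \<le> 3 * C2 / \<delta>\<^sup>2"
      proof (cases "t \<in> U")
        case False
        then have "\<delta> \<le> \<rho>" using \<delta>(2) z(1) by (force simp: \<rho>_def dist_norm)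
        then have "inverse (\<rho>\<^sup>2) \<le> inverse (\<delta>\<^sup>2)" using \<delta>(1) by (intro le_imp_inverse_le power_mono) auto
        then have "norm (r t) * (3 * inverse (\<rho>\<^sup>2)) \<le> C2 * (3 * inverse (\<delta>\<^sup>2))"
          using elim C2 by (intro mult_mono) auto
        then show ?thesis by (simp add: divide_inverse mult_ac)
      qed (use r0 C2 in simp)
      have "norm (S n z t) \<le> norm (dd t * (Y t - Y z) + r t) * (3 * inverse (\<rho>\<^sup>2))"
        unfolding S_def norm_mult \<rho>_def by (rule mult_left_mono[OF p]) simp
      also have "\<dots> \<le> (norm (dd t * (Y t - Y z)) + norm (r t)) * (3 * inverse (\<rho>\<^sup>2))"
        by (intro mult_right_mono norm_triangle_ineq) simp
      also have "\<dots> \<le> 3 * (\<bar>C1\<bar> * H) * \<rho> powr (-3/2) + 3 * C2 / \<delta>\<^sup>2"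
        using 1 2 by (simp add: distrib_right)
      finally show ?thesis using R[OF True] by (simp add: G_def \<rho>_def)
    next
      case False
      then show ?thesis using dd0 r0 C2 H(1) by (simp add: S_def G_def)
    qed
  qed
  define C0 where "C0 = 3 * (\<bar>C1\<bar> * H) * (2 * riesz_bound R) + 3 * C2 / \<delta>\<^sup>2 * measure lborel (cball (0::complex) R)"
  have C0: "0 \<le> C0" using C2 H(1) riesz_bound_pos[of R] by (simp add: C0_def)
  have G: "integrable lborel (G z)" "(LINT t|lborel. G z t) \<le> C0" for z
  proof -
    have Gn: "0 \<le> G z t" for t using H(1) C2 by (simp add: G_def)
    have Gm [measurable]: "G z \<in> borel_measurable borel" unfolding G_def by measurable
    define P where "P t = 3 * (\<bar>C1\<bar> * H) * norm (z - t) powr (-3/2)" for t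
    have [measurable]: "P \<in> borel_measurable borel" unfolding P_def by measurable
    have "(\<integral>\<^sup>+ t. ennreal (G z t) \<partial>lborel) = (\<integral>\<^sup>+ t. ennreal (P t) * indicator (cball 0 R) t + ennreal (3 * C2 / \<delta>\<^sup>2) * indicator (cball 0 R) t \<partial>lborel)"
      using H(1) C2 by (intro nn_integral_cong) (auto simp: G_def P_def indicator_def ennreal_plus)
    also have "\<dots> = (\<integral>\<^sup>+ t. ennreal (P t) * indicator (cball 0 R) t \<partial>lborel) + ennreal (3 * C2 / \<delta>\<^sup>2) * emeasure lborel (cball (0::complex) R)"
      by (subst nn_integral_add) (auto simp: nn_integral_cmult_indicator)
    also have "\<dots> \<le> ennreal (3 * (\<bar>C1\<bar> * H) * (2 * riesz_bound R)) + ennreal (3 * C2 / \<delta>\<^sup>2) * emeasure lborel (cball (0::complex) R)"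
      by (intro add_right_mono nn_integral_le_riesz_bound[where z = z and z' = z]) (use H(1) in \<open>auto simp: P_def\<close>)
    also have "\<dots> = ennreal C0"
    proof -
      have em: "emeasure lborel (cball (0::complex) R) = ennreal (measure lborel (cball (0::complex) R))"
        using emeasure_lborel_cball_finite[of "0::complex" R] by (simp add: emeasure_eq_ennreal_measure less_top)
      have *: "ennreal a + ennreal b * ennreal m = ennreal (a + b * m)" if "0 \<le> a" "0 \<le> b" "0 \<le> m" for a b m :: real
        using that by (simp add: ennreal_plus ennreal_mult)
      show ?thesis
        unfolding C0_def em by (rule *) (use C2 H(1) riesz_bound_pos[of R] in auto)
    qed
    finally have le: "(\<integral>\<^sup>+ t. ennreal (G z t) \<partial>lborel) \<le> ennreal C0" .
    then show i: "integrable lborel (G z)"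
      unfolding integrable_iff_bounded using Gn by (auto simp: intro: le_less_trans)
    show "(LINT t|lborel. G z t) \<le> C0"
      using le nn_integral_eq_integral[OF i] Gn C0 by simp
  qed
  have mS [measurable]: "S n z \<in> borel_measurable borel" "S0 z \<in> borel_measurable borel" for n z
    unfolding S_def S0_def using smooth_borel_measurable[OF smooth_pd[OF smooth_cker[OF eps_pos] e]] by measurable
  have mS2 [measurable]: "(\<lambda>z. LINT t|lborel. S0 z t) \<in> borel_measurable borel"
    unfolding S0_def by measurable
  have Sbd: "norm (LINT t|lborel. S n z t) \<le> C0" if "z \<in> K" "z \<notin> N" for n z
  proof -
    have "AE t in lborel. norm (S n z t) \<le> norm (G z t)"
      using dom[OF that, of n] by eventually_elim simp
    then have "integrable lborel (S n z)"
      by (intro Bochner_Integration.integrable_bound[OF G(1)]) auto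
    then have "(LINT t|lborel. norm (S n z t)) \<le> (LINT t|lborel. G z t)"
      by (intro integral_mono_AE G(1) dom[OF that] integrable_norm)
    then have "norm (LINT t|lborel. S n z t) \<le> (LINT t|lborel. G z t)"
      using integral_norm_bound order_trans by blast
    then show ?thesis using G(2) order_trans by blast
  qed
  have Slim: "(\<lambda>n. LINT t|lborel. S n z t) \<longlonglongrightarrow> (LINT t|lborel. S0 z t)" if z: "z \<in> K" "z \<notin> N" for z
  proof (rule integral_dominated_convergence[OF _ _ G(1)])
    show "AE t in lborel. (\<lambda>n. S n z t) \<longlonglongrightarrow> S0 z t"
      using AE_lborel_singleton[of z]
    proof eventually_elim
      case (elim t)
      then show ?case unfolding S_def S0_def
        by (intro tendsto_mult tendsto_const pd_cker_tendsto eps_tendsto eps_pos e) auto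
    qed
  qed (use dom[OF z] in auto)

  define wn where "wn n = conv (\<lambda>t. \<eta> t * w t) (moll (eps n))" for n
  define fn where "fn n = conv (\<lambda>t. \<eta> t * fe t + pd e \<eta> t * f t) (moll (eps n))" for n
  have Lw: "L1c (\<lambda>t. \<eta> t * w t)" by (rule locint_test_mult[OF locbdd_imp_locint[OF w] \<eta>(1)])
  have Lf: "L1c (\<lambda>t. \<eta> t * f t)" by (rule locint_test_mult[OF locbdd_imp_locint[OF f] \<eta>(1)])
  have Lfe: "L1c (\<lambda>t. \<eta> t * fe t + pd e \<eta> t * f t)"
    by (intro L1c_add locint_test_mult[OF locbdd_imp_locint[OF fe] \<eta>(1)]
        locint_test_mult[OF locbdd_imp_locint[OF f] test_fun_pd[OF \<eta>(1) e]])
  \<comment> \<open>Inside the convolution \<open>Y t\<close> is split as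
    \<open>(Y t - Y z) + Y z\<close>. The second part is \<open>Y z\<close> times the derivative of
    the mollified \<eta> f, and the weak derivative \<open>fe\<close> turns that into the
    mollification \<open>fn\<close> of a bounded function.\<close>
  have pdw: "2 * pd e (wn n) z = (LINT t|lborel. S n z t) + 2 * (Y z * fn n z)" for n z
  proof -
    have 1: "2 * pd e (wn n) z = conv k (pd e (cker c (eps n))) z"
      unfolding wn_def by (rule pd_conv_moll_eq_conv_pd_cker[OF Lw k e]) (unfold k_def D_def, rule conv_cauchy[OF W c \<eta>(1)])
    have "2 * pd e (conv (\<lambda>t. \<eta> t * f t) (moll (eps n))) z = conv dd (pd e (cker c (eps n))) z"
      by (rule pd_conv_moll_eq_conv_pd_cker[OF Lf dd e]) (unfold dd_def D_def, rule conv_cauchy[OF F c \<eta>(1)])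
    moreover have "pd e (conv (\<lambda>t. \<eta> t * f t) (moll (eps n))) z = fn n z"
      unfolding fn_def pd_conv[OF Lf smooth_moll[OF eps_pos] e]
      by (rule conv_cutoff_weak_d[OF Fe e \<eta>(1) smooth_moll[OF eps_pos]])
    ultimately have 2: "2 * fn n z = conv dd (pd e (cker c (eps n))) z" by simp
    have cc: "continuous_on UNIV (pd e (cker c (eps n)))"
      by (intro smooth_continuous smooth_pd smooth_cker eps_pos e)
    have mc [measurable]: "pd e (cker c (eps n)) \<in> borel_measurable borel"
      by (intro borel_measurable_continuous_onI cc)
    have "conv k (pd e (cker c (eps n))) z - Y z * conv dd (pd e (cker c (eps n))) z
       = (LINT t|lborel. k t * pd e (cker c (eps n)) (z - t) - Y z * (dd t * pd e (cker c (eps n)) (z - t)))"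
      unfolding conv_def using conv_integrable[OF k cc] conv_integrable[OF dd cc] by simp
    also have "\<dots> = (LINT t|lborel. S n z t)"
    proof (rule integral_cong_AE)
      show "AE t in lborel. k t * pd e (cker c (eps n)) (z - t) - Y z * (dd t * pd e (cker c (eps n)) (z - t)) = S n z t"
        using kd by eventually_elim (simp add: S_def algebra_simps)
    qed measurable
    finally have "conv k (pd e (cker c (eps n))) z - Y z * conv dd (pd e (cker c (eps n))) z = (LINT t|lborel. S n z t)" .
    then show ?thesis using 1 2 by (simp add: algebra_simps)
  qed
  \<comment> \<open>The limit of \<open>pdw\<close>, divided by 2 \<open>moll_mass\<close>. Its
    values at points of the null set \<open>N\<close>, where the integral of \<open>S0 z\<close>
    need not converge, are immaterial.\<close>
  define g where "g z = indicator K z *\<^sub>R ((LINT t|lborel. S0 z t) / (2 * moll_mass) + fe z * Y z)" for z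
  show ?thesis
  proof (intro exI conjI ballI impI)
    show "g \<in> borel_measurable borel" unfolding g_def by measurable
    show "AE z in lborel. norm (g z) \<le> C0 / (2 * moll_mass) + Ce * CY"
      using AEN Ce(2) CY(2)
    proof eventually_elim
      case (elim z)
      show ?case
      proof (cases "z \<in> K")
        case True
        have "norm (LINT t|lborel. S0 z t) \<le> C0"
          using Lim_bounded[OF tendsto_norm[OF Slim[OF True elim(1)]], of 0 C0] Sbd[OF True elim(1)] by blast
        then have "norm ((LINT t|lborel. S0 z t) / (2 * moll_mass)) \<le> C0 / (2 * moll_mass)"
          using moll_mass_pos by (simp add: norm_divide divide_right_mono norm_mult)
        moreover have "norm (fe z * Y z) \<le> Ce * CY"
          unfolding norm_mult using elim True KL Ce(1) by (intro mult_mono) auto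
        ultimately show ?thesis using True by (auto simp: g_def intro: norm_triangle_le)
      next
        case False
        then show ?thesis using C0 moll_mass_pos Ce CY by (simp add: g_def)
      qed
    qed
    fix \<phi> assume \<phi>: "\<phi> \<in> test_fun \<Omega>" and \<phi>0: "\<forall>z. z \<notin> K \<longrightarrow> \<phi> z = 0"
    note [measurable] = smooth_borel_measurable[OF test_fun_smooth[OF \<phi>]]
    obtain C\<phi> where C\<phi>: "0 < C\<phi>" "\<And>z. norm (\<phi> z) \<le> C\<phi>" using test_fun_bounded[OF \<phi>] by blast
    have pd\<phi>0: "pd e \<phi> z = 0" if "z \<notin> K" for z
      by (rule pd_eq_0_if_locally_const[of "- K" z \<phi> 0]) (use K \<phi>0 that in \<open>auto simp: compact_imp_closed\<close>)
    have \<eta>K: "\<eta> z = 1" if "z \<in> K" for z using \<eta>(3,4) that by blast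
    have pd\<eta>K: "pd e \<eta> z = 0" if "z \<in> K" for z
      by (rule pd_eq_0_if_locally_const[OF \<eta>(2) _ \<eta>(4)]) (use \<eta>(3) that in blast)
    obtain Cp where Cp: "0 < Cp" "\<And>z. norm (pd e \<phi> z) \<le> Cp" using test_fun_bounded[OF test_fun_pd[OF \<phi> e]] by blast
    have "(\<lambda>n. LINT z|lborel. wn n z * pd e \<phi> z) \<longlonglongrightarrow> moll_mass * (LINT z|lborel. (\<eta> z * w z) * pd e \<phi> z)"
      unfolding wn_def by (rule conv_moll_test[OF Lw test_fun_L1c[OF test_fun_pd[OF \<phi> e]] Cp(2)])
    moreover have "(LINT z|lborel. (\<eta> z * w z) * pd e \<phi> z) = (LINT z|lborel. w z * pd e \<phi> z)"
      using pd\<phi>0 \<eta>K by (intro Bochner_Integration.integral_cong) auto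
    ultimately have l1: "(\<lambda>n. LINT z|lborel. wn n z * pd e \<phi> z) \<longlonglongrightarrow> moll_mass * (LINT z|lborel. w z * pd e \<phi> z)"
      by simp
    \<comment> \<open>\<open>Y\<close> is moved onto the test function: then \<open>fn\<close> need
      only converge against one fixed, essentially bounded function.\<close>
    define \<psi> where "\<psi> z = \<phi> z * Y z" for z
    have \<psi>: "L1c \<psi>" unfolding \<psi>_def by (rule locint_test_mult[OF locbdd_imp_locint[OF Y] \<phi>])
    have \<psi>b: "AE z in lborel. norm (\<psi> z) \<le> C\<phi> * CY"
      using CY(2)
    proof eventually_elim
      case (elim z)
      show ?case
      proof (cases "z \<in> K")
        case True
        then show ?thesis unfolding \<psi>_def norm_mult using elim KL C\<phi> CY(1) by (intro mult_mono) auto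
      qed (use \<phi>0 C\<phi> CY(1) in \<open>simp add: \<psi>_def\<close>)
    qed
    have l2: "(\<lambda>n. LINT z|lborel. fn n z * \<psi> z) \<longlonglongrightarrow> moll_mass * (LINT z|lborel. (\<eta> z * fe z + pd e \<eta> z * f z) * \<psi> z)"
      unfolding fn_def by (rule conv_moll_test_AE[OF Lfe \<psi> \<psi>b])
    have eq2: "(LINT z|lborel. (\<eta> z * fe z + pd e \<eta> z * f z) * \<psi> z) = (LINT z|lborel. fe z * \<psi> z)"
    proof (rule Bochner_Integration.integral_cong[OF refl])
      fix z
      show "(\<eta> z * fe z + pd e \<eta> z * f z) * \<psi> z = fe z * \<psi> z"
        using \<phi>0 by (cases "z \<in> K") (simp_all add: \<psi>_def \<eta>K pd\<eta>K)
    qed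
    have i\<psi>: "integrable lborel (\<lambda>z. fn n z * \<psi> z)" for n
    proof -
      have cf: "continuous_on UNIV (fn n)"
        unfolding fn_def by (intro conv_continuous[OF Lfe] smooth_continuous smooth_moll eps_pos)
      have "continuous_on UNIV (\<lambda>t. fn n (- t))"
        by (intro continuous_on_compose2[OF cf] continuous_intros) auto
      from conv_integrable[OF \<psi> this, of 0] show ?thesis by (simp add: mult.commute)
    qed
    have iw: "integrable lborel (\<lambda>z. pd e (wn n) z * \<phi> z)" for n
      using L1c_integrable[OF test_fun_L1c[OF test_fun_mult[OF \<phi> smooth_pd[OF smooth_conv[OF Lw smooth_moll[OF eps_pos]] e]]]]
      by (simp add: mult.commute wn_def)
    have S\<phi>: "(LINT t|lborel. S n z t) * \<phi> z = 2 * (pd e (wn n) z * \<phi> z) - 2 * (fn n z * \<psi> z)" for n z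
    proof -
      have *: "(LINT t|lborel. S n z t) = 2 * pd e (wn n) z - 2 * (Y z * fn n z)"
        unfolding pdw by simp
      show ?thesis
        unfolding \<psi>_def * by (simp add: algebra_simps)
    qed
    have iS: "integrable lborel (\<lambda>z. (LINT t|lborel. S n z t) * \<phi> z)" for n
      unfolding S\<phi> using iw i\<psi> by (intro Bochner_Integration.integrable_diff integrable_mult_right)
    then have [measurable]: "(\<lambda>z. (LINT t|lborel. S n z t) * \<phi> z) \<in> borel_measurable borel" for n
      using borel_measurable_integrable by fastforce
    have l3: "(\<lambda>n. LINT z|lborel. (LINT t|lborel. S n z t) * \<phi> z) \<longlonglongrightarrow> (LINT z|lborel. (LINT t|lborel. S0 z t) * \<phi> z)"
    proof (rule integral_dominated_convergence)
      show "integrable lborel (\<lambda>z. C0 * norm (\<phi> z))"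
        using L1c_integrable[OF test_fun_L1c[OF \<phi>]] by auto
      show "AE z in lborel. (\<lambda>n. (LINT t|lborel. S n z t) * \<phi> z) \<longlonglongrightarrow> (LINT t|lborel. S0 z t) * \<phi> z"
        using AEN
      proof eventually_elim
        case (elim z)
        show ?case using Slim[of z] elim \<phi>0 by (cases "z \<in> K") (auto intro: tendsto_mult)
      qed
      show "AE z in lborel. norm ((LINT t|lborel. S n z t) * \<phi> z) \<le> C0 * norm (\<phi> z)" for n
        using AEN
      proof eventually_elim
        case (elim z)
        show ?case using Sbd[of z n] elim \<phi>0 by (cases "z \<in> K") (auto simp: norm_mult intro: mult_right_mono)
      qed
    qed measurable
    have i0: "integrable lborel (\<lambda>z. (LINT t|lborel. S0 z t) * \<phi> z)"
    proof (rule Bochner_Integration.integrable_bound)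
      show "integrable lborel (\<lambda>z. C0 * norm (\<phi> z))"
        using L1c_integrable[OF test_fun_L1c[OF \<phi>]] by auto
      show "AE z in lborel. norm ((LINT t|lborel. S0 z t) * \<phi> z) \<le> norm (C0 * norm (\<phi> z))"
        using AEN
      proof eventually_elim
        case (elim z)
        show ?case
        proof (cases "z \<in> K")
          case True
          have "norm (LINT t|lborel. S0 z t) \<le> C0"
            using Lim_bounded[OF tendsto_norm[OF Slim[OF True elim]], of 0 C0] Sbd[OF True elim] by blast
          then show ?thesis using C0 by (simp add: norm_mult mult_right_mono)
        qed (use \<phi>0 in simp)
      qed
    qed measurable
    have i1: "integrable lborel (\<lambda>z. fe z * \<psi> z)"
    proof (rule Bochner_Integration.integrable_bound)
      show "integrable lborel (\<lambda>z. Ce * norm (\<psi> z))" using L1c_integrable[OF \<psi>] by auto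
      show "AE z in lborel. norm (fe z * \<psi> z) \<le> norm (Ce * norm (\<psi> z))"
        using Ce(2)
      proof eventually_elim
        case (elim z)
        show ?case using elim KL \<phi>0 Ce(1) by (cases "z \<in> K") (auto simp: norm_mult \<psi>_def intro!: mult_right_mono)
      qed
    qed (use L1c_borel[OF \<psi>] in measurable)
    have "2 * (LINT z|lborel. wn n z * pd e \<phi> z) = - ((LINT z|lborel. (LINT t|lborel. S n z t) * \<phi> z) + 2 * (LINT z|lborel. fn n z * \<psi> z))" for n
    proof -
      have "2 * (LINT z|lborel. wn n z * pd e \<phi> z) = - (LINT z|lborel. 2 * (pd e (wn n) z * \<phi> z))"
        using integral_by_parts_smooth[OF \<phi> smooth_conv[OF Lw smooth_moll[OF eps_pos]] e]
        by (simp add: wn_def)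
      also have "(LINT z|lborel. 2 * (pd e (wn n) z * \<phi> z)) = (LINT z|lborel. (LINT t|lborel. S n z t) * \<phi> z + 2 * (fn n z * \<psi> z))"
        unfolding S\<phi> by simp
      also have "\<dots> = (LINT z|lborel. (LINT t|lborel. S n z t) * \<phi> z) + 2 * (LINT z|lborel. fn n z * \<psi> z)"
        using iS i\<psi> by simp
      finally show ?thesis .
    qed
    then have "(\<lambda>n. - ((LINT z|lborel. (LINT t|lborel. S n z t) * \<phi> z) + 2 * (LINT z|lborel. fn n z * \<psi> z)))
       \<longlonglongrightarrow> 2 * (moll_mass * (LINT z|lborel. w z * pd e \<phi> z))"
      using tendsto_mult[OF tendsto_const[of 2] l1] by simp
    moreover have "(\<lambda>n. - ((LINT z|lborel. (LINT t|lborel. S n z t) * \<phi> z) + 2 * (LINT z|lborel. fn n z * \<psi> z)))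
       \<longlonglongrightarrow> - ((LINT z|lborel. (LINT t|lborel. S0 z t) * \<phi> z) + 2 * (moll_mass * (LINT z|lborel. fe z * \<psi> z)))"
      using l2 unfolding eq2 by (intro tendsto_minus tendsto_add tendsto_mult tendsto_const l3)
    ultimately have main: "2 * (moll_mass * (LINT z|lborel. w z * pd e \<phi> z)) =
        - ((LINT z|lborel. (LINT t|lborel. S0 z t) * \<phi> z) + 2 * (moll_mass * (LINT z|lborel. fe z * \<psi> z)))"
      using LIMSEQ_unique by blast
    have "(LINT z|lborel. g z * \<phi> z) = (LINT z|lborel. ((LINT t|lborel. S0 z t) * \<phi> z) / (2 * moll_mass) + fe z * \<psi> z)"
      using \<phi>0 by (intro Bochner_Integration.integral_cong) (auto simp: g_def \<psi>_def indicator_def algebra_simps)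
    also have "\<dots> = (LINT z|lborel. (LINT t|lborel. S0 z t) * \<phi> z) / (2 * moll_mass) + (LINT z|lborel. fe z * \<psi> z)"
      using i0 i1 by simp
    finally have eqg: "(LINT z|lborel. g z * \<phi> z) = \<dots>" .
    have "x = - y" if "2 * (m * x) = - (s + 2 * (m * b))" "y = s / (2 * m) + b" "m \<noteq> 0" for x y s b m :: complex
    proof -
      have "2 * (m * (- y)) = - (s + 2 * (m * b))"
        unfolding that(2) using that(3) by (simp add: field_simps)
      then have "2 * (m * x) = 2 * (m * (- y))"
        unfolding that(1) by (rule sym)
      then have "m * x = m * (- y)"
        by (metis mult_left_cancel zero_neq_numeral)
      then show ?thesis
        using that(3) by (metis mult_left_cancel)
    qed
    from this[OF main eqg[unfolded of_real_mult of_real_numeral]] show "(LINT z|lborel. w z * pd e \<phi> z) = - (LINT z|lborel. g z * \<phi> z)"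
      using moll_mass_pos by simp
  qed
qed

section \<open>Linear rules, conjugation, uniqueness and gluing of weak derivatives\<close>

lemma weak_dD:
  assumes "weak_d e \<Omega> g h"
  shows "locint \<Omega> g" "locint \<Omega> h"
    "\<And>\<phi>. \<phi> \<in> test_fun \<Omega> \<Longrightarrow> (LINT z|lborel. g z * pd e \<phi> z) = - (LINT z|lborel. h z * \<phi> z)"
  using assms unfolding weak_d_def by auto

lemma locint_add: "locint \<Omega> g \<Longrightarrow> locint \<Omega> h \<Longrightarrow> locint \<Omega> (\<lambda>z. g z + h z)"
  unfolding locint_def by (auto simp: scaleR_add_right)

lemma locint_cmult:
  assumes "locint \<Omega> g"
  shows "locint \<Omega> (\<lambda>z. c * g z)"
  unfolding locint_def
proof (intro conjI allI impI)
  show "(\<lambda>z. c * g z) \<in> borel_measurable borel" using locint_borel[OF assms] by measurable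
  fix K assume K: "compact K" "K \<subseteq> \<Omega>"
  have "integrable lborel (\<lambda>z. c * (indicator K z *\<^sub>R g z))"
    using locintD[OF assms K] by (rule integrable_mult_right)
  then show "integrable lborel (\<lambda>z. indicator K z *\<^sub>R (c * g z))"
    by (simp add: mult_scaleR_right)
qed

lemma locbdd_add:
  assumes g: "locbdd \<Omega> g" and h: "locbdd \<Omega> h"
  shows "locbdd \<Omega> (\<lambda>z. g z + h z)"
  unfolding locbdd_def
proof (intro conjI allI impI)
  show "(\<lambda>z. g z + h z) \<in> borel_measurable borel" using locbdd_borel[OF g] locbdd_borel[OF h] by measurable
  fix K assume K: "compact K" "K \<subseteq> \<Omega>"
  obtain C where C: "AE z in lborel. z \<in> K \<longrightarrow> norm (g z) \<le> C" using locbddE[OF g K] by blast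
  obtain D where D: "AE z in lborel. z \<in> K \<longrightarrow> norm (h z) \<le> D" using locbddE[OF h K] by blast
  show "\<exists>C. AE z in lborel. z \<in> K \<longrightarrow> norm (g z + h z) \<le> C"
    by (rule exI[of _ "C + D"], use C D in eventually_elim) (auto intro!: norm_triangle_le add_mono)
qed

lemma locbdd_mult:
  assumes g: "locbdd \<Omega> g" and h: "locbdd \<Omega> h"
  shows "locbdd \<Omega> (\<lambda>z. g z * h z)"
  unfolding locbdd_def
proof (intro conjI allI impI)
  show "(\<lambda>z. g z * h z) \<in> borel_measurable borel" using locbdd_borel[OF g] locbdd_borel[OF h] by measurable
  fix K assume K: "compact K" "K \<subseteq> \<Omega>"
  obtain C where C: "0 \<le> C" "AE z in lborel. z \<in> K \<longrightarrow> norm (g z) \<le> C" using locbddE[OF g K] by blast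
  obtain D where D: "0 \<le> D" "AE z in lborel. z \<in> K \<longrightarrow> norm (h z) \<le> D" using locbddE[OF h K] by blast
  show "\<exists>C. AE z in lborel. z \<in> K \<longrightarrow> norm (g z * h z) \<le> C"
    by (rule exI[of _ "C * D"], use C(2) D(2) in eventually_elim) (use C(1) D(1) in \<open>auto simp: norm_mult intro!: mult_mono\<close>)
qed

lemma locbdd_bounded:
  assumes "g \<in> borel_measurable borel" "AE z in lborel. z \<in> \<Omega> \<longrightarrow> norm (g z) \<le> C"
  shows "locbdd \<Omega> g"
  unfolding locbdd_def
proof (intro conjI allI impI)
  fix K assume "K \<subseteq> \<Omega>"
  show "\<exists>C. AE z in lborel. z \<in> K \<longrightarrow> norm (g z) \<le> C"
    by (rule exI[of _ C], use assms(2) in eventually_elim) (use \<open>K \<subseteq> \<Omega>\<close> in auto)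
qed (use assms in auto)

lemma locbdd_const: "locbdd \<Omega> (\<lambda>z. c)"
  by (rule locbdd_bounded[of _ _ "norm c"]) auto

lemma locbdd_cmult: "locbdd \<Omega> g \<Longrightarrow> locbdd \<Omega> (\<lambda>z. c * g z)"
  by (rule locbdd_mult[OF locbdd_const])

lemma locbdd_cnj: "locbdd \<Omega> g \<Longrightarrow> locbdd \<Omega> (\<lambda>z. cnj (g z))"
proof -
  have [measurable]: "cnj \<in> borel_measurable borel"
    by (intro borel_measurable_continuous_onI continuous_intros)
  show "locbdd \<Omega> g \<Longrightarrow> locbdd \<Omega> (\<lambda>z. cnj (g z))"
    unfolding locbdd_def complex_mod_cnj by (elim conjE, intro conjI, measurable)
qed

lemma locbdd_cong_AE:
  assumes g: "locbdd \<Omega> g" and h: "h \<in> borel_measurable borel" "AE z in lborel. z \<in> \<Omega> \<longrightarrow> h z = g z"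
  shows "locbdd \<Omega> h"
  unfolding locbdd_def
proof (intro conjI allI impI)
  fix K assume K: "compact K" "K \<subseteq> \<Omega>"
  obtain C where C: "AE z in lborel. z \<in> K \<longrightarrow> norm (g z) \<le> C" using locbddE[OF g K] by blast
  show "\<exists>C. AE z in lborel. z \<in> K \<longrightarrow> norm (h z) \<le> C"
    by (rule exI[of _ C], use C h(2) in eventually_elim) (use K(2) in auto)
qed (use h in auto)

lemma integral_test_cong_AE:
  assumes "AE z in lborel. z \<in> \<Omega> \<longrightarrow> g z = h z" "\<phi> \<in> test_fun \<Omega>" "g \<in> borel_measurable borel" "h \<in> borel_measurable borel"
  shows "(LINT z|lborel. g z * \<phi> z) = (LINT z|lborel. h z * \<phi> z)"
proof (rule integral_cong_AE)
  note [measurable] = assms(3,4) smooth_borel_measurable[OF test_fun_smooth[OF assms(2)]]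
  show "(\<lambda>z. g z * \<phi> z) \<in> borel_measurable lborel" "(\<lambda>z. h z * \<phi> z) \<in> borel_measurable lborel" by measurable
  obtain K where K: "K \<subseteq> \<Omega>" "\<And>z. z \<notin> K \<Longrightarrow> \<phi> z = 0"
    using test_fun_supportE[OF assms(2)] by metis
  show "AE z in lborel. g z * \<phi> z = h z * \<phi> z"
    using assms(1)
  proof eventually_elim
    case (elim z)
    then show ?case using K by (cases "z \<in> K") auto
  qed
qed

lemma weak_d_add:
  assumes "weak_d e \<Omega> g g'" "weak_d e \<Omega> h h'" "e \<in> {1, \<i>}"
  shows "weak_d e \<Omega> (\<lambda>z. g z + h z) (\<lambda>z. g' z + h' z)"
  unfolding weak_d_def
proof (intro conjI ballI locint_add weak_dD(1,2)[OF assms(1)] weak_dD(1,2)[OF assms(2)])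
  fix \<phi> assume \<phi>: "\<phi> \<in> test_fun \<Omega>"
  note i = locint_test_integrable[OF weak_dD(1)[OF assms(1)] test_fun_pd[OF \<phi> assms(3)]]
    locint_test_integrable[OF weak_dD(1)[OF assms(2)] test_fun_pd[OF \<phi> assms(3)]]
    locint_test_integrable[OF weak_dD(2)[OF assms(1)] \<phi>] locint_test_integrable[OF weak_dD(2)[OF assms(2)] \<phi>]
  show "(LINT z|lborel. (g z + h z) * pd e \<phi> z) = - (LINT z|lborel. (g' z + h' z) * \<phi> z)"
    using i weak_dD(3)[OF assms(1) \<phi>] weak_dD(3)[OF assms(2) \<phi>] by (simp add: distrib_right)
qed

lemma weak_d_cmult:
  assumes "weak_d e \<Omega> g g'"
  shows "weak_d e \<Omega> (\<lambda>z. c * g z) (\<lambda>z. c * g' z)"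
  unfolding weak_d_def
proof (intro conjI ballI locint_cmult weak_dD(1,2)[OF assms(1)])
  fix \<phi> assume \<phi>: "\<phi> \<in> test_fun \<Omega>"
  show "(LINT z|lborel. c * g z * pd e \<phi> z) = - (LINT z|lborel. c * g' z * \<phi> z)"
    using weak_dD(3)[OF assms(1) \<phi>] by (simp add: mult.assoc)
qed

lemma weak_d_cong:
  assumes "weak_d e \<Omega> g g'" "AE z in lborel. z \<in> \<Omega> \<longrightarrow> g' z = h' z" "locint \<Omega> h'"
  shows "weak_d e \<Omega> g h'"
  unfolding weak_d_def
  using weak_dD[OF assms(1)] assms(3) integral_test_cong_AE[OF assms(2) _ locint_borel[OF weak_dD(2)[OF assms(1)]] locint_borel[OF assms(3)]]
  by auto

lemma weak_d_const:
  assumes "e \<in> {1, \<i>}"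
  shows "weak_d e \<Omega> (\<lambda>z. c) (\<lambda>z. 0)"
  unfolding weak_d_def
  using integral_pd_test_fun[OF _ assms] by (auto intro: locbdd_imp_locint locbdd_const)

text \<open>Partial derivatives in real directions commute with conjugation, so the conjugate of
  \<phi> can be used as test function and both integrals conjugated. This prepares the derivative of
  \<open>f z * cnj (f z)\<close>.\<close>

lemma weak_d_cnj:
  assumes g: "weak_d e \<Omega> g g'" "locbdd \<Omega> g" "locbdd \<Omega> g'" and e: "e \<in> {1, \<i>}"
  shows "weak_d e \<Omega> (\<lambda>z. cnj (g z)) (\<lambda>z. cnj (g' z))"
  unfolding weak_d_def
proof (intro conjI ballI locbdd_imp_locint locbdd_cnj g)
  fix \<phi> assume \<phi>: "\<phi> \<in> test_fun \<Omega>"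
  have "(\<lambda>z. cnj (\<phi> z)) \<in> test_fun \<Omega>"
    using \<phi> smooth_cnj unfolding test_fun_iff by (metis complex_cnj_zero)
  from weak_dD(3)[OF g(1) this]
  have *: "(LINT z|lborel. g z * cnj (pd e \<phi> z)) = - (LINT z|lborel. g' z * cnj (\<phi> z))"
    unfolding pd_cnj[OF test_fun_smooth[OF \<phi>] e] .
  have "(LINT z|lborel. cnj (g z) * pd e \<phi> z) = (LINT z|lborel. cnj (g z * cnj (pd e \<phi> z)))"
    by simp
  also have "\<dots> = cnj (LINT z|lborel. g z * cnj (pd e \<phi> z))"
    by (rule Bochner_Integration.integral_cnj)
  also have "\<dots> = - cnj (LINT z|lborel. g' z * cnj (\<phi> z))"
    unfolding * by simp
  also have "cnj (LINT z|lborel. g' z * cnj (\<phi> z)) = (LINT z|lborel. cnj (g' z * cnj (\<phi> z)))"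
    by (rule Bochner_Integration.integral_cnj[symmetric])
  finally show "(LINT z|lborel. cnj (g z) * pd e \<phi> z) = - (LINT z|lborel. cnj (g' z) * \<phi> z)"
    by simp
qed

lemma weak_opD:
  assumes "weak_op a b \<Omega> g h"
  shows "locint \<Omega> g" "locint \<Omega> h"
    "\<And>\<phi>. \<phi> \<in> test_fun \<Omega> \<Longrightarrow> (LINT z|lborel. g z * (a * pd 1 \<phi> z + b * pd \<i> \<phi> z)) = - (LINT z|lborel. h z * \<phi> z)"
  using assms unfolding weak_op_def by auto

lemma weak_op_unique:
  assumes "open \<Omega>" "weak_op a b \<Omega> g h" "weak_op a b \<Omega> g h'"
  shows "AE z in lborel. z \<in> \<Omega> \<longrightarrow> h z = h' z"
proof -
  note i = weak_opD(2)[OF assms(2)] weak_opD(2)[OF assms(3)]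
  have l: "locint \<Omega> (\<lambda>z. h z + (- 1) * h' z)"
    by (intro locint_add locint_cmult i)
  have "AE z in lborel. z \<in> \<Omega> \<longrightarrow> h z + (- 1) * h' z = 0"
  proof (rule weakly_zero_imp_AE_zero[OF assms(1) l])
    fix \<phi> assume \<phi>: "\<phi> \<in> test_fun \<Omega>"
    have "(LINT z|lborel. h z * \<phi> z) = (LINT z|lborel. h' z * \<phi> z)"
      using weak_opD(3)[OF assms(2) \<phi>] weak_opD(3)[OF assms(3) \<phi>] by simp
    then show "(LINT z|lborel. (h z + (- 1) * h' z) * \<phi> z) = 0"
      using locint_test_integrable[OF i(1) \<phi>] locint_test_integrable[OF i(2) \<phi>]
      by (simp add: algebra_simps)
  qed
  then show ?thesis by eventually_elim simp
qed

lemma weak_op_from_weak_d: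
  assumes "weak_d 1 \<Omega> g gx" "weak_d \<i> \<Omega> g gy"
  shows "weak_op 1 c \<Omega> g (\<lambda>z. gx z + c * gy z)"
  unfolding weak_op_def
proof (intro conjI ballI locint_add locint_cmult weak_dD(1)[OF assms(1)] weak_dD(2)[OF assms(1)] weak_dD(2)[OF assms(2)])
  fix \<phi> assume \<phi>: "\<phi> \<in> test_fun \<Omega>"
  have t: "pd 1 \<phi> \<in> test_fun \<Omega>" "pd \<i> \<phi> \<in> test_fun \<Omega>" using test_fun_pd[OF \<phi>] by auto
  note i = locint_test_integrable[OF weak_dD(1)[OF assms(1)] t(1)] locint_test_integrable[OF weak_dD(1)[OF assms(1)] t(2)]
    locint_test_integrable[OF weak_dD(2)[OF assms(1)] \<phi>] locint_test_integrable[OF weak_dD(2)[OF assms(2)] \<phi>]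
  have "(LINT z|lborel. g z * (1 * pd 1 \<phi> z + c * pd \<i> \<phi> z)) = (LINT z|lborel. g z * pd 1 \<phi> z + c * (g z * pd \<i> \<phi> z))"
    by (simp add: algebra_simps)
  also have "\<dots> = (LINT z|lborel. g z * pd 1 \<phi> z) + c * (LINT z|lborel. g z * pd \<i> \<phi> z)"
    using i by simp
  also have "\<dots> = - ((LINT z|lborel. gx z * \<phi> z) + c * (LINT z|lborel. gy z * \<phi> z))"
    using weak_dD(3)[OF assms(1) \<phi>] weak_dD(3)[OF assms(2) \<phi>] by simp
  also have "(LINT z|lborel. gx z * \<phi> z) + c * (LINT z|lborel. gy z * \<phi> z) = (LINT z|lborel. gx z * \<phi> z + c * (gy z * \<phi> z))"
    using i by simp
  also have "\<dots> = (LINT z|lborel. (gx z + c * gy z) * \<phi> z)"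
    by (simp add: algebra_simps)
  finally show "(LINT z|lborel. g z * (1 * pd 1 \<phi> z + c * pd \<i> \<phi> z)) = - (LINT z|lborel. (gx z + c * gy z) * \<phi> z)" .
qed

lemma exhaustion_mono:
  fixes K :: "nat \<Rightarrow> complex set"
  assumes "\<forall>n. K n \<subseteq> interior (K (Suc n))" "m \<le> n"
  shows "K m \<subseteq> K n"
  using assms(2)
proof (induction n rule: dec_induct)
  case (step n)
  then show ?case using assms(1) interior_subset by (meson order_trans)
qed simp

text \<open>Derivatives found on an exhaustion agree almost everywhere on the smaller interiors by
  the fundamental lemma. Hence at almost every point of \<Omega> the sequence is eventually
  constant.\<close>

lemma weak_d_glue:
  assumes \<Omega>: "open \<Omega>" and w: "locint \<Omega> w" and e: "e \<in> {1, \<i>}"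
    and loc: "\<And>K. compact K \<Longrightarrow> K \<subseteq> \<Omega> \<Longrightarrow> \<exists>g C. g \<in> borel_measurable borel \<and> (AE z in lborel. norm (g z) \<le> C) \<and>
     (\<forall>\<phi>\<in>test_fun \<Omega>. (\<forall>z. z \<notin> K \<longrightarrow> \<phi> z = 0) \<longrightarrow> (LINT z|lborel. w z * pd e \<phi> z) = - (LINT z|lborel. g z * \<phi> z))"
  shows "\<exists>g. locbdd \<Omega> g \<and> weak_d e \<Omega> w g"
proof -
  obtain K :: "nat \<Rightarrow> complex set" where K: "\<forall>n. compact (K n)" "\<forall>n. K n \<subseteq> \<Omega>" "\<Union>(range K) = \<Omega>"
    "\<forall>S. compact S \<longrightarrow> S \<subseteq> \<Omega> \<longrightarrow> (\<exists>N. \<forall>n\<ge>N. S \<subseteq> K n)" "\<forall>n. K n \<subseteq> interior (K (Suc n))"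
    using compact_exhaustion[OF \<Omega>] by metis
  define good where "good n g \<longleftrightarrow> g \<in> borel_measurable borel \<and> (\<exists>C. AE z in lborel. norm (g z) \<le> C) \<and>
     (\<forall>\<phi>\<in>test_fun \<Omega>. (\<forall>z. z \<notin> K n \<longrightarrow> \<phi> z = 0) \<longrightarrow> (LINT z|lborel. w z * pd e \<phi> z) = - (LINT z|lborel. g z * \<phi> z))" for n g
  have "\<exists>g. good n g" for n
    using loc[OF K(1)[THEN spec] K(2)[THEN spec], of n] unfolding good_def by (elim exE conjE) (intro exI conjI; assumption)
  then obtain G where G: "\<And>n. good n (G n)" by metis
  have Gb [measurable]: "G n \<in> borel_measurable borel" for n using G[of n] unfolding good_def by blast
  have GC: "\<exists>C. AE z in lborel. norm (G n z) \<le> C" for n using G[of n] unfolding good_def by blast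
  have GI: "(LINT z|lborel. w z * pd e \<phi> z) = - (LINT z|lborel. G n z * \<phi> z)"
    if "\<phi> \<in> test_fun \<Omega>" "\<And>z. z \<notin> K n \<Longrightarrow> \<phi> z = 0" for n \<phi>
    using G[of n] that unfolding good_def by simp
  have Gl: "locint S (G n)" for n S
  proof -
    obtain C where "AE z in lborel. norm (G n z) \<le> C" using GC by blast
    then have "AE z in lborel. z \<in> S \<longrightarrow> norm (G n z) \<le> C" by eventually_elim simp
    then show ?thesis by (intro locbdd_imp_locint locbdd_bounded[OF Gb])
  qed
  have cons: "AE z in lborel. z \<in> interior (K m) \<longrightarrow> G n z = G m z" if "m \<le> n" for m n
  proof -
    have "AE z in lborel. z \<in> interior (K m) \<longrightarrow> G n z + (-1) * G m z = 0"
    proof (rule weakly_zero_imp_AE_zero)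
      show "locint (interior (K m)) (\<lambda>z. G n z + (-1) * G m z)" by (intro locint_add locint_cmult Gl)
      fix \<phi> assume \<phi>: "\<phi> \<in> test_fun (interior (K m))"
      obtain L where L: "L \<subseteq> interior (K m)" "\<And>z. z \<notin> L \<Longrightarrow> \<phi> z = 0" "compact L"
        using test_fun_supportE[OF \<phi>] by metis
      have sub: "interior (K m) \<subseteq> \<Omega>" using K(2) interior_subset by (meson order_trans)
      have \<phi>\<Omega>: "\<phi> \<in> test_fun \<Omega>" using \<phi> L sub unfolding test_fun_iff by (meson order_trans)
      have m0: "\<phi> z = 0" if "z \<notin> K m" for z using L that interior_subset by blast
      then have n0: "\<phi> z = 0" if "z \<notin> K n" for z using exhaustion_mono[OF K(5) \<open>m \<le> n\<close>] that by blast
      have "(LINT z|lborel. G n z * \<phi> z) = (LINT z|lborel. G m z * \<phi> z)"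
        using GI[OF \<phi>\<Omega> m0] GI[OF \<phi>\<Omega> n0] by simp
      then show "(LINT z|lborel. (G n z + (-1) * G m z) * \<phi> z) = 0"
        using locint_test_integrable[OF Gl \<phi>\<Omega>, of n] locint_test_integrable[OF Gl \<phi>\<Omega>, of m] by (simp add: algebra_simps)
    qed simp
    then show ?thesis by eventually_elim simp
  qed
  \<comment> \<open>\<open>lim\<close> yields a Borel function directly; where the sequence diverges
    its value is arbitrary, but inside \<Omega> this is a null set.\<close>
  define g where "g z = lim (\<lambda>n. G n z)" for z
  have gb [measurable]: "g \<in> borel_measurable borel" unfolding g_def by measurable
  have gG: "AE z in lborel. z \<in> interior (K m) \<longrightarrow> g z = G m z" for m
  proof -
    have "\<forall>n. AE z in lborel. z \<in> interior (K m) \<longrightarrow> G (n + m) z = G m z"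
      using cons by simp
    then have "AE z in lborel. \<forall>n. z \<in> interior (K m) \<longrightarrow> G (n + m) z = G m z"
      unfolding AE_all_countable .
    then show ?thesis
    proof eventually_elim
      case (elim z)
      show ?case
      proof
        assume "z \<in> interior (K m)"
        then have "(\<lambda>n. G (n + m) z) = (\<lambda>n. G m z)" using elim by auto
        then have "(\<lambda>n. G (n + m) z) \<longlonglongrightarrow> G m z" by simp
        then have "(\<lambda>n. G n z) \<longlonglongrightarrow> G m z" by (rule LIMSEQ_offset)
        then show "g z = G m z" unfolding g_def by (rule limI)
      qed
    qed
  qed
  have ex: "\<exists>m. S \<subseteq> interior (K m)" if S: "compact S" "S \<subseteq> \<Omega>" for S
  proof -
    from K(4)[THEN spec, THEN mp, THEN mp, OF S] obtain N where "\<forall>n\<ge>N. S \<subseteq> K n"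
      by (rule exE)
    then have "S \<subseteq> K N" by simp
    then have "S \<subseteq> interior (K (Suc N))" using K(5)[THEN spec, of N] by (rule order_trans)
    then show ?thesis by (rule exI)
  qed
  have gl: "locbdd \<Omega> g"
    unfolding locbdd_def
  proof (intro conjI allI impI gb)
    fix S assume "compact S" "S \<subseteq> \<Omega>"
    then obtain m where m: "S \<subseteq> interior (K m)" using ex by blast
    obtain C where C: "AE z in lborel. norm (G m z) \<le> C" using GC by blast
    show "\<exists>C. AE z in lborel. z \<in> S \<longrightarrow> norm (g z) \<le> C"
      by (rule exI[of _ C], use C gG[of m] in eventually_elim) (use m in auto)
  qed
  have "weak_d e \<Omega> w g"
    unfolding weak_d_def
  proof (intro conjI ballI w locbdd_imp_locint[OF gl])
    fix \<phi> assume \<phi>: "\<phi> \<in> test_fun \<Omega>"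
    obtain L where L: "L \<subseteq> \<Omega>" "\<And>z. z \<notin> L \<Longrightarrow> \<phi> z = 0" "compact L"
      using test_fun_supportE[OF \<phi>] by metis
    obtain m where m: "L \<subseteq> interior (K m)" using ex L by blast
    have \<phi>m: "\<phi> \<in> test_fun (interior (K m))" using \<phi> L m unfolding test_fun_iff by blast
    have m0: "\<phi> z = 0" if "z \<notin> K m" for z using L m that interior_subset by blast
    show "(LINT z|lborel. w z * pd e \<phi> z) = - (LINT z|lborel. g z * \<phi> z)"
      using GI[OF \<phi> m0] integral_test_cong_AE[OF gG \<phi>m gb Gb] by (simp only:)
  qed
  with gl show ?thesis by blast
qed

section \<open>Product and quotient rules for weak derivatives of locally bounded functions\<close>

section \<open>Product and quotient rules\<close>

lemma locbdd_test_bound: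
  assumes "locbdd \<Omega> h" "\<phi> \<in> test_fun \<Omega>"
  obtains C where "0 \<le> C" "AE z in lborel. norm (\<phi> z * h z) \<le> C"
proof -
  obtain L where L: "L \<subseteq> \<Omega>" "\<And>z. z \<notin> L \<Longrightarrow> \<phi> z = 0" "compact L"
    using test_fun_supportE[OF assms(2)] by metis
  obtain B where B: "0 < B" "\<And>z. norm (\<phi> z) \<le> B" using test_fun_bounded[OF assms(2)] by blast
  obtain C where C: "0 \<le> C" "AE z in lborel. z \<in> L \<longrightarrow> norm (h z) \<le> C" by (rule locbddE[OF assms(1) L(3,1)])
  have "AE z in lborel. norm (\<phi> z * h z) \<le> B * C"
    using C(2)
  proof eventually_elim
    case (elim z)
    show ?case
      using elim B C(1) L(2) by (cases "z \<in> L") (auto simp: norm_mult intro!: mult_mono)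
  qed
  then show ?thesis using B C by (intro that[of "B * C"]) auto
qed

text \<open>One factor is cut off and mollified; times \<phi> it is then a test function for the
  other factor. In the limit L1 convergence is paired with local boundedness, and the common factor
  \<open>moll_mass\<close> cancels.\<close>

lemma weak_d_mult:
  assumes \<Omega>: "open \<Omega>" and e: "e \<in> {1, \<i>}"
    and g: "weak_d e \<Omega> g g'" "locbdd \<Omega> g" "locbdd \<Omega> g'" and h: "weak_d e \<Omega> h h'" "locbdd \<Omega> h" "locbdd \<Omega> h'"
  shows "weak_d e \<Omega> (\<lambda>z. g z * h z) (\<lambda>z. g' z * h z + g z * h' z)"
  unfolding weak_d_def
proof (intro conjI ballI locbdd_imp_locint locbdd_add locbdd_mult g h)
  fix \<phi> assume \<phi>: "\<phi> \<in> test_fun \<Omega>"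
  obtain L where L: "L \<subseteq> \<Omega>" "\<And>z. z \<notin> L \<Longrightarrow> \<phi> z = 0" "\<And>z. z \<notin> L \<Longrightarrow> pd e \<phi> z = 0" "compact L"
    using test_fun_supportE[OF \<phi>] by metis
  obtain \<eta> U where \<eta>: "\<eta> \<in> test_fun \<Omega>" "open U" "L \<subseteq> U" "\<And>z. z \<in> U \<Longrightarrow> \<eta> z = 1"
    by (rule cutoff_exists[OF \<Omega> L(4,1)]) blast
  have \<eta>L: "\<eta> z = 1" "pd e \<eta> z = 0" if "z \<in> L" for z
    using \<eta>(3,4) that pd_eq_0_if_locally_const[OF \<eta>(2) _ \<eta>(4), where z = z and e = e] by auto
  define G where "G z = \<eta> z * g z" for z
  define G' where "G' z = \<eta> z * g' z + pd e \<eta> z * g z" for z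
  have G: "L1c G" unfolding G_def by (rule locint_test_mult[OF weak_dD(1)[OF g(1)] \<eta>(1)])
  have G': "L1c G'" unfolding G'_def
    by (intro L1c_add locint_test_mult[OF weak_dD(2)[OF g(1)] \<eta>(1)] locint_test_mult[OF weak_dD(1)[OF g(1)] test_fun_pd[OF \<eta>(1) e]])
  define gn where "gn n = conv G (moll (eps n))" for n
  have sm: "smooth (gn n)" for n unfolding gn_def by (rule smooth_conv[OF G smooth_moll[OF eps_pos]])
  have pdgn: "pd e (gn n) z = conv G' (moll (eps n)) z" for n z
    unfolding gn_def pd_conv[OF G smooth_moll[OF eps_pos] e] unfolding G_def G'_def
    by (rule conv_cutoff_weak_d[OF g(1) e \<eta>(1) smooth_moll[OF eps_pos]])
  have pd\<phi>: "pd e \<phi> \<in> test_fun \<Omega>" by (rule test_fun_pd[OF \<phi> e])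
  have lim: "(\<lambda>n. LINT z|lborel. conv P (moll (eps n)) z * (\<psi> z * k z)) \<longlonglongrightarrow> moll_mass * (LINT z|lborel. P z * (\<psi> z * k z))"
    if *: "L1c P" "\<psi> \<in> test_fun \<Omega>" "locbdd \<Omega> k" for P \<psi> k :: "complex \<Rightarrow> complex"
  proof -
    obtain C where "0 \<le> C" and C: "AE z in lborel. norm (\<psi> z * k z) \<le> C" by (rule locbdd_test_bound[OF *(3,2)])
    show ?thesis by (rule conv_moll_test_AE[OF *(1) locint_test_mult[OF locbdd_imp_locint[OF *(3)] *(2)] C])
  qed
  have eq: "(LINT z|lborel. gn n z * (pd e \<phi> z * h z)) + (LINT z|lborel. conv G' (moll (eps n)) z * (\<phi> z * h z))
      = - (LINT z|lborel. gn n z * (\<phi> z * h' z))" for n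
  proof -
    have t: "(\<lambda>z. \<phi> z * gn n z) \<in> test_fun \<Omega>" by (rule test_fun_mult[OF \<phi> sm])
    have i1: "integrable lborel (\<lambda>z. gn n z * (pd e \<phi> z * h z))"
      using locint_test_integrable[OF weak_dD(1)[OF h(1)] test_fun_mult[OF pd\<phi> sm[of n]]] by (simp add: mult_ac)
    have i2: "integrable lborel (\<lambda>z. conv G' (moll (eps n)) z * (\<phi> z * h z))"
      using locint_test_integrable[OF weak_dD(1)[OF h(1)] test_fun_mult[OF \<phi> smooth_conv[OF G' smooth_moll[OF eps_pos[of n]]]]] by (simp add: mult_ac)
    have "(LINT z|lborel. gn n z * (pd e \<phi> z * h z)) + (LINT z|lborel. conv G' (moll (eps n)) z * (\<phi> z * h z))
       = (LINT z|lborel. gn n z * (pd e \<phi> z * h z) + conv G' (moll (eps n)) z * (\<phi> z * h z))"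
      using i1 i2 by simp
    also have "\<dots> = (LINT z|lborel. h z * pd e (\<lambda>z. \<phi> z * gn n z) z)"
      by (rule Bochner_Integration.integral_cong) (simp_all add: pd_mult[OF test_fun_smooth[OF \<phi>] sm e] pdgn algebra_simps)
    also have "\<dots> = - (LINT z|lborel. h' z * (\<phi> z * gn n z))"
      by (rule weak_dD(3)[OF h(1) t])
    finally show ?thesis by (simp add: mult_ac)
  qed
  have "(\<lambda>n. (LINT z|lborel. gn n z * (pd e \<phi> z * h z)) + (LINT z|lborel. conv G' (moll (eps n)) z * (\<phi> z * h z)))
     \<longlonglongrightarrow> moll_mass * (LINT z|lborel. G z * (pd e \<phi> z * h z)) + moll_mass * (LINT z|lborel. G' z * (\<phi> z * h z))"
    unfolding gn_def by (intro tendsto_add lim G G' pd\<phi> \<phi> h)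
  moreover have "(\<lambda>n. - (LINT z|lborel. gn n z * (\<phi> z * h' z))) \<longlonglongrightarrow> - (moll_mass * (LINT z|lborel. G z * (\<phi> z * h' z)))"
    unfolding gn_def by (intro tendsto_minus lim G \<phi> h)
  ultimately have "moll_mass * (LINT z|lborel. G z * (pd e \<phi> z * h z)) + moll_mass * (LINT z|lborel. G' z * (\<phi> z * h z))
      = - (moll_mass * (LINT z|lborel. G z * (\<phi> z * h' z)))"
    unfolding eq using LIMSEQ_unique by blast
  then have "moll_mass * ((LINT z|lborel. G z * (pd e \<phi> z * h z)) + (LINT z|lborel. G' z * (\<phi> z * h z)))
      = moll_mass * (- (LINT z|lborel. G z * (\<phi> z * h' z)))"
    by (simp add: distrib_left)
  then have m: "(LINT z|lborel. G z * (pd e \<phi> z * h z)) + (LINT z|lborel. G' z * (\<phi> z * h z)) = - (LINT z|lborel. G z * (\<phi> z * h' z))"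
    by (rule mult_left_cancel[THEN iffD1, rotated]) (use moll_mass_pos in simp)
  have 1: "G z * (pd e \<phi> z * h z) = g z * h z * pd e \<phi> z" "G' z * (\<phi> z * h z) = (g' z * h z) * \<phi> z" "G z * (\<phi> z * h' z) = (g z * h' z) * \<phi> z" for z
    using L(2,3) \<eta>L by (cases "z \<in> L"; simp add: G_def G'_def)+
  have i: "integrable lborel (\<lambda>z. (g' z * h z) * \<phi> z)" "integrable lborel (\<lambda>z. (g z * h' z) * \<phi> z)"
    by (rule locint_test_integrable[OF locbdd_imp_locint[OF locbdd_mult[OF g(3) h(2)]] \<phi>],
        rule locint_test_integrable[OF locbdd_imp_locint[OF locbdd_mult[OF g(2) h(3)]] \<phi>])
  show "(LINT z|lborel. g z * h z * pd e \<phi> z) = - (LINT z|lborel. (g' z * h z + g z * h' z) * \<phi> z)"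
    using m i unfolding 1 by (simp add: distrib_right algebra_simps)
qed

text \<open>The mollifier is real and positive, so nonnegativity of the data is inherited.\<close>

lemma conv_nonneg_real:
  assumes "L1c w" "AE t in lborel. w t = complex_of_real (Re (w t)) \<and> 0 \<le> Re (w t)"
  obtains a where "0 \<le> a" "conv w (moll (eps n)) z = complex_of_real a"
proof -
  note [measurable] = L1c_borel[OF assms(1)] smooth_borel_measurable[OF smooth_moll[OF eps_pos]]
  define \<mu> where "\<mu> t = (eps n)\<^sup>2 * (1 / ((norm t)\<^sup>2 + (eps n)\<^sup>2))\<^sup>2" for t :: complex
  have [measurable]: "\<mu> \<in> borel_measurable borel" unfolding \<mu>_def by measurable
  have "conv w (moll (eps n)) z = (LINT t|lborel. complex_of_real (Re (w t) * \<mu> (z - t)))"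
    unfolding conv_def
  proof (rule integral_cong_AE)
    show "AE t in lborel. w t * moll (eps n) (z - t) = complex_of_real (Re (w t) * \<mu> (z - t))"
      using assms(2) by eventually_elim (simp add: moll_real \<mu>_def)
  qed measurable
  also have "\<dots> = complex_of_real (LINT t|lborel. Re (w t) * \<mu> (z - t))"
    by (rule integral_complex_of_real)
  finally have eq: "conv w (moll (eps n)) z = complex_of_real (LINT t|lborel. Re (w t) * \<mu> (z - t))" .
  have "0 \<le> (LINT t|lborel. Re (w t) * \<mu> (z - t))"
  proof (rule integral_nonneg_AE)
    show "AE t in lborel. 0 \<le> Re (w t) * \<mu> (z - t)"
      using assms(2) by eventually_elim (auto simp: \<mu>_def)
  qed
  then show ?thesis using eq that by blast
qed

text \<open>Smooth approximations that keep the lower bound \<open>a\<close> have reciprocals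
  bounded by \<open>inverse a\<close>, uniformly in n, and obey the classical rule. Real values are
  essential for this argument: averages of nonzero complex numbers may vanish.\<close>

lemma weak_d_inverse_real:
  assumes \<Omega>: "open \<Omega>" and e: "e \<in> {1, \<i>}"
    and r: "weak_d e \<Omega> r r'" "locbdd \<Omega> r" "locbdd \<Omega> r'" and a: "0 < a"
    and pos: "AE z in lborel. z \<in> \<Omega> \<longrightarrow> r z = complex_of_real (Re (r z)) \<and> a \<le> Re (r z)"
  shows "locbdd \<Omega> (\<lambda>z. inverse (r z))"
    and "weak_d e \<Omega> (\<lambda>z. inverse (r z)) (\<lambda>z. - 1 * (r' z * (inverse (r z) * inverse (r z))))"
proof -
  note [measurable] = locbdd_borel[OF r(2)] locbdd_borel[OF r(3)]
  have rn: "AE z in lborel. z \<in> \<Omega> \<longrightarrow> norm (inverse (r z)) \<le> inverse a"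
    using pos
  proof eventually_elim
    case (elim z)
    then show ?case using a by (metis abs_of_nonneg le_imp_inverse_le less_le_trans norm_inverse norm_of_real order_less_imp_le)
  qed
  show li: "locbdd \<Omega> (\<lambda>z. inverse (r z))"
    by (rule locbdd_bounded[OF _ rn]) measurable
  have l': "locbdd \<Omega> (\<lambda>z. - 1 * (r' z * (inverse (r z) * inverse (r z))))"
    by (intro locbdd_cmult locbdd_mult r li)
  show "weak_d e \<Omega> (\<lambda>z. inverse (r z)) (\<lambda>z. - 1 * (r' z * (inverse (r z) * inverse (r z))))"
    unfolding weak_d_def
  proof (intro conjI ballI locbdd_imp_locint[OF li] locbdd_imp_locint[OF l'])
    fix \<phi> assume \<phi>: "\<phi> \<in> test_fun \<Omega>"
    note [measurable] = smooth_borel_measurable[OF test_fun_smooth[OF \<phi>]] smooth_borel_measurable[OF smooth_pd[OF test_fun_smooth[OF \<phi>] e]]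
    obtain L where L: "L \<subseteq> \<Omega>" "\<And>z. z \<notin> L \<Longrightarrow> \<phi> z = 0" "\<And>z. z \<notin> L \<Longrightarrow> pd e \<phi> z = 0" "compact L"
      using test_fun_supportE[OF \<phi>] by metis
    obtain \<eta> U where \<eta>: "\<eta> \<in> test_fun \<Omega>" "\<And>z. \<eta> z \<in> \<real>" "\<And>z. 0 \<le> Re (\<eta> z)" "open U" "L \<subseteq> U" "\<And>z. z \<in> U \<Longrightarrow> \<eta> z = 1"
      by (rule cutoff_exists[OF \<Omega> L(4,1)]) blast
    have \<eta>L: "\<eta> z = 1" "pd e \<eta> z = 0" if "z \<in> L" for z
      using \<eta>(5,6) that pd_eq_0_if_locally_const[OF \<eta>(4) _ \<eta>(6), where z = z and e = e] by auto
    \<comment> \<open>\<open>a\<close> is subtracted before the cutoff and restored in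
      \<open>s\<close> after mollification; cutting off \<open>r\<close> itself would destroy the
      lower bound outside the support.\<close>
    define q where "q z = r z + complex_of_real (- a)" for z
    have q: "weak_d e \<Omega> q r'"
      using weak_d_add[OF r(1) weak_d_const[OF e, of \<Omega> "complex_of_real (- a)"] e] unfolding q_def by simp
    define Q where "Q z = \<eta> z * q z" for z
    define Q' where "Q' z = \<eta> z * r' z + pd e \<eta> z * q z" for z
    have Q: "L1c Q" unfolding Q_def by (rule locint_test_mult[OF weak_dD(1)[OF q] \<eta>(1)])
    have Q': "L1c Q'" unfolding Q'_def
      by (intro L1c_add locint_test_mult[OF weak_dD(2)[OF q] \<eta>(1)] locint_test_mult[OF weak_dD(1)[OF q] test_fun_pd[OF \<eta>(1) e]])
    note [measurable] = L1c_borel[OF Q] L1c_borel[OF Q']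
    have Qpos: "AE z in lborel. Q z = complex_of_real (Re (Q z)) \<and> 0 \<le> Re (Q z)"
      using pos
    proof eventually_elim
      case (elim z)
      obtain L' where L': "L' \<subseteq> \<Omega>" "\<And>z. z \<notin> L' \<Longrightarrow> \<eta> z = 0" using test_fun_supportE[OF \<eta>(1)] by metis
      show ?case
      proof (cases "z \<in> \<Omega>")
        case True
        obtain y where y: "\<eta> z = complex_of_real y" using \<eta>(2)[of z] by (auto elim: Reals_cases)
        have "r z = complex_of_real (Re (r z))" "a \<le> Re (r z)" using elim True by auto
        then have "Q z = complex_of_real (y * (Re (r z) - a))"
          unfolding Q_def q_def y by (metis of_real_add of_real_mult of_real_minus add_uminus_conv_diff of_real_diff)
        then show ?thesis using \<eta>(3)[of z] y \<open>a \<le> Re (r z)\<close> by simp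
      next
        case False
        then have "\<eta> z = 0" using L' by blast
        then show ?thesis by (simp add: Q_def)
      qed
    qed
    define s where "s n z = complex_of_real a + complex_of_real (1 / moll_mass) * conv Q (moll (eps n)) z" for n z
    have sn: "\<exists>b. a \<le> b \<and> s n z = complex_of_real b" for n z
    proof -
      obtain b where b: "0 \<le> b" "conv Q (moll (eps n)) z = complex_of_real b" by (rule conv_nonneg_real[OF Q Qpos])
      show ?thesis
        using b moll_mass_pos by (intro exI[of _ "a + 1 / moll_mass * b"]) (simp add: s_def)
    qed
    have s0: "s n z \<noteq> 0" for n z using sn[of n z] a by auto
    have sinv: "norm (inverse (s n z)) \<le> inverse a" for n z
      using sn[of n z] a by (auto simp: norm_inverse intro!: le_imp_inverse_le simp del: inverse_inverse_eq)
    have ss: "smooth (s n)" for n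
      unfolding s_def by (intro smooth_add smooth_const smooth_cmult smooth_conv[OF Q smooth_moll[OF eps_pos]])
    have ssi: "smooth (\<lambda>z. inverse (s n z))" for n by (rule smooth_inverse[OF ss s0])
    note [measurable] = smooth_borel_measurable[OF ss] smooth_borel_measurable[OF ssi]
    have pds: "pd e (s n) z = complex_of_real (1 / moll_mass) * conv Q' (moll (eps n)) z" for n z
    proof -
      have "pd e (s n) z = complex_of_real (1 / moll_mass) * pd e (conv Q (moll (eps n))) z"
      proof -
        note sc = smooth_conv[OF Q smooth_moll[OF eps_pos[of n]]]
        show ?thesis
          unfolding s_def pd_add[OF smooth_const smooth_cmult[OF sc] e] pd_const pd_cmult[OF sc e] by simp
      qed
      also have "pd e (conv Q (moll (eps n))) z = conv Q' (moll (eps n)) z"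
        unfolding pd_conv[OF Q smooth_moll[OF eps_pos] e] unfolding Q_def Q'_def
        by (rule conv_cutoff_weak_d[OF q e \<eta>(1) smooth_moll[OF eps_pos]])
      finally show ?thesis .
    qed
    \<comment> \<open>The derivative of the reciprocal puts two factors
      \<open>inverse (s n z)\<close> into the test function, which therefore depends on n but stays
      uniformly bounded.\<close>
    define \<psi> where "\<psi> n z = \<phi> z * (inverse (s n z) * inverse (s n z))" for n z
    have \<psi>t: "\<psi> n \<in> test_fun \<Omega>" for n
      unfolding \<psi>_def by (intro test_fun_mult[OF \<phi>] smooth_mult ssi)
    obtain B where B: "0 < B" "\<And>z. norm (\<phi> z) \<le> B" using test_fun_bounded[OF \<phi>] by blast
    have inva: "0 < inverse a" using a by simp
    have \<psi>b: "norm (\<psi> n z) \<le> B * (inverse a * inverse a)" for n z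
      unfolding \<psi>_def norm_mult using B sinv[of n z] inva by (intro mult_mono) auto
    have eq: "moll_mass * (LINT z|lborel. inverse (s n z) * pd e \<phi> z) = (LINT z|lborel. conv Q' (moll (eps n)) z * \<psi> n z)" for n
    proof -
      have "(LINT z|lborel. inverse (s n z) * pd e \<phi> z) = - (LINT z|lborel. pd e (\<lambda>z. inverse (s n z)) z * \<phi> z)"
        by (rule integral_by_parts_smooth[OF \<phi> ssi e])
      also have "(LINT z|lborel. pd e (\<lambda>z. inverse (s n z)) z * \<phi> z) = (LINT z|lborel. - complex_of_real (1 / moll_mass) * (conv Q' (moll (eps n)) z * \<psi> n z))"
        by (rule Bochner_Integration.integral_cong) (simp_all add: pd_inverse[OF ss s0 e] pds \<psi>_def)
      finally show ?thesis using moll_mass_pos by simp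
    qed
    obtain \<rho> where \<rho>: "strict_mono \<rho>" "AE z in lborel. (\<lambda>n. conv Q (moll (eps (\<rho> n))) z) \<longlonglongrightarrow> moll_mass * Q z"
      by (rule conv_moll_AE[OF Q])
    have slim: "AE z in lborel. z \<in> L \<longrightarrow> (\<lambda>n. inverse (s (\<rho> n) z)) \<longlonglongrightarrow> inverse (r z)"
      using \<rho>(2) pos
    proof eventually_elim
      case (elim z)
      show ?case
      proof
        assume z: "z \<in> L"
        have rz: "r z \<noteq> 0" using elim z L(1) a by (metis Re_complex_of_real not_less subsetD of_real_0)
        have "(\<lambda>n. s (\<rho> n) z) \<longlonglongrightarrow> complex_of_real a + complex_of_real (1 / moll_mass) * (moll_mass * Q z)"
          unfolding s_def by (intro tendsto_add tendsto_mult tendsto_const elim)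
        also have "complex_of_real a + complex_of_real (1 / moll_mass) * (moll_mass * Q z) = r z"
          using z \<eta>L moll_mass_pos by (simp add: Q_def q_def)
        finally show "(\<lambda>n. inverse (s (\<rho> n) z)) \<longlonglongrightarrow> inverse (r z)"
          using rz by (rule tendsto_inverse)
      qed
    qed
    have l1: "(\<lambda>n. LINT z|lborel. inverse (s (\<rho> n) z) * pd e \<phi> z) \<longlonglongrightarrow> (LINT z|lborel. inverse (r z) * pd e \<phi> z)"
    proof (rule integral_dominated_convergence)
      show "integrable lborel (\<lambda>z. inverse a * norm (pd e \<phi> z))"
        using L1c_integrable[OF test_fun_L1c[OF test_fun_pd[OF \<phi> e]]] by auto
      show "AE z in lborel. (\<lambda>n. inverse (s (\<rho> n) z) * pd e \<phi> z) \<longlonglongrightarrow> inverse (r z) * pd e \<phi> z"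
        using slim
      proof eventually_elim
        case (elim z)
        then show ?case using L(3) by (cases "z \<in> L") (auto intro: tendsto_mult)
      qed
      show "AE z in lborel. norm (inverse (s (\<rho> n) z) * pd e \<phi> z) \<le> inverse a * norm (pd e \<phi> z)" for n
        unfolding norm_mult by (intro AE_I2 mult_right_mono sinv) simp
    qed measurable
    define \<psi>0 where "\<psi>0 z = \<phi> z * (inverse (r z) * inverse (r z))" for z
    have l2: "(\<lambda>n. LINT z|lborel. Q' z * \<psi> (\<rho> n) z) \<longlonglongrightarrow> (LINT z|lborel. Q' z * \<psi>0 z)"
    proof (rule integral_dominated_convergence)
      show "integrable lborel (\<lambda>z. norm (Q' z) * (B * (inverse a * inverse a)))"
        using L1c_integrable[OF Q'] by auto
      show "AE z in lborel. (\<lambda>n. Q' z * \<psi> (\<rho> n) z) \<longlonglongrightarrow> Q' z * \<psi>0 z"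
        using slim
      proof eventually_elim
        case (elim z)
        then show ?case unfolding \<psi>_def \<psi>0_def using L(2) by (cases "z \<in> L") (auto intro!: tendsto_mult)
      qed
      show "AE z in lborel. norm (Q' z * \<psi> (\<rho> n) z) \<le> norm (Q' z) * (B * (inverse a * inverse a))" for n
        unfolding norm_mult by (intro AE_I2 mult_left_mono \<psi>b) simp
    qed (unfold \<psi>_def \<psi>0_def, measurable)
    have "(\<lambda>n. (LINT z|lborel. conv Q' (moll (eps n)) z * \<psi> n z) - moll_mass * (LINT z|lborel. Q' z * \<psi> n z)) \<longlonglongrightarrow> 0"
      by (rule conv_moll_test_seq[OF Q' test_fun_L1c[OF \<psi>t] \<psi>b])
    from LIMSEQ_subseq_LIMSEQ[OF this \<rho>(1)]
    have "(\<lambda>n. (LINT z|lborel. conv Q' (moll (eps (\<rho> n))) z * \<psi> (\<rho> n) z) - moll_mass * (LINT z|lborel. Q' z * \<psi> (\<rho> n) z)) \<longlonglongrightarrow> 0"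
      by (simp add: o_def)
    moreover have "(\<lambda>n. moll_mass * (LINT z|lborel. Q' z * \<psi> (\<rho> n) z)) \<longlonglongrightarrow> moll_mass * (LINT z|lborel. Q' z * \<psi>0 z)"
      by (intro tendsto_mult tendsto_const l2)
    ultimately have "(\<lambda>n. ((LINT z|lborel. conv Q' (moll (eps (\<rho> n))) z * \<psi> (\<rho> n) z) - moll_mass * (LINT z|lborel. Q' z * \<psi> (\<rho> n) z))
        + moll_mass * (LINT z|lborel. Q' z * \<psi> (\<rho> n) z)) \<longlonglongrightarrow> 0 + moll_mass * (LINT z|lborel. Q' z * \<psi>0 z)"
      by (rule tendsto_add)
    then have "(\<lambda>n. moll_mass * (LINT z|lborel. inverse (s (\<rho> n) z) * pd e \<phi> z)) \<longlonglongrightarrow> moll_mass * (LINT z|lborel. Q' z * \<psi>0 z)"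
      unfolding eq by simp
    moreover have "(\<lambda>n. moll_mass * (LINT z|lborel. inverse (s (\<rho> n) z) * pd e \<phi> z)) \<longlonglongrightarrow> moll_mass * (LINT z|lborel. inverse (r z) * pd e \<phi> z)"
      by (intro tendsto_mult tendsto_const l1)
    ultimately have "moll_mass * (LINT z|lborel. inverse (r z) * pd e \<phi> z) = moll_mass * (LINT z|lborel. Q' z * \<psi>0 z)"
      using LIMSEQ_unique by blast
    then have "(LINT z|lborel. inverse (r z) * pd e \<phi> z) = (LINT z|lborel. Q' z * \<psi>0 z)"
      using moll_mass_pos by simp
    also have "\<dots> = (LINT z|lborel. - (- 1 * (r' z * (inverse (r z) * inverse (r z))) * \<phi> z))"
    proof (rule Bochner_Integration.integral_cong[OF refl])
      fix z
      show "Q' z * \<psi>0 z = - (- 1 * (r' z * (inverse (r z) * inverse (r z))) * \<phi> z)"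
        using L(2) \<eta>L by (cases "z \<in> L") (simp_all add: Q'_def \<psi>0_def)
    qed
    also have "\<dots> = - (LINT z|lborel. - 1 * (r' z * (inverse (r z) * inverse (r z))) * \<phi> z)"
      by (rule Bochner_Integration.integral_minus)
    finally show "(LINT z|lborel. inverse (r z) * pd e \<phi> z) = - (LINT z|lborel. - 1 * (r' z * (inverse (r z) * inverse (r z))) * \<phi> z)" .
  qed
qed

text \<open>Reduction to the real case through \<open>1 / f = cnj f / |f|^2\<close>, where the
  denominator is real and bounded below.\<close>

lemma weak_d_inverse:
  assumes \<Omega>: "open \<Omega>" and e: "e \<in> {1, \<i>}"
    and f: "weak_d e \<Omega> f f'" "locbdd \<Omega> f" "locbdd \<Omega> f'"
    and nz: "AE z in lborel. z \<in> \<Omega> \<longrightarrow> f z \<noteq> 0" and M: "AE z in lborel. z \<in> \<Omega> \<longrightarrow> norm (inverse (f z)) \<le> M"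
  shows "weak_d e \<Omega> (\<lambda>z. inverse (f z)) (\<lambda>z. - 1 * (f' z * (inverse (f z) * inverse (f z))))"
proof -
  note [measurable] = locbdd_borel[OF f(2)] locbdd_borel[OF f(3)]
  \<comment> \<open>Adding 1 keeps \<open>N\<close> positive for every \<open>M\<close>; the lower
    bound of \<open>|f|^2\<close> is then \<open>inverse (N^2)\<close>.\<close>
  define N where "N = \<bar>M\<bar> + 1"
  have N: "0 < N" by (simp add: N_def)
  define r where "r z = f z * cnj (f z)" for z
  define r' where "r' z = f' z * cnj (f z) + f z * cnj (f' z)" for z
  have r: "weak_d e \<Omega> r r'"
    unfolding r_def r'_def by (intro weak_d_mult \<Omega> e f weak_d_cnj locbdd_cnj)
  have lr: "locbdd \<Omega> r" "locbdd \<Omega> r'"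
    unfolding r_def r'_def by (intro locbdd_add locbdd_mult locbdd_cnj f)+
  have pos: "AE z in lborel. z \<in> \<Omega> \<longrightarrow> r z = complex_of_real (Re (r z)) \<and> inverse (N\<^sup>2) \<le> Re (r z)"
    using nz M
  proof eventually_elim
    case (elim z)
    show ?case
    proof
      assume z: "z \<in> \<Omega>"
      have rr: "r z = complex_of_real ((norm (f z))\<^sup>2)" by (simp only: r_def complex_norm_square)
      have "norm (f z) > 0" "inverse (norm (f z)) \<le> N" using elim z by (auto simp: N_def norm_inverse)
      then have "inverse N \<le> norm (f z)"
        using N by (metis inverse_inverse_eq le_imp_inverse_le positive_imp_inverse_positive)
      then have "(inverse N)\<^sup>2 \<le> (norm (f z))\<^sup>2" using N by (intro power_mono) auto
      then show "r z = complex_of_real (Re (r z)) \<and> inverse (N\<^sup>2) \<le> Re (r z)"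
        unfolding rr by (simp add: power_inverse)
    qed
  qed
  have iN: "0 < inverse (N\<^sup>2)" using N by simp
  note inv = weak_d_inverse_real[OF \<Omega> e r lr iN pos]
  have l': "locbdd \<Omega> (\<lambda>z. - 1 * (r' z * (inverse (r z) * inverse (r z))))"
    by (intro locbdd_cmult locbdd_mult lr inv(1))
  have w: "weak_d e \<Omega> (\<lambda>z. cnj (f z) * inverse (r z))
      (\<lambda>z. cnj (f' z) * inverse (r z) + cnj (f z) * (- 1 * (r' z * (inverse (r z) * inverse (r z)))))"
    by (intro weak_d_mult \<Omega> e weak_d_cnj f locbdd_cnj inv l')
  have eq: "(\<lambda>z. cnj (f z) * inverse (r z)) = (\<lambda>z. inverse (f z))"
  proof
    fix z show "cnj (f z) * inverse (r z) = inverse (f z)"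
      by (cases "f z = 0") (simp_all add: r_def)
  qed
  have li: "locbdd \<Omega> (\<lambda>z. inverse (f z))" by (rule locbdd_bounded[OF _ M]) measurable
  show ?thesis
  proof (rule weak_d_cong[OF w[unfolded eq]])
    show "AE z in lborel. z \<in> \<Omega> \<longrightarrow> cnj (f' z) * inverse (r z) + cnj (f z) * (- 1 * (r' z * (inverse (r z) * inverse (r z))))
        = - 1 * (f' z * (inverse (f z) * inverse (f z)))"
      using nz
    proof eventually_elim
      case (elim z)
      then show ?case by (auto simp: r_def r'_def field_simps)
    qed
    show "locint \<Omega> (\<lambda>z. - 1 * (f' z * (inverse (f z) * inverse (f z))))"
      by (intro locbdd_imp_locint locbdd_cmult locbdd_mult f li)
  qed
qed

section \<open>Commuting mixed derivatives and divergence-free rotated gradients\<close>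

section \<open>Symmetry of second derivatives\<close>

lemma pd_moll:
  assumes "0 < \<epsilon>"
  shows "pd 1 (moll \<epsilon>) = (\<lambda>z. (- 4 * complex_of_real (\<epsilon>\<^sup>2)) * (complex_of_real (Re z) * (sker \<epsilon> z * (sker \<epsilon> z * sker \<epsilon> z))))"
    "pd \<i> (moll \<epsilon>) = (\<lambda>z. (- 4 * complex_of_real (\<epsilon>\<^sup>2)) * (complex_of_real (Im z) * (sker \<epsilon> z * (sker \<epsilon> z * sker \<epsilon> z))))"
proof -
  note s = smooth_sker[OF assms]
  have "pd e (moll \<epsilon>) z = complex_of_real (\<epsilon>\<^sup>2) * (2 * (sker \<epsilon> z * pd e (sker \<epsilon>) z))" if "e \<in> {1, \<i>}" for e z
    unfolding moll_def pd_cmult[OF smooth_mult[OF s s] that] pd_mult[OF s s that] by simp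
  then show "pd 1 (moll \<epsilon>) = (\<lambda>z. (- 4 * complex_of_real (\<epsilon>\<^sup>2)) * (complex_of_real (Re z) * (sker \<epsilon> z * (sker \<epsilon> z * sker \<epsilon> z))))"
    "pd \<i> (moll \<epsilon>) = (\<lambda>z. (- 4 * complex_of_real (\<epsilon>\<^sup>2)) * (complex_of_real (Im z) * (sker \<epsilon> z * (sker \<epsilon> z * sker \<epsilon> z))))"
    by (auto simp: pd_sker[OF assms] fun_eq_iff)
qed

text \<open>Both sides equal \<open>24 \<epsilon>^2 x y / (|z|^2 + \<epsilon>^2)^4\<close>.\<close>

lemma pd_pd_moll:
  assumes "0 < \<epsilon>"
  shows "pd 1 (pd \<i> (moll \<epsilon>)) z = pd \<i> (pd 1 (moll \<epsilon>)) z"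
proof -
  note s = smooth_sker[OF assms]
  note ss = smooth_mult[OF s s]
  note sss = smooth_mult[OF s ss]
  have c: "pd e (\<lambda>z. sker \<epsilon> z * (sker \<epsilon> z * sker \<epsilon> z)) z = 3 * (sker \<epsilon> z * sker \<epsilon> z) * pd e (sker \<epsilon>) z" if "e \<in> {1, \<i>}" for e
    by (simp add: pd_mult[OF s ss that] pd_mult[OF s s that] algebra_simps)
  have R: "pd \<i> (\<lambda>z. complex_of_real (Re z)) z = 0"
    by (rule pd_eqI[where D = "\<lambda>h. complex_of_real (Re h)", THEN trans]) (auto intro!: derivative_eq_intros)
  have I: "pd 1 (\<lambda>z. complex_of_real (Im z)) z = 0"
    by (rule pd_eqI[where D = "\<lambda>h. complex_of_real (Im h)", THEN trans]) (auto intro!: derivative_eq_intros)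
  have "pd 1 (pd \<i> (moll \<epsilon>)) z = (- 4 * complex_of_real (\<epsilon>\<^sup>2)) * (complex_of_real (Im z) * (3 * (sker \<epsilon> z * sker \<epsilon> z) * pd 1 (sker \<epsilon>) z))"
    unfolding pd_moll[OF assms] by (subst pd_cmult) (auto intro: smooth_mult smooth_Im sss simp: pd_mult[OF smooth_Im sss] c I)
  moreover have "pd \<i> (pd 1 (moll \<epsilon>)) z = (- 4 * complex_of_real (\<epsilon>\<^sup>2)) * (complex_of_real (Re z) * (3 * (sker \<epsilon> z * sker \<epsilon> z) * pd \<i> (sker \<epsilon>) z))"
    unfolding pd_moll[OF assms] by (subst pd_cmult) (auto intro: smooth_mult smooth_Re sss simp: pd_mult[OF smooth_Re sss] c R)
  ultimately show ?thesis by (simp add: pd_sker[OF assms])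
qed

text \<open>Under convolution derivatives can be moved from \<phi> to the mollifier and back, so the
  explicit symmetry of the mollifier makes every mollification of the difference vanish. An almost
  everywhere identity is enough under the integral.\<close>

lemma AE_pd_commute:
  assumes \<phi>: "\<phi> \<in> test_fun \<Omega>"
  shows "AE z in lborel. pd 1 (pd \<i> \<phi>) z = pd \<i> (pd 1 \<phi>) z"
proof -
  \<comment> \<open>The cutoff identity for the constant function 1, whose weak derivative is 0,
    with \<psi> in the role of the cutoff.\<close>
  have move: "conv \<psi> (pd e \<kappa>) z = conv (pd e \<psi>) \<kappa> z" if "\<psi> \<in> test_fun \<Omega>" "smooth \<kappa>" "e \<in> {1, \<i>}" for \<psi> \<kappa> e z
    using conv_cutoff_weak_d[OF weak_d_const[OF that(3), of \<Omega> 1] that(3,1,2)] by simp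
  have t: "pd 1 \<phi> \<in> test_fun \<Omega>" "pd \<i> \<phi> \<in> test_fun \<Omega>" using test_fun_pd[OF \<phi>] by auto
  have t2: "pd 1 (pd \<i> \<phi>) \<in> test_fun \<Omega>" "pd \<i> (pd 1 \<phi>) \<in> test_fun \<Omega>"
    using test_fun_pd[OF t(1)] test_fun_pd[OF t(2)] by auto
  define q where "q z = pd 1 (pd \<i> \<phi>) z + (- 1) * pd \<i> (pd 1 \<phi>) z" for z
  have q: "q \<in> test_fun \<Omega>" unfolding q_def by (intro test_fun_add test_fun_cmult t2)
  have 0: "conv q (moll (eps n)) z = 0" for n z
  proof -
    let ?m = "moll (eps n)"
    have sm: "smooth ?m" "smooth (pd 1 ?m)" "smooth (pd \<i> ?m)" using smooth_moll[OF eps_pos] smooth_pd by auto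
    have "conv (pd 1 (pd \<i> \<phi>)) ?m z = conv \<phi> (pd \<i> (pd 1 ?m)) z"
      using move[OF t(2) sm(1), of 1] move[OF \<phi> sm(2), of \<i>] by simp
    also have "\<dots> = conv \<phi> (pd 1 (pd \<i> ?m)) z" using pd_pd_moll[OF eps_pos] by (simp add: conv_def)
    also have "\<dots> = conv (pd \<i> (pd 1 \<phi>)) ?m z"
      using move[OF t(1) sm(1), of \<i>] move[OF \<phi> sm(3), of 1] by simp
    finally have eq: "conv (pd 1 (pd \<i> \<phi>)) ?m z = conv (pd \<i> (pd 1 \<phi>)) ?m z" .
    have "conv q ?m z = (LINT t|lborel. pd 1 (pd \<i> \<phi>) t * ?m (z - t) - pd \<i> (pd 1 \<phi>) t * ?m (z - t))"
      unfolding conv_def q_def by (simp add: algebra_simps)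
    also have "\<dots> = conv (pd 1 (pd \<i> \<phi>)) ?m z - conv (pd \<i> (pd 1 \<phi>)) ?m z"
      unfolding conv_def by (intro Bochner_Integration.integral_diff conv_integrable test_fun_L1c[OF t2(1)] test_fun_L1c[OF t2(2)] smooth_continuous sm)
    finally show ?thesis using eq by simp
  qed
  obtain r where "AE z in lborel. (\<lambda>n. conv q (moll (eps (r n))) z) \<longlonglongrightarrow> moll_mass * q z"
    by (rule conv_moll_AE[OF test_fun_L1c[OF q]])
  then show ?thesis
  proof eventually_elim
    case (elim z)
    then have "moll_mass * q z = 0" unfolding 0 by (simp add: LIMSEQ_const_iff)
    then show ?case using moll_mass_pos by (simp add: q_def)
  qed
qed

text \<open>The field \<open>(v\<^sub>y, - v\<^sub>x)\<close> is divergence free: each integral is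
  minus that of \<open>v\<close> against one order of the mixed second derivative of \<phi>.\<close>

lemma weak_d_curl:
  assumes x: "weak_d 1 \<Omega> v vx" and y: "weak_d \<i> \<Omega> v vy" and \<phi>: "\<phi> \<in> test_fun \<Omega>"
  shows "(LINT z|lborel. vy z * pd 1 \<phi> z) = (LINT z|lborel. vx z * pd \<i> \<phi> z)"
proof -
  have t: "pd 1 \<phi> \<in> test_fun \<Omega>" "pd \<i> \<phi> \<in> test_fun \<Omega>" using test_fun_pd[OF \<phi>] by auto
  note [measurable] = locint_borel[OF weak_dD(1)[OF x]]
    smooth_borel_measurable[OF smooth_pd_1[OF test_fun_smooth[OF t(2)]]] smooth_borel_measurable[OF smooth_pd_i[OF test_fun_smooth[OF t(1)]]]
  have "(LINT z|lborel. v z * pd \<i> (pd 1 \<phi>) z) = (LINT z|lborel. v z * pd 1 (pd \<i> \<phi>) z)"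
  proof (rule integral_cong_AE)
    show "AE z in lborel. v z * pd \<i> (pd 1 \<phi>) z = v z * pd 1 (pd \<i> \<phi>) z"
      using AE_pd_commute[OF \<phi>] by eventually_elim simp
  qed measurable
  then show ?thesis
    using weak_dD(3)[OF y t(1)] weak_dD(3)[OF x t(2)] by simp
qed

section \<open>Regularity of Vekua solutions and the conjugate pair of gradients\<close>

section \<open>Regularity for the main Vekua equation\<close>

lemma locbdd_AE_null:
  assumes "locbdd \<Omega> g" "compact K" "K \<subseteq> \<Omega>"
  obtains C N where "0 \<le> C" "N \<in> null_sets lborel" "\<And>z. z \<in> K \<Longrightarrow> z \<notin> N \<Longrightarrow> norm (g z) \<le> C"
proof -
  obtain C where C: "0 \<le> C" "AE z in lborel. z \<in> K \<longrightarrow> norm (g z) \<le> C" by (rule locbddE[OF assms])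
  from AE_E3[OF C(2)] obtain N where "\<And>z. z \<in> space lborel - N \<Longrightarrow> z \<in> K \<longrightarrow> norm (g z) \<le> C" "N \<in> null_sets lborel"
    by metis
  then show ?thesis using C(1) by (intro that[of C N]) auto
qed

lemma hoelder_ae_mult:
  assumes g: "hoelder_ae K g" "locbdd \<Omega> g" and h: "hoelder_ae K h" "locbdd \<Omega> h" and K: "compact K" "K \<subseteq> \<Omega>"
  shows "hoelder_ae K (\<lambda>z. g z * h z)"
proof -
  obtain H1 N1 where 1: "0 \<le> H1" "N1 \<in> null_sets lborel"
    "\<And>z z'. z \<in> K \<Longrightarrow> z \<notin> N1 \<Longrightarrow> z' \<in> K \<Longrightarrow> z' \<notin> N1 \<Longrightarrow> norm (g z - g z') \<le> H1 * norm (z - z') powr (1/2)"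
    using hoelder_aeE[OF g(1)] by metis
  obtain H2 N2 where 2: "0 \<le> H2" "N2 \<in> null_sets lborel"
    "\<And>z z'. z \<in> K \<Longrightarrow> z \<notin> N2 \<Longrightarrow> z' \<in> K \<Longrightarrow> z' \<notin> N2 \<Longrightarrow> norm (h z - h z') \<le> H2 * norm (z - z') powr (1/2)"
    using hoelder_aeE[OF h(1)] by metis
  obtain C3 N3 where 3: "0 \<le> C3" "N3 \<in> null_sets lborel" "\<And>z. z \<in> K \<Longrightarrow> z \<notin> N3 \<Longrightarrow> norm (g z) \<le> C3"
    using locbdd_AE_null[OF g(2) K] by metis
  obtain C4 N4 where 4: "0 \<le> C4" "N4 \<in> null_sets lborel" "\<And>z. z \<in> K \<Longrightarrow> z \<notin> N4 \<Longrightarrow> norm (h z) \<le> C4"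
    using locbdd_AE_null[OF h(2) K] by metis
  show ?thesis
    unfolding hoelder_ae_def
  proof (intro exI conjI ballI)
    show "0 \<le> C3 * H2 + C4 * H1" using 1 2 3 4 by simp
    show "N1 \<union> N2 \<union> (N3 \<union> N4) \<in> null_sets lborel" using 1 2 3 4 by auto
    fix z z' assume z: "z \<in> K - (N1 \<union> N2 \<union> (N3 \<union> N4))" "z' \<in> K - (N1 \<union> N2 \<union> (N3 \<union> N4))"
    define p where "p = norm (z - z') powr (1/2)"
    have "g z * h z - g z' * h z' = g z * (h z - h z') + (g z - g z') * h z'"
      by (simp add: algebra_simps)
    then have "norm (g z * h z - g z' * h z') \<le> norm (g z) * norm (h z - h z') + norm (g z - g z') * norm (h z')"
      using norm_triangle_ineq[of "g z * (h z - h z')" "(g z - g z') * h z'"] by (simp add: norm_mult)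
    also have "\<dots> \<le> C3 * (H2 * p) + (H1 * p) * C4"
      using 1 2 3 4 z unfolding p_def by (intro add_mono mult_mono) auto
    finally show "norm (g z * h z - g z' * h z') \<le> (C3 * H2 + C4 * H1) * norm (z - z') powr (1/2)"
      by (simp add: p_def algebra_simps)
  qed
qed

lemma hoelder_ae_inverse:
  assumes g: "hoelder_ae K g" "locbdd \<Omega> (\<lambda>z. inverse (g z))" and K: "compact K" "K \<subseteq> \<Omega>"
    and nz: "\<And>z. z \<in> K \<Longrightarrow> g z \<noteq> 0"
  shows "hoelder_ae K (\<lambda>z. inverse (g z))"
proof -
  obtain H1 N1 where 1: "0 \<le> H1" "N1 \<in> null_sets lborel"
    "\<And>z z'. z \<in> K \<Longrightarrow> z \<notin> N1 \<Longrightarrow> z' \<in> K \<Longrightarrow> z' \<notin> N1 \<Longrightarrow> norm (g z - g z') \<le> H1 * norm (z - z') powr (1/2)"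
    using hoelder_aeE[OF g(1)] by metis
  obtain C3 N3 where 3: "0 \<le> C3" "N3 \<in> null_sets lborel" "\<And>z. z \<in> K \<Longrightarrow> z \<notin> N3 \<Longrightarrow> norm (inverse (g z)) \<le> C3"
    using locbdd_AE_null[OF g(2) K] by metis
  show ?thesis
    unfolding hoelder_ae_def
  proof (intro exI conjI ballI)
    show "0 \<le> C3 * H1 * C3" using 1 3 by simp
    show "N1 \<union> N3 \<in> null_sets lborel" using 1 3 by auto
    fix z z' assume z: "z \<in> K - (N1 \<union> N3)" "z' \<in> K - (N1 \<union> N3)"
    define p where "p = norm (z - z') powr (1/2)"
    have "inverse (g z) - inverse (g z') = - (inverse (g z) * (g z - g z') * inverse (g z'))"
      using nz z by (intro inverse_diff_inverse) auto
    then have "norm (inverse (g z) - inverse (g z')) = norm (inverse (g z)) * norm (g z - g z') * norm (inverse (g z'))"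
      by (simp only: norm_minus_cancel norm_mult)
    also have "\<dots> \<le> C3 * (H1 * p) * C3"
      using 1 3 z unfolding p_def by (intro mult_mono) auto
    finally show "norm (inverse (g z) - inverse (g z')) \<le> C3 * H1 * C3 * norm (z - z') powr (1/2)"
      by (simp add: p_def mult_ac)
  qed
qed

text \<open>Boundedness is obtained for both components at once. After that the factor Y, the other
  component over \<open>f\<close>, is Hoelder continuous: the component by its own equation, and
  \<open>f\<close> because it solves \<open>D\<^sub>c f = fx + c fy\<close> with bounded right-hand
  side. The inner statement \<open>grad\<close> treats both signs of c together.\<close>

lemma vekua_weak_gradient:
  assumes \<Omega>: "open \<Omega>" and fx: "weak_d 1 \<Omega> f fx" and fy: "weak_d \<i> \<Omega> f fy"
    and lf: "locbdd \<Omega> f" "locbdd \<Omega> fx" "locbdd \<Omega> fy" and nz: "\<And>z. f z \<noteq> 0" and li: "locbdd \<Omega> (\<lambda>z. inverse (f z))"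
    and A: "AE z in lborel. z \<in> \<Omega> \<longrightarrow> norm (fx z) \<le> A" "AE z in lborel. z \<in> \<Omega> \<longrightarrow> norm (fy z) \<le> A"
    and M: "AE z in lborel. z \<in> \<Omega> \<longrightarrow> norm (inverse (f z)) \<le> M"
    and W1: "weak_op 1 \<i> \<Omega> w1 h1" and W2: "weak_op 1 (-\<i>) \<Omega> w2 h2"
    and h1: "AE z in lborel. z \<in> \<Omega> \<longrightarrow> h1 z = (fx z + \<i> * fy z) * (inverse (f z) * w2 z)"
    and h2: "AE z in lborel. z \<in> \<Omega> \<longrightarrow> h2 z = (fx z + (-\<i>) * fy z) * (inverse (f z) * w1 z)"
  shows "locbdd \<Omega> w1" "locbdd \<Omega> w2"
    and "\<And>e. e \<in> {1, \<i>} \<Longrightarrow> \<exists>g. locbdd \<Omega> g \<and> weak_d e \<Omega> w1 g"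
    and "\<And>e. e \<in> {1, \<i>} \<Longrightarrow> \<exists>g. locbdd \<Omega> g \<and> weak_d e \<Omega> w2 g"
proof -
  have le: "AE z in lborel. z \<in> \<Omega> \<longrightarrow> norm (h z) \<le> (2 * \<bar>A\<bar> * \<bar>M\<bar>) * norm (w z)"
    if "AE z in lborel. z \<in> \<Omega> \<longrightarrow> h z = (fx z + c * fy z) * (inverse (f z) * w z)" "norm c = 1" for h w :: "complex \<Rightarrow> complex" and c
    using that(1) A M
  proof eventually_elim
    case (elim z)
    show ?case
    proof
      assume z: "z \<in> \<Omega>"
      have "norm (fx z + c * fy z) \<le> norm (fx z) + norm (fy z)"
        using norm_triangle_ineq[of "fx z" "c * fy z"] that(2) by (simp add: norm_mult)
      then have 1: "norm (fx z + c * fy z) \<le> 2 * \<bar>A\<bar>" using elim z by fastforce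
      have "norm (h z) = norm (fx z + c * fy z) * (norm (inverse (f z)) * norm (w z))"
        using elim z by (simp add: norm_mult)
      also have "\<dots> \<le> (2 * \<bar>A\<bar>) * (\<bar>M\<bar> * norm (w z))"
        using 1 elim z by (intro mult_mono) auto
      finally show "norm (h z) \<le> (2 * \<bar>A\<bar> * \<bar>M\<bar>) * norm (w z)" by (simp only: mult.assoc)
    qed
  qed
  have A0: "0 \<le> 2 * \<bar>A\<bar> * \<bar>M\<bar>" by simp
  note lw = vekua_locally_bounded[OF \<Omega> W1 W2 A0 le[OF h1] le[OF h2]]
  show lw1: "locbdd \<Omega> w1" and lw2: "locbdd \<Omega> w2" using lw by simp_all
  have grad: "\<exists>g. locbdd \<Omega> g \<and> weak_d e \<Omega> w g"
    if c: "c \<in> {\<i>, -\<i>}" and W: "weak_op 1 c \<Omega> w h" and lw: "locbdd \<Omega> w" and lw': "locbdd \<Omega> w'"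
      and W': "weak_op 1 (-c) \<Omega> w' h'" and h: "AE z in lborel. z \<in> \<Omega> \<longrightarrow> h z = (fx z + c * fy z) * (inverse (f z) * w' z)"
      and h': "AE z in lborel. z \<in> \<Omega> \<longrightarrow> h' z = (fx z + (-c) * fy z) * (inverse (f z) * w z)"
      and e: "e \<in> {1, \<i>}" for c w h w' h' e
  proof (rule weak_d_glue[OF \<Omega> locbdd_imp_locint[OF lw] e])
    fix K assume K: "compact K" "K \<subseteq> \<Omega>"
    have F: "weak_op 1 c \<Omega> f (\<lambda>z. fx z + c * fy z)" by (rule weak_op_from_weak_d[OF fx fy])
    have ld: "locbdd \<Omega> (\<lambda>z. fx z + a * fy z)" for a by (intro locbdd_add locbdd_cmult lf)
    have lh': "locbdd \<Omega> h'"
      by (rule locbdd_cong_AE[OF locbdd_mult[OF ld locbdd_mult[OF li lw]] locint_borel[OF weak_opD(2)[OF W']] h'])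
    have mc: "- c \<in> {\<i>, -\<i>}" using c by auto
    have Yh: "hoelder_ae S (\<lambda>z. inverse (f z) * w' z)" if S: "compact S" "S \<subseteq> \<Omega>" for S
      by (intro hoelder_ae_mult[OF _ li _ lw' S] hoelder_ae_inverse[OF _ li S nz]
          weak_solution_hoelder[OF \<Omega> F c lf(1) ld S] weak_solution_hoelder[OF \<Omega> W' mc lw' lh' S])
    obtain fe where fe: "weak_d e \<Omega> f fe" "locbdd \<Omega> fe" using e fx fy lf by blast
    show "\<exists>g C. g \<in> borel_measurable borel \<and> (AE z in lborel. norm (g z) \<le> C) \<and>
     (\<forall>\<phi>\<in>test_fun \<Omega>. (\<forall>z. z \<notin> K \<longrightarrow> \<phi> z = 0) \<longrightarrow> (LINT z|lborel. w z * pd e \<phi> z) = - (LINT z|lborel. g z * \<phi> z))"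
      by (rule gradient_local[OF \<Omega> c e W lw F lf(1) ld fe locbdd_mult[OF li lw'] Yh h K])
  qed
  show "\<exists>g. locbdd \<Omega> g \<and> weak_d e \<Omega> w1 g" if "e \<in> {1, \<i>}" for e
    by (rule grad[of \<i>, OF _ W1 lw1 lw2 W2 h1 h2 that]) simp
  show "\<exists>g. locbdd \<Omega> g \<and> weak_d e \<Omega> w2 g" if "e \<in> {1, \<i>}" for e
    by (rule grad[of "-\<i>", OF _ W2 lw2 lw1 _ h2 _ that]) (use W1 h1 in simp_all)
qed

text \<open>The two complex equations combine to
  \<open>f (u\<^sub>x - v\<^sub>y) = f\<^sub>x u + f\<^sub>y v\<close> and
  \<open>f (u\<^sub>y + v\<^sub>x) = f\<^sub>y u - f\<^sub>x v\<close>. By the quotient rule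
  \<open>f^2 (u/f)\<^sub>x = f u\<^sub>x - u f\<^sub>x\<close>, which the first relation identifies
  with the y-derivative of f v; the second does the same for the other coordinate.\<close>

lemma vekua_conductivity:
  assumes \<Omega>: "open \<Omega>" and fx: "weak_d 1 \<Omega> f fx" and fy: "weak_d \<i> \<Omega> f fy"
    and lf: "locbdd \<Omega> f" "locbdd \<Omega> fx" "locbdd \<Omega> fy" and nz: "\<And>z. f z \<noteq> 0" and li: "locbdd \<Omega> (\<lambda>z. inverse (f z))"
    and A: "AE z in lborel. z \<in> \<Omega> \<longrightarrow> norm (fx z) \<le> A" "AE z in lborel. z \<in> \<Omega> \<longrightarrow> norm (fy z) \<le> A"
    and M: "AE z in lborel. z \<in> \<Omega> \<longrightarrow> norm (inverse (f z)) \<le> M"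
    and W1: "weak_op 1 \<i> \<Omega> (\<lambda>z. u z + \<i> * v z) h1" and W2: "weak_op 1 (-\<i>) \<Omega> (\<lambda>z. u z + (-\<i>) * v z) h2"
    and h1: "AE z in lborel. z \<in> \<Omega> \<longrightarrow> h1 z = (fx z + \<i> * fy z) * (inverse (f z) * (u z + (-\<i>) * v z))"
    and h2: "AE z in lborel. z \<in> \<Omega> \<longrightarrow> h2 z = (fx z + (-\<i>) * fy z) * (inverse (f z) * (u z + \<i> * v z))"
  obtains Ux Uy Vx Vy where "locbdd \<Omega> (\<lambda>z. u z * inverse (f z))" "locbdd \<Omega> (\<lambda>z. f z * v z)"
    "locbdd \<Omega> Ux" "locbdd \<Omega> Uy" "locbdd \<Omega> Vx" "locbdd \<Omega> Vy"
    "weak_d 1 \<Omega> (\<lambda>z. u z * inverse (f z)) Ux" "weak_d \<i> \<Omega> (\<lambda>z. u z * inverse (f z)) Uy"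
    "weak_d 1 \<Omega> (\<lambda>z. f z * v z) Vx" "weak_d \<i> \<Omega> (\<lambda>z. f z * v z) Vy"
    "AE z in lborel. z \<in> \<Omega> \<longrightarrow> (f z)\<^sup>2 * Ux z = Vy z \<and> (f z)\<^sup>2 * Uy z = - Vx z"
proof -
  define w1 where "w1 z = u z + \<i> * v z" for z
  define w2 where "w2 z = u z + (-\<i>) * v z" for z
  note reg = vekua_weak_gradient[OF \<Omega> fx fy lf nz li A M W1[folded w1_def] W2[folded w2_def] h1[folded w2_def] h2[folded w1_def]]
  have e: "1 \<in> {1, \<i>}" "\<i> \<in> {1, \<i>}" by auto
  obtain ax where ax: "locbdd \<Omega> ax" "weak_d 1 \<Omega> w1 ax" using reg(3)[OF e(1)] by blast
  obtain ay where ay: "locbdd \<Omega> ay" "weak_d \<i> \<Omega> w1 ay" using reg(3)[OF e(2)] by blast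
  obtain bx where bx: "locbdd \<Omega> bx" "weak_d 1 \<Omega> w2 bx" using reg(4)[OF e(1)] by blast
  obtain bY where bY: "locbdd \<Omega> bY" "weak_d \<i> \<Omega> w2 bY" using reg(4)[OF e(2)] by blast
  \<comment> \<open>The inverse of the splitting: u and v are recovered from the two components
    \<open>w1\<close>, \<open>w2\<close>, and their gradients by linearity.\<close>
  have u: "u = (\<lambda>z. (1/2) * w1 z + (1/2) * w2 z)" and v: "v = (\<lambda>z. (-\<i>/2) * w1 z + (\<i>/2) * w2 z)"
    by (auto simp: w1_def w2_def fun_eq_iff algebra_simps)
  define ux where "ux z = (1/2) * ax z + (1/2) * bx z" for z
  define uy where "uy z = (1/2) * ay z + (1/2) * bY z" for z
  define vx where "vx z = (-\<i>/2) * ax z + (\<i>/2) * bx z" for z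
  define vy where "vy z = (-\<i>/2) * ay z + (\<i>/2) * bY z" for z
  have lu: "locbdd \<Omega> u" "locbdd \<Omega> v" by (subst u v, intro locbdd_add locbdd_cmult reg)+
  have lux: "locbdd \<Omega> ux" "locbdd \<Omega> uy" "locbdd \<Omega> vx" "locbdd \<Omega> vy"
    unfolding ux_def uy_def vx_def vy_def by (intro locbdd_add locbdd_cmult ax ay bx bY)+
  have du: "weak_d 1 \<Omega> u ux" "weak_d \<i> \<Omega> u uy" "weak_d 1 \<Omega> v vx" "weak_d \<i> \<Omega> v vy"
    unfolding ux_def uy_def vx_def vy_def
    by (subst u v, intro weak_d_add weak_d_cmult ax ay bx bY e)+
  have r1: "AE z in lborel. z \<in> \<Omega> \<longrightarrow> ax z + \<i> * ay z = h1 z"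
    by (rule weak_op_unique[OF \<Omega> weak_op_from_weak_d[OF ax(2) ay(2)] W1[folded w1_def]])
  have r2: "AE z in lborel. z \<in> \<Omega> \<longrightarrow> bx z + (-\<i>) * bY z = h2 z"
    by (rule weak_op_unique[OF \<Omega> weak_op_from_weak_d[OF bx(2) bY(2)] W2[folded w2_def]])
  have rel: "AE z in lborel. z \<in> \<Omega> \<longrightarrow> f z * (ux z - vy z) = fx z * u z + fy z * v z \<and> f z * (uy z + vx z) = fy z * u z - fx z * v z"
    using r1 r2 h1 h2
  proof eventually_elim
    case (elim z)
    show ?case
    proof
      assume z: "z \<in> \<Omega>"
      have 1: "f z * (ax z + \<i> * ay z) = (fx z + \<i> * fy z) * (u z - \<i> * v z)"
        using elim z nz[of z] by simp
      have 2: "f z * (bx z - \<i> * bY z) = (fx z - \<i> * fy z) * (u z + \<i> * v z)"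
        using elim z nz[of z] by simp
      have "f z * (ux z - vy z) = (1/2) * (f z * (ax z + \<i> * ay z)) + (1/2) * (f z * (bx z - \<i> * bY z))"
        by (simp add: ux_def vy_def algebra_simps)
      also have "\<dots> = fx z * u z + fy z * v z"
        unfolding 1 2 by (simp add: algebra_simps)
      finally have 3: "f z * (ux z - vy z) = fx z * u z + fy z * v z" .
      have "f z * (uy z + vx z) = (-\<i>/2) * (f z * (ax z + \<i> * ay z)) + (\<i>/2) * (f z * (bx z - \<i> * bY z))"
        by (simp add: uy_def vx_def algebra_simps)
      also have "\<dots> = fy z * u z - fx z * v z"
        unfolding 1 2 by (simp add: algebra_simps)
      finally show "f z * (ux z - vy z) = fx z * u z + fy z * v z \<and> f z * (uy z + vx z) = fy z * u z - fx z * v z"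
        using 3 by blast
    qed
  qed
  have nzA: "AE z in lborel. z \<in> \<Omega> \<longrightarrow> f z \<noteq> 0" using nz by simp
  define ix where "ix z = - 1 * (fx z * (inverse (f z) * inverse (f z)))" for z
  define iy where "iy z = - 1 * (fy z * (inverse (f z) * inverse (f z)))" for z
  have di: "weak_d 1 \<Omega> (\<lambda>z. inverse (f z)) ix" "weak_d \<i> \<Omega> (\<lambda>z. inverse (f z)) iy"
    unfolding ix_def iy_def
    by (rule weak_d_inverse[OF \<Omega> e(1) fx lf(1,2) nzA M], rule weak_d_inverse[OF \<Omega> e(2) fy lf(1,3) nzA M])
  have lix: "locbdd \<Omega> ix" "locbdd \<Omega> iy"
    unfolding ix_def iy_def by (intro locbdd_cmult locbdd_mult lf li)+
  define Ux where "Ux z = ux z * inverse (f z) + u z * ix z" for z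
  define Uy where "Uy z = uy z * inverse (f z) + u z * iy z" for z
  define Vx where "Vx z = fx z * v z + f z * vx z" for z
  define Vy where "Vy z = fy z * v z + f z * vy z" for z
  have "AE z in lborel. z \<in> \<Omega> \<longrightarrow> (f z)\<^sup>2 * Ux z = Vy z \<and> (f z)\<^sup>2 * Uy z = - Vx z"
    using rel
  proof eventually_elim
    case (elim z)
    show ?case
    proof
      assume "z \<in> \<Omega>"
      then have r: "f z * (ux z - vy z) = fx z * u z + fy z * v z" "f z * (uy z + vx z) = fy z * u z - fx z * v z"
        using elim by auto
      have "(f z)\<^sup>2 * Ux z = f z * ux z - u z * fx z" "(f z)\<^sup>2 * Uy z = f z * uy z - u z * fy z"
        using nz[of z] by (simp_all add: Ux_def Uy_def ix_def iy_def field_simps power2_eq_square)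
      moreover have "f z * ux z = fx z * u z + fy z * v z + f z * vy z" "f z * uy z = fy z * u z - fx z * v z - f z * vx z"
        unfolding r[symmetric] by (simp_all add: right_diff_distrib distrib_left)
      ultimately show "(f z)\<^sup>2 * Ux z = Vy z \<and> (f z)\<^sup>2 * Uy z = - Vx z"
        by (simp add: Vx_def Vy_def mult.commute[of "u z"])
    qed
  qed
  moreover have "weak_d 1 \<Omega> (\<lambda>z. u z * inverse (f z)) Ux" "weak_d \<i> \<Omega> (\<lambda>z. u z * inverse (f z)) Uy"
    unfolding Ux_def Uy_def by (intro weak_d_mult \<Omega> e du lu lux di li lix)+
  moreover have "weak_d 1 \<Omega> (\<lambda>z. f z * v z) Vx" "weak_d \<i> \<Omega> (\<lambda>z. f z * v z) Vy"
    unfolding Vx_def Vy_def by (intro weak_d_mult \<Omega> e fx fy lf du lu lux)+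
  moreover have "locbdd \<Omega> Ux" "locbdd \<Omega> Uy" "locbdd \<Omega> Vx" "locbdd \<Omega> Vy"
    unfolding Ux_def Uy_def Vx_def Vy_def by (intro locbdd_add locbdd_mult lux lu li lix lf)+
  moreover have "locbdd \<Omega> (\<lambda>z. u z * inverse (f z))" "locbdd \<Omega> (\<lambda>z. f z * v z)"
    by (intro locbdd_mult lu li lf)+
  ultimately show ?thesis using that by blast
qed

section \<open>From Lebesgue measurable representatives on \<Omega> to Borel functions on the
  plane\<close>

section \<open>Borel representatives\<close>

text \<open>Extension by zero, followed by Borel versions of the real and the imaginary
  part.\<close>

lemma borel_representative:
  fixes g :: "complex \<Rightarrow> complex"
  assumes g: "g \<in> borel_measurable (lebesgue_on \<Omega>)" and \<Omega>: "\<Omega> \<in> sets borel"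
  obtains g' where "g' \<in> borel_measurable borel" "AE z in lborel. z \<in> \<Omega> \<longrightarrow> g z = g' z"
proof -
  let ?G = "\<lambda>z. if z \<in> \<Omega> then g z else 0"
  have G: "?G \<in> borel_measurable lebesgue"
    by (rule borel_measurable_if_I[OF g]) (use \<Omega> in auto)
  have "(\<lambda>z. Re (?G z)) \<in> borel_measurable lebesgue" "(\<lambda>z. Im (?G z)) \<in> borel_measurable lebesgue"
    using measurable_compose[OF G borel_measurable_Re] measurable_compose[OF G borel_measurable_Im] by simp_all
  from this[THEN completion_ex_borel_measurable_real]
  obtain a b where ab: "a \<in> borel_measurable lborel" "b \<in> borel_measurable lborel"
    "AE z in lborel. Re (?G z) = a z" "AE z in lborel. Im (?G z) = b z" by blast
  have [measurable]: "a \<in> borel_measurable borel" "b \<in> borel_measurable borel" using ab by auto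
  show ?thesis
  proof (rule that[of "\<lambda>z. Complex (a z) (b z)"])
    show "(\<lambda>z. Complex (a z) (b z)) \<in> borel_measurable borel"
      unfolding Complex_eq by measurable
    show "AE z in lborel. z \<in> \<Omega> \<longrightarrow> g z = Complex (a z) (b z)"
      using ab(3,4) by eventually_elim (auto simp: complex_eq_iff)
  qed
qed

lemma AE_lebesgue_on_iff:
  assumes "\<Omega> \<in> sets borel"
  shows "(AE z in lebesgue_on \<Omega>. P z) \<longleftrightarrow> (AE z in lborel. z \<in> \<Omega> \<longrightarrow> P z)"
  using assms by (subst AE_restrict_space_iff) (auto simp: AE_completion_iff)

text \<open>Since \<open>F'\<close> vanishes off \<Omega>, the restricted integral is one over the
  plane; passing to a Borel function and to the uncompleted measure changes only null sets. In
  applications the vanishing comes from a test function.\<close>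

lemma integral_lebesgue_on_eq:
  fixes F F' :: "complex \<Rightarrow> complex"
  assumes F: "F \<in> borel_measurable (lebesgue_on \<Omega>)" and F': "F' \<in> borel_measurable borel" and \<Omega>: "\<Omega> \<in> sets borel"
    and eq: "AE z in lborel. z \<in> \<Omega> \<longrightarrow> F z = F' z" and 0: "\<And>z. z \<notin> \<Omega> \<Longrightarrow> F' z = 0"
  shows "(LINT z|lebesgue_on \<Omega>. F z) = (LINT z|lborel. F' z)"
proof -
  have s: "\<Omega> \<inter> space lebesgue \<in> sets lebesgue" "\<Omega> \<in> sets lebesgue" using \<Omega> by auto
  have "(LINT z|lebesgue_on \<Omega>. F z) = (LINT z|lebesgue. indicator \<Omega> z *\<^sub>R F z)"
    by (rule integral_restrict_space[OF s(1)])
  also have "\<dots> = (LINT z|lebesgue. F' z)"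
  proof (rule integral_cong_AE)
    have "(\<lambda>z. if z \<in> \<Omega> then F z else 0) \<in> borel_measurable lebesgue"
      by (rule borel_measurable_if_I[OF F s(2)])
    also have "(\<lambda>z. if z \<in> \<Omega> then F z else 0) = (\<lambda>z. indicator \<Omega> z *\<^sub>R F z)"
      by (auto simp: indicator_def)
    finally show "(\<lambda>z. indicator \<Omega> z *\<^sub>R F z) \<in> borel_measurable lebesgue" .
    show "F' \<in> borel_measurable lebesgue" using F' by (intro measurable_completion) simp
    have "AE z in lborel. indicator \<Omega> z *\<^sub>R F z = F' z"
      using eq by eventually_elim (use 0 in \<open>auto simp: indicator_def\<close>)
    then show "AE z in lebesgue. indicator \<Omega> z *\<^sub>R F z = F' z" by (rule AE_completion)
  qed
  also have "\<dots> = (LINT z|lborel. F' z)" by (rule integral_completion) (use F' in simp)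
  finally show ?thesis .
qed

lemma borel_imp_lebesgue_on: "\<psi> \<in> borel_measurable borel \<Longrightarrow> \<psi> \<in> borel_measurable (lebesgue_on \<Omega>)"
  by (intro measurable_restrict_space1 measurable_completion) simp

text \<open>Local spaces give measurability on compact subsets only; truncations to an exhaustion
  converge pointwise to the extension by zero.\<close>

lemma Lp_loc_borel_measurable:
  assumes \<Omega>: "open \<Omega>" and g: "g \<in> Lp_loc p \<Omega>"
  shows "g \<in> borel_measurable (lebesgue_on \<Omega>)"
proof (rule borel_measurable_if_D)
  obtain K :: "nat \<Rightarrow> complex set" where K: "\<forall>n. compact (K n)" "\<forall>n. K n \<subseteq> \<Omega>" "\<Union>(range K) = \<Omega>"
    "\<forall>n. K n \<subseteq> interior (K (Suc n))"
    using compact_exhaustion[OF \<Omega>] by metis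
  have m: "(\<lambda>z. if z \<in> K n then g z else 0) \<in> borel_measurable lebesgue" for n
  proof (rule borel_measurable_if_I)
    show "g \<in> borel_measurable (lebesgue_on (K n))"
      using g K(1,2) unfolding Lp_loc_def Lp_def by blast
    show "K n \<in> sets lebesgue" by (rule fmeasurableD[OF lmeasurable_compact[OF K(1)[THEN spec]]])
  qed
  show "(\<lambda>z. if z \<in> \<Omega> then g z else 0) \<in> borel_measurable lebesgue"
  proof (rule borel_measurable_LIMSEQ_metric[OF m])
    fix z
    show "(\<lambda>n. if z \<in> K n then g z else 0) \<longlonglongrightarrow> (if z \<in> \<Omega> then g z else 0)"
    proof (cases "z \<in> \<Omega>")
      case True
      then obtain m where "z \<in> K m" using K(3) by blast
      then have "z \<in> K n" if "n \<ge> m" for n using exhaustion_mono[OF K(4) that] by blast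
      then have "\<forall>\<^sub>F n in sequentially. (if z \<in> K n then g z else 0) = g z"
        unfolding eventually_sequentially by auto
      then show ?thesis using True by (simp add: tendsto_eventually)
    next
      case False
      then have "z \<notin> K n" for n using K(2) by blast
      then show ?thesis using False by simp
    qed
  qed
qed

lemma Lp_loc_1_imp_locint:
  assumes g: "g \<in> Lp_loc 1 \<Omega>" and g': "g' \<in> borel_measurable borel" "AE z in lborel. z \<in> \<Omega> \<longrightarrow> g z = g' z"
  shows "locint \<Omega> g'"
  unfolding locint_def
proof (intro conjI allI impI g')
  fix K assume K: "compact K" "K \<subseteq> \<Omega>"
  have [measurable]: "K \<in> sets borel" using K by (simp add: compact_imp_closed)
  note [measurable] = g'(1)
  have s: "K \<inter> space lebesgue \<in> sets lebesgue" "K \<in> sets lebesgue" by auto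
  have m: "g \<in> borel_measurable (lebesgue_on K)" and i: "integrable (lebesgue_on K) (\<lambda>z. norm (g z) powr 1)"
    using g K unfolding Lp_loc_def Lp_def by blast+
  have "integrable (lebesgue_on K) (\<lambda>z. norm (g z))" using i by simp
  then have "integrable (lebesgue_on K) g" using integrable_norm_iff[OF m] by simp
  then have ig: "integrable lebesgue (\<lambda>z. indicator K z *\<^sub>R g z)"
    by (subst (asm) integrable_restrict_space[OF s(1)])
  have mb: "(\<lambda>z. indicator K z *\<^sub>R g' z) \<in> borel_measurable lborel" by measurable
  have ae: "AE z in lborel. indicator K z *\<^sub>R g z = indicator K z *\<^sub>R g' z"
    using g'(2) by eventually_elim (use K(2) in \<open>auto simp: indicator_def\<close>)
  have "integrable lebesgue (\<lambda>z. indicator K z *\<^sub>R g' z)"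
    by (rule integrable_cong_AE_imp[OF ig measurable_completion[OF mb] AE_completion[OF ae]])
  then show "integrable lborel (\<lambda>z. indicator K z *\<^sub>R g' z)"
    by (rule integrable_completion[OF mb, THEN iffD1])
qed

lemma locbdd_imp_Lp_loc:
  assumes g: "g \<in> borel_measurable (lebesgue_on \<Omega>)" and g': "locbdd \<Omega> g'" "AE z in lborel. z \<in> \<Omega> \<longrightarrow> g z = g' z"
    and p: "0 < p"
  shows "g \<in> Lp_loc p \<Omega>"
  unfolding Lp_loc_def
proof (intro CollectI allI impI)
  fix K assume "compact K \<and> K \<subseteq> \<Omega>"
  then have K: "compact K" "K \<subseteq> \<Omega>" by auto
  have m: "g \<in> borel_measurable (lebesgue_on K)"
    by (rule measurable_restrict_mono[OF g K(2)])
  have Kb: "K \<in> sets borel" using K by (auto simp: compact_imp_closed)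
  obtain C where C: "0 \<le> C" "AE z in lborel. z \<in> K \<longrightarrow> norm (g' z) \<le> C" by (rule locbddE[OF g'(1) K])
  have "K \<in> lmeasurable" by (rule lmeasurable_compact[OF K(1)])
  then interpret finite_measure "lebesgue_on K" by (rule finite_measure_lebesgue_on)
  have "integrable (lebesgue_on K) (\<lambda>z. norm (g z) powr p)"
  proof (rule integrable_const_bound)
    have "AE z in lborel. z \<in> K \<longrightarrow> norm (norm (g z) powr p) \<le> C powr p"
      using C(2) g'(2) by eventually_elim (use K p in \<open>auto intro!: powr_mono2\<close>)
    then show "AE z in lebesgue_on K. norm (norm (g z) powr p) \<le> C powr p"
      by (rule AE_lebesgue_on_iff[OF Kb, THEN iffD2])
    show "(\<lambda>z. norm (g z) powr p) \<in> borel_measurable (lebesgue_on K)" using m by measurable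
  qed
  with m show "g \<in> Lp p K" by (simp add: Lp_def)
qed

lemma integral_test_transfer:
  assumes \<Omega>: "open \<Omega>" and g: "g \<in> borel_measurable (lebesgue_on \<Omega>)" "g' \<in> borel_measurable borel"
    "AE z in lborel. z \<in> \<Omega> \<longrightarrow> g z = g' z" and \<phi>: "\<phi> \<in> test_fun \<Omega>"
  shows "(LINT z|lebesgue_on \<Omega>. g z * \<phi> z) = (LINT z|lborel. g' z * \<phi> z)"
proof (rule integral_lebesgue_on_eq)
  note b = smooth_borel_measurable[OF test_fun_smooth[OF \<phi>]]
  show "(\<lambda>z. g z * \<phi> z) \<in> borel_measurable (lebesgue_on \<Omega>)"
    using g(1) borel_imp_lebesgue_on[OF b] by (rule borel_measurable_times)
  show "(\<lambda>z. g' z * \<phi> z) \<in> borel_measurable borel" using g(2) b by measurable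
  show "\<Omega> \<in> sets borel" using \<Omega> by simp
  show "AE z in lborel. z \<in> \<Omega> \<longrightarrow> g z * \<phi> z = g' z * \<phi> z" using g(3) by eventually_elim simp
  obtain L where L: "L \<subseteq> \<Omega>" "\<And>z. z \<notin> L \<Longrightarrow> \<phi> z = 0"
    using test_fun_supportE[OF \<phi>] by metis
  show "g' z * \<phi> z = 0" if "z \<notin> \<Omega>" for z using L that by auto
qed

lemma weak_pd_imp_weak_d:
  assumes \<Omega>: "open \<Omega>" and e: "e \<in> {1, \<i>}" and W: "weak_pd e \<Omega> g h"
    and g: "g' \<in> borel_measurable borel" "AE z in lborel. z \<in> \<Omega> \<longrightarrow> g z = g' z"
    and h: "h' \<in> borel_measurable borel" "AE z in lborel. z \<in> \<Omega> \<longrightarrow> h z = h' z"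
  shows "weak_d e \<Omega> g' h'"
proof -
  have l: "g \<in> Lp_loc 1 \<Omega>" "h \<in> Lp_loc 1 \<Omega>" using W unfolding weak_pd_def by blast+
  note m = Lp_loc_borel_measurable[OF \<Omega> l(1)] Lp_loc_borel_measurable[OF \<Omega> l(2)]
  show ?thesis
    unfolding weak_d_def
  proof (intro conjI ballI Lp_loc_1_imp_locint[OF l(1) g] Lp_loc_1_imp_locint[OF l(2) h])
    fix \<phi> assume \<phi>: "\<phi> \<in> test_fun \<Omega>"
    show "(LINT z|lborel. g' z * pd e \<phi> z) = - (LINT z|lborel. h' z * \<phi> z)"
      using W \<phi> integral_test_transfer[OF \<Omega> m(1) g test_fun_pd[OF \<phi> e]] integral_test_transfer[OF \<Omega> m(2) h \<phi>]
      unfolding weak_pd_def by auto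
  qed
qed

lemma weak_d_imp_weak_pd:
  assumes \<Omega>: "open \<Omega>" and e: "e \<in> {1, \<i>}" and W: "weak_d e \<Omega> g' h"
    and l: "locbdd \<Omega> g'" "locbdd \<Omega> h"
    and g: "g \<in> borel_measurable (lebesgue_on \<Omega>)" "AE z in lborel. z \<in> \<Omega> \<longrightarrow> g z = g' z"
  shows "weak_pd e \<Omega> g h"
  unfolding weak_pd_def
proof (intro conjI ballI)
  have mh: "h \<in> borel_measurable (lebesgue_on \<Omega>)" by (rule borel_imp_lebesgue_on[OF locbdd_borel[OF l(2)]])
  show "g \<in> Lp_loc 1 \<Omega>" by (rule locbdd_imp_Lp_loc[OF g(1) l(1) g(2)]) simp
  show "h \<in> Lp_loc 1 \<Omega>" by (rule locbdd_imp_Lp_loc[OF mh l(2)]) auto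
  fix \<phi> assume \<phi>: "\<phi> \<in> test_fun \<Omega>"
  show "(LINT z|lebesgue_on \<Omega>. g z * pd e \<phi> z) = - (LINT z|lebesgue_on \<Omega>. h z * \<phi> z)"
    using integral_test_transfer[OF \<Omega> g(1) locbdd_borel[OF l(1)] g(2) test_fun_pd[OF \<phi> e]]
      integral_test_transfer[OF \<Omega> mh locbdd_borel[OF l(2)] _ \<phi>] weak_dD(3)[OF W \<phi>] by simp
qed

text \<open>A test function with zero \<open>Vec\<close> part turns the bicomplex identity into two
  complex ones, its \<open>Sc\<close> and \<open>Vec\<close> components. The division by 2 is that
  of \<open>bc_dbar\<close>.\<close>

lemma weak_dbar_scalar_test:
  assumes W: "weak_dbar \<Omega> W V" and \<phi>: "\<phi> \<in> test_fun \<Omega>"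
  shows "(LINT z|lebesgue_on \<Omega>. (Sc (W z) * pd 1 \<phi> z - Vec (W z) * pd \<i> \<phi> z) / 2) = - (LINT z|lebesgue_on \<Omega>. Sc (V z) * \<phi> z)"
    and "(LINT z|lebesgue_on \<Omega>. (Sc (W z) * pd \<i> \<phi> z + Vec (W z) * pd 1 \<phi> z) / 2) = - (LINT z|lebesgue_on \<Omega>. Vec (V z) * \<phi> z)"
proof -
  let ?\<Phi> = "\<lambda>z. Bicomplex (\<phi> z) 0"
  have "(\<lambda>z. 0) \<in> test_fun \<Omega>" using test_fun_cmult[OF \<phi>, of 0] by simp
  then have "?\<Phi> \<in> bc_valued (test_fun \<Omega>)" using \<phi> by (simp add: bc_valued_def)
  then have eq: "bc_integral \<Omega> (\<lambda>z. W z * bc_dbar ?\<Phi> z) = - bc_integral \<Omega> (\<lambda>z. V z * ?\<Phi> z)"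
    using W unfolding weak_dbar_def by blast
  have d: "bc_dbar ?\<Phi> z = Bicomplex (pd 1 \<phi> z / 2) (pd \<i> \<phi> z / 2)" for z
    by (simp add: bc_dbar_def bc_pd_def bc_j_def bc_of_complex_def times_bicomplex_def plus_bicomplex_def pd_const)
  have "W z * bc_dbar ?\<Phi> z = Bicomplex ((Sc (W z) * pd 1 \<phi> z - Vec (W z) * pd \<i> \<phi> z) / 2)
      ((Sc (W z) * pd \<i> \<phi> z + Vec (W z) * pd 1 \<phi> z) / 2)" for z
    unfolding d by (simp add: times_bicomplex_def diff_divide_distrib add_divide_distrib)
  moreover have "V z * ?\<Phi> z = Bicomplex (Sc (V z) * \<phi> z) (Vec (V z) * \<phi> z)" for z
    by (simp add: times_bicomplex_def)
  ultimately show "(LINT z|lebesgue_on \<Omega>. (Sc (W z) * pd 1 \<phi> z - Vec (W z) * pd \<i> \<phi> z) / 2) = - (LINT z|lebesgue_on \<Omega>. Sc (V z) * \<phi> z)"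
    and "(LINT z|lebesgue_on \<Omega>. (Sc (W z) * pd \<i> \<phi> z + Vec (W z) * pd 1 \<phi> z) / 2) = - (LINT z|lebesgue_on \<Omega>. Vec (V z) * \<phi> z)"
    using eq by (simp_all add: bc_integral_def uminus_bicomplex_def)
qed

text \<open>The \<open>Sc\<close> identity plus c times the \<open>Vec\<close> identity;
  \<open>c^2 = -1\<close> factors the integrand into
  \<open>(u + c v) (\<phi>\<^sub>x + c \<phi>\<^sub>y)\<close>. This is the ring homomorphism that
  sends j to c, applied to a weak equation. The 2 on the right clears the one half in
  \<open>bc_dbar\<close>.\<close>

lemma weak_dbar_imp_weak_op:
  assumes \<Omega>: "open \<Omega>" and W: "weak_dbar \<Omega> W V" and c: "c * c = - 1"
    and u: "u \<in> borel_measurable borel" "AE z in lborel. z \<in> \<Omega> \<longrightarrow> Sc (W z) = u z"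
    and v: "v \<in> borel_measurable borel" "AE z in lborel. z \<in> \<Omega> \<longrightarrow> Vec (W z) = v z"
    and a: "a \<in> borel_measurable borel" "AE z in lborel. z \<in> \<Omega> \<longrightarrow> Sc (V z) = a z"
    and b: "b \<in> borel_measurable borel" "AE z in lborel. z \<in> \<Omega> \<longrightarrow> Vec (V z) = b z"
  shows "weak_op 1 c \<Omega> (\<lambda>z. u z + c * v z) (\<lambda>z. 2 * (a z + c * b z))"
proof -
  have l: "(\<lambda>z. Sc (W z)) \<in> Lp_loc 1 \<Omega>" "(\<lambda>z. Vec (W z)) \<in> Lp_loc 1 \<Omega>" "(\<lambda>z. Sc (V z)) \<in> Lp_loc 1 \<Omega>" "(\<lambda>z. Vec (V z)) \<in> Lp_loc 1 \<Omega>"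
    using W unfolding weak_dbar_def bc_valued_def by blast+
  note m = l[THEN Lp_loc_borel_measurable[OF \<Omega>]]
  have lu: "locint \<Omega> u" "locint \<Omega> v" "locint \<Omega> a" "locint \<Omega> b"
    using Lp_loc_1_imp_locint[OF l(1) u] Lp_loc_1_imp_locint[OF l(2) v] Lp_loc_1_imp_locint[OF l(3) a] Lp_loc_1_imp_locint[OF l(4) b] .
  show ?thesis
    unfolding weak_op_def
  proof (intro conjI ballI locint_add locint_cmult lu)
    fix \<phi> assume \<phi>: "\<phi> \<in> test_fun \<Omega>"
    have t: "pd 1 \<phi> \<in> test_fun \<Omega>" "pd \<i> \<phi> \<in> test_fun \<Omega>" using test_fun_pd[OF \<phi>] by auto
    note [measurable] = u(1) v(1) smooth_borel_measurable[OF test_fun_smooth[OF t(1)]] smooth_borel_measurable[OF test_fun_smooth[OF t(2)]]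
    note mt = t[THEN test_fun_smooth, THEN smooth_borel_measurable, THEN borel_imp_lebesgue_on[where \<Omega> = \<Omega>]]
    obtain L where L: "L \<subseteq> \<Omega>" "\<And>z e. z \<notin> L \<Longrightarrow> pd e \<phi> z = 0"
      using test_fun_supportE[OF \<phi>] by metis
    have p0: "pd e \<phi> z = 0" if "z \<notin> \<Omega>" for z e using L that by blast
    note [measurable] = m(1,2) mt
    have "(LINT z|lebesgue_on \<Omega>. (Sc (W z) * pd 1 \<phi> z - Vec (W z) * pd \<i> \<phi> z) / 2)
       = (LINT z|lborel. (u z * pd 1 \<phi> z - v z * pd \<i> \<phi> z) / 2)"
    proof (rule integral_lebesgue_on_eq)
      show "AE z in lborel. z \<in> \<Omega> \<longrightarrow> (Sc (W z) * pd 1 \<phi> z - Vec (W z) * pd \<i> \<phi> z) / 2 = (u z * pd 1 \<phi> z - v z * pd \<i> \<phi> z) / 2"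
        using u(2) v(2) by eventually_elim simp
      show "(\<lambda>z. (Sc (W z) * pd 1 \<phi> z - Vec (W z) * pd \<i> \<phi> z) / 2) \<in> borel_measurable (lebesgue_on \<Omega>)"
        by (intro borel_measurable_divide borel_measurable_diff borel_measurable_times m mt borel_measurable_const)
    qed (use p0 \<Omega> in \<open>auto\<close>)
    also have "(LINT z|lborel. (u z * pd 1 \<phi> z - v z * pd \<i> \<phi> z) / 2) = ((LINT z|lborel. u z * pd 1 \<phi> z) - (LINT z|lborel. v z * pd \<i> \<phi> z)) / 2"
      using locint_test_integrable[OF lu(1) t(1)] locint_test_integrable[OF lu(2) t(2)] by simp
    finally have 1: "((LINT z|lborel. u z * pd 1 \<phi> z) - (LINT z|lborel. v z * pd \<i> \<phi> z)) / 2 = - (LINT z|lborel. a z * \<phi> z)"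
      using weak_dbar_scalar_test(1)[OF W \<phi>] integral_test_transfer[OF \<Omega> m(3) a \<phi>] by simp
    have "(LINT z|lebesgue_on \<Omega>. (Sc (W z) * pd \<i> \<phi> z + Vec (W z) * pd 1 \<phi> z) / 2)
       = (LINT z|lborel. (u z * pd \<i> \<phi> z + v z * pd 1 \<phi> z) / 2)"
    proof (rule integral_lebesgue_on_eq)
      show "AE z in lborel. z \<in> \<Omega> \<longrightarrow> (Sc (W z) * pd \<i> \<phi> z + Vec (W z) * pd 1 \<phi> z) / 2 = (u z * pd \<i> \<phi> z + v z * pd 1 \<phi> z) / 2"
        using u(2) v(2) by eventually_elim simp
      show "(\<lambda>z. (Sc (W z) * pd \<i> \<phi> z + Vec (W z) * pd 1 \<phi> z) / 2) \<in> borel_measurable (lebesgue_on \<Omega>)"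
        by (intro borel_measurable_divide borel_measurable_add borel_measurable_times m mt borel_measurable_const)
    qed (use p0 \<Omega> in \<open>auto\<close>)
    also have "(LINT z|lborel. (u z * pd \<i> \<phi> z + v z * pd 1 \<phi> z) / 2) = ((LINT z|lborel. u z * pd \<i> \<phi> z) + (LINT z|lborel. v z * pd 1 \<phi> z)) / 2"
      using locint_test_integrable[OF lu(1) t(2)] locint_test_integrable[OF lu(2) t(1)] by simp
    finally have 2: "((LINT z|lborel. u z * pd \<i> \<phi> z) + (LINT z|lborel. v z * pd 1 \<phi> z)) / 2 = - (LINT z|lborel. b z * \<phi> z)"
      using weak_dbar_scalar_test(2)[OF W \<phi>] integral_test_transfer[OF \<Omega> m(4) b \<phi>] by simp
    have "(LINT z|lborel. (u z + c * v z) * (1 * pd 1 \<phi> z + c * pd \<i> \<phi> z))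
       = (LINT z|lborel. (u z * pd 1 \<phi> z - v z * pd \<i> \<phi> z) + c * (u z * pd \<i> \<phi> z + v z * pd 1 \<phi> z))"
    proof (rule Bochner_Integration.integral_cong[OF refl])
      fix z
      have "(u z + c * v z) * (1 * pd 1 \<phi> z + c * pd \<i> \<phi> z) = u z * pd 1 \<phi> z + (c * c) * (v z * pd \<i> \<phi> z) + c * (u z * pd \<i> \<phi> z + v z * pd 1 \<phi> z)"
        by (simp add: algebra_simps)
      then show "(u z + c * v z) * (1 * pd 1 \<phi> z + c * pd \<i> \<phi> z) = (u z * pd 1 \<phi> z - v z * pd \<i> \<phi> z) + c * (u z * pd \<i> \<phi> z + v z * pd 1 \<phi> z)"
        unfolding c by simp
    qed
    also have "\<dots> = 2 * (((LINT z|lborel. u z * pd 1 \<phi> z) - (LINT z|lborel. v z * pd \<i> \<phi> z)) / 2)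
        + 2 * c * (((LINT z|lborel. u z * pd \<i> \<phi> z) + (LINT z|lborel. v z * pd 1 \<phi> z)) / 2)"
      using locint_test_integrable[OF lu(1) t(2)] locint_test_integrable[OF lu(2) t(1)]
        locint_test_integrable[OF lu(1) t(1)] locint_test_integrable[OF lu(2) t(2)] by simp
    also have "\<dots> = - (2 * ((LINT z|lborel. a z * \<phi> z) + c * (LINT z|lborel. b z * \<phi> z)))"
      unfolding 1 2 by (simp add: algebra_simps)
    also have "2 * ((LINT z|lborel. a z * \<phi> z) + c * (LINT z|lborel. b z * \<phi> z)) = (LINT z|lborel. 2 * (a z * \<phi> z + c * (b z * \<phi> z)))"
      using locint_test_integrable[OF lu(3) \<phi>] locint_test_integrable[OF lu(4) \<phi>] by simp
    also have "\<dots> = (LINT z|lborel. 2 * (a z + c * b z) * \<phi> z)"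
      by (simp add: algebra_simps)
    finally show "(LINT z|lborel. (u z + c * v z) * (1 * pd 1 \<phi> z + c * pd \<i> \<phi> z)) = - (LINT z|lborel. 2 * (a z + c * b z) * \<phi> z)" .
  qed
qed

lemma Linf_bound:
  assumes "g \<in> Linf \<Omega>" "\<Omega> \<in> sets borel" "AE z in lborel. z \<in> \<Omega> \<longrightarrow> g z = g' z"
  obtains C where "AE z in lborel. z \<in> \<Omega> \<longrightarrow> norm (g' z) \<le> C"
proof -
  obtain C where "AE z in lebesgue_on \<Omega>. norm (g z) \<le> C"
    using assms(1) unfolding Linf_def by blast
  then have "AE z in lborel. z \<in> \<Omega> \<longrightarrow> norm (g z) \<le> C"
    by (rule AE_lebesgue_on_iff[OF assms(2), THEN iffD1])
  then have "AE z in lborel. z \<in> \<Omega> \<longrightarrow> norm (g' z) \<le> C"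
    using assms(3) by eventually_elim simp
  then show ?thesis by (rule that)
qed

text \<open>\<open>V\<close> is a conjugate function: the flux \<open>\<sigma> \<nabla>U\<close> is
  the rotated gradient \<open>(V\<^sub>y, - V\<^sub>x)\<close>, so the weak equation is the symmetry
  of mixed derivatives. The Sobolev membership for exponent \<open>p\<close> follows from local
  boundedness of \<open>U\<close> and its gradient.\<close>

lemma weak_conductivity_solutionI:
  assumes \<Omega>: "open \<Omega>" and p: "0 < p"
    and g: "g \<in> borel_measurable (lebesgue_on \<Omega>)" "AE z in lborel. z \<in> \<Omega> \<longrightarrow> g z = U z" "locbdd \<Omega> U"
    and Ux: "weak_d 1 \<Omega> U Ux" "locbdd \<Omega> Ux" and Uy: "weak_d \<i> \<Omega> U Uy" "locbdd \<Omega> Uy"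
    and Vx: "weak_d 1 \<Omega> V Vx" and Vy: "weak_d \<i> \<Omega> V Vy"
    and \<sigma>: "\<sigma> \<in> borel_measurable (lebesgue_on \<Omega>)"
    and flux: "AE z in lborel. z \<in> \<Omega> \<longrightarrow> \<sigma> z * Ux z = Vy z \<and> \<sigma> z * Uy z = - Vx z"
  shows "weak_conductivity_solution p \<Omega> \<sigma> g"
proof -
  have e: "1 \<in> {1, \<i>}" "\<i> \<in> {1, \<i>}" by auto
  note m = borel_imp_lebesgue_on[OF locbdd_borel[OF Ux(2)], of \<Omega>] borel_imp_lebesgue_on[OF locbdd_borel[OF Uy(2)], of \<Omega>]
  have grad: "weak_gradient \<Omega> g Ux Uy"
    unfolding weak_gradient_def
    using weak_d_imp_weak_pd[OF \<Omega> e(1) Ux(1) g(3) Ux(2) g(1,2)] weak_d_imp_weak_pd[OF \<Omega> e(2) Uy(1) g(3) Uy(2) g(1,2)] by blast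
  have "g \<in> Lp_loc p \<Omega>" by (rule locbdd_imp_Lp_loc[OF g(1,3,2) p])
  moreover have "Ux \<in> Lp_loc p \<Omega>" by (rule locbdd_imp_Lp_loc[OF m(1) Ux(2) _ p]) simp
  moreover have "Uy \<in> Lp_loc p \<Omega>" by (rule locbdd_imp_Lp_loc[OF m(2) Uy(2) _ p]) simp
  ultimately have "g \<in> W1p_loc p \<Omega>" using grad unfolding W1p_loc_def by blast
  moreover have "(LINT z|lebesgue_on \<Omega>. \<sigma> z * (Ux z * pd 1 \<phi> z + Uy z * pd \<i> \<phi> z)) = 0" if \<phi>: "\<phi> \<in> test_fun \<Omega>" for \<phi>
  proof -
    have t: "pd 1 \<phi> \<in> test_fun \<Omega>" "pd \<i> \<phi> \<in> test_fun \<Omega>" using test_fun_pd[OF \<phi>] by auto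
    note mt = t[THEN test_fun_smooth, THEN smooth_borel_measurable]
    note ml = mt[THEN borel_imp_lebesgue_on[where \<Omega> = \<Omega>]]
    note [measurable] = mt locint_borel[OF weak_dD(2)[OF Vx]] locint_borel[OF weak_dD(2)[OF Vy]]
    obtain L where L: "L \<subseteq> \<Omega>" "\<And>z e. z \<notin> L \<Longrightarrow> pd e \<phi> z = 0"
      using test_fun_supportE[OF \<phi>] by metis
    have p0: "pd e \<phi> z = 0" if "z \<notin> \<Omega>" for z e using L that by blast
    have "(LINT z|lebesgue_on \<Omega>. \<sigma> z * (Ux z * pd 1 \<phi> z + Uy z * pd \<i> \<phi> z)) = (LINT z|lborel. Vy z * pd 1 \<phi> z - Vx z * pd \<i> \<phi> z)"
    proof (rule integral_lebesgue_on_eq)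
      show "(\<lambda>z. \<sigma> z * (Ux z * pd 1 \<phi> z + Uy z * pd \<i> \<phi> z)) \<in> borel_measurable (lebesgue_on \<Omega>)"
        by (intro borel_measurable_times borel_measurable_add \<sigma> m ml)
      show "AE z in lborel. z \<in> \<Omega> \<longrightarrow> \<sigma> z * (Ux z * pd 1 \<phi> z + Uy z * pd \<i> \<phi> z) = Vy z * pd 1 \<phi> z - Vx z * pd \<i> \<phi> z"
        using flux
      proof eventually_elim
        case (elim z)
        show ?case
        proof
          assume "z \<in> \<Omega>"
          then have "\<sigma> z * Ux z = Vy z" "\<sigma> z * Uy z = - Vx z" using elim by auto
          then show "\<sigma> z * (Ux z * pd 1 \<phi> z + Uy z * pd \<i> \<phi> z) = Vy z * pd 1 \<phi> z - Vx z * pd \<i> \<phi> z"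
            by (simp add: distrib_left flip: mult.assoc)
        qed
      qed
      show "(\<lambda>z. Vy z * pd 1 \<phi> z - Vx z * pd \<i> \<phi> z) \<in> borel_measurable borel" by measurable
      show "\<Omega> \<in> sets borel" using \<Omega> by simp
      show "Vy z * pd 1 \<phi> z - Vx z * pd \<i> \<phi> z = 0" if "z \<notin> \<Omega>" for z using p0[OF that] by simp
    qed
    also have "\<dots> = (LINT z|lborel. Vy z * pd 1 \<phi> z) - (LINT z|lborel. Vx z * pd \<i> \<phi> z)"
      using locint_test_integrable[OF weak_dD(2)[OF Vy] t(1)] locint_test_integrable[OF weak_dD(2)[OF Vx] t(2)]
      by (rule Bochner_Integration.integral_diff)
    also have "\<dots> = 0" using weak_d_curl[OF Vx Vy \<phi>] by simp
    finally show ?thesis .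
  qed
  ultimately show ?thesis
    unfolding weak_conductivity_solution_def using grad by blast
qed

section \<open>Assembly of the two conductivity equations from the bicomplex equation\<close>

theorem proposition39:
  fixes \<Omega> :: "complex set" and p :: real and f :: "complex \<Rightarrow> complex"
  assumes "open \<Omega>" and "connected \<Omega>" and "bounded \<Omega>" and "simply_connected \<Omega>"
    and "1 < p"
    and "f \<in> W1inf \<Omega>"
    and "\<forall>z\<in>\<Omega>. f z \<noteq> 0"
    and "(\<lambda>z. 1 / f z) \<in> Linf \<Omega>"
  shows "\<forall>W \<in> vekua_space p \<Omega> f.
           weak_conductivity_solution p \<Omega> (\<lambda>z. (f z)\<^sup>2) (\<lambda>z. Sc (W z) / f z) \<and>
           weak_conductivity_solution p \<Omega> (\<lambda>z. 1 / (f z)\<^sup>2) (\<lambda>z. f z * Vec (W z))"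
proof
  fix W assume "W \<in> vekua_space p \<Omega> f"
  note \<Omega> = \<open>open \<Omega>\<close>
  have \<Omega>b: "\<Omega> \<in> sets borel" using \<Omega> by simp
  have p: "0 < p" using assms by simp
  have e: "1 \<in> {1, \<i>}" "\<i> \<in> {1, \<i>}" by auto
  from \<open>W \<in> vekua_space p \<Omega> f\<close> obtain D where D: "weak_dbar \<Omega> (\<lambda>z. bc_of_complex (f z)) D"
    "weak_dbar \<Omega> W (\<lambda>z. D z * bc_of_complex (1 / f z) * bc_cnj (W z))"
    and WLp: "(\<lambda>z. Sc (W z)) \<in> Lp p \<Omega>" "(\<lambda>z. Vec (W z)) \<in> Lp p \<Omega>"
    unfolding vekua_space_def bc_valued_def by blast
  define V where "V z = D z * bc_of_complex (1 / f z) * bc_cnj (W z)" for z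
  have DV: "weak_dbar \<Omega> W V" using D(2) unfolding V_def .
  from \<open>f \<in> W1inf \<Omega>\<close> obtain gx gy where f: "f \<in> Linf \<Omega>" and gx: "gx \<in> Linf \<Omega>" and gy: "gy \<in> Linf \<Omega>"
    and grad: "weak_pd 1 \<Omega> f gx" "weak_pd \<i> \<Omega> f gy"
    unfolding W1inf_def weak_gradient_def by blast
  have mf: "f \<in> borel_measurable (lebesgue_on \<Omega>)" and mgx: "gx \<in> borel_measurable (lebesgue_on \<Omega>)" and mgy: "gy \<in> borel_measurable (lebesgue_on \<Omega>)"
    using f gx gy unfolding Linf_def by blast+
  have mW: "(\<lambda>z. Sc (W z)) \<in> borel_measurable (lebesgue_on \<Omega>)" "(\<lambda>z. Vec (W z)) \<in> borel_measurable (lebesgue_on \<Omega>)"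
    using WLp unfolding Lp_def by blast+
  have mD: "(\<lambda>z. Sc (D z)) \<in> borel_measurable (lebesgue_on \<Omega>)" "(\<lambda>z. Vec (D z)) \<in> borel_measurable (lebesgue_on \<Omega>)"
    and mV: "(\<lambda>z. Sc (V z)) \<in> borel_measurable (lebesgue_on \<Omega>)" "(\<lambda>z. Vec (V z)) \<in> borel_measurable (lebesgue_on \<Omega>)"
    using D(1) DV unfolding weak_dbar_def bc_valued_def by (auto intro: Lp_loc_borel_measurable[OF \<Omega>])
  obtain f1 where f1: "f1 \<in> borel_measurable borel" "AE z in lborel. z \<in> \<Omega> \<longrightarrow> f z = f1 z" by (rule borel_representative[OF mf \<Omega>b])
  \<comment> \<open>A representative may vanish on a null set or outside \<Omega>; the default value
    1 makes \<open>f'\<close> nonzero everywhere, as the pointwise algebra expects.\<close>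
  define f' where "f' z = (if f1 z = 0 then 1 else f1 z)" for z
  have f': "f' \<in> borel_measurable borel" "AE z in lborel. z \<in> \<Omega> \<longrightarrow> f z = f' z" and nz: "\<And>z. f' z \<noteq> 0"
  proof -
    note [measurable] = f1(1)
    show "f' \<in> borel_measurable borel" unfolding f'_def by measurable
    show "AE z in lborel. z \<in> \<Omega> \<longrightarrow> f z = f' z"
      using f1(2) by eventually_elim (use assms(7) in \<open>auto simp: f'_def\<close>)
    show "\<And>z. f' z \<noteq> 0" by (simp add: f'_def)
  qed
  obtain fx where fx: "fx \<in> borel_measurable borel" "AE z in lborel. z \<in> \<Omega> \<longrightarrow> gx z = fx z" by (rule borel_representative[OF mgx \<Omega>b])
  obtain fy where fy: "fy \<in> borel_measurable borel" "AE z in lborel. z \<in> \<Omega> \<longrightarrow> gy z = fy z" by (rule borel_representative[OF mgy \<Omega>b])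
  obtain u where u: "u \<in> borel_measurable borel" "AE z in lborel. z \<in> \<Omega> \<longrightarrow> Sc (W z) = u z" by (rule borel_representative[OF mW(1) \<Omega>b])
  obtain v where v: "v \<in> borel_measurable borel" "AE z in lborel. z \<in> \<Omega> \<longrightarrow> Vec (W z) = v z" by (rule borel_representative[OF mW(2) \<Omega>b])
  obtain d1 where d1: "d1 \<in> borel_measurable borel" "AE z in lborel. z \<in> \<Omega> \<longrightarrow> Sc (D z) = d1 z" by (rule borel_representative[OF mD(1) \<Omega>b])
  obtain d2 where d2: "d2 \<in> borel_measurable borel" "AE z in lborel. z \<in> \<Omega> \<longrightarrow> Vec (D z) = d2 z" by (rule borel_representative[OF mD(2) \<Omega>b])
  obtain a where a: "a \<in> borel_measurable borel" "AE z in lborel. z \<in> \<Omega> \<longrightarrow> Sc (V z) = a z" by (rule borel_representative[OF mV(1) \<Omega>b])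
  obtain b where b: "b \<in> borel_measurable borel" "AE z in lborel. z \<in> \<Omega> \<longrightarrow> Vec (V z) = b z" by (rule borel_representative[OF mV(2) \<Omega>b])
  have dx: "weak_d 1 \<Omega> f' fx" by (rule weak_pd_imp_weak_d[OF \<Omega> e(1) grad(1) f' fx])
  have dy: "weak_d \<i> \<Omega> f' fy" by (rule weak_pd_imp_weak_d[OF \<Omega> e(2) grad(2) f' fy])
  obtain Cf where Cf: "AE z in lborel. z \<in> \<Omega> \<longrightarrow> norm (f' z) \<le> Cf" by (rule Linf_bound[OF f \<Omega>b f'(2)])
  obtain Cx where Cx: "AE z in lborel. z \<in> \<Omega> \<longrightarrow> norm (fx z) \<le> Cx" by (rule Linf_bound[OF gx \<Omega>b fx(2)])
  obtain Cy where Cy: "AE z in lborel. z \<in> \<Omega> \<longrightarrow> norm (fy z) \<le> Cy" by (rule Linf_bound[OF gy \<Omega>b fy(2)])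
  have inv: "AE z in lborel. z \<in> \<Omega> \<longrightarrow> 1 / f z = inverse (f' z)"
    using f'(2) by eventually_elim (simp add: inverse_eq_divide)
  obtain M where M: "AE z in lborel. z \<in> \<Omega> \<longrightarrow> norm (inverse (f' z)) \<le> M" by (rule Linf_bound[OF assms(8) \<Omega>b inv])
  have mi: "(\<lambda>z. inverse (f' z)) \<in> borel_measurable borel" using f'(1) by (rule borel_measurable_inverse)
  note lf = locbdd_bounded[OF f'(1) Cf] locbdd_bounded[OF fx(1) Cx] locbdd_bounded[OF fy(1) Cy]
  note li = locbdd_bounded[OF mi M]
  have A: "AE z in lborel. z \<in> \<Omega> \<longrightarrow> norm (fx z) \<le> max Cx Cy" "AE z in lborel. z \<in> \<Omega> \<longrightarrow> norm (fy z) \<le> max Cx Cy"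
    using Cx Cy by (eventually_elim, simp add: le_max_iff_disj)+
  \<comment> \<open>The image of the Vekua equation when j is sent to c; conjugation becomes the
    change from c to -c. The weak derivative \<open>D\<close> of \<open>f\<close> is given only by
    existence, but uniqueness identifies its image \<open>2 * (d1 z + c * d2 z)\<close> with
    \<open>fx z + c * fy z\<close> almost everywhere.\<close>
  have h: "AE z in lborel. z \<in> \<Omega> \<longrightarrow> 2 * (a z + c * b z) = (fx z + c * fy z) * (inverse (f' z) * (u z + (-c) * v z))"
    if c: "c * c = - 1" for c
  proof -
    have "weak_op 1 c \<Omega> (\<lambda>z. f' z + c * 0) (\<lambda>z. 2 * (d1 z + c * d2 z))"
      by (rule weak_dbar_imp_weak_op[OF \<Omega> D(1) c f'(1) _ _ _ d1 d2]) (use f'(2) in \<open>auto simp: bc_of_complex_def\<close>)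
    then have "weak_op 1 c \<Omega> f' (\<lambda>z. 2 * (d1 z + c * d2 z))" by simp
    from weak_op_unique[OF \<Omega> this weak_op_from_weak_d[OF dx dy]]
    have "AE z in lborel. z \<in> \<Omega> \<longrightarrow> 2 * (d1 z + c * d2 z) = fx z + c * fy z" .
    then show ?thesis
      using f'(2) u(2) v(2) d1(2) d2(2) a(2) b(2)
    proof eventually_elim
      case (elim z)
      show ?case
      proof
        assume z: "z \<in> \<Omega>"
        define i where "i = inverse (f' z)"
        have "V z = Bicomplex (d1 z) (d2 z) * Bicomplex i 0 * Bicomplex (u z) (- v z)"
          unfolding V_def bc_of_complex_def bc_cnj_def i_def using elim z
          by (metis bicomplex.collapse inverse_eq_divide)
        then have ab: "a z = i * (d1 z * u z + d2 z * v z)" "b z = i * (d2 z * u z - d1 z * v z)"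
          using elim z by (auto simp: times_bicomplex_def algebra_simps)
        have "2 * (a z + c * b z) = i * (2 * (d1 z * u z + d2 z * v z + c * (d2 z * u z - d1 z * v z)))"
          unfolding ab by (simp add: algebra_simps)
        \<comment> \<open>The sign of the \<open>d2 z * v z\<close> term is rewritten as minus
          \<open>c * c\<close>, after which the expression factors.\<close>
        also have "2 * (d1 z * u z + d2 z * v z + c * (d2 z * u z - d1 z * v z)) = 2 * (d1 z * u z - (c * c) * (d2 z * v z) + c * (d2 z * u z - d1 z * v z))"
          unfolding c by simp
        also have "\<dots> = 2 * (d1 z + c * d2 z) * (u z + (-c) * v z)"
          by (simp add: algebra_simps)
        also have "2 * (d1 z + c * d2 z) = fx z + c * fy z" using elim z by blast
        finally show "2 * (a z + c * b z) = (fx z + c * fy z) * (inverse (f' z) * (u z + (-c) * v z))"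
          by (simp only: i_def mult_ac)
      qed
    qed
  qed
  have W1: "weak_op 1 \<i> \<Omega> (\<lambda>z. u z + \<i> * v z) (\<lambda>z. 2 * (a z + \<i> * b z))"
    by (rule weak_dbar_imp_weak_op[OF \<Omega> DV _ u v a b]) simp
  have W2: "weak_op 1 (-\<i>) \<Omega> (\<lambda>z. u z + (-\<i>) * v z) (\<lambda>z. 2 * (a z + (-\<i>) * b z))"
    by (rule weak_dbar_imp_weak_op[OF \<Omega> DV _ u v a b]) simp
  have h2: "AE z in lborel. z \<in> \<Omega> \<longrightarrow> 2 * (a z + (-\<i>) * b z) = (fx z + (-\<i>) * fy z) * (inverse (f' z) * (u z + \<i> * v z))"
    using h[of "-\<i>"] by simp
  have h1: "AE z in lborel. z \<in> \<Omega> \<longrightarrow> 2 * (a z + \<i> * b z) = (fx z + \<i> * fy z) * (inverse (f' z) * (u z + (-\<i>) * v z))"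
    using h[of "\<i>"] by simp
  obtain Ux Uy Vx Vy where UV: "locbdd \<Omega> (\<lambda>z. u z * inverse (f' z))" "locbdd \<Omega> (\<lambda>z. f' z * v z)"
    "locbdd \<Omega> Ux" "locbdd \<Omega> Uy" "locbdd \<Omega> Vx" "locbdd \<Omega> Vy"
    "weak_d 1 \<Omega> (\<lambda>z. u z * inverse (f' z)) Ux" "weak_d \<i> \<Omega> (\<lambda>z. u z * inverse (f' z)) Uy"
    "weak_d 1 \<Omega> (\<lambda>z. f' z * v z) Vx" "weak_d \<i> \<Omega> (\<lambda>z. f' z * v z) Vy"
    "AE z in lborel. z \<in> \<Omega> \<longrightarrow> (f' z)\<^sup>2 * Ux z = Vy z \<and> (f' z)\<^sup>2 * Uy z = - Vx z"
    by (rule vekua_conductivity[OF \<Omega> dx dy lf nz li A M W1 W2 h1 h2])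
  show "weak_conductivity_solution p \<Omega> (\<lambda>z. (f z)\<^sup>2) (\<lambda>z. Sc (W z) / f z) \<and>
           weak_conductivity_solution p \<Omega> (\<lambda>z. 1 / (f z)\<^sup>2) (\<lambda>z. f z * Vec (W z))"
  proof
    show "weak_conductivity_solution p \<Omega> (\<lambda>z. (f z)\<^sup>2) (\<lambda>z. Sc (W z) / f z)"
    proof (rule weak_conductivity_solutionI[OF \<Omega> p _ _ UV(1) UV(7,3) UV(8,4) UV(9,10)])
      show "(\<lambda>z. Sc (W z) / f z) \<in> borel_measurable (lebesgue_on \<Omega>)" by (intro borel_measurable_divide mW mf)
      show "AE z in lborel. z \<in> \<Omega> \<longrightarrow> Sc (W z) / f z = u z * inverse (f' z)"
        using u(2) f'(2) by eventually_elim (simp add: divide_inverse)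
      show "(\<lambda>z. (f z)\<^sup>2) \<in> borel_measurable (lebesgue_on \<Omega>)" by (intro borel_measurable_power mf)
      show "AE z in lborel. z \<in> \<Omega> \<longrightarrow> (f z)\<^sup>2 * Ux z = Vy z \<and> (f z)\<^sup>2 * Uy z = - Vx z"
        using UV(11) f'(2) by eventually_elim simp
    qed
    \<comment> \<open>For the second equation the conjugate function is -u/f: the flux
      \<open>(1 / f^2) \<nabla>(f v)\<close> has components \<open>-(u/f)\<^sub>y\<close> and
      \<open>(u/f)\<^sub>x\<close>, the rotated gradient of -u/f.\<close>
    have nU: "weak_d 1 \<Omega> (\<lambda>z. - 1 * (u z * inverse (f' z))) (\<lambda>z. - 1 * Ux z)" "weak_d \<i> \<Omega> (\<lambda>z. - 1 * (u z * inverse (f' z))) (\<lambda>z. - 1 * Uy z)"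
      by (intro weak_d_cmult UV)+
    show "weak_conductivity_solution p \<Omega> (\<lambda>z. 1 / (f z)\<^sup>2) (\<lambda>z. f z * Vec (W z))"
    proof (rule weak_conductivity_solutionI[OF \<Omega> p _ _ UV(2) UV(9,5) UV(10,6) nU])
      show "(\<lambda>z. f z * Vec (W z)) \<in> borel_measurable (lebesgue_on \<Omega>)" by (intro borel_measurable_times mW mf)
      show "AE z in lborel. z \<in> \<Omega> \<longrightarrow> f z * Vec (W z) = f' z * v z"
        using v(2) f'(2) by eventually_elim simp
      show "(\<lambda>z. 1 / (f z)\<^sup>2) \<in> borel_measurable (lebesgue_on \<Omega>)"
        by (intro borel_measurable_divide borel_measurable_const borel_measurable_power mf)
      show "AE z in lborel. z \<in> \<Omega> \<longrightarrow> 1 / (f z)\<^sup>2 * Vx z = - 1 * Uy z \<and> 1 / (f z)\<^sup>2 * Vy z = - (- 1 * Ux z)"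
        using UV(11) f'(2)
      proof eventually_elim
        case (elim z)
        show ?case
        proof
          assume z: "z \<in> \<Omega>"
          then have "Vy z = (f' z)\<^sup>2 * Ux z" "Vx z = - ((f' z)\<^sup>2 * Uy z)" "f z = f' z" using elim by auto
          then show "1 / (f z)\<^sup>2 * Vx z = - 1 * Uy z \<and> 1 / (f z)\<^sup>2 * Vy z = - (- 1 * Ux z)"
            using nz[of z] by simp
        qed
      qed
    qed
  qed
qed

end
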